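(* Let $T>0$, $H\in(\tfrac12,1)$, $y\in\mathbb{R}^m$, let $N\ge2$ be an integer and $V\in\mathcal{C}^{N+1}_b(\mathbb{R}^m;\mathbb{R}^{m\times d})$. Let $Y$ be the solution of $dY_t=V(Y_t)\,dX_t$, $t\in(0,T]$, $Y_0=y$. For $n\in\mathbb{N}_+$ and $h=T/n$, let $Y^n_{t_k}$, $k=0,\dots,n$, be the simplified step-$N$ Euler scheme (defined in the context), and let $Y^{n,linear}$ be its linear interpolation, $Y^{n,linear}_0=y$ and $$Y^{n,linear}_t:=Y^n_{t_k}+\frac{t-t_k}{h}\big(Y^n_{t_{k+1}}-Y^n_{t_k}\big),\qquad t\in(t_k,t_{k+1}].$$ Then for every $p\ge1$ there exists a constant $C$ independent of $n$ such that $$\Big\|\sup_{t\in[0,T]}|Y_t-Y^{n,linear}_t|\Big\|_{L^p(\Omega)}\le C\Big(h^{2H-\frac12}+h^H\sqrt{\log\tfrac{T}{h}}\Big).$$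
   Context: $X_t=(X^1_t,\dots,X^d_t)^\top\in\mathbb{R}^d$, $t\in[0,T]$, where $X^1_t=t$ and $X^2,\dots,X^d$ are independent fractional Brownian motions with Hurst parameter $H\in(\frac12,1)$ on a probability space $(\Omega,\mathcal{F},\mathbb{P})$, i.e. centered Gaussian processes with continuous sample paths and covariance $\frac12(t^{2H}+s^{2H}-|t-s|^{2H})$. The equation $dY_t=V(Y_t)dX_t=\sum_{l=1}^dV_l(Y_t)dX^l_t$, $Y_0=y$ ($V_l$ is the $l$-th column of $V$) is understood pathwise via Young integrals. $\mathcal{C}_b^N(\mathbb{R}^m;\mathbb{R}^M)$ is the space of bounded, $N$-times continuously differentiable functions with bounded derivatives. For $n\in\mathbb{N}_+$: $h=T/n$, $t_k=kh$ for $k=0,\dots,n$, $\Delta X^l_k=X^l_{t_{k+1}}-X^l_{t_k}$. Let $\mathscr{V}_l=\sum_{q=1}^mV^q_l(y)\frac{\partial}{\partial y^q}$ be the first order differential operator associated with $V_l$ (acting componentwise on vector-valued functions), and let $I:\mathbb{R}^m\to\mathbb{R}^m$ be the identity map. The simplified step-$N$ Euler scheme is $Y^n_{t_0}=y$ and, for $k=0,\dots,n-1$, $$Y^n_{t_{k+1}}=Y^n_{t_k}+\sum_{w=1}^N\ \sum_{l_w,\dots,l_1=1}^d\mathscr{V}_{l_w}\cdots\mathscr{V}_{l_1}I(Y^n_{t_k})\frac{\Delta X^{l_w}_k\cdots\Delta X^{l_1}_k}{w!}.$$ For $N=2$, this scheme with linear interpolation is called the modified Milstein scheme. *)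

theory Defs
  imports "HOL-Probability.Probability"
begin

section \<open>The spaces \<open>C\<^sub>b\<^sup>N\<close>\<close>

text \<open>Bounded functions that are \<open>N\<close> times continuously (Frechet) differentiable with bounded
  derivatives. The derivative, which takes values in linear maps, is handled through its
  evaluations at each direction \<open>v\<close>; as the domain is finite dimensional, continuity and boundedness
  of all evaluations is continuity and boundedness in operator norm.\<close>

primrec Cb :: "nat \<Rightarrow> ('a::euclidean_space \<Rightarrow> 'b::real_normed_vector) \<Rightarrow> bool" where
  "Cb 0 f \<longleftrightarrow> continuous_on UNIV f \<and> bounded (range f)"
| "Cb (Suc N) f \<longleftrightarrow> bounded (range f) \<and> (\<forall>x. f differentiable (at x)) \<and>
     (\<forall>v. Cb N (\<lambda>x. frechet_derivative f (at x) v))"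


section \<open>Gaussian processes and fractional Brownian motion\<close>

text \<open>Point masses count as (degenerate) Gaussian laws.\<close>

definition gaussian_rv :: "'w measure \<Rightarrow> ('w \<Rightarrow> real) \<Rightarrow> bool" where
  "gaussian_rv M Z \<longleftrightarrow> Z \<in> borel_measurable M \<and>
     (\<exists>\<mu>. (AE \<omega> in M. Z \<omega> = \<mu>) \<or> (\<exists>\<sigma>>0. distributed M lborel Z (normal_density \<mu> \<sigma>)))"

definition gaussian_process :: "'w measure \<Rightarrow> real set \<Rightarrow> (real \<Rightarrow> 'w \<Rightarrow> real) \<Rightarrow> bool" where
  "gaussian_process M I B \<longleftrightarrow>
     (\<forall>S c. finite S \<and> S \<subseteq> I \<longrightarrow> gaussian_rv M (\<lambda>\<omega>. \<Sum>s\<in>S. c s * B s \<omega>))"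

definition fractional_brownian_motion ::
    "'w measure \<Rightarrow> real \<Rightarrow> real \<Rightarrow> (real \<Rightarrow> 'w \<Rightarrow> real) \<Rightarrow> bool" where
  "fractional_brownian_motion M H T B \<longleftrightarrow>
     gaussian_process M {0..T} B \<and>
     (\<forall>t\<in>{0..T}. (\<integral>\<omega>. B t \<omega> \<partial>M) = 0) \<and>
     (\<forall>s\<in>{0..T}. \<forall>t\<in>{0..T}. (\<integral>\<omega>. B s \<omega> * B t \<omega> \<partial>M) =
        (t powr (2 * H) + s powr (2 * H) - \<bar>t - s\<bar> powr (2 * H)) / 2) \<and>
     (\<forall>\<omega>\<in>space M. continuous_on {0..T} (\<lambda>t. B t \<omega>))"

text \<open>The driving process. The index \<open>i\<^sub>1\<close> plays the role of the first coordinate; independence of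
  the other coordinates is independence of processes, that is, of random elements of
  \<open>\<real>\<close> to the power \<open>[0,T]\<close>.\<close>

definition driving_process ::
    "'w measure \<Rightarrow> real \<Rightarrow> real \<Rightarrow> 'd::finite \<Rightarrow> (real \<Rightarrow> 'w \<Rightarrow> real ^ 'd) \<Rightarrow> bool" where
  "driving_process M H T i\<^sub>1 X \<longleftrightarrow>
     (\<forall>\<omega>\<in>space M. \<forall>t\<in>{0..T}. X t \<omega> $ i\<^sub>1 = t) \<and>
     (\<forall>l. l \<noteq> i\<^sub>1 \<longrightarrow> fractional_brownian_motion M H T (\<lambda>t \<omega>. X t \<omega> $ l)) \<and>
     prob_space.indep_vars M (\<lambda>_. PiM {0..T} (\<lambda>_. borel))
       (\<lambda>l \<omega>. \<lambda>t\<in>{0..T}. X t \<omega> $ l) {l. l \<noteq> i\<^sub>1}"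


section \<open>Young integrals and Young differential equations\<close>

definition holder_on :: "real \<Rightarrow> real set \<Rightarrow> (real \<Rightarrow> 'a::metric_space) \<Rightarrow> bool" where
  "holder_on \<alpha> S f \<longleftrightarrow> (\<exists>C. \<forall>s\<in>S. \<forall>t\<in>S. dist (f s) (f t) \<le> C * \<bar>s - t\<bar> powr \<alpha>)"

text \<open>\<open>has_young_integral f g a b J\<close> means that \<open>J\<close> is the integral of \<open>f\<close> against \<open>g\<close> over \<open>[a,b]\<close>,
  where \<open>f\<close> and \<open>g\<close> are Hoelder with exponents adding up to more than 1. The value is the limit of
  Riemann-Stieltjes sums as the mesh tends to zero: a constant radius in place of a general gauge
  makes fineness a mesh condition.\<close>

definition has_young_integral ::
    "(real \<Rightarrow> 'a::real_normed_vector) \<Rightarrow> (real \<Rightarrow> real) \<Rightarrow> real \<Rightarrow> real \<Rightarrow> 'a \<Rightarrow> bool" where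
  "has_young_integral f g a b J \<longleftrightarrow>
     (\<exists>\<alpha> \<beta>. 0 < \<alpha> \<and> 0 < \<beta> \<and> \<alpha> + \<beta> > 1 \<and> holder_on \<alpha> {a..b} f \<and> holder_on \<beta> {a..b} g) \<and>
     (\<forall>\<epsilon>>0. \<exists>\<delta>>0. \<forall>\<D>. \<D> tagged_division_of {a..b} \<and> (\<lambda>x. ball x \<delta>) fine \<D> \<longrightarrow>
        norm ((\<Sum>(x, K)\<in>\<D>. (g (Sup K) - g (Inf K)) *\<^sub>R f x) - J) < \<epsilon>)"

definition young_solution ::
    "(real ^ 'm \<Rightarrow> real ^ 'd ^ 'm) \<Rightarrow> real ^ 'm \<Rightarrow> real \<Rightarrow> (real \<Rightarrow> real ^ 'd) \<Rightarrow> (real \<Rightarrow> real ^ 'm) \<Rightarrow> bool"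
  where
  "young_solution V y T x Y \<longleftrightarrow> Y 0 = y \<and>
     (\<forall>t\<in>{0<..T}. \<exists>J. (\<forall>l. has_young_integral (\<lambda>s. column l (V (Y s))) (\<lambda>s. x s $ l) 0 t (J l)) \<and>
        Y t = y + (\<Sum>l\<in>UNIV. J l))"


section \<open>The simplified step-\<open>N\<close> Euler scheme\<close>

definition partial_derivative ::
    "'m \<Rightarrow> (real ^ 'm \<Rightarrow> 'b::real_normed_vector) \<Rightarrow> real ^ 'm \<Rightarrow> 'b" where
  "partial_derivative q f z = vector_derivative (\<lambda>s. f (z + s *\<^sub>R axis q 1)) (at 0)"

definition vf_op ::
    "(real ^ 'm \<Rightarrow> real ^ 'd ^ 'm) \<Rightarrow> 'd \<Rightarrow> (real ^ 'm \<Rightarrow> 'b::real_normed_vector) \<Rightarrow> real ^ 'm \<Rightarrow> 'b" where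
  "vf_op V l f z = (\<Sum>q\<in>UNIV. (V z $ q $ l) *\<^sub>R partial_derivative q f z)"

text \<open>A multi-index is the list \<open>[l\<^sub>w, \<dots>, l\<^sub>1]\<close>, so that the operator of \<open>l\<^sub>1\<close> acts first.\<close>

definition simplified_step ::
    "(real ^ 'm \<Rightarrow> real ^ 'd ^ 'm) \<Rightarrow> nat \<Rightarrow> real ^ 'd \<Rightarrow> real ^ 'm \<Rightarrow> real ^ 'm" where
  "simplified_step V N \<Delta> z = z + (\<Sum>w=1..N. \<Sum>ls | length ls = w.
     (prod_list (map (\<lambda>l. \<Delta> $ l) ls) / fact w) *\<^sub>R foldr (vf_op V) ls (\<lambda>z. z) z)"

primrec simplified_euler ::
    "(real ^ 'm \<Rightarrow> real ^ 'd ^ 'm) \<Rightarrow> nat \<Rightarrow> real \<Rightarrow> (real \<Rightarrow> real ^ 'd) \<Rightarrow> real ^ 'm \<Rightarrow> nat \<Rightarrow> real ^ 'm"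
  where
  "simplified_euler V N h x y 0 = y"
| "simplified_euler V N h x y (Suc k) =
     simplified_step V N (x (real (Suc k) * h) - x (real k * h)) (simplified_euler V N h x y k)"

definition linear_interpolation :: "real \<Rightarrow> (nat \<Rightarrow> 'a::real_vector) \<Rightarrow> real \<Rightarrow> 'a" where
  "linear_interpolation h u t =
     (if t \<le> 0 then u 0
      else let k = nat (\<lceil>t / h\<rceil> - 1) in u k + ((t - real k * h) / h) *\<^sub>R (u (Suc k) - u k))"

lemma linear_interpolation_eq:
  assumes "h > 0" and "t \<in> {real k * h <.. real (Suc k) * h}"
  shows "linear_interpolation h u t = u k + ((t - real k * h) / h) *\<^sub>R (u (Suc k) - u k)"
proof -
  have "real k < t / h" "t / h \<le> real k + 1"
    using assms by (auto simp: field_simps)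
  then have "\<lceil>t / h\<rceil> = int k + 1"
    by (intro ceiling_unique) auto
  moreover have "t > 0"
    using assms by (auto intro: le_less_trans[of 0 "real k * h"])
  ultimately show ?thesis
    by (simp add: linear_interpolation_def)
qed


section \<open>\<open>L\<^sup>p\<close> norms\<close>

text \<open>Extended-valued, so that a bound by a finite number includes finiteness of the norm.\<close>

definition enn_powr :: "ennreal \<Rightarrow> real \<Rightarrow> ennreal" where
  "enn_powr x p = (if x = \<top> then \<top> else ennreal (enn2real x powr p))"

definition Lp_norm :: "'w measure \<Rightarrow> real \<Rightarrow> ('w \<Rightarrow> ennreal) \<Rightarrow> ennreal" where
  "Lp_norm M p F = enn_powr (\<integral>\<^sup>+ \<omega>. enn_powr (F \<omega>) p \<partial>M) (1 / p)"

end

theory Submission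
  imports Defs
begin

text \<open>The factor \<open>sqrt (log (T / h))\<close> is only needed for the oscillation of the driving path within a cell of
  the grid; every other error is of order \<open>h\<^sup>H\<close> in all \<open>L\<^sup>p\<close>. Fix \<open>\<beta> = (H + 1) / 3\<close>, so that
  \<open>1 / 2 < \<beta> < H\<close> and \<open>3 * \<beta> = 1 + H\<close>, and let \<open>K\<close> be a \<open>\<beta>\<close>-Hoelder constant of the path. Over a cell,
  the solution and the scheme have the same expansion up to the Levy areas of the cell and a remainder of
  order \<open>h\<close> to the power \<open>3 * \<beta>\<close>. The error therefore solves a discrete Young equation whose
  inhomogeneity is small as soon as the sums of Levy areas over runs of consecutive cells are
  \<open>\<beta>\<close>-Hoelder with a constant of order \<open>h\<^sup>H\<close>. Sewing solves this equation on intervals whose length is of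
  order \<open>K\<close> to the power \<open>-1 / \<beta>\<close>, and iteration costs a factor \<open>exp (C * K powr (1 / \<beta>))\<close>, which has all
  moments because \<open>1 / \<beta> < 2\<close> and \<open>K\<close> has Gaussian tails.

  For the Levy areas, condition on one of the two coordinates: the sum over a run of cells becomes a
  Gaussian variable, whose variance is easy to bound because the increments of a fractional Brownian motion
  with \<open>H > 1 / 2\<close> are nonnegatively correlated. Dyadic chaining passes from a single run to all runs.\<close>

section \<open>Sewing\<close>

text \<open>The choice 3 \<beta> = 1 + H balances the local errors: n remainders of order h^(3
  \<beta>) add up to order h^H. The condition \<beta> > 1/2 is needed twice, for the discrete Young
  sums to converge and for K^(1/\<beta>) to be integrable in the exponent. The obstacle is the Levy
  area. A single cell carries an area of order h^(2 H), so adding absolute values over n cells would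
  only give h^(2 H - 1). A run of cells of total length l has in fact size h^H * l^H: one coordinate
  contributes its cell increments, of order h^H, as coefficients, and the other contributes a
  variance of order l^(2 H) for the whole run. The gap between l^H and l^\<beta> pays for the union
  over all runs, so the areas lose no logarithm. The oscillation within a cell has no such gap: it
  is a maximum of n variables of equal size. All pathwise constants have to stay of the form K^m *
  exp (C * K^(1/\<beta>)), also on grids too coarse for the sewing argument; there h^H is itself
  bounded below by a power of 1 / K, so that a crude bound suffices.\<close>

lemma powr_add_le_superadd:
  fixes a b :: real
  assumes "0 \<le> a" "0 \<le> b" "1 \<le> \<theta>"
  shows "a powr \<theta> + b powr \<theta> \<le> (a + b) * (max a b) powr (\<theta> - 1)"
proof -
  have *: "x powr \<theta> \<le> x * (max a b) powr (\<theta> - 1)" if "0 \<le> x" "x \<le> max a b" for x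
  proof (cases "x = 0")
    case False
    then have "x powr \<theta> = x * x powr (\<theta> - 1)"
      using that by (simp add: powr_diff)
    also have "\<dots> \<le> x * (max a b) powr (\<theta> - 1)"
      using that assms by (intro mult_left_mono powr_mono2) auto
    finally show ?thesis .
  qed simp
  show ?thesis
    using *[of a] *[of b] assms by (simp add: algebra_simps)
qed

text \<open>Solves C * (2/3)^(\<theta> - 1) + 1 = C. The ratio 2/3 is the worst share of the longer
  half when an integer interval of length at least 2 is cut in the middle; length 3 attains
  it.\<close>

definition sew_const :: "real \<Rightarrow> real" where
  "sew_const \<theta> = 1 / (1 - (2 / 3) powr (\<theta> - 1))"

lemma sew_const:
  assumes "1 < \<theta>"
  shows "1 \<le> sew_const \<theta>" "sew_const \<theta> * (2 / 3) powr (\<theta> - 1) + 1 = sew_const \<theta>"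
proof -
  have "(2 / 3 :: real) powr (\<theta> - 1) < (2/3) powr 0"
    using assms by (intro powr_less_mono') auto
  then have *: "(2 / 3 :: real) powr (\<theta> - 1) < 1" by simp
  show "1 \<le> sew_const \<theta>"
    using * by (simp add: sew_const_def field_simps)
  have "1 - (2 / 3 :: real) powr (\<theta> - 1) \<noteq> 0" using * by linarith
  then show "sew_const \<theta> * (2 / 3) powr (\<theta> - 1) + 1 = sew_const \<theta>"
    unfolding sew_const_def by (simp add: divide_simps)
qed

text \<open>Induction on the number of cells, cutting in the middle: for one cell both sides agree,
  and \<theta> > 1 makes the two halves contribute strictly less than the whole, which leaves room
  for the defect. No limit is taken, so the constant depends neither on the grid nor on the number
  of cells.\<close>

lemma discrete_sewing:
  fixes \<Xi> :: "nat \<Rightarrow> nat \<Rightarrow> 'a::real_normed_vector"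
  assumes "1 < \<theta>" "0 \<le> h" "0 \<le> A"
    and defect: "\<And>i j k. a \<le> i \<Longrightarrow> i < j \<Longrightarrow> j < k \<Longrightarrow> k \<le> b \<Longrightarrow>
      norm (\<Xi> i k - \<Xi> i j - \<Xi> j k) \<le> A * (real (k - i) * h) powr \<theta>"
    and "a \<le> i" "i < k" "k \<le> b"
  shows "norm ((\<Sum>c\<in>{i..<k}. \<Xi> c (Suc c)) - \<Xi> i k) \<le> sew_const \<theta> * A * (real (k - i) * h) powr \<theta>"
  using assms(5-)
proof (induction "k - i" arbitrary: i k rule: less_induct)
  case less
  note C = sew_const[OF assms(1)]
  show ?case
  proof (cases "k = Suc i")
    case True
    then show ?thesis using assms(2,3) C(1) by simp
  next
    case False
    define m where "m = (k - i) div 2"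
    define j where "j = i + m"
    define n where "n = k - i"
    have n2: "2 \<le> n" and n: "n = k - i" using False less.prems by (auto simp: n_def)
    have m: "1 \<le> m" "m < n" "3 * m \<le> 2 * n" "3 * (n - m) \<le> 2 * n"
      using n2 unfolding m_def n_def by auto
    have j: "i < j" "j < k" "j - i = m" "k - j = n - m"
      using m less.prems by (auto simp: j_def n_def)
    have I1: "norm ((\<Sum>c\<in>{i..<j}. \<Xi> c (Suc c)) - \<Xi> i j) \<le> sew_const \<theta> * A * (real m * h) powr \<theta>"
      using less.hyps[of j i] j m less.prems n by auto
    have I2: "norm ((\<Sum>c\<in>{j..<k}. \<Xi> c (Suc c)) - \<Xi> j k) \<le> sew_const \<theta> * A * (real (n - m) * h) powr \<theta>"
      using less.hyps[of k j] j m less.prems n by auto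
    have I3: "norm (\<Xi> i k - \<Xi> i j - \<Xi> j k) \<le> A * (real n * h) powr \<theta>"
      using defect[of i j k] j less.prems n by auto
    have sum: "(\<Sum>c\<in>{i..<k}. \<Xi> c (Suc c)) = (\<Sum>c\<in>{i..<j}. \<Xi> c (Suc c)) + (\<Sum>c\<in>{j..<k}. \<Xi> c (Suc c))"
      using j by (simp add: sum.atLeastLessThan_concat)
    have "(real m * h) powr \<theta> + (real (n - m) * h) powr \<theta>
       \<le> (real m * h + real (n - m) * h) * (max (real m * h) (real (n - m) * h)) powr (\<theta> - 1)"
      using assms by (intro powr_add_le_superadd) auto
    also have "\<dots> \<le> (real n * h) * (2/3 * (real n * h)) powr (\<theta> - 1)"
    proof (intro mult_mono powr_mono2)
      have "real m * 3 \<le> 2 * real n" "real (n - m) * 3 \<le> 2 * real n"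
        using m by linarith+
      then show "max (real m * h) (real (n - m) * h) \<le> 2/3 * (real n * h)"
        using mult_right_mono[OF _ assms(2), of "real m * 3" "2 * real n"]
          mult_right_mono[OF _ assms(2), of "real (n - m) * 3" "2 * real n"]
        by (intro max.boundedI) (simp_all add: algebra_simps)
      show "real m * h + real (n - m) * h \<le> real n * h"
        using m by (simp add: algebra_simps of_nat_diff)
    qed (use assms in \<open>auto simp: le_max_iff_disj\<close>)
    also have "\<dots> = (2/3) powr (\<theta> - 1) * (real n * h) powr \<theta>"
    proof (cases "h = 0")
      case False
      then have "real n * h > 0" using assms n2 by simp
      then have "(real n * h) powr \<theta> = (real n * h) * (real n * h) powr (\<theta> - 1)"
        by (simp add: powr_diff)
      moreover have "(2/3 * (real n * h)) powr (\<theta> - 1) = (2/3) powr (\<theta> - 1) * (real n * h) powr (\<theta> - 1)"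
        using \<open>real n * h > 0\<close> by (subst powr_mult) auto
      ultimately show ?thesis by simp
    qed simp
    finally have *: "(real m * h) powr \<theta> + (real (n - m) * h) powr \<theta> \<le> (2/3) powr (\<theta> - 1) * (real n * h) powr \<theta>" .
    have "norm ((\<Sum>c\<in>{i..<k}. \<Xi> c (Suc c)) - \<Xi> i k)
      = norm (((\<Sum>c\<in>{i..<j}. \<Xi> c (Suc c)) - \<Xi> i j) + ((\<Sum>c\<in>{j..<k}. \<Xi> c (Suc c)) - \<Xi> j k)
          - (\<Xi> i k - \<Xi> i j - \<Xi> j k))"
      by (simp add: sum)
    also have "\<dots> \<le> norm ((\<Sum>c\<in>{i..<j}. \<Xi> c (Suc c)) - \<Xi> i j) + norm ((\<Sum>c\<in>{j..<k}. \<Xi> c (Suc c)) - \<Xi> j k)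
        + norm (\<Xi> i k - \<Xi> i j - \<Xi> j k)"
      by (rule norm_triangle_le_diff) (simp add: norm_triangle_ineq)
    also have "\<dots> \<le> sew_const \<theta> * A * (real m * h) powr \<theta> + sew_const \<theta> * A * (real (n - m) * h) powr \<theta>
        + A * (real n * h) powr \<theta>"
      using I1 I2 I3 by linarith
    also have "\<dots> = sew_const \<theta> * A * ((real m * h) powr \<theta> + (real (n - m) * h) powr \<theta>) + A * (real n * h) powr \<theta>"
      by (simp add: algebra_simps)
    also have "\<dots> \<le> sew_const \<theta> * A * ((2/3) powr (\<theta> - 1) * (real n * h) powr \<theta>) + A * (real n * h) powr \<theta>"
      using * C(1) assms(3) by (intro add_right_mono mult_left_mono) auto
    also have "\<dots> = (sew_const \<theta> * (2/3) powr (\<theta> - 1) + 1) * A * (real n * h) powr \<theta>"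
      by (simp add: algebra_simps)
    finally show ?thesis by (simp add: C(2) n)
  qed
qed

text \<open>Sewing of the germ \<open>(x k - x i) *\<^sub>R z i\<close>: its defect is, up to sign,
  the single product \<open>(x k - x j) *\<^sub>R (z j - z i)\<close>, of order
  \<open>\<alpha> + \<beta>\<close>.\<close>

lemma discrete_young:
  fixes z :: "nat \<Rightarrow> 'a::real_normed_vector" and x :: "nat \<Rightarrow> real"
  assumes "1 < \<alpha> + \<beta>" "0 \<le> \<alpha>" "0 \<le> \<beta>" "0 \<le> h" "0 \<le> A" "0 \<le> B"
    and z: "\<And>i j. a \<le> i \<Longrightarrow> i < j \<Longrightarrow> j \<le> b \<Longrightarrow> norm (z j - z i) \<le> A * (real (j - i) * h) powr \<alpha>"
    and x: "\<And>i j. a \<le> i \<Longrightarrow> i < j \<Longrightarrow> j \<le> b \<Longrightarrow> \<bar>x j - x i\<bar> \<le> B * (real (j - i) * h) powr \<beta>"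
    and "a \<le> i" "i < k" "k \<le> b"
  shows "norm ((\<Sum>c\<in>{i..<k}. (x (Suc c) - x c) *\<^sub>R z c) - (x k - x i) *\<^sub>R z i)
    \<le> sew_const (\<alpha> + \<beta>) * (A * B) * (real (k - i) * h) powr (\<alpha> + \<beta>)"
proof -
  have "norm ((x k - x i) *\<^sub>R z i - (x j - x i) *\<^sub>R z i - (x k - x j) *\<^sub>R z j)
      \<le> A * B * (real (k - i) * h) powr (\<alpha> + \<beta>)"
    if "a \<le> i" "i < j" "j < k" "k \<le> b" for i j k
  proof -
    have "(x k - x i) *\<^sub>R z i - (x j - x i) *\<^sub>R z i - (x k - x j) *\<^sub>R z j = - ((x k - x j) *\<^sub>R (z j - z i))"
      by (simp add: algebra_simps)
    then have "norm ((x k - x i) *\<^sub>R z i - (x j - x i) *\<^sub>R z i - (x k - x j) *\<^sub>R z j)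
      = norm (z j - z i) * \<bar>x k - x j\<bar>" by simp
    also have "\<dots> \<le> (A * (real (j - i) * h) powr \<alpha>) * (B * (real (k - j) * h) powr \<beta>)"
      using that assms by (intro mult_mono z x) auto
    also have "\<dots> \<le> (A * (real (k - i) * h) powr \<alpha>) * (B * (real (k - i) * h) powr \<beta>)"
      using that assms by (intro mult_mono mult_left_mono powr_mono2 mult_right_mono) auto
    also have "\<dots> = A * B * (real (k - i) * h) powr (\<alpha> + \<beta>)"
      by (simp add: powr_add)
    finally show ?thesis .
  qed
  from discrete_sewing[OF assms(1,4) _ this assms(9-11)] assms(5,6) show ?thesis
    by simp
qed

text \<open>The defect is controlled at midpoints only, because the dyadic Levy area is additive up
  to a known term only there. After r halvings the a priori bound contributes 2^r terms of order
  (2^-r (t - s))^\<theta>', which vanish in the limit since \<theta>' > 1, while the defects form a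
  geometric series.\<close>

lemma bisection_bound:
  fixes \<Delta> :: "real \<Rightarrow> real \<Rightarrow> 'a::real_normed_vector"
  assumes "1 < \<theta>" "1 < \<theta>'" "0 \<le> A" "0 \<le> B"
    and defect: "\<And>s t. a \<le> s \<Longrightarrow> s < t \<Longrightarrow> t \<le> b \<Longrightarrow>
      norm (\<Delta> s t - \<Delta> s ((s + t) / 2) - \<Delta> ((s + t) / 2) t) \<le> A * (t - s) powr \<theta>"
    and small: "\<And>s t. a \<le> s \<Longrightarrow> s < t \<Longrightarrow> t \<le> b \<Longrightarrow> norm (\<Delta> s t) \<le> B * (t - s) powr \<theta>'"
    and "a \<le> s" "s < t" "t \<le> b"
  shows "norm (\<Delta> s t) \<le> A / (1 - 2 powr (1 - \<theta>)) * (t - s) powr \<theta>"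
proof -
  define C where "C = 1 / (1 - 2 powr (1 - \<theta>))"
  have "2 powr (1 - \<theta>) < 2 powr (0::real)"
    using assms by (intro powr_less_mono) auto
  then have "1 - 2 powr (1 - \<theta>) > 0" by simp
  then have C: "C * 2 powr (1 - \<theta>) + 1 = C" "C > 0"
    by (auto simp: C_def divide_simps)
  have half: "2 * (u / 2) powr e = 2 powr (1 - e) * u powr e" if "u > 0" for u e :: real
    using that by (simp add: powr_divide powr_diff)
  have ind: "norm (\<Delta> s t) \<le> A * C * (t - s) powr \<theta> + (2 powr (1 - \<theta>')) ^ r * B * (t - s) powr \<theta>'"
    if "a \<le> s" "s < t" "t \<le> b" for s t and r :: nat
    using that
  proof (induction r arbitrary: s t)
    case 0
    then show ?case using small[of s t] C assms by (simp add: add_increasing)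
  next
    case (Suc r)
    define u where "u = (s + t) / 2"
    have u: "a \<le> s" "s < u" "u \<le> b" "a \<le> u" "u < t" "t \<le> b" "u - s = (t - s) / 2" "t - u = (t - s) / 2"
      using Suc.prems by (auto simp: u_def field_simps)
    let ?R = "\<lambda>v. A * C * v powr \<theta> + (2 powr (1 - \<theta>')) ^ r * B * v powr \<theta>'"
    have "norm (\<Delta> s t) = norm ((\<Delta> s t - \<Delta> s u - \<Delta> u t) + \<Delta> s u + \<Delta> u t)" by simp
    also have "\<dots> \<le> norm (\<Delta> s t - \<Delta> s u - \<Delta> u t) + norm (\<Delta> s u) + norm (\<Delta> u t)"
      by (meson norm_triangle_ineq norm_triangle_le add_right_mono order_trans)
    also have "\<dots> \<le> A * (t - s) powr \<theta> + ?R ((t - s) / 2) + ?R ((t - s) / 2)"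
      using Suc.IH[OF u(1-3)] Suc.IH[OF u(4-6)] defect[OF Suc.prems, folded u_def]
      unfolding u(7,8) by linarith
    also have "\<dots> = A * (t - s) powr \<theta> + A * C * (2 * ((t - s) / 2) powr \<theta>)
        + (2 powr (1 - \<theta>')) ^ r * B * (2 * ((t - s) / 2) powr \<theta>')"
      by (simp add: algebra_simps)
    also have "\<dots> = A * (C * 2 powr (1 - \<theta>) + 1) * (t - s) powr \<theta>
        + (2 powr (1 - \<theta>')) ^ Suc r * B * (t - s) powr \<theta>'"
      using Suc.prems by (subst half, simp)+ (simp add: algebra_simps)
    finally show ?case by (simp add: C)
  qed
  have "2 powr (1 - \<theta>') < 2 powr (0::real)"
    using assms by (intro powr_less_mono) auto
  then have "(\<lambda>r. A * C * (t - s) powr \<theta> + (2 powr (1 - \<theta>')) ^ r * B * (t - s) powr \<theta>')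
     \<longlonglongrightarrow> A * C * (t - s) powr \<theta> + 0 * B * (t - s) powr \<theta>'"
    by (intro tendsto_intros LIMSEQ_power_zero) auto
  then have "norm (\<Delta> s t) \<le> A * C * (t - s) powr \<theta>"
    using ind[OF assms(7-9)] by (intro LIMSEQ_le_const[of _ "A * C * (t - s) powr \<theta>"]) auto
  then show ?thesis by (simp add: C_def)
qed

text \<open>A bound that improves itself from \<open>\<Lambda>\<close> to
  \<open>\<Lambda> / 2 + B\<close> can be iterated towards the fixed point \<open>2 * B\<close>.
  Some finite bound must be known at the start, but its size leaves no trace; this is how
  quantitative Hoelder constants arise from merely qualitative regularity.\<close>

lemma absorb:
  fixes v w :: "'i \<Rightarrow> real"
  assumes init: "0 \<le> \<Lambda>\<^sub>0" "\<And>i. i \<in> I \<Longrightarrow> v i \<le> \<Lambda>\<^sub>0 * w i" and "0 \<le> B"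
    and step: "\<And>\<Lambda> i. 0 \<le> \<Lambda> \<Longrightarrow> (\<And>i. i \<in> I \<Longrightarrow> v i \<le> \<Lambda> * w i) \<Longrightarrow> i \<in> I \<Longrightarrow> v i \<le> (\<Lambda> / 2 + B) * w i"
    and "\<And>i. i \<in> I \<Longrightarrow> 0 \<le> w i" and "i \<in> I"
  shows "v i \<le> 2 * B * w i"
proof -
  have *: "v i \<le> (\<Lambda>\<^sub>0 / 2 ^ r + 2 * B) * w i" if "i \<in> I" for r i
    using that
  proof (induction r arbitrary: i)
    case 0
    then show ?case using init(2)[of i] assms(3) assms(5)[of i] by (simp add: distrib_right add_increasing2)
  next
    case (Suc r)
    show ?case using step[of "\<Lambda>\<^sub>0 / 2 ^ r + 2 * B", OF _ Suc.IH Suc.prems] init(1) assms(3)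
      by (simp add: field_simps)
  qed
  have "(\<lambda>r. (\<Lambda>\<^sub>0 * (1/2) ^ r + 2 * B) * w i) \<longlonglongrightarrow> (\<Lambda>\<^sub>0 * 0 + 2 * B) * w i"
    by (intro tendsto_intros LIMSEQ_power_zero) auto
  then show ?thesis
    using *[OF assms(6)] by (intro LIMSEQ_le_const[of _ "2 * B * w i"]) (auto simp: power_divide)
qed


section \<open>Young integrals\<close>

lemma tagged_division_of_sequence:
  fixes p :: "nat \<Rightarrow> real"
  assumes "\<And>c. c < Suc N \<Longrightarrow> p c < p (Suc c)"
  shows "p 0 < p (Suc N) \<and> (\<lambda>c. (p c, {p c..p (Suc c)})) ` {..<Suc N} tagged_division_of {p 0..p (Suc N)}"
  using assms
proof (induction N)
  case 0
  have "{(p 0, cbox (p 0) (p 1))} tagged_division_of cbox (p 0) (p 1)"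
    using 0 by (intro tagged_division_of_self) (auto intro: less_imp_le)
  then show ?case using 0 by (simp add: lessThan_Suc)
next
  case (Suc N)
  have lt: "p (Suc N) < p (Suc (Suc N))" using Suc.prems by simp
  have IH: "p 0 < p (Suc N)"
    "(\<lambda>c. (p c, {p c..p (Suc c)})) ` {..<Suc N} tagged_division_of {p 0..p (Suc N)}"
    using Suc by auto
  have "{(p (Suc N), cbox (p (Suc N)) (p (Suc (Suc N))))} tagged_division_of cbox (p (Suc N)) (p (Suc (Suc N)))"
    using lt by (intro tagged_division_of_self) auto
  then have 2: "{(p (Suc N), {p (Suc N)..p (Suc (Suc N))})} tagged_division_of {p (Suc N)..p (Suc (Suc N))}"
    by simp
  have 3: "interior {p 0..p (Suc N)} \<inter> interior {p (Suc N)..p (Suc (Suc N))} = {}"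
    by auto
  have "{p 0..p (Suc N)} \<union> {p (Suc N)..p (Suc (Suc N))} = {p 0..p (Suc (Suc N))}"
    using lt IH(1) by auto
  with tagged_division_Un[OF IH(2) 2 3] lt IH(1) show ?case
    by (subst lessThan_Suc) (simp add: Un_commute del: lessThan_Suc)
qed

text \<open>Passes from tagged divisions to left-point sums along an increasing sequence, the form
  on which discrete sewing acts.\<close>

lemma young_integral_riemann_sum:
  fixes f :: "real \<Rightarrow> 'a::real_normed_vector"
  assumes "has_young_integral f g a b J" "0 < \<epsilon>"
  shows "\<exists>\<delta>>0. \<forall>p N. 0 < N \<and> p 0 = a \<and> p N = b \<and> (\<forall>c<N. p c < p (Suc c) \<and> p (Suc c) - p c < \<delta>) \<longrightarrow>
     norm ((\<Sum>c<N. (g (p (Suc c)) - g (p c)) *\<^sub>R f (p c)) - J) < \<epsilon>"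
proof -
  define Q where "Q \<delta> \<longleftrightarrow> (\<forall>\<D>. \<D> tagged_division_of {a..b} \<and> (\<lambda>x. ball x \<delta>) fine \<D> \<longrightarrow>
        norm ((\<Sum>(x, K)\<in>\<D>. (g (Sup K) - g (Inf K)) *\<^sub>R f x) - J) < \<epsilon>)" for \<delta>
  have "\<exists>\<delta>>0. Q \<delta>"
    using assms by (simp add: has_young_integral_def Q_def)
  then obtain \<delta> where \<delta>: "0 < \<delta>" "Q \<delta>"
    by blast
  have "norm ((\<Sum>c<N. (g (p (Suc c)) - g (p c)) *\<^sub>R f (p c)) - J) < \<epsilon>"
    if N: "0 < N" "p 0 = a" "p N = b" and p: "\<And>c. c < N \<Longrightarrow> p c < p (Suc c) \<and> p (Suc c) - p c < \<delta>" for p N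
  proof -
    let ?D = "(\<lambda>c. (p c, {p c..p (Suc c)})) ` {..<N}"
    obtain N' where N': "N = Suc N'" using N(1) gr0_implies_Suc by blast
    have t: "p c < p (Suc c)" if "c < Suc N'" for c using p that N' by auto
    have "?D tagged_division_of {a..b}"
      using tagged_division_of_sequence[of N' p, OF t] N(2,3) by (simp only: N')
    moreover have "(\<lambda>x. ball x \<delta>) fine ?D"
      using p by (force simp: fine_def dist_real_def)
    ultimately have *: "norm ((\<Sum>(x, K)\<in>?D. (g (Sup K) - g (Inf K)) *\<^sub>R f x) - J) < \<epsilon>"
      by (intro \<delta>(2)[unfolded Q_def, rule_format] conjI)
    \<comment> \<open>Distinct indices must give distinct tagged intervals, since a sum over a set
      would count a repeated one only once.\<close>
    have "inj_on (\<lambda>c. (p c, {p c..p (Suc c)})) {..<N}"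
    proof (rule linorder_inj_onI)
      fix c d assume cd: "c < d" "c \<in> {..<N}" "d \<in> {..<N}"
      have "p c < p d"
        using cd
      proof (induction d)
        case (Suc d)
        then show ?case using p[of d] by (cases "c = d") auto
      qed simp
      then show "(p c, {p c..p (Suc c)}) \<noteq> (p d, {p d..p (Suc d)})" by simp
    qed auto
    then have "(\<Sum>(x, K)\<in>?D. (g (Sup K) - g (Inf K)) *\<^sub>R f x)
       = (\<Sum>c<N. (g (Sup {p c..p (Suc c)}) - g (Inf {p c..p (Suc c)})) *\<^sub>R f (p c))"
      by (subst sum.reindex) (auto simp: o_def)
    also have "\<dots> = (\<Sum>c<N. (g (p (Suc c)) - g (p c)) *\<^sub>R f (p c))"
      using p by (intro sum.cong refl) (auto simp: less_imp_le)
    finally show ?thesis using * by simp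
  qed
  then show ?thesis
    by (intro exI[of _ \<delta>] conjI allI impI \<delta>(1)) auto
qed

text \<open>The Young-Loeve estimate. Both integrals start at 0, so their difference is read off
  from one partition of [0,t] that passes through s: the part beyond s is a Riemann sum that
  \<open>discrete_young\<close> controls uniformly in the mesh. For s = 0 the convention J = 0
  replaces the integral over a degenerate interval.\<close>

lemma young_loeve:
  fixes f :: "real \<Rightarrow> 'a::real_normed_vector"
  assumes J': "has_young_integral f g 0 t J'"
    and J: "if s = 0 then J = 0 else has_young_integral f g 0 s J"
    and st: "0 \<le> s" "s < t"
    and "1 < \<alpha> + \<beta>" "0 \<le> \<alpha>" "0 \<le> \<beta>" "0 \<le> A" "0 \<le> B"
    and f: "\<And>u v. s \<le> u \<Longrightarrow> u < v \<Longrightarrow> v \<le> t \<Longrightarrow> norm (f v - f u) \<le> A * (v - u) powr \<alpha>"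
    and g: "\<And>u v. s \<le> u \<Longrightarrow> u < v \<Longrightarrow> v \<le> t \<Longrightarrow> \<bar>g v - g u\<bar> \<le> B * (v - u) powr \<beta>"
  shows "norm (J' - J - (g t - g s) *\<^sub>R f s) \<le> sew_const (\<alpha> + \<beta>) * (A * B) * (t - s) powr (\<alpha> + \<beta>)"
proof (rule field_le_epsilon)
  fix \<epsilon> :: real assume "0 < \<epsilon>"
  then have e2: "0 < \<epsilon> / 2" by simp
  define close where "close r K \<delta> \<longleftrightarrow> (\<forall>p N. 0 < N \<and> p 0 = 0 \<and> p N = r \<and>
     (\<forall>c<N. p c < p (Suc c) \<and> p (Suc c) - p c < \<delta>) \<longrightarrow>
     norm ((\<Sum>c<N. (g (p (Suc c)) - g (p c)) *\<^sub>R f (p c)) - K) < \<epsilon> / 2)" for r K \<delta>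
  have close: "\<exists>\<delta>>0. close r K \<delta>" if "has_young_integral f g 0 r K" for r K
    using young_integral_riemann_sum[OF that e2] by (simp add: close_def)
  obtain \<delta>' where \<delta>': "0 < \<delta>'" "close t J' \<delta>'"
    using close[OF J'] by blast
  obtain \<delta> where \<delta>: "0 < \<delta>" "s \<noteq> 0 \<Longrightarrow> close s J \<delta>"
    using close[of s J] J by (cases "s = 0") (auto intro: that[of 1])
  define m where "m = min \<delta> \<delta>'"
  have m: "0 < m" using \<delta>(1) \<delta>'(1) by (simp add: m_def)
  obtain N where N: "t / m < real N" using reals_Archimedean2 by blast
  have "0 < t / m" using m st by simp
  then have N0: "0 < N" "0 < real N" using N by (auto intro: Nat.gr0I)
  \<comment> \<open>\<open>k\<close> is the index of s in the partition: N cells of length s / N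
    come first, or none when s = 0, and then N cells of length \<open>h\<close>. Both lengths are at
    most t / N, hence below the mesh bound.\<close>
  define k where "k = (if s = 0 then 0 else N)"
  define h where "h = (t - s) / real N"
  define p where "p c = (if c \<le> k then real c * (s / real N) else s + real (c - k) * h)" for c
  have tN: "t / real N < m" using N m N0 by (simp add: field_simps)
  have h: "0 < h" "h < m" "s / real N < m"
    using st N0 tN m by (auto simp: h_def field_simps)
  have pk: "p k = s" using N0 by (auto simp: p_def k_def)
  have p_ge: "p c = s + real (c - k) * h" if "k \<le> c" for c
    using that pk by (cases "c = k") (auto simp: p_def)
  have p0: "p 0 = 0" by (simp add: p_def)
  have pt: "p (k + N) = t" using N0 by (simp add: p_ge h_def)
  have pS1: "p (Suc c) - p c = s / real N" if "c < k" for c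
    using that by (simp add: p_def algebra_simps add_divide_distrib)
  have pS2: "p (Suc c) - p c = h" if "k \<le> c" for c
    using that by (simp add: p_ge Suc_diff_le algebra_simps)
  have sk: "0 < s / real N" if "c < k" for c
    using that st N0 by (auto simp: k_def split: if_splits)
  have step: "p c < p (Suc c) \<and> p (Suc c) - p c < m" for c
    using pS1[of c] pS2[of c] sk[of c] h by (cases "c < k") auto
  have R': "norm ((\<Sum>c<k + N. (g (p (Suc c)) - g (p c)) *\<^sub>R f (p c)) - J') < \<epsilon> / 2"
    using \<delta>'(2)[unfolded close_def, rule_format, of "k + N" p] step N0 p0 pt by (auto simp: m_def)
  have R: "norm ((\<Sum>c<k. (g (p (Suc c)) - g (p c)) *\<^sub>R f (p c)) - J) < \<epsilon> / 2"
  proof (cases "s = 0")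
    case True
    then show ?thesis using J e2 by (auto simp: k_def)
  next
    case False
    then show ?thesis using \<delta>(2)[OF False, unfolded close_def, rule_format, of k p] step N0 p0 pk by (auto simp: m_def k_def)
  qed
  have le: "p c \<le> p d" if "c \<le> d" for c d
    using lift_Suc_mono_le[of p, OF _ that] step by (simp add: less_imp_le)
  have lt: "p c < p d" if "c < d" for c d
    using le[of "Suc c" d] step[of c] that by auto
  have diff: "p d - p c = real (d - c) * h" if "k \<le> c" "c \<le> d" for c d
    using that by (simp add: p_ge of_nat_diff algebra_simps)
  have S: "norm ((\<Sum>c\<in>{k..<k + N}. (g (p (Suc c)) - g (p c)) *\<^sub>R f (p c)) - (g (p (k + N)) - g (p k)) *\<^sub>R f (p k))
    \<le> sew_const (\<alpha> + \<beta>) * (A * B) * (real (k + N - k) * h) powr (\<alpha> + \<beta>)"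
  proof (rule discrete_young[where a = k and b = "k + N"])
    fix i j assume ij: "k \<le> i" "i < j" "j \<le> k + N"
    have "s \<le> p i" "p i < p j" "p j \<le> t"
      using le[of k i] le[of j "k + N"] lt[of i j] ij pk pt by auto
    then show "norm (f (p j) - f (p i)) \<le> A * (real (j - i) * h) powr \<alpha>"
      "\<bar>g (p j) - g (p i)\<bar> \<le> B * (real (j - i) * h) powr \<beta>"
      using f[of "p i" "p j"] g[of "p i" "p j"] diff[of i j] ij by auto
  qed (use assms h N0 in auto)
  have "(\<Sum>c<k + N. (g (p (Suc c)) - g (p c)) *\<^sub>R f (p c)) =
     (\<Sum>c<k. (g (p (Suc c)) - g (p c)) *\<^sub>R f (p c)) + (\<Sum>c\<in>{k..<k + N}. (g (p (Suc c)) - g (p c)) *\<^sub>R f (p c))"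
    by (simp add: lessThan_atLeast0 sum.atLeastLessThan_concat)
  then have "J' - J - (g t - g s) *\<^sub>R f s =
      ((\<Sum>c\<in>{k..<k + N}. (g (p (Suc c)) - g (p c)) *\<^sub>R f (p c)) - (g (p (k + N)) - g (p k)) *\<^sub>R f (p k))
      + ((\<Sum>c<k. (g (p (Suc c)) - g (p c)) *\<^sub>R f (p c)) - J)
      - ((\<Sum>c<k + N. (g (p (Suc c)) - g (p c)) *\<^sub>R f (p c)) - J')"
    by (simp add: pt pk)
  also have "norm \<dots> \<le> sew_const (\<alpha> + \<beta>) * (A * B) * (real (k + N - k) * h) powr (\<alpha> + \<beta>) + \<epsilon> / 2 + \<epsilon> / 2"
    using S R R' norm_triangle_ineq4 norm_triangle_ineq by (smt (verit))
  also have "real (k + N - k) * h = t - s" using N0 by (simp add: h_def)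
  finally show "norm (J' - J - (g t - g s) *\<^sub>R f s)
      \<le> sew_const (\<alpha> + \<beta>) * (A * B) * (t - s) powr (\<alpha> + \<beta>) + \<epsilon>" by simp
qed


section \<open>Pathwise expansion of the solution\<close>

lemma norm_le_of_diff:
  fixes a b :: "'a::real_normed_vector"
  assumes "norm (a - b) \<le> p" "norm b \<le> q" shows "norm a \<le> p + q"
  using norm_triangle_ineq[of "a - b" b] assms by simp

lemma sum_lessThan_add:
  fixes f :: "nat \<Rightarrow> 'a::comm_monoid_add"
  shows "(\<Sum>c<m + n. f c) = (\<Sum>c<m. f c) + (\<Sum>c<n. f (m + c))"
  by (induction n) (auto simp: ac_simps)

text \<open>\<open>levy_area x i j s t\<close> is the Levy area of \<open>(x i, x j)\<close> over \<open>[s,t]\<close>, that is, the difference between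
  the iterated integral and half the product of the increments. It is defined by its dyadic expansion,
  because the moments of the levels of that expansion can be estimated one by one.\<close>

definition levy_piece :: "('d \<Rightarrow> real \<Rightarrow> real) \<Rightarrow> 'd \<Rightarrow> 'd \<Rightarrow> real \<Rightarrow> real \<Rightarrow> real" where
  "levy_piece x i j s t = ((x i ((s + t) / 2) - x i s) * (x j t - x j ((s + t) / 2))
     - (x i t - x i ((s + t) / 2)) * (x j ((s + t) / 2) - x j s)) / 2"

text \<open>The area gained when the inscribed polygon with 2^r edges is refined to 2^(r + 1) edges:
  over each edge one signed triangle, a \<open>levy_piece\<close>.\<close>

definition levy_level :: "('d \<Rightarrow> real \<Rightarrow> real) \<Rightarrow> 'd \<Rightarrow> 'd \<Rightarrow> real \<Rightarrow> real \<Rightarrow> nat \<Rightarrow> real" where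
  "levy_level x i j s t r = (\<Sum>c<2 ^ r. levy_piece x i j (s + real c * ((t - s) / 2 ^ r)) (s + real (Suc c) * ((t - s) / 2 ^ r)))"

definition levy_area :: "('d \<Rightarrow> real \<Rightarrow> real) \<Rightarrow> 'd \<Rightarrow> 'd \<Rightarrow> real \<Rightarrow> real \<Rightarrow> real" where
  "levy_area x i j s t = (\<Sum>r. levy_level x i j s t r)"

text \<open>\<open>DU l\<close> stands for the derivative of \<open>U l\<close>, and
  \<open>DU j z (U i z)\<close> is the second-order coefficient of the pair (i, j). The four-point
  estimate \<open>U_four\<close> makes the difference of coefficients along two paths Hoelder again.
  \<open>R3\<close> is the remainder constant of one scheme step; it sits here so that every
  constant below depends on these data alone, never on the path or the grid.\<close>

locale vector_fields =
  fixes U :: "'d::finite \<Rightarrow> 'a::real_normed_vector \<Rightarrow> 'a" and DU :: "'d \<Rightarrow> 'a \<Rightarrow> 'a \<Rightarrow> 'a" and D L \<beta> R3 :: real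
  assumes D_eq: "D = real CARD('d)" and L: "1 \<le> L" and R3: "0 \<le> R3" and beta: "1 / 2 < \<beta>" "\<beta> \<le> 1"
    and U_bound: "norm (U l z) \<le> L"
    and U_lip: "norm (U l z - U l z') \<le> L * norm (z - z')"
    and DU_linear: "linear (DU l z)"
    and DU_bound: "norm (DU l z v) \<le> L * norm v"
    and U_taylor: "norm (U l z' - U l z - DU l z (z' - z)) \<le> L * (norm (z' - z))\<^sup>2"
    and U_four: "norm ((U l a - U l b) - (U l c - U l e)) \<le> L * norm ((a - b) - (c - e)) + L * norm (a - b) * norm (b - e)"
    and G_bound: "norm (DU j z (U i z)) \<le> L"
    and G_lip: "norm (DU j z (U i z) - DU j z' (U i z')) \<le> L * norm (z - z')"
begin

abbreviation G :: "'d \<Rightarrow> 'd \<Rightarrow> 'a \<Rightarrow> 'a" where "G i j z \<equiv> DU j z (U i z)"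
abbreviation \<sigma> :: real where "\<sigma> \<equiv> sew_const (2 * \<beta>)"

lemma D: "1 \<le> D" by (simp add: D_eq Suc_leI)
lemma sigma: "1 \<le> \<sigma>" using sew_const(1)[of "2 * \<beta>"] beta by simp

text \<open>\<open>R1\<close> and \<open>R2\<close> are the remainder constants of the first- and
  second-order expansions of the solution, to be multiplied by K^2 and K^3; \<open>CA\<close> is the
  constant of the Levy area.\<close>

definition R1 :: real where "R1 = 2 * D\<^sup>2 * \<sigma> * L\<^sup>2"
definition CA :: real where "CA = 1 / (1 - 2 powr (1 - 2 * \<beta>))"
definition R2 :: real where
  "R2 = (D * L * (4 * D\<^sup>2 * L\<^sup>2 + R1) + 4 * D ^ 3 * L\<^sup>2 * CA) / (1 - 2 powr (1 - 3 * \<beta>))"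

lemma CA: "1 \<le> CA"
proof -
  have "2 powr (1 - 2 * \<beta>) < 2 powr (0::real)" using beta by (intro powr_less_mono) auto
  moreover have "0 < 2 powr (1 - 2 * \<beta>)" by simp
  ultimately show ?thesis by (simp add: CA_def field_simps)
qed

lemma R1: "0 \<le> R1" using sigma by (simp add: R1_def)

lemma R2: "0 \<le> R2"
proof -
  have "2 powr (1 - 3 * \<beta>) < 2 powr (0::real)" using beta by (intro powr_less_mono) auto
  then show ?thesis using R1 CA L D by (simp add: R2_def)
qed

text \<open>\<open>R4\<close> bounds the remainder of a scheme step after its first-order terms,
  \<open>Cy\<close> the Hoelder constant of the scheme, \<open>C5\<close> the feedback of the
  supremum of the error into its Hoelder constant.\<close>

definition R4 :: real where "R4 = D\<^sup>2 * L / 2 + R3"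
definition Cy :: real where "Cy = 2 * (D * L + R4)"
definition C5 :: real where "C5 = D * L + D * \<sigma> * L * Cy + D\<^sup>2 * L / 2"
text \<open>Threshold for \<open>K * \<tau> powr \<beta>\<close>, which fixes the block length
  \<open>\<tau>\<close>: small enough that sewing returns at most half of the constant it is given,
  and that the supremum of the error on a block can be reabsorbed.\<close>

definition cs :: real where "cs = 1 / (4 * (1 + C5 + D * \<sigma> * L + R4))"
lemma R4: "0 \<le> R4" using L R3 by (simp add: R4_def)
lemma Cy: "0 \<le> Cy" using L R4 D by (simp add: Cy_def)
lemma C5: "0 \<le> C5" using L Cy D sigma by (simp add: C5_def)
lemma cs: "0 < cs" "cs \<le> 1" "D * \<sigma> * L * cs \<le> 1 / 2" "R4 * cs \<le> 1" "C5 * cs \<le> 1 / 4"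
proof -
  define m where "m = D * \<sigma> * L"
  have p: "0 \<le> C5" "0 \<le> m" "0 \<le> R4" using L C5 D sigma R4 by (auto simp: m_def)
  then have "0 < 1 + C5 + m + R4" by linarith
  with p show "0 < cs" "cs \<le> 1" "D * \<sigma> * L * cs \<le> 1 / 2" "R4 * cs \<le> 1" "C5 * cs \<le> 1 / 4"
    unfolding cs_def m_def[symmetric] by (auto simp: divide_simps)
qed
end

locale driven = vector_fields U DU D L \<beta> R3
  for U :: "'d::finite \<Rightarrow> 'a::real_normed_vector \<Rightarrow> 'a" and DU D L \<beta> R3 +
  fixes x :: "'d \<Rightarrow> real \<Rightarrow> real" and T K :: real
  assumes T: "0 < T" and K: "1 \<le> K"
    and x: "0 \<le> s \<Longrightarrow> s < t \<Longrightarrow> t \<le> T \<Longrightarrow> \<bar>x l t - x l s\<bar> \<le> K * (t - s) powr \<beta>"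
begin

abbreviation "area_piece \<equiv> levy_piece x"
abbreviation "area_level \<equiv> levy_level x"
abbreviation "area \<equiv> levy_area x"

section \<open>Convergence of the dyadic Levy area and Chen's relation\<close>

lemma area_piece_bound:
  assumes "0 \<le> s" "s < t" "t \<le> T"
  shows "\<bar>area_piece i j s t\<bar> \<le> K\<^sup>2 * (t - s) powr (2 * \<beta>)"
proof -
  let ?u = "(s + t) / 2"
  have le: "\<bar>x i ?u - x i s\<bar> \<le> K * (t - s) powr \<beta>" "\<bar>x i t - x i ?u\<bar> \<le> K * (t - s) powr \<beta>" for i
  proof -
    have "\<bar>x i ?u - x i s\<bar> \<le> K * (?u - s) powr \<beta>" "\<bar>x i t - x i ?u\<bar> \<le> K * (t - ?u) powr \<beta>"
      by (rule x; use assms in simp)+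
    moreover have "(?u - s) powr \<beta> \<le> (t - s) powr \<beta>" "(t - ?u) powr \<beta> \<le> (t - s) powr \<beta>"
      using assms beta by (auto intro!: powr_mono2)
    ultimately show "\<bar>x i ?u - x i s\<bar> \<le> K * (t - s) powr \<beta>" "\<bar>x i t - x i ?u\<bar> \<le> K * (t - s) powr \<beta>"
      using K by (meson mult_left_mono order_trans zero_le_one)+
  qed
  have "\<bar>(x i ?u - x i s) * (x j t - x j ?u)\<bar> \<le> (K * (t - s) powr \<beta>) * (K * (t - s) powr \<beta>)"
    unfolding abs_mult by (intro mult_mono le) (use K in auto)
  moreover have "\<bar>(x i t - x i ?u) * (x j ?u - x j s)\<bar> \<le> (K * (t - s) powr \<beta>) * (K * (t - s) powr \<beta>)"
    unfolding abs_mult by (intro mult_mono le) (use K in auto)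
  moreover have "(K * (t - s) powr \<beta>) * (K * (t - s) powr \<beta>) = K\<^sup>2 * (t - s) powr (2 * \<beta>)"
    by (simp add: power2_eq_square mult_ac flip: powr_add)
  ultimately show ?thesis unfolding levy_piece_def by (simp add: abs_triangle_ineq4 order_trans[OF abs_triangle_ineq4])
qed

text \<open>There are 2^r triangles of order (2^-r (t - s))^(2 \<beta>), so the levels decay
  geometrically because \<beta> > 1/2.\<close>

lemma area_level_bound:
  assumes "0 \<le> s" "s < t" "t \<le> T"
  shows "\<bar>area_level i j s t r\<bar> \<le> K\<^sup>2 * (t - s) powr (2 * \<beta>) * (2 powr (1 - 2 * \<beta>)) ^ r"
proof -
  define d where "d = (t - s) / 2 ^ r"
  have d: "0 < d" using assms by (simp add: d_def)
  have "\<bar>area_level i j s t r\<bar> \<le> (\<Sum>c<(2::nat) ^ r. K\<^sup>2 * d powr (2 * \<beta>))"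
    unfolding levy_level_def d_def[symmetric]
  proof (rule order_trans[OF sum_abs], rule sum_mono)
    fix c :: nat assume "c \<in> {..<2 ^ r}"
    then have "real (Suc c) \<le> 2 ^ r" by (metis Suc_leI lessThan_iff of_nat_le_iff of_nat_numeral of_nat_power)
    then have "real (Suc c) * d \<le> 2 ^ r * d" using d by (intro mult_right_mono) auto
    then have "s + real (Suc c) * d \<le> T" using assms by (simp add: d_def)
    then have "\<bar>area_piece i j (s + real c * d) (s + real (Suc c) * d)\<bar>
       \<le> K\<^sup>2 * ((s + real (Suc c) * d) - (s + real c * d)) powr (2 * \<beta>)"
      using assms d by (intro area_piece_bound) (auto simp: algebra_simps)
    then show "\<bar>area_piece i j (s + real c * d) (s + real (Suc c) * d)\<bar> \<le> K\<^sup>2 * d powr (2 * \<beta>)"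
      by (simp add: algebra_simps)
  qed
  also have "\<dots> = K\<^sup>2 * (2 ^ r * d powr (2 * \<beta>))" by simp
  also have "2 ^ r * d powr (2 * \<beta>) = (t - s) powr (2 * \<beta>) * (2 powr (1 - 2 * \<beta>)) ^ r"
  proof -
    have "(2 powr (1 - 2 * \<beta>)) ^ r = 2 powr (real r * (1 - 2 * \<beta>))"
      by (simp add: powr_powr mult.commute flip: powr_realpow)
    also have "\<dots> = 2 ^ r / 2 powr (real r * (2 * \<beta>))"
      by (simp add: right_diff_distrib powr_diff powr_realpow)
    also have "2 powr (real r * (2 * \<beta>)) = (2 ^ r) powr (2 * \<beta>)"
      by (simp add: powr_powr flip: powr_realpow)
    finally show ?thesis using assms by (simp add: d_def powr_divide)
  qed
  finally show ?thesis by (simp add: mult_ac)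
qed

lemma area_summable:
  assumes "0 \<le> s" "s < t" "t \<le> T"
  shows "summable (area_level i j s t)" "\<bar>area i j s t\<bar> \<le> CA * K\<^sup>2 * (t - s) powr (2 * \<beta>)"
proof -
  have "2 powr (1 - 2 * \<beta>) < 2 powr (0::real)" using beta by (intro powr_less_mono) auto
  then have lt: "norm (2 powr (1 - 2 * \<beta>) :: real) < 1" by simp
  have s: "summable (\<lambda>r. K\<^sup>2 * (t - s) powr (2 * \<beta>) * (2 powr (1 - 2 * \<beta>)) ^ r)"
    using lt by (intro summable_mult summable_geometric)
  have b: "norm (area_level i j s t r) \<le> K\<^sup>2 * (t - s) powr (2 * \<beta>) * (2 powr (1 - 2 * \<beta>)) ^ r" for r
    using area_level_bound[OF assms] by simp
  show "summable (area_level i j s t)"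
    by (rule summable_comparison_test'[OF s, of 0]) (rule b)
  have "norm (area i j s t) \<le> (\<Sum>r. K\<^sup>2 * (t - s) powr (2 * \<beta>) * (2 powr (1 - 2 * \<beta>)) ^ r)"
    unfolding levy_area_def by (rule norm_suminf_le[OF b s])
  also have "\<dots> = K\<^sup>2 * (t - s) powr (2 * \<beta>) * (1 / (1 - 2 powr (1 - 2 * \<beta>)))"
    unfolding suminf_mult[OF summable_geometric[OF lt]] suminf_geometric[OF lt] ..
  finally show "\<bar>area i j s t\<bar> \<le> CA * K\<^sup>2 * (t - s) powr (2 * \<beta>)"
    by (simp add: CA_def mult_ac)
qed

lemma area_level_Suc:
  fixes s t :: real
  defines "u \<equiv> (s + t) / 2"
  shows "area_level i j s t (Suc r) = area_level i j s u r + area_level i j u t r"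
proof -
  define d where "d = (t - s) / 2 ^ Suc r"
  have du: "(u - s) / 2 ^ r = d" "(t - u) / 2 ^ r = d"
    by (auto simp: d_def u_def field_simps)
  have u: "u = s + 2 ^ r * d" by (simp add: d_def u_def field_simps)
  have "area_level i j s t (Suc r) = (\<Sum>c<(2::nat) ^ r + 2 ^ r. area_piece i j (s + real c * d) (s + real (Suc c) * d))"
    unfolding levy_level_def d_def[symmetric] by (simp only: power_Suc mult_2)
  also have "\<dots> = (\<Sum>c<2 ^ r. area_piece i j (s + real c * d) (s + real (Suc c) * d))
      + (\<Sum>c<2 ^ r. area_piece i j (s + real (2 ^ r + c) * d) (s + real (Suc (2 ^ r + c)) * d))"
    by (rule sum_lessThan_add)
  also have "(\<Sum>c<2 ^ r. area_piece i j (s + real (2 ^ r + c) * d) (s + real (Suc (2 ^ r + c)) * d))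
     = area_level i j u t r"
    unfolding levy_level_def du by (intro sum.cong refl) (simp add: u algebra_simps)
  finally show ?thesis by (simp add: levy_level_def[of x i j s u] du)
qed

text \<open>Chen's relation at a midpoint: level r + 1 on [s,t] consists of the levels r on its two
  halves, so only level 0 is left over.\<close>

lemma area_midpoint:
  fixes s t :: real
  assumes "0 \<le> s" "s < t" "t \<le> T"
  defines "u \<equiv> (s + t) / 2"
  shows "area i j s t = area i j s u + area i j u t + area_piece i j s t"
proof -
  have u: "s < u" "u < t" "0 \<le> u" "u \<le> T" using assms by (auto simp: u_def)
  have "area i j s t = area_level i j s t 0 + (\<Sum>r. area_level i j s t (Suc r))"
    unfolding levy_area_def using area_summable(1)[OF assms(1-3)] by (subst suminf_split_head) auto
  also have "(\<Sum>r. area_level i j s t (Suc r)) = area i j s u + area i j u t"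
    unfolding area_level_Suc levy_area_def u_def[symmetric] using u assms
    by (intro suminf_add[symmetric] area_summable(1)) auto
  finally show ?thesis by (simp add: levy_level_def)
qed

end

text \<open>Abstracts what is used of a Young solution. \<open>Y_young\<close> is the Young-Loeve
  estimate for the sum of the integrals, conditional on a Hoelder constant \<open>\<Lambda>\<close>
  of \<open>Y\<close> on the interval; \<open>\<Lambda>\<^sub>0\<close> is an a priori constant of
  uncontrolled size that starts \<open>absorb\<close>.\<close>

locale driven_solution = driven U DU D L \<beta> R3 x T K
  for U :: "'d::finite \<Rightarrow> 'a::real_normed_vector \<Rightarrow> 'a" and DU D L \<beta> R3 x T K +
  fixes Y :: "real \<Rightarrow> 'a" and \<Lambda>\<^sub>0 :: real
  assumes Y0: "0 \<le> \<Lambda>\<^sub>0" "0 \<le> s \<Longrightarrow> s < t \<Longrightarrow> t \<le> T \<Longrightarrow> norm (Y t - Y s) \<le> \<Lambda>\<^sub>0 * (t - s) powr \<beta>"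
    and Y_young: "0 \<le> s \<Longrightarrow> s < t \<Longrightarrow> t \<le> T \<Longrightarrow> 0 \<le> \<Lambda> \<Longrightarrow>
      (\<And>u v. s \<le> u \<Longrightarrow> u < v \<Longrightarrow> v \<le> t \<Longrightarrow> norm (Y v - Y u) \<le> \<Lambda> * (v - u) powr \<beta>) \<Longrightarrow>
      norm (Y t - Y s - (\<Sum>l\<in>UNIV. (x l t - x l s) *\<^sub>R U l (Y s))) \<le> D * (\<sigma> * (L * \<Lambda> * K)) * (t - s) powr (2 * \<beta>)"
begin

section \<open>Expansions of the solution on short intervals\<close>

lemma sum_U_bound:
  assumes "\<And>l. \<bar>d l\<bar> \<le> w" shows "norm (\<Sum>l\<in>UNIV. d l *\<^sub>R U l z) \<le> D * L * w"
proof -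
  have "norm (\<Sum>l\<in>UNIV. d l *\<^sub>R U l z) \<le> (\<Sum>l\<in>(UNIV::'d set). w * L)"
  proof (rule order_trans[OF norm_sum], rule sum_mono)
    fix l :: 'd
    have "0 \<le> w" using assms[of l] by linarith
    then show "norm (d l *\<^sub>R U l z) \<le> w * L"
      using assms[of l] U_bound[of l z] by (auto intro!: mult_mono)
  qed
  then show ?thesis by (simp add: D_eq mult_ac)
qed

text \<open>Absorption over all intervals of length at most \<open>\<tau>\<close>: the hypothesis on
  \<open>\<tau>\<close> is what brings the factor of \<open>\<Lambda>\<close> down to 1/2.\<close>

lemma Y_holder:
  assumes \<tau>: "D * \<sigma> * L * (K * \<tau> powr \<beta>) \<le> 1 / 2" and st: "0 \<le> s" "s < t" "t \<le> T" "t - s \<le> \<tau>"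
  shows "norm (Y t - Y s) \<le> 2 * D * L * K * (t - s) powr \<beta>"
proof -
  let ?I = "{(s, t). 0 \<le> s \<and> s < t \<and> t \<le> T \<and> t - s \<le> \<tau>}"
  have "norm (Y (snd p) - Y (fst p)) \<le> 2 * (D * L * K) * ((snd p - fst p) powr \<beta>)" if "p \<in> ?I" for p
  proof (rule absorb[where I = ?I and \<Lambda>\<^sub>0 = \<Lambda>\<^sub>0 and i = p])
    fix \<Lambda> :: real and i :: "real \<times> real"
    assume \<Lambda>: "0 \<le> \<Lambda>" and hyp: "\<And>i. i \<in> ?I \<Longrightarrow> norm (Y (snd i) - Y (fst i)) \<le> \<Lambda> * (snd i - fst i) powr \<beta>"
      and "i \<in> ?I"
    then obtain s t where i: "i = (s, t)" and st: "0 \<le> s" "s < t" "t \<le> T" "t - s \<le> \<tau>" by auto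
    have hyp': "norm (Y v - Y u) \<le> \<Lambda> * (v - u) powr \<beta>" if "s \<le> u" "u < v" "v \<le> t" for u v
      using hyp[of "(u, v)"] that st by simp
    have "norm (Y t - Y s - (\<Sum>l\<in>UNIV. (x l t - x l s) *\<^sub>R U l (Y s))) \<le> D * (\<sigma> * (L * \<Lambda> * K)) * (t - s) powr (2 * \<beta>)"
      by (rule Y_young) (use st \<Lambda> hyp' in auto)
    moreover have "norm (\<Sum>l\<in>UNIV. (x l t - x l s) *\<^sub>R U l (Y s)) \<le> D * L * (K * (t - s) powr \<beta>)"
      using st by (intro sum_U_bound x) auto
    ultimately have "norm (Y t - Y s) \<le> D * (\<sigma> * (L * \<Lambda> * K)) * (t - s) powr (2 * \<beta>) + D * L * (K * (t - s) powr \<beta>)"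
      by (rule norm_le_of_diff)
    also have "(t - s) powr (2 * \<beta>) = (t - s) powr \<beta> * (t - s) powr \<beta>"
      by (simp flip: powr_add)
    also have "D * (\<sigma> * (L * \<Lambda> * K)) * ((t - s) powr \<beta> * (t - s) powr \<beta>) + D * L * (K * (t - s) powr \<beta>)
       = ((D * \<sigma> * L * (K * (t - s) powr \<beta>)) * \<Lambda> + D * L * K) * (t - s) powr \<beta>"
      by (simp add: algebra_simps)
    also have "\<dots> \<le> ((1/2) * \<Lambda> + D * L * K) * (t - s) powr \<beta>"
    proof (intro mult_right_mono add_right_mono)
      have "D * \<sigma> * L * (K * (t - s) powr \<beta>) \<le> D * \<sigma> * L * (K * \<tau> powr \<beta>)"
        using st K sigma L D beta by (intro mult_left_mono powr_mono2) auto
      then show "D * \<sigma> * L * (K * (t - s) powr \<beta>) \<le> 1/2" using \<tau> by linarith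
    qed (use \<Lambda> in auto)
    finally show "norm (Y (snd i) - Y (fst i)) \<le> (\<Lambda> / 2 + D * L * K) * (snd i - fst i) powr \<beta>"
      by (simp add: i)
  qed (use that Y0 L K D in auto)
  from this[of "(s, t)"] st show ?thesis by (simp add: mult_ac)
qed

lemma Y_first_order:
  assumes \<tau>: "D * \<sigma> * L * (K * \<tau> powr \<beta>) \<le> 1 / 2" and st: "0 \<le> s" "s < t" "t \<le> T" "t - s \<le> \<tau>"
  shows "norm (Y t - Y s - (\<Sum>l\<in>UNIV. (x l t - x l s) *\<^sub>R U l (Y s))) \<le> R1 * K\<^sup>2 * (t - s) powr (2 * \<beta>)"
proof -
  have "norm (Y t - Y s - (\<Sum>l\<in>UNIV. (x l t - x l s) *\<^sub>R U l (Y s)))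
      \<le> D * (\<sigma> * (L * (2 * D * L * K) * K)) * (t - s) powr (2 * \<beta>)"
    by (rule Y_young) (use st K L D in \<open>auto intro!: Y_holder[OF \<tau>]\<close>)
  also have "D * (\<sigma> * (L * (2 * D * L * K) * K)) = R1 * K\<^sup>2"
    by (simp add: R1_def power2_eq_square)
  finally show ?thesis .
qed

text \<open>The remainder has a midpoint defect of order 3 \<beta>, since the second-order terms are
  built to cancel the change of \<open>U j\<close> over the first half to leading order. A priori it
  is of order 2 \<beta> > 1, so \<open>bisection_bound\<close> applies.\<close>

lemma Y_second_order:
  assumes \<tau>: "D * \<sigma> * L * (K * \<tau> powr \<beta>) \<le> 1 / 2" and st: "0 \<le> s" "s < t" "t \<le> T" "t - s \<le> \<tau>"
  shows "norm (Y t - Y s - (\<Sum>l\<in>UNIV. (x l t - x l s) *\<^sub>R U l (Y s))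
     - (\<Sum>i\<in>UNIV. \<Sum>j\<in>UNIV. ((x i t - x i s) * (x j t - x j s) / 2 + area i j s t) *\<^sub>R G i j (Y s)))
     \<le> R2 * K ^ 3 * (t - s) powr (3 * \<beta>)"
proof -
  \<comment> \<open>The iterated integral of x i against x j, as symmetric part plus Levy
    area.\<close>
  define xx where "xx i j s t = (x i t - x i s) * (x j t - x j s) / 2 + area i j s t" for i j s t
  define \<Delta> where "\<Delta> s t = Y t - Y s - (\<Sum>l\<in>UNIV. (x l t - x l s) *\<^sub>R U l (Y s))
     - (\<Sum>i\<in>UNIV. \<Sum>j\<in>UNIV. xx i j s t *\<^sub>R G i j (Y s))" for s t
  have xx_bound: "\<bar>xx i j u v\<bar> \<le> 2 * CA * K\<^sup>2 * (v - u) powr (2 * \<beta>)" if "0 \<le> u" "u < v" "v \<le> T" for i j u v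
  proof -
    have "\<bar>(x i v - x i u) * (x j v - x j u)\<bar> \<le> (K * (v - u) powr \<beta>) * (K * (v - u) powr \<beta>)"
      unfolding abs_mult by (intro mult_mono x) (use that K in auto)
    also have "\<dots> = K\<^sup>2 * (v - u) powr (2 * \<beta>)"
      by (simp add: power2_eq_square mult_ac flip: powr_add)
    finally have "\<bar>(x i v - x i u) * (x j v - x j u) / 2\<bar> \<le> K\<^sup>2 * (v - u) powr (2 * \<beta>)" by simp
    also have "\<dots> \<le> CA * K\<^sup>2 * (v - u) powr (2 * \<beta>)"
      using CA by (simp add: mult_le_cancel_right1 mult_right_mono)
    finally show ?thesis using area_summable(2)[OF that, of i j] unfolding xx_def by linarith
  qed
  define A where "A = D * L * (4 * D\<^sup>2 * L\<^sup>2 + R1) + 4 * D ^ 3 * L\<^sup>2 * CA"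
  have A0: "0 \<le> A" using D L CA R1 by (simp add: A_def)
  have "norm (\<Delta> s t) \<le> A * K ^ 3 / (1 - 2 powr (1 - 3 * \<beta>)) * (t - s) powr (3 * \<beta>)"
  proof (rule bisection_bound[where a = s and b = t and \<theta>' = "2 * \<beta>" and B = "R1 * K\<^sup>2 + D * D * (2 * CA * K\<^sup>2 * L)"])
    fix v w assume vw: "s \<le> v" "v < w" "w \<le> t"
    have vw': "0 \<le> v" "w \<le> T" "w - v \<le> \<tau>" using vw st by auto
    define u where "u = (v + w) / 2"
    have u: "v < u" "u < w" "u - v \<le> w - v" "w - u \<le> w - v" using vw by (auto simp: u_def field_simps)
    define r where "r = (w - v) powr \<beta>"
    have r0: "0 \<le> r" by (simp add: r_def)
    have r2: "(w - v) powr (2 * \<beta>) = r * r" by (simp add: r_def flip: powr_add)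
    have r3: "(w - v) powr (3 * \<beta>) = r * r * r" by (simp add: r_def flip: powr_add)
    have ur: "(u - v) powr \<beta> \<le> r" "(w - u) powr \<beta> \<le> r" "(u - v) powr (2 * \<beta>) \<le> r * r"  "(w - u) powr (2 * \<beta>) \<le> r * r"
      unfolding r_def r2[unfolded r_def, symmetric] using u beta by (auto intro!: powr_mono2)
    define a where "a l = x l u - x l v" for l
    define b where "b l = x l w - x l u" for l
    have b: "\<bar>b l\<bar> \<le> K * r" for l
      using x[of u w l] u vw' ur(2) K by (simp add: b_def) (smt (verit) mult_left_mono)
    \<comment> \<open>The antisymmetric \<open>levy_piece\<close> turns the two mixed terms with
      factor 1/2 into the single product \<open>a i * b j\<close>: coordinate i moves first.\<close>
    have xxs: "xx i j v w = xx i j v u + xx i j u w + a i * b j" for i j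
      using area_midpoint[of v w i j] vw vw' unfolding xx_def levy_piece_def u_def[symmetric] a_def b_def
      by (simp add: field_simps)
    have "\<Delta> v w - \<Delta> v u - \<Delta> u w = (\<Sum>j\<in>UNIV. b j *\<^sub>R (U j (Y u) - U j (Y v)))
      - (\<Sum>i\<in>UNIV. \<Sum>j\<in>UNIV. (a i * b j) *\<^sub>R G i j (Y v))
      + (\<Sum>i\<in>UNIV. \<Sum>j\<in>UNIV. xx i j u w *\<^sub>R (G i j (Y u) - G i j (Y v)))"
      unfolding \<Delta>_def xxs b_def
      by (simp add: sum.distrib sum_subtractf scaleR_diff_right scaleR_diff_left scaleR_add_left algebra_simps)
    also have "(\<Sum>i\<in>UNIV. \<Sum>j\<in>UNIV. (a i * b j) *\<^sub>R G i j (Y v)) = (\<Sum>j\<in>UNIV. b j *\<^sub>R (\<Sum>i\<in>UNIV. a i *\<^sub>R G i j (Y v)))"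
      by (subst sum.swap) (simp add: scaleR_sum_right mult.commute)
    also have "(\<Sum>j\<in>UNIV. b j *\<^sub>R (U j (Y u) - U j (Y v))) - (\<Sum>j\<in>UNIV. b j *\<^sub>R (\<Sum>i\<in>UNIV. a i *\<^sub>R G i j (Y v)))
      = (\<Sum>j\<in>UNIV. b j *\<^sub>R (U j (Y u) - U j (Y v) - (\<Sum>i\<in>UNIV. a i *\<^sub>R G i j (Y v))))"
      by (simp add: scaleR_diff_right sum_subtractf)
    finally have eq: "\<Delta> v w - \<Delta> v u - \<Delta> u w =
      (\<Sum>j\<in>UNIV. b j *\<^sub>R (U j (Y u) - U j (Y v) - (\<Sum>i\<in>UNIV. a i *\<^sub>R G i j (Y v))))
      + (\<Sum>i\<in>UNIV. \<Sum>j\<in>UNIV. xx i j u w *\<^sub>R (G i j (Y u) - G i j (Y v)))" .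
    have Yh: "norm (Y u - Y v) \<le> 2 * D * L * K * r"
      using Y_holder[OF \<tau>, of v u] vw' u ur(1) D L K
      by (auto intro: order_trans[OF _ mult_left_mono])
    have 1: "norm (b j *\<^sub>R (U j (Y u) - U j (Y v) - (\<Sum>i\<in>UNIV. a i *\<^sub>R G i j (Y v)))) \<le>
       (K * r) * (L * ((4 * D\<^sup>2 * L\<^sup>2 + R1) * K\<^sup>2 * (r * r)))" for j
    proof -
      \<comment> \<open>The first-order remainder over the first half. Applying the linear map
        \<open>DU j (Y v)\<close> to it exposes the cancellation; what is left is the Taylor
        remainder of \<open>U j\<close>.\<close>
      define F where "F = Y u - Y v - (\<Sum>i\<in>UNIV. a i *\<^sub>R U i (Y v))"
      have F: "norm F \<le> R1 * K\<^sup>2 * (r * r)"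
        using Y_first_order[OF \<tau>, of v u] vw' u unfolding F_def a_def
        by (auto intro!: order_trans[OF _ mult_left_mono[OF ur(3)]] simp: R1)
      have "DU j (Y v) F = DU j (Y v) (Y u - Y v) - (\<Sum>i\<in>UNIV. a i *\<^sub>R G i j (Y v))"
        unfolding F_def using DU_linear[of j "Y v"] by (simp add: linear_diff linear_sum linear_scale)
      then have "U j (Y u) - U j (Y v) - (\<Sum>i\<in>UNIV. a i *\<^sub>R G i j (Y v))
         = (U j (Y u) - U j (Y v) - DU j (Y v) (Y u - Y v)) + DU j (Y v) F" by simp
      also have "norm \<dots> \<le> L * (norm (Y u - Y v))\<^sup>2 + L * norm F"
        by (intro norm_triangle_mono U_taylor DU_bound)
      also have "\<dots> \<le> L * (2 * D * L * K * r)\<^sup>2 + L * (R1 * K\<^sup>2 * (r * r))"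
        using L by (intro add_mono mult_left_mono power_mono Yh F) auto
      also have "\<dots> = L * ((4 * D\<^sup>2 * L\<^sup>2 + R1) * K\<^sup>2 * (r * r))"
        by (simp add: power2_eq_square algebra_simps)
      finally show ?thesis using b[of j] K r0 by (auto intro!: mult_mono)
    qed
    have 2: "norm (xx i j u w *\<^sub>R (G i j (Y u) - G i j (Y v))) \<le> (2 * CA * K\<^sup>2 * (r * r)) * (L * (2 * D * L * K * r))" for i j
    proof -
      have "\<bar>xx i j u w\<bar> \<le> 2 * CA * K\<^sup>2 * (r * r)"
        using xx_bound[of u w i j] u vw' CA
        by (auto intro!: order_trans[OF _ mult_left_mono[OF ur(4)]])
      moreover have "norm (G i j (Y u) - G i j (Y v)) \<le> L * (2 * D * L * K * r)"
        using G_lip[of j "Y u" i "Y v"] Yh L by (auto intro: order_trans[OF _ mult_left_mono])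
      ultimately show ?thesis unfolding norm_scaleR by (intro mult_mono) (use CA r0 in auto)
    qed
    have "norm (\<Delta> v w - \<Delta> v u - \<Delta> u w)
      \<le> (\<Sum>j\<in>(UNIV::'d set). (K * r) * (L * ((4 * D\<^sup>2 * L\<^sup>2 + R1) * K\<^sup>2 * (r * r))))
       + (\<Sum>i\<in>(UNIV::'d set). \<Sum>j\<in>(UNIV::'d set). (2 * CA * K\<^sup>2 * (r * r)) * (L * (2 * D * L * K * r)))"
      unfolding eq by (intro norm_triangle_mono order_trans[OF norm_sum] sum_mono 1 2)
    also have "\<dots> = A * K ^ 3 * (r * r * r)"
      by (simp add: A_def D_eq[symmetric] power2_eq_square power3_eq_cube algebra_simps)
    finally show "norm (\<Delta> v w - \<Delta> v ((v + w) / 2) - \<Delta> ((v + w) / 2) w) \<le> A * K ^ 3 * (w - v) powr (3 * \<beta>)"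
      by (simp add: r3 u_def)
  next
    \<comment> \<open>The a priori bound of order 2 \<beta>; its constant does not survive the
      bisection.\<close>
    fix v w assume vw: "s \<le> v" "v < w" "w \<le> t"
    have vw': "0 \<le> v" "w \<le> T" "w - v \<le> \<tau>" using vw st by auto
    have "norm (\<Sum>i\<in>UNIV. \<Sum>j\<in>UNIV. xx i j v w *\<^sub>R G i j (Y v)) \<le>
      (\<Sum>i\<in>(UNIV::'d set). \<Sum>j\<in>(UNIV::'d set). 2 * CA * K\<^sup>2 * (w - v) powr (2 * \<beta>) * L)"
      unfolding norm_scaleR
      by (intro order_trans[OF norm_sum] sum_mono) (use vw vw' CA L in \<open>auto intro!: mult_mono xx_bound G_bound\<close>)
    then show "norm (\<Delta> v w) \<le> (R1 * K\<^sup>2 + D * D * (2 * CA * K\<^sup>2 * L)) * (w - v) powr (2 * \<beta>)"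
      unfolding \<Delta>_def using Y_first_order[OF \<tau> vw'(1) vw(2) vw'(2,3)]
      by (intro order_trans[OF norm_triangle_ineq4]) (simp add: D_eq algebra_simps)
  qed (use A0 K st beta R1 CA L in auto)
  then show ?thesis
    by (simp add: \<Delta>_def xx_def R2_def A_def)
qed

end

section \<open>Error propagation\<close>

text \<open>\<open>Q\<close> is a Hoelder constant for the Levy areas summed over runs of cells; it
  is the quantity that probability must make small. \<open>Kh\<close> says that the path is small on
  a single cell.\<close>

locale scheme = driven_solution U DU D L \<beta> R3 x T K Y \<Lambda>\<^sub>0
  for U :: "'d::finite \<Rightarrow> 'a::real_normed_vector \<Rightarrow> 'a" and DU D L \<beta> R3 x T K Y \<Lambda>\<^sub>0 +
  fixes n :: nat and h Q :: real and y :: "nat \<Rightarrow> 'a"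
  assumes n: "1 \<le> n" and h: "real n * h = T" and Kh: "K * h powr \<beta> \<le> 1" and Q: "0 \<le> Q"
    and step: "k < n \<Longrightarrow> norm (y (Suc k) - y k - (\<Sum>l\<in>UNIV. (x l (real (Suc k) * h) - x l (real k * h)) *\<^sub>R U l (y k))
      - (\<Sum>i\<in>UNIV. \<Sum>j\<in>UNIV. ((x i (real (Suc k) * h) - x i (real k * h)) * (x j (real (Suc k) * h) - x j (real k * h)) / 2)
          *\<^sub>R G i j (y k))) \<le> R3 * K ^ 3 * h powr (3 * \<beta>)"
    and y0: "y 0 = Y 0"
    and area_sum: "a < b \<Longrightarrow> b \<le> n \<Longrightarrow>
      \<bar>\<Sum>k\<in>{a..<b}. area i j (real k * h) (real (Suc k) * h)\<bar> \<le> Q * (real (b - a) * h) powr \<beta>"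
begin

text \<open>The part of the error equation that does not involve the error: the summed areas, and
  the one-step remainders, m of which satisfy m h^(3 \<beta>) <= (m h)^\<beta> * T^(1 - \<beta>) *
  h^(3 \<beta> - 1).\<close>

definition \<Phi> :: real where
  "\<Phi> = D\<^sup>2 * L * (1 + 2 * \<sigma> * D * L) * Q + (R2 + R3) * K ^ 3 * T powr (1 - \<beta>) * h powr (3 * \<beta> - 1)"

lemma h_pos: "0 < h" using n h T by (metis less_le_not_le mult_nonneg_nonpos of_nat_0_le_iff not_le)

lemma \<Phi>: "0 \<le> \<Phi>" unfolding \<Phi>_def using L Q D sigma R2 R3 K by simp

abbreviation \<xi> :: "'d \<Rightarrow> nat \<Rightarrow> real" where "\<xi> l k \<equiv> x l (real k * h)"
abbreviation \<eta> :: "nat \<Rightarrow> 'a" where "\<eta> k \<equiv> Y (real k * h)"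
abbreviation e :: "nat \<Rightarrow> 'a" where "e k \<equiv> \<eta> k - y k"

lemma grid: assumes "i < j" "j \<le> n"
  shows "0 \<le> real i * h" "real i * h < real j * h" "real j * h \<le> T" "real j * h - real i * h = real (j - i) * h"
proof -
  have "real j * h \<le> real n * h" using assms h_pos by (intro mult_right_mono) auto
  then show "real j * h \<le> T" by (simp add: h)
qed (use assms h_pos in \<open>auto simp: of_nat_diff algebra_simps\<close>)

lemma xi_holder: assumes "i < j" "j \<le> n" shows "\<bar>\<xi> l j - \<xi> l i\<bar> \<le> K * (real (j - i) * h) powr \<beta>"
  using x[OF grid(1-3)[OF assms]] grid(4)[OF assms] by simp

lemma sum_powr_le:
  assumes "a < b" "1 \<le> \<theta>"
  shows "real (b - a) * h powr \<theta> \<le> (real (b - a) * h) powr \<theta>"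
proof -
  have "real (b - a) powr 1 \<le> real (b - a) powr \<theta>"
    using assms by (intro powr_mono) auto
  then show ?thesis using h_pos assms by (simp add: powr_mult mult_right_mono)
qed

text \<open>On a finite grid some a priori constant always exists, which is all that
  \<open>absorb\<close> asks for.\<close>

lemma finite_init:
  assumes "finite I" "\<And>i. i \<in> I \<Longrightarrow> 0 < w i"
  shows "\<exists>\<Lambda>\<ge>0. \<forall>i\<in>I. v i \<le> \<Lambda> * (w i :: real)"
proof (intro exI conjI ballI)
  show "0 \<le> (\<Sum>i\<in>I. \<bar>v i\<bar> / w i)" using assms(2) by (intro sum_nonneg) (simp add: less_imp_le)
  fix i assume i: "i \<in> I"
  then have "\<bar>v i\<bar> / w i \<le> (\<Sum>i\<in>I. \<bar>v i\<bar> / w i)"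
    using assms by (intro member_le_sum) (auto simp: less_imp_le)
  then show "v i \<le> (\<Sum>i\<in>I. \<bar>v i\<bar> / w i) * w i"
    using assms(2)[OF i] by (simp add: divide_simps)
qed

lemma y_increment:
  assumes "k < n"
  shows "norm (y (Suc k) - y k - (\<Sum>l\<in>UNIV. (\<xi> l (Suc k) - \<xi> l k) *\<^sub>R U l (y k))) \<le> R4 * K\<^sup>2 * h powr (2 * \<beta>)"
proof -
  have r: "h powr (2 * \<beta>) = h powr \<beta> * h powr \<beta>" "h powr (3 * \<beta>) = h powr \<beta> * h powr \<beta> * h powr \<beta>"
    by (simp_all flip: powr_add)
  have "norm (\<Sum>i\<in>UNIV. \<Sum>j\<in>UNIV. ((\<xi> i (Suc k) - \<xi> i k) * (\<xi> j (Suc k) - \<xi> j k) / 2) *\<^sub>R G i j (y k))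
    \<le> (\<Sum>i\<in>(UNIV::'d set). \<Sum>j\<in>(UNIV::'d set). (K * h powr \<beta>) * (K * h powr \<beta>) / 2 * L)"
  proof (intro order_trans[OF norm_sum] sum_mono)
    fix i j
    have "\<bar>\<xi> i (Suc k) - \<xi> i k\<bar> \<le> K * h powr \<beta>" for i
      using xi_holder[of k "Suc k" i] assms by simp
    then have "\<bar>(\<xi> i (Suc k) - \<xi> i k) * (\<xi> j (Suc k) - \<xi> j k)\<bar> \<le> (K * h powr \<beta>) * (K * h powr \<beta>)"
      unfolding abs_mult by (intro mult_mono) (use K in auto)
    then show "norm (((\<xi> i (Suc k) - \<xi> i k) * (\<xi> j (Suc k) - \<xi> j k) / 2) *\<^sub>R G i j (y k))
      \<le> (K * h powr \<beta>) * (K * h powr \<beta>) / 2 * L"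
      unfolding norm_scaleR by (intro mult_mono G_bound) (use K in auto)
  qed
  also have "\<dots> = D\<^sup>2 * L / 2 * K\<^sup>2 * h powr (2 * \<beta>)"
    by (simp add: r D_eq power2_eq_square)
  finally have 1: "norm (\<Sum>i\<in>UNIV. \<Sum>j\<in>UNIV. ((\<xi> i (Suc k) - \<xi> i k) * (\<xi> j (Suc k) - \<xi> j k) / 2) *\<^sub>R G i j (y k))
    \<le> D\<^sup>2 * L / 2 * K\<^sup>2 * h powr (2 * \<beta>)" .
  \<comment> \<open>One factor \<open>K * h powr \<beta>\<close> is at most 1, so the third-order
    remainder is counted at second order.\<close>
  have "R3 * K ^ 3 * h powr (3 * \<beta>) = (R3 * K\<^sup>2 * h powr (2 * \<beta>)) * (K * h powr \<beta>)"
    by (simp add: r power2_eq_square power3_eq_cube)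
  also have "\<dots> \<le> (R3 * K\<^sup>2 * h powr (2 * \<beta>)) * 1"
    using R3 K Kh by (intro mult_left_mono) auto
  finally have "norm (y (Suc k) - y k - (\<Sum>l\<in>UNIV. (\<xi> l (Suc k) - \<xi> l k) *\<^sub>R U l (y k))
      - (\<Sum>i\<in>UNIV. \<Sum>j\<in>UNIV. ((\<xi> i (Suc k) - \<xi> i k) * (\<xi> j (Suc k) - \<xi> j k) / 2) *\<^sub>R G i j (y k)))
      \<le> R3 * K\<^sup>2 * h powr (2 * \<beta>)"
    using step[OF assms] by simp
  from norm_le_of_diff[OF this 1] show ?thesis
    by (simp add: R4_def algebra_simps)
qed

text \<open>The same absorption as for the solution, with the scheme read as a discrete Young sum
  plus one-step remainders. The cells from p to q form a block that is short in the sense of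
  \<open>cs\<close>.\<close>

lemma y_holder:
  assumes \<tau>: "K * \<tau> powr \<beta> \<le> cs" and pq: "q \<le> n" "real (q - p) * h \<le> \<tau>" and ab: "p \<le> a" "a < b" "b \<le> q"
  shows "norm (y b - y a) \<le> Cy * K * (real (b - a) * h) powr \<beta>"
proof -
  let ?I = "{(a, b). p \<le> a \<and> a < b \<and> b \<le> q}"
  let ?w = "\<lambda>i. (real (snd i - fst i) * h) powr \<beta>"
  have "finite ?I" by (rule finite_subset[of _ "{..q} \<times> {..q}"]) auto
  then obtain \<Lambda>1 where \<Lambda>1: "0 \<le> \<Lambda>1" "\<And>i. i \<in> ?I \<Longrightarrow> norm (y (snd i) - y (fst i)) \<le> \<Lambda>1 * ?w i"
    using finite_init[of ?I ?w "\<lambda>i. norm (y (snd i) - y (fst i))"] h_pos by auto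
  have "norm (y (snd i) - y (fst i)) \<le> 2 * ((D * L + R4) * K) * ?w i" if "i \<in> ?I" for i
  proof (rule absorb[where I = ?I and \<Lambda>\<^sub>0 = \<Lambda>1 and i = i])
    fix \<Lambda> :: real and i
    assume \<Lambda>: "0 \<le> \<Lambda>" and hyp: "\<And>i. i \<in> ?I \<Longrightarrow> norm (y (snd i) - y (fst i)) \<le> \<Lambda> * ?w i"
      and "i \<in> ?I"
    then obtain a b where i: "i = (a, b)" and ab: "p \<le> a" "a < b" "b \<le> q" by auto
    define r where "r = (real (b - a) * h) powr \<beta>"
    have r0: "0 \<le> r" by (simp add: r_def)
    have r2: "(real (b - a) * h) powr (2 * \<beta>) = r * r" by (simp add: r_def flip: powr_add)
    have le: "real (b - a) * h \<le> real (q - p) * h" using ab h_pos by (intro mult_right_mono) auto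
    have "r \<le> \<tau> powr \<beta>" using order_trans[OF le pq(2)] beta h_pos unfolding r_def by (intro powr_mono2) auto
    then have "K * r \<le> K * \<tau> powr \<beta>" using K by (intro mult_left_mono) auto
    then have Kr: "K * r \<le> cs" using \<tau> by simp
    have y1: "norm ((\<Sum>k\<in>{a..<b}. (\<xi> l (Suc k) - \<xi> l k) *\<^sub>R U l (y k)) - (\<xi> l b - \<xi> l a) *\<^sub>R U l (y a)) \<le> \<sigma> * ((L * \<Lambda>) * K) * (r * r)" for l
    proof -
      have "norm ((\<Sum>k\<in>{a..<b}. (\<xi> l (Suc k) - \<xi> l k) *\<^sub>R U l (y k)) - (\<xi> l b - \<xi> l a) *\<^sub>R U l (y a))
        \<le> sew_const (\<beta> + \<beta>) * ((L * \<Lambda>) * K) * (real (b - a) * h) powr (\<beta> + \<beta>)"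
      proof (rule discrete_young[where a = p and b = q])
        fix i j assume ij: "p \<le> i" "i < j" "j \<le> q"
        have "norm (U l (y j) - U l (y i)) \<le> L * norm (y j - y i)" by (rule U_lip)
        also have "\<dots> \<le> L * (\<Lambda> * (real (j - i) * h) powr \<beta>)"
          using hyp[of "(i, j)"] ij L by (intro mult_left_mono) auto
        finally show "norm (U l (y j) - U l (y i)) \<le> L * \<Lambda> * (real (j - i) * h) powr \<beta>" by simp
        show "\<bar>\<xi> l j - \<xi> l i\<bar> \<le> K * (real (j - i) * h) powr \<beta>" using ij pq by (intro xi_holder) auto
      qed (use ab beta L \<Lambda> K h_pos in auto)
      then show ?thesis by (simp add: r2)
    qed
    have y2: "norm ((\<xi> l b - \<xi> l a) *\<^sub>R U l (y a)) \<le> K * r * L" for l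
      using xi_holder[of a b l] ab pq U_bound[of l "y a"] K r0 by (auto intro!: mult_mono simp: r_def)
    have y3: "norm (\<Sum>k\<in>{a..<b}. (\<xi> l (Suc k) - \<xi> l k) *\<^sub>R U l (y k)) \<le> \<sigma> * ((L * \<Lambda>) * K) * (r * r) + K * r * L" for l
      by (rule norm_le_of_diff[OF y1 y2])
    have "norm ((y b - y a) - (\<Sum>k\<in>{a..<b}. \<Sum>l\<in>UNIV. (\<xi> l (Suc k) - \<xi> l k) *\<^sub>R U l (y k)))
      = norm (\<Sum>k\<in>{a..<b}. y (Suc k) - y k - (\<Sum>l\<in>UNIV. (\<xi> l (Suc k) - \<xi> l k) *\<^sub>R U l (y k)))"
      by (subst sum_subtractf, subst sum_Suc_diff') (use ab in auto)
    also have "\<dots> \<le> (\<Sum>k\<in>{a..<b}. R4 * K\<^sup>2 * h powr (2 * \<beta>))"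
      using ab pq by (intro order_trans[OF norm_sum] sum_mono y_increment) auto
    also have "\<dots> = R4 * K\<^sup>2 * (real (b - a) * h powr (2 * \<beta>))" by simp
    also have "\<dots> \<le> R4 * K\<^sup>2 * (r * r)"
      unfolding r2[symmetric] using ab beta R4 by (intro mult_left_mono sum_powr_le) auto
    finally have y4: "norm ((y b - y a) - (\<Sum>k\<in>{a..<b}. \<Sum>l\<in>UNIV. (\<xi> l (Suc k) - \<xi> l k) *\<^sub>R U l (y k))) \<le> R4 * K\<^sup>2 * (r * r)" .
    have y5: "norm (\<Sum>k\<in>{a..<b}. \<Sum>l\<in>UNIV. (\<xi> l (Suc k) - \<xi> l k) *\<^sub>R U l (y k)) \<le> (\<Sum>l\<in>(UNIV::'d set). \<sigma> * ((L * \<Lambda>) * K) * (r * r) + K * r * L)"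
      by (subst sum.swap) (intro order_trans[OF norm_sum] sum_mono y3)
    have "norm (y b - y a) \<le> R4 * K\<^sup>2 * (r * r) + D * (\<sigma> * ((L * \<Lambda>) * K) * (r * r) + K * r * L)"
      using norm_le_of_diff[OF y4 y5] by (simp add: D_eq)
    also have "\<dots> = ((D * \<sigma> * L * (K * r)) * \<Lambda> + D * L * K + R4 * K * (K * r)) * r"
      by (simp add: algebra_simps power2_eq_square)
    also have "\<dots> \<le> ((D * \<sigma> * L * cs) * \<Lambda> + D * L * K + R4 * K * 1) * r"
      using Kr \<Lambda> r0 D sigma L R4 K cs by (intro mult_right_mono add_mono mult_left_mono) auto
    also have "\<dots> \<le> ((1/2) * \<Lambda> + D * L * K + R4 * K * 1) * r"
      using \<Lambda> r0 cs by (intro order_refl mult_right_mono add_mono) auto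
    finally show "norm (y (snd i) - y (fst i)) \<le> (\<Lambda> / 2 + (D * L + R4) * K) * ?w i"
      by (simp add: i r_def algebra_simps)
  qed (use \<Lambda>1 that D L R4 K in auto)
  from this[of "(a, b)"] ab show ?thesis by (simp add: Cy_def mult_ac)
qed

text \<open>The telescoped error splits into differences of first-order terms, differences of
  second-order terms, areas and remainders. Only the first of these returns the Hoelder constant
  \<open>\<Lambda>\<close> of the error, halved on a short block; the supremum \<open>E\<close>
  returns with a factor \<open>K\<close>, and everything else is collected in
  \<open>\<Phi>\<close>.\<close>

lemma error_holder:
  assumes \<tau>: "K * \<tau> powr \<beta> \<le> cs" and pq: "q \<le> n" "real (q - p) * h \<le> \<tau>"
    and E: "\<And>k. p \<le> k \<Longrightarrow> k \<le> q \<Longrightarrow> norm (e k) \<le> E" and ab: "p \<le> a" "a < b" "b \<le> q"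
  shows "norm (e b - e a) \<le> 2 * (C5 * K * E + \<Phi>) * (real (b - a) * h) powr \<beta>"
proof -
  let ?I = "{(a, b). p \<le> a \<and> a < b \<and> b \<le> q}"
  let ?w = "\<lambda>i. (real (snd i - fst i) * h) powr \<beta>"
  have E0: "0 \<le> E" using E[of a] ab by (auto intro: order_trans[OF norm_ge_zero])
  have LE: "L * norm (e k) \<le> L * E" if "p \<le> k" "k \<le> q" for k
    using E[OF that] L by (intro mult_left_mono) auto
  have Kt: "D * \<sigma> * L * (K * \<tau> powr \<beta>) \<le> 1/2"
  proof -
    have "D * \<sigma> * L * (K * \<tau> powr \<beta>) \<le> D * \<sigma> * L * cs"
      using D sigma L by (intro mult_left_mono \<tau>) auto
    then show ?thesis using cs(3) by linarith
  qed
  have "finite ?I" by (rule finite_subset[of _ "{..q} \<times> {..q}"]) auto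
  then obtain \<Lambda>1 where \<Lambda>1: "0 \<le> \<Lambda>1" "\<And>i. i \<in> ?I \<Longrightarrow> norm (e (snd i) - e (fst i)) \<le> \<Lambda>1 * ?w i"
    using finite_init[of ?I ?w "\<lambda>i. norm (e (snd i) - e (fst i))"] h_pos by auto
  have "norm (e (snd i) - e (fst i)) \<le> 2 * (C5 * K * E + \<Phi>) * ?w i" if "i \<in> ?I" for i
  proof (rule absorb[where I = ?I and \<Lambda>\<^sub>0 = \<Lambda>1 and i = i])
    fix \<Lambda> :: real and i
    assume \<Lambda>: "0 \<le> \<Lambda>" and hyp: "\<And>i. i \<in> ?I \<Longrightarrow> norm (e (snd i) - e (fst i)) \<le> \<Lambda> * ?w i"
      and "i \<in> ?I"
    then obtain a b where i: "i = (a, b)" and ab: "p \<le> a" "a < b" "b \<le> q" by auto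
    define r where "r = (real (b - a) * h) powr \<beta>"
    have r0: "0 \<le> r" by (simp add: r_def)
    have r2: "(real (b - a) * h) powr (2 * \<beta>) = r * r" by (simp add: r_def flip: powr_add)
    have le: "real (b - a) * h \<le> real (q - p) * h" using ab h_pos by (intro mult_right_mono) auto
    have "r \<le> \<tau> powr \<beta>" using order_trans[OF le pq(2)] beta h_pos unfolding r_def by (intro powr_mono2) auto
    then have "K * r \<le> K * \<tau> powr \<beta>" using K by (intro mult_left_mono) auto
    then have Kr: "K * r \<le> cs" using \<tau> by simp
    have Kr1: "K * r \<le> 1" using Kr cs by simp
    have Yh: "norm (\<eta> j - \<eta> i) \<le> 2 * D * L * K * (real (j - i) * h) powr \<beta>" if "p \<le> i" "i < j" "j \<le> q" for i j
    proof -
      have "real (j - i) * h \<le> real (q - p) * h" using that h_pos by (intro mult_right_mono) auto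
      then show ?thesis
        using Y_holder[OF Kt, of "real i * h" "real j * h"] grid[of i j] that pq by auto
    qed
    define dx where "dx l k = \<xi> l (Suc k) - \<xi> l k" for l k
    define A where "A i j k = area i j (real k * h) (real (Suc k) * h)" for i j k
    define uY where "uY k = (\<Sum>l\<in>UNIV. dx l k *\<^sub>R U l (\<eta> k))" for k
    define uy where "uy k = (\<Sum>l\<in>UNIV. dx l k *\<^sub>R U l (y k))" for k
    define gY where "gY k = (\<Sum>i\<in>UNIV. \<Sum>j\<in>UNIV. (dx i k * dx j k / 2) *\<^sub>R G i j (\<eta> k))" for k
    define gy where "gy k = (\<Sum>i\<in>UNIV. \<Sum>j\<in>UNIV. (dx i k * dx j k / 2) *\<^sub>R G i j (y k))" for k
    define aY where "aY k = (\<Sum>i\<in>UNIV. \<Sum>j\<in>UNIV. A i j k *\<^sub>R G i j (\<eta> k))" for k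
    define rY where "rY k = \<eta> (Suc k) - \<eta> k - uY k - (gY k + aY k)" for k
    define ry where "ry k = y (Suc k) - y k - uy k - gy k" for k
    have dx: "\<bar>dx l k\<bar> \<le> K * h powr \<beta>" if "k < n" for l k
      using xi_holder[of k "Suc k" l] that by (simp add: dx_def)
    have rY: "norm (rY k) \<le> R2 * K ^ 3 * h powr (3 * \<beta>)" if "p \<le> k" "k < q" for k
    proof -
      have "h \<le> real (q - p) * h" using that h_pos by simp
      then have "real (Suc k) * h - real k * h \<le> \<tau>" using pq by (simp add: algebra_simps)
      moreover have "gY k + aY k = (\<Sum>i\<in>UNIV. \<Sum>j\<in>UNIV. ((\<xi> i (Suc k) - \<xi> i k) * (\<xi> j (Suc k) - \<xi> j k) / 2
          + area i j (real k * h) (real (Suc k) * h)) *\<^sub>R G i j (\<eta> k))"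
        by (simp only: gY_def aY_def dx_def A_def scaleR_add_left sum.distrib)
      ultimately show ?thesis
        using Y_second_order[OF Kt, of "real k * h" "real (Suc k) * h"] grid[of k "Suc k"] that pq
        unfolding rY_def uY_def dx_def by auto
    qed
    have ry: "norm (ry k) \<le> R3 * K ^ 3 * h powr (3 * \<beta>)" if "k < n" for k
      using step[OF that] by (simp add: ry_def uy_def gy_def dx_def)
    have eq: "e b - e a = (\<Sum>k\<in>{a..<b}. uY k - uy k) + (\<Sum>k\<in>{a..<b}. gY k - gy k)
       + (\<Sum>k\<in>{a..<b}. aY k) + (\<Sum>k\<in>{a..<b}. rY k - ry k)"
    proof -
      have "(\<Sum>k\<in>{a..<b}. e (Suc k) - e k) = e b - e a" by (rule sum_Suc_diff') (use ab in auto)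
      moreover have "e (Suc k) - e k = (uY k - uy k) + (gY k - gy k) + aY k + (rY k - ry k)" for k
        by (simp add: rY_def ry_def algebra_simps)
      ultimately show ?thesis by (simp only: sum.distrib)
    qed
    \<comment> \<open>By the four-point estimate the difference of the coefficients is Hoelder with
      constant \<open>L * (\<Lambda> + Cy * K * E)\<close>, so discrete Young applies with the path
      as driver.\<close>
    have T1: "norm (\<Sum>k\<in>{a..<b}. uY k - uy k) \<le> D * (\<sigma> * ((L * (\<Lambda> + Cy * K * E)) * K) * (r * r) + K * r * (L * E))"
    proof -
      define z where "z l k = U l (\<eta> k) - U l (y k)" for l k
      have z1: "norm ((\<Sum>k\<in>{a..<b}. (\<xi> l (Suc k) - \<xi> l k) *\<^sub>R z l k) - (\<xi> l b - \<xi> l a) *\<^sub>R z l a)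
          \<le> \<sigma> * ((L * (\<Lambda> + Cy * K * E)) * K) * (r * r)" for l
      proof -
        have "norm ((\<Sum>k\<in>{a..<b}. (\<xi> l (Suc k) - \<xi> l k) *\<^sub>R z l k) - (\<xi> l b - \<xi> l a) *\<^sub>R z l a)
          \<le> sew_const (\<beta> + \<beta>) * ((L * (\<Lambda> + Cy * K * E)) * K) * (real (b - a) * h) powr (\<beta> + \<beta>)"
        proof (rule discrete_young[where a = p and b = q])
          fix i j assume ij: "p \<le> i" "i < j" "j \<le> q"
          have "norm (z l j - z l i) \<le> L * norm (e j - e i) + L * norm (e j) * norm (y j - y i)"
            unfolding z_def by (rule U_four)
          also have "\<dots> \<le> L * (\<Lambda> * (real (j - i) * h) powr \<beta>) + L * E * (Cy * K * (real (j - i) * h) powr \<beta>)"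
            using hyp[of "(i, j)"] ij L E[of j] E0 y_holder[OF \<tau> pq ij]
            by (intro add_mono mult_mono mult_left_mono) auto
          also have "\<dots> = L * (\<Lambda> + Cy * K * E) * (real (j - i) * h) powr \<beta>" by (simp add: algebra_simps)
          finally show "norm (z l j - z l i) \<le> L * (\<Lambda> + Cy * K * E) * (real (j - i) * h) powr \<beta>" .
          show "\<bar>\<xi> l j - \<xi> l i\<bar> \<le> K * (real (j - i) * h) powr \<beta>" using ij pq by (intro xi_holder) auto
        qed (use ab beta L \<Lambda> K h_pos Cy E0 in auto)
        then show ?thesis by (simp add: r2)
      qed
      have "norm (z l a) \<le> L * E" for l
        unfolding z_def by (rule order_trans[OF U_lip LE]) (use ab in auto)
      then have z2: "norm ((\<xi> l b - \<xi> l a) *\<^sub>R z l a) \<le> K * r * (L * E)" for l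
        unfolding norm_scaleR using xi_holder[of a b l] ab pq K r0 by (intro mult_mono) (auto simp: r_def)
      have eq1: "(\<Sum>k\<in>{a..<b}. uY k - uy k) = (\<Sum>k\<in>{a..<b}. \<Sum>l\<in>UNIV. (\<xi> l (Suc k) - \<xi> l k) *\<^sub>R z l k)"
        by (simp only: uY_def uy_def dx_def z_def sum_subtractf scaleR_diff_right)
      have "norm (\<Sum>k\<in>{a..<b}. \<Sum>l\<in>UNIV. (\<xi> l (Suc k) - \<xi> l k) *\<^sub>R z l k) \<le> (\<Sum>l\<in>(UNIV::'d set). \<sigma> * ((L * (\<Lambda> + Cy * K * E)) * K) * (r * r) + K * r * (L * E))"
        by (subst sum.swap) (intro order_trans[OF norm_sum] sum_mono norm_le_of_diff[OF z1 z2])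
      then show ?thesis by (simp only: eq1 sum_constant D_eq[symmetric])
    qed
    have T2: "norm (\<Sum>k\<in>{a..<b}. gY k - gy k) \<le> D\<^sup>2 * L / 2 * K\<^sup>2 * E * (r * r)"
    proof -
      have "norm (gY k - gy k) \<le> D\<^sup>2 * L / 2 * K\<^sup>2 * E * h powr (2 * \<beta>)" if k: "a \<le> k" "k < b" for k
      proof -
        have eq1: "gY k - gy k = (\<Sum>i\<in>UNIV. \<Sum>j\<in>UNIV. (dx i k * dx j k / 2) *\<^sub>R (G i j (\<eta> k) - G i j (y k)))"
          by (simp only: gY_def gy_def sum_subtractf scaleR_diff_right)
        have "norm (gY k - gy k) \<le> (\<Sum>i\<in>(UNIV::'d set). \<Sum>j\<in>(UNIV::'d set). (K * h powr \<beta>) * (K * h powr \<beta>) / 2 * (L * E))"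
          unfolding eq1
        proof (intro order_trans[OF norm_sum] sum_mono)
          fix i j
          have "\<bar>dx i k * dx j k\<bar> \<le> (K * h powr \<beta>) * (K * h powr \<beta>)"
            unfolding abs_mult using k ab pq by (intro mult_mono dx) (use K in auto)
          moreover have "norm (G i j (\<eta> k) - G i j (y k)) \<le> L * E"
            by (rule order_trans[OF G_lip LE]) (use ab k in auto)
          ultimately show "norm ((dx i k * dx j k / 2) *\<^sub>R (G i j (\<eta> k) - G i j (y k)))
              \<le> (K * h powr \<beta>) * (K * h powr \<beta>) / 2 * (L * E)"
            unfolding norm_scaleR by (intro mult_mono) (use K in auto)
        qed
        also have "\<dots> = D\<^sup>2 * L / 2 * K\<^sup>2 * E * h powr (2 * \<beta>)"
          by (simp add: D_eq[symmetric] power2_eq_square flip: powr_add)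
        finally show ?thesis .
      qed
      then have "norm (\<Sum>k\<in>{a..<b}. gY k - gy k) \<le> (\<Sum>k\<in>{a..<b}. D\<^sup>2 * L / 2 * K\<^sup>2 * E * h powr (2 * \<beta>))"
        by (intro order_trans[OF norm_sum] sum_mono) auto
      also have "\<dots> = D\<^sup>2 * L / 2 * K\<^sup>2 * E * (real (b - a) * h powr (2 * \<beta>))" by simp
      also have "\<dots> \<le> D\<^sup>2 * L / 2 * K\<^sup>2 * E * (r * r)"
        unfolding r2[symmetric] using ab beta E0 L by (intro mult_left_mono sum_powr_le) auto
      finally show ?thesis .
    qed
    \<comment> \<open>The partial sums \<open>S\<close> of the areas act as driver and
      \<open>G\<close> along the solution as integrand. Only the Hoelder constant \<open>Q\<close>
      of \<open>S\<close> enters, so cancellation between cells is kept.\<close>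
    have T3: "norm (\<Sum>k\<in>{a..<b}. aY k) \<le> D\<^sup>2 * (\<sigma> * ((L * (2 * D * L * K)) * Q) * (r * r) + Q * r * L)"
    proof -
      define S where "S i j k = (\<Sum>c<k. A i j c)" for i j k
      have S: "S i j b' - S i j a' = (\<Sum>c\<in>{a'..<b'}. A i j c)" if "a' \<le> b'" for i j a' b'
        using that unfolding S_def by (simp add: lessThan_atLeast0 flip: sum.atLeastLessThan_concat[of 0 a' b'])
      have Sh: "\<bar>S i j b' - S i j a'\<bar> \<le> Q * (real (b' - a') * h) powr \<beta>" if "a' < b'" "b' \<le> n" for i j a' b'
        using area_sum[OF that, of i j] that by (simp add: S A_def)
      have z1: "norm ((\<Sum>k\<in>{a..<b}. (S i j (Suc k) - S i j k) *\<^sub>R G i j (\<eta> k)) - (S i j b - S i j a) *\<^sub>R G i j (\<eta> a))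
          \<le> \<sigma> * ((L * (2 * D * L * K)) * Q) * (r * r)" for i j
      proof -
        have "norm ((\<Sum>k\<in>{a..<b}. (S i j (Suc k) - S i j k) *\<^sub>R G i j (\<eta> k)) - (S i j b - S i j a) *\<^sub>R G i j (\<eta> a))
          \<le> sew_const (\<beta> + \<beta>) * ((L * (2 * D * L * K)) * Q) * (real (b - a) * h) powr (\<beta> + \<beta>)"
        proof (rule discrete_young[where a = p and b = q])
          fix i' j' assume ij: "p \<le> i'" "i' < j'" "j' \<le> q"
          have "norm (G i j (\<eta> j') - G i j (\<eta> i')) \<le> L * norm (\<eta> j' - \<eta> i')" by (rule G_lip)
          also have "\<dots> \<le> L * (2 * D * L * K * (real (j' - i') * h) powr \<beta>)"
            using Yh[OF ij] L by (intro mult_left_mono) auto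
          finally show "norm (G i j (\<eta> j') - G i j (\<eta> i')) \<le> L * (2 * D * L * K) * (real (j' - i') * h) powr \<beta>"
            by (simp add: mult_ac)
          show "\<bar>S i j j' - S i j i'\<bar> \<le> Q * (real (j' - i') * h) powr \<beta>" using ij pq by (intro Sh) auto
        qed (use ab beta L K h_pos D Q in auto)
        then show ?thesis by (simp add: r2)
      qed
      have z2: "norm ((S i j b - S i j a) *\<^sub>R G i j (\<eta> a)) \<le> Q * r * L" for i j
        unfolding norm_scaleR using Sh[of a b i j] ab pq Q r0 by (intro mult_mono G_bound) (auto simp: r_def)
      have eq1: "(\<Sum>k\<in>{a..<b}. aY k) = (\<Sum>k\<in>{a..<b}. \<Sum>i\<in>UNIV. \<Sum>j\<in>UNIV. (S i j (Suc k) - S i j k) *\<^sub>R G i j (\<eta> k))"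
        by (simp add: aY_def S_def)
      have eq2: "(\<Sum>k\<in>{a..<b}. \<Sum>i\<in>UNIV. \<Sum>j\<in>UNIV. (S i j (Suc k) - S i j k) *\<^sub>R G i j (\<eta> k))
          = (\<Sum>i\<in>UNIV. \<Sum>j\<in>UNIV. \<Sum>k\<in>{a..<b}. (S i j (Suc k) - S i j k) *\<^sub>R G i j (\<eta> k))"
        by (subst sum.swap, rule sum.cong[OF refl], rule sum.swap)
      have "norm (\<Sum>k\<in>{a..<b}. aY k) \<le> (\<Sum>i\<in>(UNIV::'d set). \<Sum>j\<in>(UNIV::'d set). \<sigma> * ((L * (2 * D * L * K)) * Q) * (r * r) + Q * r * L)"
        unfolding eq1 eq2 by (intro order_trans[OF norm_sum] sum_mono norm_le_of_diff[OF z1 z2])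
      then show ?thesis by (simp only: sum_constant D_eq[symmetric] power2_eq_square mult.assoc)
    qed
    have T4: "norm (\<Sum>k\<in>{a..<b}. rY k - ry k) \<le> (R2 + R3) * K ^ 3 * T powr (1 - \<beta>) * h powr (3 * \<beta> - 1) * r"
    proof -
      have "norm (\<Sum>k\<in>{a..<b}. rY k - ry k) \<le> (\<Sum>k\<in>{a..<b}. R2 * K ^ 3 * h powr (3 * \<beta>) + R3 * K ^ 3 * h powr (3 * \<beta>))"
        using ab pq by (intro order_trans[OF norm_sum] sum_mono order_trans[OF norm_triangle_ineq4] add_mono rY ry) auto
      also have "\<dots> = (R2 + R3) * K ^ 3 * (real (b - a) * h powr (3 * \<beta>))" by (simp add: algebra_simps)
      also have "real (b - a) * h powr (3 * \<beta>) = (real (b - a) * h) * h powr (3 * \<beta> - 1)"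
        using h_pos by (simp add: powr_diff)
      also have "real (b - a) * h = r * (real (b - a) * h) powr (1 - \<beta>)"
        using h_pos ab by (simp add: r_def flip: powr_add)
      also have "(R2 + R3) * K ^ 3 * ((r * (real (b - a) * h) powr (1 - \<beta>)) * h powr (3 * \<beta> - 1))
         \<le> (R2 + R3) * K ^ 3 * ((r * T powr (1 - \<beta>)) * h powr (3 * \<beta> - 1))"
      proof (intro mult_left_mono mult_right_mono powr_mono2)
        have "real (b - a) * h \<le> real n * h" using ab pq h_pos by (intro mult_right_mono) auto
        then show "real (b - a) * h \<le> T" by (simp add: h)
      qed (use r0 R2 R3 K beta h_pos in auto)
      finally show ?thesis by (simp add: mult_ac)
    qed
    have "norm (e b - e a) \<le> D * (\<sigma> * ((L * (\<Lambda> + Cy * K * E)) * K) * (r * r) + K * r * (L * E))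
       + D\<^sup>2 * L / 2 * K\<^sup>2 * E * (r * r) + D\<^sup>2 * (\<sigma> * ((L * (2 * D * L * K)) * Q) * (r * r) + Q * r * L)
       + (R2 + R3) * K ^ 3 * T powr (1 - \<beta>) * h powr (3 * \<beta> - 1) * r"
      unfolding eq by (intro norm_triangle_mono T1 T2 T3 T4)
    also have "\<dots> = ((D * \<sigma> * L) * (K * r) * \<Lambda> + (D * \<sigma> * L * Cy * K * E) * (K * r) + D * K * L * E
        + (D\<^sup>2 * L / 2 * K * E) * (K * r) + (D\<^sup>2 * L * 2 * \<sigma> * D * L * Q) * (K * r) + D\<^sup>2 * L * Q
        + (R2 + R3) * K ^ 3 * T powr (1 - \<beta>) * h powr (3 * \<beta> - 1)) * r"
      by (simp add: algebra_simps power2_eq_square)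
    also have "\<dots> \<le> ((D * \<sigma> * L) * cs * \<Lambda> + (D * \<sigma> * L * Cy * K * E) * 1 + D * K * L * E
        + (D\<^sup>2 * L / 2 * K * E) * 1 + (D\<^sup>2 * L * 2 * \<sigma> * D * L * Q) * 1 + D\<^sup>2 * L * Q
        + (R2 + R3) * K ^ 3 * T powr (1 - \<beta>) * h powr (3 * \<beta> - 1)) * r"
      using Kr Kr1 \<Lambda> r0 D sigma L K Cy E0 Q by (intro order_refl mult_right_mono add_mono mult_left_mono) auto
    also have "\<dots> \<le> ((1 / 2) * \<Lambda> + (D * \<sigma> * L * Cy * K * E) * 1 + D * K * L * E
        + (D\<^sup>2 * L / 2 * K * E) * 1 + (D\<^sup>2 * L * 2 * \<sigma> * D * L * Q) * 1 + D\<^sup>2 * L * Q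
        + (R2 + R3) * K ^ 3 * T powr (1 - \<beta>) * h powr (3 * \<beta> - 1)) * r"
      using \<Lambda> r0 cs(3) by (intro order_refl mult_right_mono add_mono) auto
    also have "\<dots> = (\<Lambda> / 2 + (C5 * K * E + \<Phi>)) * r"
      by (simp add: C5_def \<Phi>_def algebra_simps)
    finally show "norm (e (snd i) - e (fst i)) \<le> (\<Lambda> / 2 + (C5 * K * E + \<Phi>)) * ?w i"
      by (simp add: i r_def)
  qed (use \<Lambda>1 that C5 K E0 \<Phi> in auto)
  from this[of "(a, b)"] ab show ?thesis by simp
qed

text \<open>The supremum \<open>E\<close> over the block feeds back into itself with the factor 2 *
  C5 * cs <= 1/2 and is absorbed, so that the error at most doubles up to a multiple of
  \<open>\<Phi>\<close>.\<close>

lemma error_block: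
  assumes \<tau>: "K * \<tau> powr \<beta> \<le> cs" and pq: "p \<le> q" "q \<le> n" "real (q - p) * h \<le> \<tau>" and k: "p \<le> k" "k \<le> q"
  shows "norm (e k) \<le> 2 * norm (e p) + 4 * \<Phi>"
proof -
  define E where "E = Max ((\<lambda>k. norm (e k)) ` {p..q})"
  have E: "norm (e k) \<le> E" if "p \<le> k" "k \<le> q" for k
    unfolding E_def using that by (intro Max_ge) auto
  have "0 \<le> E" using E[of p] pq by (auto intro: order_trans[OF norm_ge_zero])
  have "E \<in> (\<lambda>k. norm (e k)) ` {p..q}" unfolding E_def using pq by (intro Max_in) auto
  then obtain m where m: "p \<le> m" "m \<le> q" "E = norm (e m)" by auto
  have "0 \<le> \<tau>" using pq h_pos by (meson mult_nonneg_nonneg of_nat_0_le_iff order_trans less_imp_le)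
  have t1: "\<tau> powr \<beta> \<le> 1"
    using \<tau> cs(2) mult_right_mono[OF K, of "\<tau> powr \<beta>"] by simp
  have "E \<le> norm (e p) + 2 * (C5 * K * E + \<Phi>) * \<tau> powr \<beta>"
  proof (cases "m = p")
    case False
    then have "norm (e m - e p) \<le> 2 * (C5 * K * E + \<Phi>) * (real (m - p) * h) powr \<beta>"
      using m by (intro error_holder[OF \<tau> pq(2,3) E]) auto
    also have "\<dots> \<le> 2 * (C5 * K * E + \<Phi>) * \<tau> powr \<beta>"
    proof (intro mult_left_mono powr_mono2)
      have "real (m - p) * h \<le> real (q - p) * h" using m h_pos by (intro mult_right_mono) auto
      then show "real (m - p) * h \<le> \<tau>" using pq by simp
    qed (use h_pos beta C5 K \<open>0 \<le> E\<close> \<Phi> in auto)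
    finally show ?thesis unfolding m(3) using norm_triangle_ineq2[of "e m" "e p"] by linarith
  qed (use m C5 K \<open>0 \<le> E\<close> \<Phi> in auto)
  also have "\<dots> = norm (e p) + 2 * (C5 * E) * (K * \<tau> powr \<beta>) + 2 * \<Phi> * \<tau> powr \<beta>"
    by (simp add: algebra_simps)
  also have "\<dots> \<le> norm (e p) + 2 * (C5 * E) * cs + 2 * \<Phi> * 1"
    using \<tau> t1 C5 \<open>0 \<le> E\<close> \<Phi> by (intro add_mono mult_left_mono) auto
  also have "\<dots> = norm (e p) + 2 * (C5 * cs) * E + 2 * \<Phi>" by simp
  also have "\<dots> \<le> norm (e p) + 2 * (1/4) * E + 2 * \<Phi>"
    using cs(5) \<open>0 \<le> E\<close> by (intro order_refl add_mono mult_right_mono mult_left_mono) auto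
  finally show ?thesis using E[OF k] by simp
qed

text \<open>The recursion a -> 2 a + 4 \<Phi> started from zero error. Its growth, 2 to the power of
  the number of blocks, is the source of the exponential in K^(1/\<beta>).\<close>

lemma error_blocks:
  assumes \<tau>: "K * \<tau> powr \<beta> \<le> cs" and m: "real m * h \<le> \<tau>" and k: "k \<le> n" "k \<le> b * m"
  shows "norm (e k) \<le> 4 * \<Phi> * (2 ^ b - 1)"
  using k
proof (induction b arbitrary: k)
  case 0
  then show ?case using y0 by simp
next
  case (Suc b)
  show ?case
  proof (cases "k \<le> b * m")
    case True
    then have "norm (e k) \<le> 4 * \<Phi> * (2 ^ b - 1)" using Suc by simp
    also have "\<dots> \<le> 4 * \<Phi> * (2 ^ Suc b - 1)" using \<Phi> by (intro mult_left_mono) auto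
    finally show ?thesis .
  next
    case False
    then have bm: "b * m \<le> n" using Suc by simp
    have "real (k - b * m) * h \<le> real m * h"
      using Suc.prems h_pos by (intro mult_right_mono) auto
    then have "norm (e k) \<le> 2 * norm (e (b * m)) + 4 * \<Phi>"
      using False Suc.prems m by (intro error_block[OF \<tau>, of "b * m" k]) auto
    also have "\<dots> \<le> 2 * (4 * \<Phi> * (2 ^ b - 1)) + 4 * \<Phi>"
      using bm by (intro add_right_mono mult_left_mono Suc.IH) auto
    finally show ?thesis by (simp add: algebra_simps)
  qed
qed

lemma error_grid:
  assumes \<tau>: "0 < \<tau>" "K * \<tau> powr \<beta> \<le> cs" "h \<le> \<tau>" and k: "k \<le> n"
  shows "norm (e k) \<le> 4 * \<Phi> * (2 * exp (2 * T / \<tau>))"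
proof -
  \<comment> \<open>The largest number of cells that fits into \<open>\<tau>\<close>. As h <=
    \<tau>, it is at least 1 and covers at least half of \<open>\<tau>\<close>, whence at most 2 T /
    \<tau> + 1 blocks.\<close>
  define m where "m = nat \<lfloor>\<tau> / h\<rfloor>"
  have "1 \<le> \<tau> / h" using \<tau> h_pos by simp
  then have m: "1 \<le> m" "real m \<le> \<tau> / h" "\<tau> / h < real m + 1"
    unfolding m_def by (auto intro!: le_nat_floor of_nat_floor)
  define b where "b = nat \<lceil>real n / real m\<rceil>"
  have "real n / real m \<le> real b" "real b \<le> real n / real m + 1"
    using ceiling_correct[of "real n / real m"] unfolding b_def by (auto simp: of_nat_nat)
  then have "real n \<le> real b * real m" using m by (simp add: field_simps)
  then have nbm: "n \<le> b * m" by (metis of_nat_le_iff of_nat_mult)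
  have "norm (e k) \<le> 4 * \<Phi> * (2 ^ b - 1)"
    using m h_pos k nbm by (intro error_blocks[OF \<tau>(2), of m]) (auto simp: field_simps)
  also have "\<dots> \<le> 4 * \<Phi> * (2 * exp (2 * T / \<tau>))"
  proof (intro mult_left_mono)
    have "\<tau> / h \<le> 2 * real m" using m by linarith
    then have "\<tau> \<le> 2 * real m * h" using h_pos by (simp add: field_simps)
    then have "real n * \<tau> \<le> real n * (2 * real m * h)" by (intro mult_left_mono) auto
    also have "\<dots> = 2 * T * real m" by (simp flip: h)
    finally have "real n / real m \<le> 2 * T / \<tau>" using m \<tau> by (simp add: field_simps)
    then have "real b \<le> 2 * T / \<tau> + 1" using \<open>real b \<le> real n / real m + 1\<close> by linarith
    then have "(2::real) powr real b \<le> 2 powr (2 * T / \<tau> + 1)" by simp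
    also have "\<dots> = 2 * 2 powr (2 * T / \<tau>)" by (simp add: powr_add)
    also have "(2::real) powr (2 * T / \<tau>) \<le> exp 1 powr (2 * T / \<tau>)"
      using T \<tau> exp_ge_add_one_self[of 1] by (intro powr_mono2) auto
    also have "\<dots> = exp (2 * T / \<tau>)" by (simp add: powr_def)
    finally show "2 ^ b - 1 \<le> 2 * exp (2 * T / \<tau>)" by (simp add: powr_realpow)
  qed (use \<Phi> in auto)
  finally show ?thesis .
qed

end


section \<open>Linear interpolation and coarse grids\<close>

lemma grid_cell:
  assumes "0 < h" "0 < t" "t \<le> real n * h"
  obtains k where "k < n" "t \<in> {real k * h <.. real (Suc k) * h}"
proof -
  define k where "k = nat (\<lceil>t / h\<rceil> - 1)"
  have "0 < \<lceil>t / h\<rceil>" using assms by simp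
  then have k: "\<lceil>t / h\<rceil> = int k + 1" by (simp add: k_def)
  have "real k < t / h" "t / h \<le> real k + 1"
    using ceiling_correct[of "t / h"] unfolding k by auto
  then have b: "real k * h < t" "t \<le> real (Suc k) * h"
    using assms by (auto simp: field_simps)
  then have "real k * h < real n * h" using assms by linarith
  then have "k < n" using assms by simp
  with b that show thesis by simp
qed

lemma linear_interpolation_bound:
  fixes y :: "nat \<Rightarrow> 'a::real_normed_vector"
  assumes "0 < h" "t \<in> {real k * h <.. real (Suc k) * h}"
  shows "norm (linear_interpolation h y t - y k) \<le> norm (y (Suc k) - y k)"
proof -
  have "\<bar>(t - real k * h) / h\<bar> \<le> 1" using assms by (auto simp: field_simps)
  then show ?thesis
    using mult_right_mono[of "\<bar>(t - real k * h) / h\<bar>" 1 "norm (y (Suc k) - y k)"]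
    by (simp only: linear_interpolation_eq[OF assms] add_diff_cancel_left' norm_scaleR norm_ge_zero mult_1)
qed

context driven_solution
begin

text \<open>At most T / \<tau> + 1 intervals of length \<open>\<tau>\<close> are crossed, and the
  solution moves by at most 1 on each of them.\<close>

lemma Y_crude:
  assumes \<tau>: "0 < \<tau>" "D * \<sigma> * L * (K * \<tau> powr \<beta>) \<le> 1 / 2" and t: "0 \<le> t" "t \<le> T"
  shows "norm (Y t - Y 0) \<le> T / \<tau> + 1"
proof -
  have s1: "2 * D * L * K * \<tau> powr \<beta> \<le> 1"
  proof -
    have "(D * L * K * \<tau> powr \<beta>) * 1 \<le> (D * L * K * \<tau> powr \<beta>) * \<sigma>"
      using D L K sigma by (intro mult_left_mono) auto
    also have "\<dots> = D * \<sigma> * L * (K * \<tau> powr \<beta>)" by simp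
    finally show ?thesis using \<tau> by simp
  qed
  have st: "norm (Y t - Y s) \<le> 1" if "0 \<le> s" "s \<le> t" "t \<le> T" "t - s \<le> \<tau>" for s t
  proof (cases "s = t")
    case False
    then have "norm (Y t - Y s) \<le> 2 * D * L * K * (t - s) powr \<beta>"
      using that by (intro Y_holder[OF \<tau>(2)]) auto
    also have "\<dots> \<le> 2 * D * L * K * \<tau> powr \<beta>"
      using that D L K beta by (intro mult_left_mono powr_mono2) auto
    finally show ?thesis using s1 by simp
  qed simp
  have ind: "norm (Y t - Y 0) \<le> real j" if "0 \<le> t" "t \<le> T" "t \<le> real j * \<tau>" for t j
    using that
  proof (induction j arbitrary: t)
    case (Suc j)
    show ?case
    proof (cases "t \<le> real j * \<tau>")
      case True
      then show ?thesis using Suc.IH[of t] Suc.prems by simp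
    next
      case False
      have "norm (Y (real j * \<tau>) - Y 0) \<le> real j" using False Suc \<tau> by (intro Suc.IH) auto
      moreover have "norm (Y t - Y (real j * \<tau>)) \<le> 1"
        using False Suc.prems \<tau> by (intro st) (auto simp: algebra_simps)
      ultimately show ?thesis using norm_triangle_ineq[of "Y t - Y (real j * \<tau>)" "Y (real j * \<tau>) - Y 0"] by simp
    qed
  qed simp
  define j where "j = nat \<lceil>t / \<tau>\<rceil>"
  have j: "t / \<tau> \<le> real j" "real j \<le> t / \<tau> + 1"
    using ceiling_correct[of "t / \<tau>"] t \<tau>(1) unfolding j_def by (auto simp: of_nat_nat)
  have "norm (Y t - Y 0) \<le> real j" using t j \<tau>(1) by (intro ind) (auto simp: field_simps)
  also have "\<dots> \<le> t / \<tau> + 1" by (rule j)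
  also have "\<dots> \<le> T / \<tau> + 1" using t \<tau>(1) by (simp add: divide_right_mono)
  finally show ?thesis .
qed

text \<open>On a grid coarser than \<open>\<tau>\<close> the two paths are not compared with each
  other but with their common starting point: the scheme makes at most T / \<tau> steps of size at
  most \<open>B\<close>.\<close>

lemma error_crude:
  fixes y :: "nat \<Rightarrow> 'a"
  assumes \<tau>: "0 < \<tau>" "D * \<sigma> * L * (K * \<tau> powr \<beta>) \<le> 1 / 2" and h: "\<tau> \<le> h" "real n * h = T"
    and y: "y 0 = Y 0" "\<And>k. k < n \<Longrightarrow> norm (y (Suc k) - y k) \<le> B" and "0 \<le> B" and t: "0 \<le> t" "t \<le> T"
  shows "norm (Y t - linear_interpolation h y t) \<le> (T / \<tau> + 1) * (1 + B)"
proof -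
  have h0: "0 < h" using \<tau> h by simp
  have yk: "norm (y k - y 0) \<le> real k * B" if "k \<le> n" for k
    using that
  proof (induction k)
    case (Suc k)
    then show ?case
      using norm_triangle_ineq[of "y (Suc k) - y k" "y k - y 0"] y(2)[of k] by (simp add: algebra_simps)
  qed simp
  have "norm (linear_interpolation h y t - y 0) \<le> real n * B"
  proof (cases "t = 0")
    case True
    then show ?thesis using \<open>0 \<le> B\<close> by (simp add: linear_interpolation_def)
  next
    case False
    then obtain k where k: "k < n" "t \<in> {real k * h <.. real (Suc k) * h}"
      using grid_cell[OF h0, of t n] t h by auto
    have "norm (linear_interpolation h y t - y 0) \<le> B + real k * B"
      using linear_interpolation_bound[OF h0 k(2), of y] y(2)[OF k(1)] yk[of k] k(1)
        norm_triangle_ineq[of "linear_interpolation h y t - y k" "y k - y 0"] by simp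
    also have "\<dots> = real (Suc k) * B" by (simp add: algebra_simps)
    also have "\<dots> \<le> real n * B" using k \<open>0 \<le> B\<close> by (intro mult_right_mono) auto
    finally show ?thesis .
  qed
  also have "\<dots> \<le> (T / \<tau>) * B"
  proof (intro mult_right_mono)
    have "real n * \<tau> \<le> T" using mult_left_mono[OF h(1), of "real n"] h(2) by simp
    then show "real n \<le> T / \<tau>" using \<tau> by (simp add: field_simps)
  qed fact
  finally have 1: "norm (linear_interpolation h y t - y 0) \<le> (T / \<tau>) * B" .
  have "Y t - linear_interpolation h y t = (Y t - Y 0) - (linear_interpolation h y t - y 0)"
    by (simp add: y)
  also have "norm \<dots> \<le> norm (Y t - Y 0) + norm (linear_interpolation h y t - y 0)" by (rule norm_triangle_ineq4)
  also have "\<dots> \<le> (T / \<tau> + 1) + (T / \<tau>) * B" using Y_crude[OF \<tau> t] 1 by linarith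
  also have "\<dots> \<le> (T / \<tau> + 1) * (1 + B)" using \<open>0 \<le> B\<close> by (simp add: algebra_simps add_divide_distrib)
  finally show ?thesis .
qed

end

context scheme
begin

text \<open>Three errors meet inside a cell: the error at the left grid point, the movement of the
  solution, and one step of the scheme. The last two are of first order in the oscillation
  \<open>W\<close> of the driver, which is why \<open>W\<close> appears without amplification by the
  exponential.\<close>

lemma error_interpolation:
  assumes \<tau>: "0 < \<tau>" "K * \<tau> powr \<beta> \<le> cs" "h \<le> \<tau>"
    and W: "\<And>l k t. k < n \<Longrightarrow> real k * h \<le> t \<Longrightarrow> t \<le> real (Suc k) * h \<Longrightarrow> \<bar>x l t - \<xi> l k\<bar> \<le> W"
    and t: "0 \<le> t" "t \<le> T"
  shows "norm (Y t - linear_interpolation h y t)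
    \<le> 8 * \<Phi> * exp (2 * T / \<tau>) + 2 * D * L * W + (R1 + R4) * K\<^sup>2 * h powr (2 * \<beta>)"
proof -
  have W0: "0 \<le> W" using W[of 0 0 undefined] n h_pos by (auto intro: order_trans[OF abs_ge_zero])
  show ?thesis
  proof (cases "t = 0")
    case True
    then show ?thesis using \<Phi> D L W0 R1 R4 y0 by (simp add: linear_interpolation_def)
  next
    case False
    then obtain k where k: "k < n" "t \<in> {real k * h <.. real (Suc k) * h}"
      using grid_cell[OF h_pos, of t n] t h by auto
    have "real k * h < t" "t \<le> real k * h + h" using k(2) by (auto simp: algebra_simps)
    then have tk: "0 \<le> real k * h" "real k * h < t" "t - real k * h \<le> \<tau>" "0 \<le> t - real k * h" "t - real k * h \<le> h"
      using \<tau> h_pos by auto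
    have Kt: "D * \<sigma> * L * (K * \<tau> powr \<beta>) \<le> 1/2"
    proof -
      have "D * \<sigma> * L * (K * \<tau> powr \<beta>) \<le> D * \<sigma> * L * cs"
        using D sigma L by (intro mult_left_mono \<tau>) auto
      then show ?thesis using cs(3) by linarith
    qed
    have "norm (Y t - \<eta> k - (\<Sum>l\<in>UNIV. (x l t - x l (real k * h)) *\<^sub>R U l (\<eta> k))) \<le> R1 * K\<^sup>2 * (t - real k * h) powr (2 * \<beta>)"
      using t tk by (intro Y_first_order[OF Kt]) auto
    also have "\<dots> \<le> R1 * K\<^sup>2 * h powr (2 * \<beta>)"
      using tk R1 beta by (intro mult_left_mono powr_mono2) auto
    finally have "norm (Y t - \<eta> k) \<le> R1 * K\<^sup>2 * h powr (2 * \<beta>) + D * L * W"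
      by (rule norm_le_of_diff) (intro sum_U_bound W, use k in auto)
    moreover have "norm (y (Suc k) - y k) \<le> R4 * K\<^sup>2 * h powr (2 * \<beta>) + D * L * W"
      by (rule norm_le_of_diff[OF y_increment]) (intro sum_U_bound W | use k h_pos in simp)+
    moreover have "norm (linear_interpolation h y t - y k) \<le> norm (y (Suc k) - y k)"
      by (rule linear_interpolation_bound[OF h_pos k(2)])
    moreover have "norm (e k) \<le> 4 * \<Phi> * (2 * exp (2 * T / \<tau>))"
      using k by (intro error_grid[OF \<tau>]) auto
    moreover have "norm (Y t - linear_interpolation h y t) \<le> norm (Y t - \<eta> k) + norm (e k) + norm (linear_interpolation h y t - y k)"
      using norm_triangle_ineq[of "Y t - \<eta> k" "e k"] norm_triangle_ineq4[of "Y t - \<eta> k + e k" "linear_interpolation h y t - y k"]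
      by simp
    ultimately show ?thesis by (simp add: algebra_simps)
  qed
qed

end

text \<open>The last hypothesis on \<open>y\<close> only serves the case of a coarse grid, where the driving path is not
  small on a single cell.\<close>

lemma (in vector_fields) pathwise_error:
  fixes T B :: real and N :: nat
  assumes T: "0 < T" and B: "0 \<le> B"
  shows "\<exists>C\<ge>1. \<forall>x K Y \<Lambda>\<^sub>0 n h Q W y t.
     driven_solution U DU D L \<beta> R3 x T K Y \<Lambda>\<^sub>0 \<and> 1 \<le> (n::nat) \<and> real n * h = T \<and> 0 \<le> Q \<and> y 0 = Y 0 \<and>
     (K * h powr \<beta> \<le> 1 \<longrightarrow> scheme U DU D L \<beta> R3 x T K Y \<Lambda>\<^sub>0 n h Q y) \<and>
     (\<forall>l k t. k < n \<and> real k * h \<le> t \<and> t \<le> real (Suc k) * h \<longrightarrow> \<bar>x l t - x l (real k * h)\<bar> \<le> W) \<and>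
     (\<forall>k<n. norm (y (Suc k) - y k) \<le> B * K ^ N) \<and> 0 \<le> t \<and> t \<le> T
     \<longrightarrow> norm (Y t - linear_interpolation h y t)
       \<le> C * K ^ (N + 4) * exp (C * K powr (1 / \<beta>)) * (Q + W + h powr (3 * \<beta> - 1))"
proof -
  \<comment> \<open>\<open>P1\<close> and \<open>P2\<close> are the factors of \<open>Q\<close> and
    of h^(3 \<beta> - 1) on fine grids, \<open>P3\<close> is that of the coarse case, and
    \<open>E\<close> turns the number of blocks into a multiple of K^(1/\<beta>).\<close>
  define P1 where "P1 = 8 * (D\<^sup>2 * L * (1 + 2 * \<sigma> * D * L))"
  define P2 where "P2 = 8 * ((R2 + R3) * T powr (1 - \<beta>)) + (R1 + R4) * T powr (1 - \<beta>)"
  define P3 where "P3 = (T / cs ^ 2 + 1) * (1 + B) / cs ^ 2"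
  define E where "E = 2 * T / cs powr (1 / \<beta>)"
  define C where "C = 1 + E + P1 + P2 + P3 + 2 * D * L"
  have pos: "0 \<le> P1" "0 \<le> P2" "0 \<le> P3" "0 \<le> E" "0 \<le> 2 * D * L"
    unfolding P1_def P2_def P3_def E_def using D L sigma R1 R2 R3 R4 T B by auto
  have C: "1 \<le> C" "E \<le> C" "P1 + P2 + P3 + 2 * D * L \<le> C"
    using pos by (auto simp: C_def)
  have main: "norm (Y t - linear_interpolation h y t)
       \<le> C * K ^ (N + 4) * exp (C * K powr (1 / \<beta>)) * (Q + W + h powr (3 * \<beta> - 1))"
    if sol: "driven_solution U DU D L \<beta> R3 x T K Y \<Lambda>\<^sub>0" and n: "1 \<le> n" "real n * h = T" and Q: "0 \<le> Q" and y0: "y 0 = Y 0"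
    and sch: "K * h powr \<beta> \<le> 1 \<longrightarrow> scheme U DU D L \<beta> R3 x T K Y \<Lambda>\<^sub>0 n h Q y"
    and W: "\<forall>l k t. k < n \<and> real k * h \<le> t \<and> t \<le> real (Suc k) * h \<longrightarrow> \<bar>x l t - x l (real k * h)\<bar> \<le> W"
    and yB: "\<forall>k<n. norm (y (Suc k) - y k) \<le> B * K ^ N" and t: "0 \<le> t" "t \<le> T"
    for x :: "'d \<Rightarrow> real \<Rightarrow> real" and K \<Lambda>\<^sub>0 h Q W t :: real and n :: nat and Y :: "real \<Rightarrow> 'a" and y :: "nat \<Rightarrow> 'a"
  proof -
    interpret driven_solution U DU D L \<beta> R3 x T K Y \<Lambda>\<^sub>0 by (rule sol)
    have h0: "0 < h" using n T by (metis less_le_not_le mult_nonneg_nonpos of_nat_0_le_iff not_le)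
    have W0: "0 \<le> W" using W[rule_format, of 0 0 undefined] n h0 by (auto intro: order_trans[OF abs_ge_zero])
    \<comment> \<open>Solves \<open>K * \<tau> powr \<beta> = cs\<close>, the largest admissible
      block length.\<close>
    define \<tau> where "\<tau> = (cs / K) powr (1 / \<beta>)"
    have \<tau>: "0 < \<tau>" "\<tau> powr \<beta> = cs / K"
      using cs(1) K beta by (auto simp: \<tau>_def powr_powr)
    then have K\<tau>: "K * \<tau> powr \<beta> = cs" using K by simp
    define H where "H = h powr (3 * \<beta> - 1)"
    have H: "0 < H" using h0 by (simp add: H_def)
    define M where "M = K ^ (N + 4) * exp (C * K powr (1 / \<beta>))"
    have K1: "1 \<le> K ^ m" for m using K by simp
    have M1: "1 \<le> exp (C * K powr (1 / \<beta>))" using C(1) by simp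
    have M: "K ^ (N + 4) \<le> M" "0 \<le> M"
      using mult_left_mono[OF M1, of "K ^ (N + 4)"] K by (auto simp: M_def)
    have "norm (Y t - linear_interpolation h y t) \<le> (P1 + P2 + P3 + 2 * D * L) * M * (Q + W + H)"
    proof (cases "h \<le> \<tau>")
      case True
      have hT: "h \<le> T" using n h0 mult_right_mono[of 1 "real n" h] by simp
      have "h powr \<beta> \<le> \<tau> powr \<beta>" using True h0 beta by (intro powr_mono2) auto
      then have "K * h powr \<beta> \<le> K * \<tau> powr \<beta>" using K by (intro mult_left_mono) auto
      then have "K * h powr \<beta> \<le> 1" using K\<tau> cs(2) by linarith
      then interpret scheme U DU D L \<beta> R3 x T K Y \<Lambda>\<^sub>0 n h Q y using sch by blast
      have "1 / \<tau> = K powr (1 / \<beta>) / cs powr (1 / \<beta>)"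
        using K cs(1) by (simp add: \<tau>_def powr_divide)
      then have tE: "2 * T / \<tau> = E * K powr (1 / \<beta>)" by (simp add: E_def divide_inverse)
      have ex: "exp (2 * T / \<tau>) \<le> exp (C * K powr (1 / \<beta>))"
        unfolding tE using C(2) by (simp add: mult_right_mono)
      have "\<Phi> \<le> (P1 * Q + 8 * ((R2 + R3) * T powr (1 - \<beta>)) * (K ^ 3 * H)) / 8"
        by (simp add: \<Phi>_def P1_def H_def)
      then have 1: "8 * \<Phi> \<le> P1 * Q + 8 * ((R2 + R3) * T powr (1 - \<beta>)) * (K ^ 3 * H)" by simp
      have "h powr (2 * \<beta>) = H * h powr (1 - \<beta>)" by (simp add: H_def flip: powr_add)
      also have "\<dots> \<le> H * T powr (1 - \<beta>)"
        using H hT h0 beta by (intro mult_left_mono powr_mono2) auto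
      finally have "(R1 + R4) * K\<^sup>2 * h powr (2 * \<beta>) \<le> (R1 + R4) * K\<^sup>2 * (H * T powr (1 - \<beta>))"
        using R1 R4 by (intro mult_left_mono) auto
      then have 2: "(R1 + R4) * K\<^sup>2 * h powr (2 * \<beta>) \<le> ((R1 + R4) * T powr (1 - \<beta>)) * (K\<^sup>2 * H)"
        by (simp add: mult_ac)
      let ?e = "exp (2 * T / \<tau>)"
      have KM: "K ^ m * ?e \<le> M" if "m \<le> N + 4" for m
        unfolding M_def using K that ex by (intro mult_mono power_increasing) auto
      have KM': "K ^ m \<le> M" if "m \<le> N + 4" for m
        using power_increasing[OF that K] M(1) by linarith
      have "norm (Y t - linear_interpolation h y t)
        \<le> 8 * \<Phi> * ?e + 2 * D * L * W + (R1 + R4) * K\<^sup>2 * h powr (2 * \<beta>)"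
        using t W by (intro error_interpolation[OF \<tau>(1) _ True]) (auto simp: K\<tau>)
      also have "\<dots> \<le> (P1 * Q + 8 * ((R2 + R3) * T powr (1 - \<beta>)) * (K ^ 3 * H)) * ?e + 2 * D * L * W
         + ((R1 + R4) * T powr (1 - \<beta>)) * (K\<^sup>2 * H)"
        using 1 2 by (intro add_mono mult_right_mono order_refl) auto
      also have "\<dots> = P1 * Q * (K ^ 0 * ?e) + 8 * ((R2 + R3) * T powr (1 - \<beta>)) * H * (K ^ 3 * ?e)
         + 2 * D * L * W * K ^ 0 + ((R1 + R4) * T powr (1 - \<beta>)) * H * K\<^sup>2"
        by (simp add: algebra_simps)
      also have "\<dots> \<le> P1 * Q * M + 8 * ((R2 + R3) * T powr (1 - \<beta>)) * H * M
         + 2 * D * L * W * M + ((R1 + R4) * T powr (1 - \<beta>)) * H * M"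
        using pos Q H W0 R1 R2 R3 R4 D L
        by (intro add_mono mult_left_mono KM KM' mult_nonneg_nonneg add_nonneg_nonneg) auto
      also have "\<dots> = (P1 * Q + P2 * H + 2 * D * L * W) * M" by (simp add: P2_def algebra_simps)
      also have "\<dots> \<le> ((P1 + P2 + P3 + 2 * D * L) * (Q + W + H)) * M"
      proof (intro mult_right_mono M(2))
        let ?S = "P1 + P2 + P3 + 2 * D * L"
        have "P1 * Q \<le> ?S * Q" "P2 * H \<le> ?S * H" "2 * D * L * W \<le> ?S * W"
          using pos Q H W0 by (auto intro!: mult_right_mono)
        then show "P1 * Q + P2 * H + 2 * D * L * W \<le> ?S * (Q + W + H)"
          unfolding distrib_left by linarith
      qed
      finally show ?thesis by (simp add: mult_ac)
    next
      case False
      then have h\<tau>: "\<tau> \<le> h" by simp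
      have Kt: "D * \<sigma> * L * (K * \<tau> powr \<beta>) \<le> 1/2" using cs(3) by (simp add: K\<tau>)
      \<comment> \<open>On a coarse grid \<open>H\<close> is bounded below by a power of
        \<open>K\<close>, so the crude bound is already within the rate. The estimates 1 / \<tau> <=
        v^2 (from \<beta> > 1/2) and 1 <= v^2 * H (from \<beta> <= 1) account for the four extra
        powers of \<open>K\<close>.\<close>
      define v where "v = K / cs"
      have v1: "1 \<le> v" using K cs by (simp add: v_def)
      have inv: "1 / \<tau> = v powr (1 / \<beta>)" using K cs(1) by (simp add: \<tau>_def v_def powr_divide)
      have "v powr (1 / \<beta>) \<le> v powr 2" using v1 beta by (intro powr_mono) (auto simp: field_simps)
      then have i2: "1 / \<tau> \<le> v ^ 2" using v1 inv by (simp add: powr_numeral)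
      have "1 = (1 / \<tau>) powr (3 * \<beta> - 1) * \<tau> powr (3 * \<beta> - 1)"
        using \<tau> by (simp add: powr_divide)
      also have "\<dots> \<le> (1 / \<tau>) powr (3 * \<beta> - 1) * H"
        unfolding H_def using h\<tau> \<tau> beta by (intro mult_left_mono powr_mono2) auto
      also have "(1 / \<tau>) powr (3 * \<beta> - 1) = v powr (3 - 1 / \<beta>)"
        unfolding inv using beta by (simp add: powr_powr field_simps)
      also have "\<dots> \<le> v powr 2" using v1 beta by (intro powr_mono) (auto simp: field_simps)
      finally have one: "1 \<le> v ^ 2 * H" using v1 H by (simp add: powr_numeral mult_right_mono)
      have "norm (Y t - linear_interpolation h y t) \<le> (T / \<tau> + 1) * (1 + B * K ^ N)"
        by (rule error_crude[where y = y and n = n]) (use yB B K \<tau>(1) Kt h\<tau> n(2) y0 t in auto)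
      also have "\<dots> \<le> ((T / cs ^ 2 + 1) * K ^ 2) * ((1 + B) * K ^ N)"
      proof (intro mult_mono)
        have "T * (1 / \<tau>) \<le> T * v ^ 2" using i2 T by (intro mult_left_mono) auto
        then show "T / \<tau> + 1 \<le> (T / cs ^ 2 + 1) * K ^ 2"
          using K1[of 2] by (simp add: v_def power_divide algebra_simps)
        show "1 + B * K ^ N \<le> (1 + B) * K ^ N" using K1[of N] by (simp add: algebra_simps)
      qed (use T B K \<tau> in auto)
      also have "\<dots> \<le> ((T / cs ^ 2 + 1) * K ^ 2) * ((1 + B) * K ^ N) * (v ^ 2 * H)"
        using mult_left_mono[OF one, of "((T / cs ^ 2 + 1) * K ^ 2) * ((1 + B) * K ^ N)"] T B K by simp
      also have "\<dots> = P3 * K ^ (N + 4) * H"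
        by (simp add: P3_def v_def power_divide power_add power_numeral_reduce)
      also have "\<dots> \<le> (P1 + P2 + P3 + 2 * D * L) * M * (Q + W + H)"
        using pos M Q W0 H K by (intro mult_mono) auto
      finally show ?thesis .
    qed
    also have "\<dots> \<le> C * M * (Q + W + H)"
      using C(3) M(2) Q W0 H by (intro mult_right_mono) auto
    finally show ?thesis by (simp add: M_def H_def mult.assoc)
  qed
  show ?thesis
    by (intro exI[of _ C] conjI C(1) allI impI) (elim conjE, rule main; assumption)
qed


section \<open>Calculus in \<open>C\<^sub>b\<^sup>N\<close>\<close>

lemma Cb_bounded: "Cb n f \<Longrightarrow> bounded (range f)"
  by (cases n) auto

lemma Cb_differentiable: "Cb (Suc n) f \<Longrightarrow> (f has_derivative frechet_derivative f (at x)) (at x)"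
  by (simp add: frechet_derivative_works[symmetric])

lemma Cb_direction: "Cb (Suc n) f \<Longrightarrow> Cb n (\<lambda>x. frechet_derivative f (at x) v)"
  by simp

lemma Cb_SucI:
  assumes "bounded (range f)" "\<And>x. (f has_derivative f' x) (at x)" "\<And>v. Cb n (\<lambda>x. f' x v)"
  shows "Cb (Suc n) f"
proof -
  have "frechet_derivative f (at x) = f' x" for x
    using frechet_derivative_at[OF assms(2)] by simp
  then show ?thesis using assms by (auto simp: differentiable_def)
qed

lemma Cb_Suc_imp: "Cb (Suc n) f \<Longrightarrow> Cb n f"
proof (induction n arbitrary: f)
  case 0
  then have "continuous_on UNIV f"
    by (auto intro!: differentiable_imp_continuous_on simp: differentiable_on_def)
  then show ?case using 0 by simp
next
  case (Suc n)
  then show ?case by simp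
qed

lemma Cb_le: "Cb n f \<Longrightarrow> m \<le> n \<Longrightarrow> Cb m f"
  by (induction n) (auto simp: le_Suc_eq simp del: Cb.simps dest: Cb_Suc_imp)

lemma Cb_const: "Cb n (\<lambda>x. c)"
proof (induction n arbitrary: c)
  case (Suc n)
  have "bounded (range (\<lambda>x::'a. c))" by (auto simp: bounded_iff)
  then show ?case by (rule Cb_SucI[where f' = "\<lambda>x v. 0"]) (use Suc in auto)
qed (auto simp: bounded_iff)

lemma Cb_add: "Cb n f \<Longrightarrow> Cb n g \<Longrightarrow> Cb n (\<lambda>x. f x + g x)"
proof (induction n arbitrary: f g)
  case 0
  then show ?case by (auto intro!: continuous_intros bounded_plus_comp)
next
  case (Suc n)
  show ?case
  proof (rule Cb_SucI)
    show "bounded (range (\<lambda>x. f x + g x))"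
      using Suc.prems[THEN Cb_bounded] by (intro bounded_plus_comp)
    show "((\<lambda>x. f x + g x) has_derivative
      (\<lambda>v. frechet_derivative f (at x) v + frechet_derivative g (at x) v)) (at x)" for x
      using Suc.prems[THEN Cb_differentiable] by (intro has_derivative_add)
  qed (intro Suc.IH Suc.prems[THEN Cb_direction])
qed

lemma Cb_sum: "(\<And>i. i \<in> I \<Longrightarrow> Cb n (f i)) \<Longrightarrow> Cb n (\<lambda>x. \<Sum>i\<in>I. f i x)"
  by (induction I rule: infinite_finite_induct) (auto intro!: Cb_const Cb_add simp del: Cb.simps)

lemma Cb_bounded_linear:
  assumes "bounded_linear T"
  shows "Cb n f \<Longrightarrow> Cb n (\<lambda>x. T (f x))"
proof (induction n arbitrary: f)
  case 0
  have "range (\<lambda>x. T (f x)) = T ` range f" by auto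
  then show ?case
    using 0 bounded_linear_image[OF _ assms, of "range f"]
    by (auto intro!: bounded_linear.continuous_on[OF assms])
next
  case (Suc n)
  show ?case
  proof (rule Cb_SucI)
    have "range (\<lambda>x. T (f x)) = T ` range f" by auto
    then show "bounded (range (\<lambda>x. T (f x)))"
      using bounded_linear_image[OF _ assms, of "range f"] Suc.prems by auto
    show "((\<lambda>x. T (f x)) has_derivative (\<lambda>v. T (frechet_derivative f (at x) v))) (at x)" for x
      by (rule bounded_linear.has_derivative[OF assms Cb_differentiable[OF Suc.prems]])
  qed (intro Suc.IH Suc.prems[THEN Cb_direction])
qed

lemma bounded_range_scaleR:
  fixes g :: "'c \<Rightarrow> 'b::real_normed_vector"
  assumes "bounded (range f)" "bounded (range g)"
  shows "bounded (range (\<lambda>x. (f x :: real) *\<^sub>R g x))"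
proof -
  obtain a b where "\<And>x. \<bar>f x\<bar> \<le> a" "\<And>x. norm (g x) \<le> b"
    using assms by (auto simp: bounded_iff)
  then have "norm (f x *\<^sub>R g x) \<le> a * b" for x
    unfolding norm_scaleR by (intro mult_mono) (auto intro: order_trans[OF abs_ge_zero])
  then show ?thesis by (auto simp: bounded_iff)
qed

lemma Cb_scaleR: "Cb n f \<Longrightarrow> Cb n g \<Longrightarrow> Cb n (\<lambda>x. (f x :: real) *\<^sub>R g x)"
proof (induction n arbitrary: f g)
  case 0
  then show ?case by (auto intro!: continuous_intros bounded_range_scaleR)
next
  case (Suc n)
  show ?case
  proof (rule Cb_SucI)
    show "bounded (range (\<lambda>x. f x *\<^sub>R g x))"
      using Suc.prems[THEN Cb_bounded] by (intro bounded_range_scaleR)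
    show "((\<lambda>x. f x *\<^sub>R g x) has_derivative
      (\<lambda>v. f x *\<^sub>R frechet_derivative g (at x) v + frechet_derivative f (at x) v *\<^sub>R g x)) (at x)" for x
      using Suc.prems[THEN Cb_differentiable] by (intro has_derivative_scaleR)
  qed (intro Cb_add Suc.IH Suc.prems[THEN Cb_direction] Suc.prems[THEN Cb_Suc_imp])
qed

text \<open>\<open>Cb\<close> bounds the evaluation of the derivative at each direction separately;
  expanding a direction in the finite basis gives one bound for the operator norm.\<close>

lemma Cb_derivative_bound:
  fixes f :: "'a::euclidean_space \<Rightarrow> 'b::real_normed_vector"
  assumes "Cb (Suc n) f"
  shows "\<exists>C\<ge>0. \<forall>z v. norm (frechet_derivative f (at z) v) \<le> C * norm v"
proof -
  have "\<forall>b. \<exists>c. \<forall>z. norm (frechet_derivative f (at z) b) \<le> c"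
    using Cb_bounded[OF Cb_direction[OF assms]] by (auto simp: bounded_iff)
  then obtain c where c: "\<And>b z. norm (frechet_derivative f (at z) b) \<le> c b" by metis
  have c0: "0 \<le> c b" for b using order_trans[OF norm_ge_zero c] .
  have "norm (frechet_derivative f (at z) v) \<le> (\<Sum>b\<in>Basis. c b) * norm v" for z v
  proof -
    have lin: "linear (frechet_derivative f (at z))"
      using Cb_differentiable[OF assms, of z] has_derivative_linear by blast
    have "frechet_derivative f (at z) v = frechet_derivative f (at z) (\<Sum>b\<in>Basis. (v \<bullet> b) *\<^sub>R b)"
      by (simp add: euclidean_representation)
    also have "\<dots> = (\<Sum>b\<in>Basis. (v \<bullet> b) *\<^sub>R frechet_derivative f (at z) b)"
      using lin by (simp add: linear_sum linear_scale)
    also have "norm \<dots> \<le> (\<Sum>b\<in>Basis. norm v * c b)"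
      by (intro order_trans[OF norm_sum] sum_mono) (auto intro!: mult_mono c simp: Basis_le_norm)
    finally show ?thesis by (simp add: sum_distrib_left[symmetric] mult.commute)
  qed
  then show ?thesis using c0 by (intro exI[of _ "\<Sum>b\<in>Basis. c b"]) (auto intro: sum_nonneg)
qed

lemma Cb_lipschitz:
  fixes f :: "'a::euclidean_space \<Rightarrow> 'b::real_normed_vector"
  assumes "Cb (Suc n) f"
  shows "\<exists>C\<ge>0. \<forall>z z'. norm (f z - f z') \<le> C * norm (z - z')"
proof -
  obtain C where C: "C \<ge> 0" "\<And>z v. norm (frechet_derivative f (at z) v) \<le> C * norm v"
    using Cb_derivative_bound[OF assms] by blast
  have "norm (f z - f z') \<le> C * norm (z - z')" for z z'
    by (rule differentiable_bound[of UNIV f "\<lambda>x. frechet_derivative f (at x)"])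
       (use C Cb_differentiable[OF assms] in \<open>auto intro!: onorm_bound\<close>)
  then show ?thesis using C by blast
qed

lemma Cb_derivative_lipschitz:
  fixes f :: "'a::euclidean_space \<Rightarrow> 'b::real_normed_vector"
  assumes "Cb (Suc (Suc n)) f"
  shows "\<exists>C\<ge>0. \<forall>z z' v. norm (frechet_derivative f (at z) v - frechet_derivative f (at z') v) \<le> C * norm (z - z') * norm v"
proof -
  have "\<forall>b. \<exists>C. \<forall>z z'. norm (frechet_derivative f (at z) b - frechet_derivative f (at z') b) \<le> C * norm (z - z') \<and> 0 \<le> C"
    using Cb_lipschitz[OF Cb_direction[OF assms]] by meson
  then obtain c where c: "\<And>b z z'. norm (frechet_derivative f (at z) b - frechet_derivative f (at z') b) \<le> c b * norm (z - z')"
    and c0: "\<And>b. 0 \<le> c b" by metis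
  have "norm (frechet_derivative f (at z) v - frechet_derivative f (at z') v) \<le> (\<Sum>b\<in>Basis. c b) * norm (z - z') * norm v" for z z' v
  proof -
    have lin: "linear (frechet_derivative f (at z))" for z
      using Cb_differentiable[OF assms, of z] has_derivative_linear by blast
    have rep: "frechet_derivative f (at z) v = (\<Sum>b\<in>Basis. (v \<bullet> b) *\<^sub>R frechet_derivative f (at z) b)" for z
      using lin[of z] by (subst (1) euclidean_representation[of v, symmetric]) (simp add: linear_sum linear_scale)
    have "frechet_derivative f (at z) v - frechet_derivative f (at z') v
       = (\<Sum>b\<in>Basis. (v \<bullet> b) *\<^sub>R (frechet_derivative f (at z) b - frechet_derivative f (at z') b))"
      unfolding rep[of z] rep[of z'] by (simp add: sum_subtractf scaleR_diff_right)
    also have "norm \<dots> \<le> (\<Sum>b\<in>Basis. norm v * (c b * norm (z - z')))"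
      by (intro order_trans[OF norm_sum] sum_mono) (auto intro!: mult_mono c simp: Basis_le_norm)
    finally show ?thesis by (simp add: sum_distrib_left[symmetric] sum_distrib_right[symmetric] mult_ac)
  qed
  then show ?thesis using c0 by (intro exI[of _ "\<Sum>b\<in>Basis. c b"]) (auto intro: sum_nonneg)
qed

text \<open>Stated for all L above a threshold, so that finitely many such estimates can share one
  constant.\<close>

lemma Cb2_estimates:
  fixes f :: "'a::euclidean_space \<Rightarrow> 'b::real_normed_vector"
  assumes "Cb (Suc (Suc n)) f"
  shows "\<exists>C. \<forall>L\<ge>C. (\<forall>z. norm (f z) \<le> L) \<and> (\<forall>z z'. norm (f z - f z') \<le> L * norm (z - z')) \<and>
    (\<forall>z v. norm (frechet_derivative f (at z) v) \<le> L * norm v) \<and>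
    (\<forall>z z'. norm (f z' - f z - frechet_derivative f (at z) (z' - z)) \<le> L * (norm (z' - z))\<^sup>2) \<and>
    (\<forall>a b c e. norm ((f a - f b) - (f c - f e)) \<le> L * norm ((a - b) - (c - e)) + L * norm (a - b) * norm (b - e))"
proof -
  obtain C0 where C0: "\<And>z. norm (f z) \<le> C0"
    using Cb_bounded[OF assms] by (auto simp: bounded_iff)
  obtain C1 where C1: "C1 \<ge> 0" "\<And>z v. norm (frechet_derivative f (at z) v) \<le> C1 * norm v"
    using Cb_derivative_bound[OF assms] by blast
  obtain C2 where C2: "C2 \<ge> 0" "\<And>z z'. norm (f z - f z') \<le> C2 * norm (z - z')"
    using Cb_lipschitz[OF assms] by blast
  obtain C3 where C3: "C3 \<ge> 0"
    "\<And>z z' v. norm (frechet_derivative f (at z) v - frechet_derivative f (at z') v) \<le> C3 * norm (z - z') * norm v"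
    using Cb_derivative_lipschitz[OF assms] by blast
  have taylor: "norm (f z' - f z - frechet_derivative f (at z) (z' - z)) \<le> norm (z' - z) * (C3 * norm (z' - z))" for z z'
  proof (rule differentiable_bound_linearization[of z z' "cball z (norm (z' - z))" f "\<lambda>x. frechet_derivative f (at x)"])
    show "z + t *\<^sub>R (z' - z) \<in> cball z (norm (z' - z))" if "t \<in> {0..1}" for t
      using that by (auto simp: dist_norm mult_left_le_one_le)
    show "(f has_derivative frechet_derivative f (at x)) (at x within cball z (norm (z' - z)))" for x
      using Cb_differentiable[OF assms] by (rule has_derivative_at_withinI)
    show "onorm (frechet_derivative f (at x) - frechet_derivative f (at z)) \<le> C3 * norm (z' - z)"
      if "x \<in> cball z (norm (z' - z))" for x
      unfolding fun_diff_def
    proof (rule onorm_bound)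
      fix v
      have "norm (x - z) \<le> norm (z' - z)" using that by (simp add: dist_norm norm_minus_commute)
      then show "norm (frechet_derivative f (at x) v - frechet_derivative f (at z) v) \<le> C3 * norm (z' - z) * norm v"
        by (intro order_trans[OF C3(2)] mult_right_mono mult_left_mono C3) auto
    qed (use C3 in auto)
  qed auto
  have four: "norm ((f a - f b) - (f c - f e)) \<le> C2 * norm ((a - b) - (c - e)) + C3 * norm (a - b) * norm (b - e)" for a b c e
  proof -
    \<comment> \<open>Replacing \<open>c\<close> by the translate \<open>e + d\<close> splits off a
      Lipschitz error. What remains compares x -> f (x + d) - f x at \<open>b\<close> and at
      \<open>e\<close>, and this map has derivative at most \<open>C3 * norm d\<close>.\<close>
    define d where "d = a - b"
    have d1: "norm ((f (b + d) - f b) - (f (e + d) - f e)) \<le> (C3 * norm d) * norm (b - e)"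
    proof (rule differentiable_bound[of UNIV "\<lambda>x. f (x + d) - f x"
          "\<lambda>x v. frechet_derivative f (at (x + d)) v - frechet_derivative f (at x) v"])
      fix x
      have "((\<lambda>x. f (x + d)) has_derivative frechet_derivative f (at (x + d))) (at x)"
        by (rule has_derivative_compose[of "\<lambda>x. x + d" "\<lambda>v. v" x UNIV f])
          (auto intro!: derivative_eq_intros Cb_differentiable[OF assms])
      then show "((\<lambda>x. f (x + d) - f x) has_derivative (\<lambda>v. frechet_derivative f (at (x + d)) v - frechet_derivative f (at x) v)) (at x within UNIV)"
        using Cb_differentiable[OF assms, of x] by (intro has_derivative_diff)
      show "onorm (\<lambda>v. frechet_derivative f (at (x + d)) v - frechet_derivative f (at x) v) \<le> C3 * norm d"
        using C3(2)[of "x + d" _ x] C3(1) by (intro onorm_bound) auto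
    qed auto
    have d2: "norm (f (e + d) - f c) \<le> C2 * norm ((a - b) - (c - e))"
      using C2(2)[of c "e + d"] by (simp add: d_def algebra_simps norm_minus_commute)
    have d3: "(f a - f b) - (f c - f e) = (f (e + d) - f c) + ((f (b + d) - f b) - (f (e + d) - f e))"
      by (simp add: d_def)
    show ?thesis
      unfolding d3 using norm_triangle_mono[OF d2 d1] by (simp only: d_def)
  qed
  show ?thesis
  proof (intro exI[of _ "max C0 (max C1 (max C2 C3))"] allI impI conjI)
    fix L assume "max C0 (max C1 (max C2 C3)) \<le> L"
    then have L: "C0 \<le> L" "C1 \<le> L" "C2 \<le> L" "C3 \<le> L" by auto
    show "norm (f z) \<le> L" for z using C0[of z] L by simp
    show "norm (f z - f z') \<le> L * norm (z - z')" for z z'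
      by (rule order_trans[OF C2(2)]) (intro mult_right_mono L norm_ge_zero)
    show "norm (frechet_derivative f (at z) v) \<le> L * norm v" for z v
      by (rule order_trans[OF C1(2)]) (intro mult_right_mono L norm_ge_zero)
    show "norm (f z' - f z - frechet_derivative f (at z) (z' - z)) \<le> L * (norm (z' - z))\<^sup>2" for z z'
      using taylor[of z' z] mult_right_mono[OF L(4), of "(norm (z' - z))\<^sup>2"] by (simp add: power2_eq_square mult_ac)
    show "norm ((f a - f b) - (f c - f e)) \<le> L * norm ((a - b) - (c - e)) + L * norm (a - b) * norm (b - e)" for a b c e
      by (rule order_trans[OF four]) (intro add_mono mult_right_mono L norm_ge_zero)
  qed
qed

section \<open>The operators of the scheme\<close>

lemma partial_derivative_eq:
  assumes "(f has_derivative f') (at z)"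
  shows "partial_derivative q f z = f' (axis q 1)"
proof -
  have "((\<lambda>s. f (z + s *\<^sub>R axis q 1)) has_derivative (\<lambda>s. f' (s *\<^sub>R axis q 1))) (at 0)"
    using assms by (intro has_derivative_compose[where f = "\<lambda>s. z + s *\<^sub>R axis q 1" and g = f])
      (auto intro!: derivative_eq_intros)
  then have "((\<lambda>s. f (z + s *\<^sub>R axis q 1)) has_vector_derivative f' (axis q 1)) (at 0)"
    using has_derivative_linear[OF assms] by (simp add: has_vector_derivative_def linear_scale)
  then show ?thesis unfolding partial_derivative_def by (rule vector_derivative_at)
qed

lemma vf_op_eq:
  fixes V :: "real ^ 'm \<Rightarrow> real ^ 'd ^ 'm"
  assumes "(f has_derivative f') (at z)"
  shows "vf_op V l f z = f' (column l (V z))"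
proof -
  have "column l (V z) = (\<Sum>q\<in>UNIV. (V z $ q $ l) *\<^sub>R axis q 1)"
    by (simp add: vec_eq_iff column_def axis_def if_distrib[of "\<lambda>x. _ * x"] cong: if_cong)
  then show ?thesis
    unfolding vf_op_def partial_derivative_eq[OF assms]
    using has_derivative_linear[OF assms] by (simp add: linear_sum linear_scale)
qed

lemma vf_op_id: "vf_op V l (\<lambda>z. z) = (\<lambda>z. column l (V z))"
  by (rule ext) (subst vf_op_eq[OF has_derivative_ident], simp)

lemma Cb_nth2: "Cb n V \<Longrightarrow> Cb n (\<lambda>z. V z $ q $ l)"
  by (rule Cb_bounded_linear[of "\<lambda>M. M $ q $ l"])
    (rule bounded_linear_compose[OF bounded_linear_vec_nth bounded_linear_vec_nth])

lemma Cb_column: "Cb n V \<Longrightarrow> Cb n (\<lambda>z. column l (V z) :: real ^ 'm)"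
  for V :: "real ^ 'm \<Rightarrow> real ^ 'd ^ 'm"
  by (rule Cb_bounded_linear[where T = "column l"])
    (auto intro!: linear_conv_bounded_linear[THEN iffD1] linearI simp: column_def vec_eq_iff)

lemma Cb_vf_op:
  assumes "Cb n V" "Cb (Suc n) f"
  shows "Cb n (vf_op V l f)"
proof -
  have "vf_op V l f = (\<lambda>z. \<Sum>q\<in>UNIV. (V z $ q $ l) *\<^sub>R frechet_derivative f (at z) (axis q 1))"
    unfolding vf_op_def by (intro ext sum.cong refl arg_cong2[where f = scaleR] partial_derivative_eq Cb_differentiable[OF assms(2)])
  then show ?thesis
    by (auto intro!: Cb_sum Cb_scaleR Cb_nth2 assms(1) Cb_direction[OF assms(2)] simp del: Cb.simps)
qed

text \<open>The first operator acts on the identity and differentiates nothing of \<open>V\<close>;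
  each of the remaining w operators costs one derivative.\<close>

lemma Cb_iterated_vf_op:
  assumes "Cb M V" "length ls = Suc w" "w \<le> M"
  shows "Cb (M - w) (foldr (vf_op V) ls (\<lambda>z. z))"
  using assms(2,3)
proof (induction w arbitrary: ls)
  case 0
  then obtain l where "ls = [l]" by (auto simp: length_Suc_conv)
  then show ?case using Cb_column[OF assms(1)] by (simp add: vf_op_id del: Cb.simps)
next
  case (Suc w)
  then obtain l ls' where ls: "ls = l # ls'" "length ls' = Suc w" by (auto simp: length_Suc_conv)
  have "Cb (Suc (M - Suc w)) (foldr (vf_op V) ls' (\<lambda>z. z))"
    using Suc.IH[OF ls(2)] Suc.prems by (simp add: Suc_diff_Suc del: Cb.simps)
  then show ?case
    unfolding ls(1) foldr.simps o_def using assms(1) by (intro Cb_vf_op Cb_le[OF assms(1)]) auto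
qed


section \<open>Constants for the vector fields\<close>

lemma uniform_constant:
  fixes P :: "'i::finite \<Rightarrow> real \<Rightarrow> bool"
  assumes "\<And>i. \<exists>C. \<forall>L\<ge>C. P i L"
  shows "\<exists>C. \<forall>L\<ge>C. \<forall>i. P i L"
proof -
  from assms obtain C where C: "\<And>i L. C i \<le> L \<Longrightarrow> P i L" by metis
  have "C i \<le> Max (range C)" for i by (intro Max_ge) auto
  then show ?thesis using C by (meson order_trans)
qed

lemma Cb1_estimates:
  fixes f :: "'a::euclidean_space \<Rightarrow> 'b::real_normed_vector"
  assumes "Cb (Suc n) f"
  shows "\<exists>C. \<forall>L\<ge>C. \<forall>z z'. norm (f z) \<le> L \<and> norm (f z - f z') \<le> L * norm (z - z')"
proof -
  obtain C0 where C0: "\<And>z. norm (f z) \<le> C0"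
    using Cb_bounded[OF assms] by (auto simp: bounded_iff)
  obtain C2 where C2: "C2 \<ge> 0" "\<And>z z'. norm (f z - f z') \<le> C2 * norm (z - z')"
    using Cb_lipschitz[OF assms] by blast
  show ?thesis
  proof (intro exI[of _ "max C0 C2"] allI impI conjI)
    fix L z z' assume "max C0 C2 \<le> L"
    then have L: "C0 \<le> L" "C2 \<le> L" by auto
    show "norm (f z) \<le> L" using C0[of z] L by simp
    show "norm (f z - f z') \<le> L * norm (z - z')"
      by (rule order_trans[OF C2(2)]) (intro mult_right_mono L norm_ge_zero)
  qed
qed

text \<open>Two derivatives of each column give the Taylor and four-point estimates; the
  second-order coefficients have one derivative less and are still Lipschitz. \<open>L\<close> does
  not depend on \<open>R3\<close>, so it can be fixed before the step of the scheme is
  expanded.\<close>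

lemma vector_fields_of_Cb:
  fixes V :: "real ^ 'm \<Rightarrow> real ^ 'd::finite ^ 'm"
  assumes V: "Cb 3 V" and beta: "1 / 2 < \<beta>" "\<beta> \<le> 1"
  defines "U \<equiv> \<lambda>l z. column l (V z)"
  shows "\<exists>L. \<forall>R3\<ge>0. vector_fields U (\<lambda>l z. frechet_derivative (U l) (at z)) (real CARD('d)) L \<beta> R3"
proof -
  have U: "Cb (Suc (Suc 1)) (U l)" for l
    using Cb_column[OF V, of l] by (simp add: U_def numeral_3_eq_3 del: Cb.simps)
  have G_eq: "vf_op V i (U j) z = frechet_derivative (U j) (at z) (U i z)" for i j z
    using vf_op_eq[OF Cb_differentiable[OF U]] by (simp add: U_def)
  have G: "Cb (Suc 0) (vf_op V i (U j))" for i j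
    by (rule Cb_vf_op) (use U V in \<open>auto intro: Cb_le simp del: Cb.simps\<close>)
  have "\<exists>C. \<forall>L\<ge>C. \<forall>l. (\<forall>z. norm (U l z) \<le> L) \<and> (\<forall>z z'. norm (U l z - U l z') \<le> L * norm (z - z')) \<and>
    (\<forall>z v. norm (frechet_derivative (U l) (at z) v) \<le> L * norm v) \<and>
    (\<forall>z z'. norm (U l z' - U l z - frechet_derivative (U l) (at z) (z' - z)) \<le> L * (norm (z' - z))\<^sup>2) \<and>
    (\<forall>a b c e. norm ((U l a - U l b) - (U l c - U l e)) \<le> L * norm ((a - b) - (c - e)) + L * norm (a - b) * norm (b - e))"
    by (rule uniform_constant, rule Cb2_estimates[OF U])
  then obtain C1 where C1: "\<forall>L\<ge>C1. \<forall>l. (\<forall>z. norm (U l z) \<le> L) \<and> (\<forall>z z'. norm (U l z - U l z') \<le> L * norm (z - z')) \<and>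
    (\<forall>z v. norm (frechet_derivative (U l) (at z) v) \<le> L * norm v) \<and>
    (\<forall>z z'. norm (U l z' - U l z - frechet_derivative (U l) (at z) (z' - z)) \<le> L * (norm (z' - z))\<^sup>2) \<and>
    (\<forall>a b c e. norm ((U l a - U l b) - (U l c - U l e)) \<le> L * norm ((a - b) - (c - e)) + L * norm (a - b) * norm (b - e))"
    by (elim exE)
  have "\<exists>C. \<forall>L\<ge>C. \<forall>ij. \<forall>z z'. norm (vf_op V (fst ij) (U (snd ij)) z) \<le> L \<and>
     norm (vf_op V (fst ij) (U (snd ij)) z - vf_op V (fst ij) (U (snd ij)) z') \<le> L * norm (z - z')"
    by (rule uniform_constant, rule Cb1_estimates[OF G])
  then obtain C2 where C2: "\<forall>L\<ge>C2. \<forall>ij z z'. norm (vf_op V (fst ij) (U (snd ij)) z) \<le> L \<and>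
     norm (vf_op V (fst ij) (U (snd ij)) z - vf_op V (fst ij) (U (snd ij)) z') \<le> L * norm (z - z')"
    by (elim exE)
  define L where "L = max 1 (max C1 C2)"
  have L: "1 \<le> L" "C1 \<le> L" "C2 \<le> L" by (auto simp: L_def)
  have 1: "\<And>l z. norm (U l z) \<le> L" "\<And>l z z'. norm (U l z - U l z') \<le> L * norm (z - z')"
    "\<And>l z v. norm (frechet_derivative (U l) (at z) v) \<le> L * norm v"
    "\<And>l z z'. norm (U l z' - U l z - frechet_derivative (U l) (at z) (z' - z)) \<le> L * (norm (z' - z))\<^sup>2"
    "\<And>l a b c e. norm ((U l a - U l b) - (U l c - U l e)) \<le> L * norm ((a - b) - (c - e)) + L * norm (a - b) * norm (b - e)"
    using C1[rule_format, OF L(2)] by blast+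
  have 2: "norm (frechet_derivative (U j) (at z) (U i z)) \<le> L"
    "norm (frechet_derivative (U j) (at z) (U i z) - frechet_derivative (U j) (at z') (U i z')) \<le> L * norm (z - z')" for i j z z'
    using C2[rule_format, OF L(3), of "(i, j)" z z'] by (auto simp: G_eq)
  have lin: "linear (frechet_derivative (U l) (at z))" for l z
    using Cb_differentiable[OF U, of l z] has_derivative_linear by blast
  show ?thesis
  proof (intro exI[of _ L] allI impI)
    fix R3 :: real assume "0 \<le> R3"
    then show "vector_fields U (\<lambda>l z. frechet_derivative (U l) (at z)) (real CARD('d)) L \<beta> R3"
      by (intro vector_fields.intro 1 2 lin L(1) beta) auto
  qed
qed

section \<open>Expansion of one step\<close>

lemma sum_length_1:
  "(\<Sum>ls | length ls = Suc 0. f ls) = (\<Sum>l\<in>(UNIV::'d::finite set). f [l])"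
proof -
  have "{ls::'d list. length ls = Suc 0} = range (\<lambda>l. [l])"
    by (auto simp: length_Suc_conv)
  then show ?thesis by (simp add: sum.reindex inj_on_def)
qed

lemma sum_length_2:
  "(\<Sum>ls | length ls = Suc (Suc 0). f ls) = (\<Sum>i\<in>(UNIV::'d::finite set). \<Sum>j\<in>(UNIV::'d set). f [i, j])"
proof -
  have "{ls::'d list. length ls = Suc (Suc 0)} = (\<lambda>(i, j). [i, j]) ` UNIV"
    by (auto simp: length_Suc_conv)
  then show ?thesis
    by (simp add: sum.reindex inj_on_def split_def sum.cartesian_product UNIV_Times_UNIV[symmetric] del: UNIV_Times_UNIV)
qed

lemma abs_prod_list_le:
  assumes "\<And>l. \<bar>\<Delta> l\<bar> \<le> (\<delta>::real)"
  shows "\<bar>prod_list (map \<Delta> ls)\<bar> \<le> \<delta> ^ length ls"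
proof (induction ls)
  case (Cons l ls)
  have "0 \<le> \<delta>" using assms[of l] by linarith
  then show ?case using Cons assms[of l] by (auto simp: abs_mult intro!: mult_mono)
qed simp

text \<open>The words of length 1 and 2 are the displayed terms, and longer ones carry at least
  \<delta>^3 when \<delta> <= 1. When \<delta> >= 1 every word is at most of order \<delta>^N, the
  form that coarse grids require.\<close>

lemma simplified_step_expansion:
  fixes V :: "real ^ 'm \<Rightarrow> real ^ 'd::finite ^ 'm"
  assumes V: "Cb (N + 1) V" and N: "2 \<le> N"
  defines "U \<equiv> \<lambda>l z. column l (V z)"
  shows "\<exists>R\<ge>0. \<forall>\<Delta> z \<delta>. (\<forall>l. \<bar>\<Delta> $ l\<bar> \<le> \<delta>) \<longrightarrow>
      (\<delta> \<le> 1 \<longrightarrow> norm (simplified_step V N \<Delta> z - z - (\<Sum>l\<in>UNIV. (\<Delta> $ l) *\<^sub>R U l z)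
        - (\<Sum>i\<in>UNIV. \<Sum>j\<in>UNIV. ((\<Delta> $ i) * (\<Delta> $ j) / 2) *\<^sub>R frechet_derivative (U j) (at z) (U i z))) \<le> R * \<delta> ^ 3) \<and>
      (1 \<le> \<delta> \<longrightarrow> norm (simplified_step V N \<Delta> z - z) \<le> R * \<delta> ^ N)"
proof -
  define F where "F ls = foldr (vf_op V) ls (\<lambda>z. z)" for ls
  have "\<exists>c\<ge>0. \<forall>z. norm (F ls z) \<le> c" if len: "1 \<le> length ls" "length ls \<le> N" for ls
  proof -
    obtain w where w: "length ls = Suc w" using len by (cases "length ls") auto
    then have "Cb (N + 1 - w) (F ls)"
      using Cb_iterated_vf_op[OF V w] that by (simp add: F_def)
    from Cb_bounded[OF this] obtain c where "\<And>z. norm (F ls z) \<le> c" by (auto simp: bounded_iff)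
    moreover from this[of undefined] have "0 \<le> c" using norm_ge_zero order_trans by blast
    ultimately show ?thesis by blast
  qed
  then have "\<forall>ls. \<exists>c\<ge>0. 1 \<le> length ls \<longrightarrow> length ls \<le> N \<longrightarrow> (\<forall>z. norm (F ls z) \<le> c)"
    by (metis order_refl)
  then obtain c where c0: "\<And>ls. 0 \<le> c ls" and c: "\<And>ls z. 1 \<le> length ls \<Longrightarrow> length ls \<le> N \<Longrightarrow> norm (F ls z) \<le> c ls"
    by metis
  define R where "R = (\<Sum>w=1..N. \<Sum>ls | length ls = w. c ls)"
  have R0: "0 \<le> R" unfolding R_def by (intro sum_nonneg c0)
  define t where "t \<Delta> z w = (\<Sum>ls | length ls = w. (prod_list (map (\<lambda>l. \<Delta> $ l) ls) / fact w) *\<^sub>R F ls z)" for \<Delta> z w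
  have t: "norm (t \<Delta> z w) \<le> \<delta> ^ w * (\<Sum>ls | length ls = w. c ls)"
    if "\<And>l. \<bar>\<Delta> $ l\<bar> \<le> \<delta>" "1 \<le> w" "w \<le> N" for \<Delta> :: "real ^ 'd" and z \<delta> w
    unfolding t_def sum_distrib_left
  proof (intro order_trans[OF norm_sum] sum_mono)
    fix ls :: "'d list" assume "ls \<in> {ls. length ls = w}"
    then have ls: "length ls = w" by simp
    have "\<bar>prod_list (map (\<lambda>l. \<Delta> $ l) ls) / fact w\<bar> = \<bar>prod_list (map (\<lambda>l. \<Delta> $ l) ls)\<bar> / fact w" by simp
    also have "\<dots> \<le> \<bar>prod_list (map (\<lambda>l. \<Delta> $ l) ls)\<bar> / 1" by (intro divide_left_mono) auto
    also have "\<dots> \<le> \<delta> ^ w" using abs_prod_list_le[of "\<lambda>l. \<Delta> $ l" \<delta> ls] that(1) ls by simp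
    finally show "norm ((prod_list (map (\<lambda>l. \<Delta> $ l) ls) / fact w) *\<^sub>R F ls z) \<le> \<delta> ^ w * c ls"
      unfolding norm_scaleR using c[of ls z] ls that order_trans[OF abs_ge_zero that(1)[of undefined]]
      by (intro mult_mono) auto
  qed
  have st: "simplified_step V N \<Delta> z - z = (\<Sum>w=1..N. t \<Delta> z w)" for \<Delta> z
    by (simp add: simplified_step_def t_def F_def)
  have V3: "Cb (Suc 2) V" by (rule Cb_le[OF V]) (use N in auto)
  have t1: "t \<Delta> z (Suc 0) = (\<Sum>l\<in>UNIV. (\<Delta> $ l) *\<^sub>R U l z)" for \<Delta> z
    unfolding t_def sum_length_1 by (simp add: F_def vf_op_id U_def)
  have t2: "t \<Delta> z (Suc (Suc 0)) = (\<Sum>i\<in>UNIV. \<Sum>j\<in>UNIV. ((\<Delta> $ i) * (\<Delta> $ j) / 2) *\<^sub>R frechet_derivative (U j) (at z) (U i z))" for \<Delta> z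
  \<comment> \<open>In the list \<open>[i, j]\<close> the operator of j acts first, so the
    second-order term differentiates \<open>U j\<close> along \<open>U i\<close>.\<close>
  proof -
    have "vf_op V i (U j) z = frechet_derivative (U j) (at z) (U i z)" for i j
      using vf_op_eq[OF Cb_differentiable[OF Cb_column[OF V3, of j]], of V i z] by (simp add: U_def)
    then show ?thesis
      unfolding t_def sum_length_2 by (simp add: F_def vf_op_id U_def)
  qed
  have split: "{1..N} = insert (Suc 0) (insert (Suc (Suc 0)) {3..N})" using N by auto
  have A: "norm (simplified_step V N \<Delta> z - z - (\<Sum>l\<in>UNIV. (\<Delta> $ l) *\<^sub>R U l z)
        - (\<Sum>i\<in>UNIV. \<Sum>j\<in>UNIV. ((\<Delta> $ i) * (\<Delta> $ j) / 2) *\<^sub>R frechet_derivative (U j) (at z) (U i z))) \<le> R * \<delta> ^ 3"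
    if "\<And>l. \<bar>\<Delta> $ l\<bar> \<le> \<delta>" "\<delta> \<le> 1" for \<Delta> z \<delta>
  proof -
    have d0: "0 \<le> \<delta>" using that(1)[of undefined] by linarith
    have "simplified_step V N \<Delta> z - z - (\<Sum>l\<in>UNIV. (\<Delta> $ l) *\<^sub>R U l z)
        - (\<Sum>i\<in>UNIV. \<Sum>j\<in>UNIV. ((\<Delta> $ i) * (\<Delta> $ j) / 2) *\<^sub>R frechet_derivative (U j) (at z) (U i z)) = (\<Sum>w=3..N. t \<Delta> z w)"
      unfolding st split by (simp add: t1 t2)
    also have "norm \<dots> \<le> (\<Sum>w=3..N. \<delta> ^ 3 * (\<Sum>ls::'d list | length ls = w. c ls))"
    proof (intro order_trans[OF norm_sum] sum_mono order_trans[OF t])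
      fix w assume "w \<in> {3..N}"
      then show "\<delta> ^ w * (\<Sum>ls::'d list | length ls = w. c ls) \<le> \<delta> ^ 3 * (\<Sum>ls::'d list | length ls = w. c ls)"
        using d0 that c0 by (intro mult_right_mono power_decreasing sum_nonneg) auto
    qed (use that in auto)
    also have "\<dots> = \<delta> ^ 3 * (\<Sum>w=3..N. \<Sum>ls::'d list | length ls = w. c ls)" by (simp add: sum_distrib_left)
    also have "\<dots> \<le> \<delta> ^ 3 * R"
      unfolding R_def using d0 c0 by (intro mult_left_mono sum_mono2 sum_nonneg) auto
    finally show ?thesis by (simp add: mult.commute)
  qed
  have B: "norm (simplified_step V N \<Delta> z - z) \<le> R * \<delta> ^ N"
    if "\<And>l. \<bar>\<Delta> $ l\<bar> \<le> \<delta>" "1 \<le> \<delta>" for \<Delta> z \<delta>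
  proof -
    have "norm (simplified_step V N \<Delta> z - z) \<le> (\<Sum>w=1..N. \<delta> ^ N * (\<Sum>ls::'d list | length ls = w. c ls))"
      unfolding st
    proof (intro order_trans[OF norm_sum] sum_mono order_trans[OF t])
      fix w assume "w \<in> {1..N}"
      then show "\<delta> ^ w * (\<Sum>ls::'d list | length ls = w. c ls) \<le> \<delta> ^ N * (\<Sum>ls::'d list | length ls = w. c ls)"
        using that c0 by (intro mult_right_mono power_increasing sum_nonneg) auto
    qed (use that in auto)
    also have "\<dots> = R * \<delta> ^ N" by (simp add: R_def sum_distrib_left mult.commute)
    finally show ?thesis .
  qed
  show ?thesis using R0 A B by (intro exI[of _ R]) blast
qed

section \<open>Young solutions\<close>

text \<open>The integrals come with Hoelder exponents of their own, one pair for each coordinate and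
  unrelated to \<open>\<beta>\<close>. Raising the driver's exponent to \<open>\<beta>\<close> where
  it is smaller keeps the sum above 1, and Young-Loeve then makes the solution
  \<open>\<beta>\<close>-Hoelder, with the constant \<open>\<Lambda>\<^sub>0\<close> that starts the
  absorption.\<close>

lemma young_solution_driven:
  fixes V :: "real ^ 'm \<Rightarrow> real ^ 'd::finite ^ 'm" and x :: "real \<Rightarrow> real ^ 'd" and Y :: "real \<Rightarrow> real ^ 'm"
  defines "U \<equiv> \<lambda>l z. column l (V z)"
  assumes vf: "vector_fields U DU (real CARD('d)) L \<beta> R3" and T: "0 < T" and K: "1 \<le> K"
    and x: "\<And>l s t. 0 \<le> s \<Longrightarrow> s < t \<Longrightarrow> t \<le> T \<Longrightarrow> \<bar>x t $ l - x s $ l\<bar> \<le> K * (t - s) powr \<beta>"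
    and sol: "young_solution V y T x Y"
  shows "\<exists>\<Lambda>\<^sub>0. driven_solution U DU (real CARD('d)) L \<beta> R3 (\<lambda>l t. x t $ l) T K Y \<Lambda>\<^sub>0"
proof -
  interpret vector_fields U DU "real CARD('d)" L \<beta> R3 by (rule vf)
  interpret driven U DU "real CARD('d)" L \<beta> R3 "\<lambda>l t. x t $ l" T K
    by unfold_locales (use T K x in auto)
  have "\<forall>t. \<exists>J. t \<in> {0<..T} \<longrightarrow> (\<forall>l. has_young_integral (\<lambda>s. U l (Y s)) (\<lambda>s. x s $ l) 0 t (J l)) \<and> Y t = y + (\<Sum>l\<in>UNIV. J l)"
    using sol unfolding young_solution_def U_def by blast
  then obtain J where J: "\<And>t l. t \<in> {0<..T} \<Longrightarrow> has_young_integral (\<lambda>s. U l (Y s)) (\<lambda>s. x s $ l) 0 t (J t l)"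
    and YJ: "\<And>t. t \<in> {0<..T} \<Longrightarrow> Y t = y + (\<Sum>l\<in>UNIV. J t l)" by metis
  \<comment> \<open>Integrals are given for positive times only; time 0 gets the value 0.\<close>
  define J' where "J' t l = (if t = 0 then 0 else J t l)" for t l
  have Ydiff: "Y t - Y s = (\<Sum>l\<in>UNIV. J' t l - J' s l)" if "0 \<le> s" "s < t" "t \<le> T" for s t
  proof -
    have "Y r = y + (\<Sum>l\<in>UNIV. J' r l)" if "0 \<le> r" "r \<le> T" for r
      using YJ[of r] sol that by (cases "r = 0") (auto simp: J'_def young_solution_def)
    then show ?thesis using that by (simp add: sum_subtractf)
  qed
  have loeve: "norm (J' t l - J' s l - (x t $ l - x s $ l) *\<^sub>R U l (Y s)) \<le> sew_const (a + b) * (A * B) * (t - s) powr (a + b)"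
    if st: "0 \<le> s" "s < t" "t \<le> T" and ab: "1 < a + b" "0 \<le> a" "0 \<le> b" "0 \<le> A" "0 \<le> B"
      and f: "\<And>u v. s \<le> u \<Longrightarrow> u < v \<Longrightarrow> v \<le> t \<Longrightarrow> norm (U l (Y v) - U l (Y u)) \<le> A * (v - u) powr a"
      and g: "\<And>u v. s \<le> u \<Longrightarrow> u < v \<Longrightarrow> v \<le> t \<Longrightarrow> \<bar>x v $ l - x u $ l\<bar> \<le> B * (v - u) powr b" for s t l a b A B
  proof (rule young_loeve[where f = "\<lambda>s. U l (Y s)" and g = "\<lambda>s. x s $ l"])
    show "has_young_integral (\<lambda>s. U l (Y s)) (\<lambda>s. x s $ l) 0 t (J' t l)" using st J[of t l] by (simp add: J'_def)
    show "if s = 0 then J' s l = 0 else has_young_integral (\<lambda>s. U l (Y s)) (\<lambda>s. x s $ l) 0 s (J' s l)"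
      using st J[of s l] by (simp add: J'_def)
  qed (use that in auto)
  have sum_bound: "norm (Y t - Y s - (\<Sum>l\<in>UNIV. (x t $ l - x s $ l) *\<^sub>R U l (Y s))) \<le> (\<Sum>l\<in>UNIV. c l)"
    if "0 \<le> s" "s < t" "t \<le> T" "\<And>l. norm (J' t l - J' s l - (x t $ l - x s $ l) *\<^sub>R U l (Y s)) \<le> c l" for s t and c :: "'d \<Rightarrow> real"
    using that(1-3) by (simp add: Ydiff flip: sum_subtractf) (intro order_trans[OF norm_sum] sum_mono that(4))
  have "\<exists>a b A B. 0 \<le> a \<and> \<beta> \<le> b \<and> 1 < a + b \<and> 0 \<le> A \<and> 0 \<le> B \<and>
    (\<forall>u v. 0 \<le> u \<and> u < v \<and> v \<le> T \<longrightarrow> norm (U l (Y v) - U l (Y u)) \<le> A * (v - u) powr a \<and> \<bar>x v $ l - x u $ l\<bar> \<le> B * (v - u) powr b)" for l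
  proof -
    obtain a b where ab: "0 < a" "0 < b" "1 < a + b" "holder_on a {0..T} (\<lambda>s. U l (Y s))" "holder_on b {0..T} (\<lambda>s. x s $ l)"
      using J[of T l] T unfolding has_young_integral_def by auto
    obtain A where A: "\<And>s t. s \<in> {0..T} \<Longrightarrow> t \<in> {0..T} \<Longrightarrow> norm (U l (Y s) - U l (Y t)) \<le> A * \<bar>s - t\<bar> powr a"
      using ab(4) unfolding holder_on_def dist_norm by blast
    obtain B where B: "\<And>s t. s \<in> {0..T} \<Longrightarrow> t \<in> {0..T} \<Longrightarrow> \<bar>x s $ l - x t $ l\<bar> \<le> B * \<bar>s - t\<bar> powr b"
      using ab(5) unfolding holder_on_def dist_real_def by blast
    have A': "norm (U l (Y v) - U l (Y u)) \<le> max 0 A * (v - u) powr a" if "0 \<le> u" "u < v" "v \<le> T" for u v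
      using A[of v u] that by (auto intro: order_trans[OF _ mult_right_mono])
    show ?thesis
    proof (cases "\<beta> \<le> b")
      case True
      have B': "\<bar>x v $ l - x u $ l\<bar> \<le> max 0 B * (v - u) powr b" if "0 \<le> u" "u < v" "v \<le> T" for u v
        using B[of v u] that by (auto intro: order_trans[OF _ mult_right_mono])
      show ?thesis using A' B' ab True by (intro exI[of _ a] exI[of _ b] exI[of _ "max 0 A"] exI[of _ "max 0 B"]) auto
    next
      case False
      then show ?thesis using A' x ab K by (intro exI[of _ a] exI[of _ \<beta>] exI[of _ "max 0 A"] exI[of _ K]) auto
    qed
  qed
  then obtain a b A B where ab: "\<And>l. 0 \<le> a l" "\<And>l. \<beta> \<le> b l" "\<And>l. 1 < a l + b l" "\<And>l. 0 \<le> A l" "\<And>l::'d. 0 \<le> B l"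
    and AB: "\<And>l u v. 0 \<le> u \<and> u < v \<and> v \<le> T \<Longrightarrow> norm (U l (Y v) - U l (Y u)) \<le> A l * (v - u) powr a l \<and> \<bar>x v $ l - x u $ l\<bar> \<le> B l * (v - u) powr b l"
    by metis
  \<comment> \<open>Since a l + b l > 1 >= \<beta>, the power of the length in excess of \<beta> is
    bounded by a power of T.\<close>
  define c where "c l = sew_const (a l + b l) * (A l * B l) * T powr (a l + b l - \<beta>)" for l
  define \<Lambda>\<^sub>0 where "\<Lambda>\<^sub>0 = (\<Sum>l\<in>UNIV. c l) + real CARD('d) * L * K"
  have c0: "0 \<le> c l" for l
    using ab sew_const(1)[OF ab(3), of l] by (simp add: c_def)
  have first: "norm (Y t - Y s) \<le> \<Lambda>\<^sub>0 * (t - s) powr \<beta>" if st: "0 \<le> s" "s < t" "t \<le> T" for s t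
  proof -
    have le: "norm (J' t l - J' s l - (x t $ l - x s $ l) *\<^sub>R U l (Y s)) \<le> c l * (t - s) powr \<beta>" for l
    proof -
      have "norm (J' t l - J' s l - (x t $ l - x s $ l) *\<^sub>R U l (Y s)) \<le> sew_const (a l + b l) * (A l * B l) * (t - s) powr (a l + b l)"
        by (rule loeve) (use st ab AB beta in \<open>auto intro: order_trans[of 0 \<beta>]\<close>)
      also have "(t - s) powr (a l + b l) = (t - s) powr (a l + b l - \<beta>) * (t - s) powr \<beta>"
        by (simp flip: powr_add)
      also have "sew_const (a l + b l) * (A l * B l) * ((t - s) powr (a l + b l - \<beta>) * (t - s) powr \<beta>)
         \<le> sew_const (a l + b l) * (A l * B l) * (T powr (a l + b l - \<beta>) * (t - s) powr \<beta>)"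
        using st ab(3)[of l] ab(4)[of l] ab(5)[of l] beta sew_const(1)[OF ab(3), of l] by (intro mult_left_mono mult_right_mono powr_mono2) auto
      finally show ?thesis by (simp add: c_def)
    qed
    have "norm (\<Sum>l\<in>UNIV. (x t $ l - x s $ l) *\<^sub>R U l (Y s)) \<le> (\<Sum>l\<in>(UNIV::'d set). (K * (t - s) powr \<beta>) * L)"
      unfolding norm_scaleR using K x[OF st]
      by (intro order_trans[OF norm_sum] sum_mono) (auto intro!: mult_mono U_bound)
    from norm_le_of_diff[OF sum_bound[OF st le] this] show ?thesis
      by (simp add: \<Lambda>\<^sub>0_def algebra_simps sum_distrib_left sum_distrib_right)
  qed
  have "driven_solution U DU (real CARD('d)) L \<beta> R3 (\<lambda>l t. x t $ l) T K Y \<Lambda>\<^sub>0"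
  proof unfold_locales
    show "0 \<le> \<Lambda>\<^sub>0" unfolding \<Lambda>\<^sub>0_def using c0 L K by (auto intro!: add_nonneg_nonneg sum_nonneg)
  next
    fix s t \<Lambda> :: real assume st: "0 \<le> s" "s < t" "t \<le> T" and \<Lambda>: "0 \<le> \<Lambda>"
      and h: "\<And>u v. s \<le> u \<Longrightarrow> u < v \<Longrightarrow> v \<le> t \<Longrightarrow> norm (Y v - Y u) \<le> \<Lambda> * (v - u) powr \<beta>"
    have "norm (J' t l - J' s l - (x t $ l - x s $ l) *\<^sub>R U l (Y s)) \<le> sew_const (\<beta> + \<beta>) * ((L * \<Lambda>) * K) * (t - s) powr (\<beta> + \<beta>)" for l
    proof (rule loeve[OF st])
      fix u v assume uv: "s \<le> u" "u < v" "v \<le> t"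
      show "norm (U l (Y v) - U l (Y u)) \<le> L * \<Lambda> * (v - u) powr \<beta>"
        using mult_left_mono[OF h[OF uv], of L] L by (intro order_trans[OF U_lip]) auto
    qed (use st \<Lambda> beta L K x in auto)
    then have "norm (J' t l - J' s l - (x t $ l - x s $ l) *\<^sub>R U l (Y s)) \<le> \<sigma> * (L * \<Lambda> * K) * (t - s) powr (2 * \<beta>)" for l
      by simp
    from sum_bound[OF st this]
    show "norm (Y t - Y s - (\<Sum>l\<in>UNIV. (x t $ l - x s $ l) *\<^sub>R U l (Y s)))
       \<le> real CARD('d) * (\<sigma> * (L * \<Lambda> * K)) * (t - s) powr (2 * \<beta>)"
      by simp
  qed (use first in auto)
  then show ?thesis by blast
qed


section \<open>Dyadic chaining\<close>

text \<open>The sum of 2^(- k \<beta>) over k >= 1, the cost of a chain through all finer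
  levels.\<close>

definition chain_const :: "real \<Rightarrow> real" where
  "chain_const \<beta> = 1 / (2 powr \<beta> - 1)"

lemma chain_const:
  assumes "0 < \<beta>" "\<beta> \<le> 1"
  shows "1 \<le> chain_const \<beta>" "chain_const \<beta> * 2 powr \<beta> = chain_const \<beta> + 1"
proof -
  have "2 powr 0 < 2 powr \<beta>" "2 powr \<beta> \<le> 2 powr 1" using assms by (intro powr_less_mono powr_mono; simp)+
  then have "0 < 2 powr \<beta> - 1" "2 powr \<beta> - 1 \<le> 1" by auto
  then show "1 \<le> chain_const \<beta>" "chain_const \<beta> * 2 powr \<beta> = chain_const \<beta> + 1"
    by (auto simp: chain_const_def divide_simps)
qed

context
  fixes s :: "nat \<Rightarrow> 'a::real_normed_vector" and \<beta> B :: real and n :: nat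
  assumes beta: "0 < \<beta>" "\<beta> \<le> 1" and B: "0 \<le> B"
    and block: "\<And>\<rho> j. (j + 1) * 2 ^ \<rho> \<le> n \<Longrightarrow> norm (s ((j + 1) * 2 ^ \<rho>) - s (j * 2 ^ \<rho>)) \<le> B * (2 ^ \<rho>) powr \<beta>"
begin

lemma chain_step:
  "B * (2 ^ r) powr \<beta> + B * chain_const \<beta> * (2 ^ r) powr \<beta> = B * chain_const \<beta> * (2 ^ Suc r) powr \<beta>"
proof -
  have "B * (2 ^ r) powr \<beta> + B * chain_const \<beta> * (2 ^ r) powr \<beta> = B * (chain_const \<beta> + 1) * (2 ^ r) powr \<beta>"
    by (simp add: algebra_simps)
  also have "\<dots> = B * (chain_const \<beta> * 2 powr \<beta>) * (2 ^ r) powr \<beta>" by (simp only: chain_const(2)[OF beta])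
  finally show ?thesis by (simp add: powr_mult)
qed

lemma chain_0: "B \<le> B * chain_const \<beta>" "0 \<le> B * chain_const \<beta>"
proof -
  show "B \<le> B * chain_const \<beta>" using chain_const(1)[OF beta] B mult_left_mono[of 1 "chain_const \<beta>" B] by simp
  then show "0 \<le> B * chain_const \<beta>" using B by linarith
qed

lemma chain_Suc:
  assumes "x \<le> B * chain_const \<beta> * (2 ^ r) powr \<beta>" shows "x \<le> B * chain_const \<beta> * (2 ^ Suc r) powr \<beta>"
proof -
  have "0 \<le> B * (2 ^ r) powr \<beta>" using B by simp
  then show ?thesis using assms chain_step[of r] by linarith
qed

text \<open>A point of a block lies in one of its halves, and passing to that half costs at most one
  block of the finer level. All blocks on the way end at or before b, so a block that extends beyond
  n does no harm.\<close>

lemma chain_right: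
  "j * 2 ^ r \<le> b \<Longrightarrow> b \<le> (j + 1) * 2 ^ r \<Longrightarrow> b \<le> n \<Longrightarrow>
    norm (s b - s (j * 2 ^ r)) \<le> B * chain_const \<beta> * (2 ^ r) powr \<beta>"
proof (induction r arbitrary: j b)
  case 0
  then have "b = j \<or> b = Suc j" by auto
  then show ?case using block[of j 0] 0 chain_0 by auto
next
  case (Suc r)
  show ?case
  proof (cases "b \<le> (2 * j + 1) * 2 ^ r")
    case True
    have "norm (s b - s (2 * j * 2 ^ r)) \<le> B * chain_const \<beta> * (2 ^ r) powr \<beta>"
      using Suc.IH[of "2 * j" b] Suc.prems True by simp
    then have "norm (s b - s (2 * j * 2 ^ r)) \<le> B * chain_const \<beta> * (2 ^ Suc r) powr \<beta>" by (rule chain_Suc)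
    then show ?thesis by (simp add: mult_ac)
  next
    case False
    have 1: "norm (s b - s ((2 * j + 1) * 2 ^ r)) \<le> B * chain_const \<beta> * (2 ^ r) powr \<beta>"
      using Suc.IH[of "2 * j + 1" b] Suc.prems False by (simp add: algebra_simps)
    have 2: "norm (s ((2 * j + 1) * 2 ^ r) - s (2 * j * 2 ^ r)) \<le> B * (2 ^ r) powr \<beta>"
      using Suc.prems False by (intro block) auto
    have "norm (s b - s (2 * j * 2 ^ r)) \<le> B * chain_const \<beta> * (2 ^ Suc r) powr \<beta>"
      using norm_triangle_mono[OF 2 1] unfolding chain_step by simp
    then show ?thesis by (simp add: mult_ac)
  qed
qed

lemma chain_left:
  "j * 2 ^ r \<le> a \<Longrightarrow> a \<le> (j + 1) * 2 ^ r \<Longrightarrow> (j + 1) * 2 ^ r \<le> n \<Longrightarrow>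
    norm (s ((j + 1) * 2 ^ r) - s a) \<le> B * chain_const \<beta> * (2 ^ r) powr \<beta>"
proof (induction r arbitrary: j a)
  case 0
  then have "a = j \<or> a = Suc j" by auto
  then show ?case using block[of j 0] 0 chain_0 by auto
next
  case (Suc r)
  have le: "(2 * j + 2) * 2 ^ r = (j + 1) * 2 ^ Suc r" by simp
  show ?case
  proof (cases "(2 * j + 1) * 2 ^ r \<le> a")
    case True
    have "norm (s ((2 * j + 2) * 2 ^ r) - s a) \<le> B * chain_const \<beta> * (2 ^ r) powr \<beta>"
      using Suc.IH[of "2 * j + 1" a] Suc.prems True by (simp add: algebra_simps)
    then have "norm (s ((2 * j + 2) * 2 ^ r) - s a) \<le> B * chain_const \<beta> * (2 ^ Suc r) powr \<beta>" by (rule chain_Suc)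
    then show ?thesis unfolding le .
  next
    case False
    have m: "(2 * j + 1) * 2 ^ r \<le> (2 * j + 2) * 2 ^ r" by (intro mult_right_mono) auto
    have 1: "norm (s ((2 * j + 1) * 2 ^ r) - s a) \<le> B * chain_const \<beta> * (2 ^ r) powr \<beta>"
      using Suc.IH[of "2 * j" a] Suc.prems False m by (simp add: algebra_simps)
    have 2: "norm (s ((2 * j + 2) * 2 ^ r) - s ((2 * j + 1) * 2 ^ r)) \<le> B * (2 ^ r) powr \<beta>"
      using block[of "2 * j + 1" r] Suc.prems(3) by (simp add: algebra_simps)
    have "norm (s ((2 * j + 2) * 2 ^ r) - s a) \<le> B * chain_const \<beta> * (2 ^ Suc r) powr \<beta>"
      using norm_triangle_mono[OF 2 1] unfolding chain_step by simp
    then show ?thesis unfolding le .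
  qed
qed

lemma dyadic_chaining:
  assumes ab: "a < b" "b \<le> n"
  shows "norm (s b - s a) \<le> 3 * B * chain_const \<beta> * real (b - a) powr \<beta>"
proof -
  have "\<exists>r. 2 ^ r \<le> b - a \<and> b - a < 2 ^ (r + 1)"
    using ab by (intro ex_power_ivl1) auto
  then obtain r where r: "2 ^ r \<le> b - a" "b - a < 2 ^ (r + 1)" by blast
  \<comment> \<open>\<open>j * 2 ^ r\<close> is the first multiple of 2^r at or after a. Since b < a
    + 2 * 2^r, the run consists of a left rest, at most one whole block and a right rest, whence the
    factor 3.\<close>
  define j where "j = (a + 2 ^ r - 1) div 2 ^ r"
  have p: "(0::nat) < 2 ^ r" by simp
  have j: "a \<le> j * 2 ^ r" "j * 2 ^ r < a + 2 ^ r"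
  proof -
    have "j * 2 ^ r \<le> a + 2 ^ r - 1" unfolding j_def by (rule div_times_less_eq_dividend)
    then show "j * 2 ^ r < a + 2 ^ r" using p by linarith
    have "a + 2 ^ r - 1 < (j + 1) * 2 ^ r" unfolding j_def
      using dividend_less_div_times[OF p, of "a + 2 ^ r - 1"] by (simp add: algebra_simps)
    then show "a \<le> j * 2 ^ r" by simp
  qed
  let ?C = "B * chain_const \<beta> * (2 ^ r) powr \<beta>"
  have C0: "0 \<le> ?C" using chain_0 by simp
  have 1: "norm (s (j * 2 ^ r) - s a) \<le> ?C"
  proof (cases "a = j * 2 ^ r")
    case False
    then have "0 < j" using j by (auto intro: Nat.gr0I)
    then obtain i where i: "j = i + 1" by (metis Suc_eq_plus1 gr0_implies_Suc)
    show ?thesis unfolding i by (rule chain_left) (use i j r ab in auto)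
  qed (use C0 in simp)
  have 2: "norm (s b - s (j * 2 ^ r)) \<le> ?C + ?C"
  proof (cases "b \<le> (j + 1) * 2 ^ r")
    case True
    have "norm (s b - s (j * 2 ^ r)) \<le> ?C" by (rule chain_right) (use True j r ab in auto)
    then show ?thesis using C0 by linarith
  next
    case False
    have "norm (s b - s ((j + 1) * 2 ^ r)) \<le> ?C"
      by (rule chain_right) (use False j r ab in \<open>auto simp: algebra_simps\<close>)
    moreover have "norm (s ((j + 1) * 2 ^ r) - s (j * 2 ^ r)) \<le> ?C"
      using block[of j r] False ab chain_0(1) by (auto intro: order_trans[OF _ mult_right_mono])
    ultimately show ?thesis using norm_triangle_mono by fastforce
  qed
  have "norm (s b - s a) \<le> 3 * ?C"
    using norm_triangle_mono[OF 2 1] by simp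
  also have "\<dots> \<le> 3 * (B * chain_const \<beta> * real (b - a) powr \<beta>)"
  proof (intro mult_left_mono powr_mono2)
    show "2 ^ r \<le> real (b - a)" using r(1) by (metis of_nat_le_iff of_nat_numeral of_nat_power)
  qed (use beta chain_0 in auto)
  finally show ?thesis by simp
qed

end

section \<open>Hoelder bounds from dyadic increments\<close>

lemma dyadic_floor_tendsto:
  fixes u :: real
  assumes "0 \<le> u"
  shows "(\<lambda>R. real (nat \<lfloor>u * 2 ^ R\<rfloor>) / 2 ^ R) \<longlonglongrightarrow> u"
proof (rule tendsto_sandwich)
  show "(\<lambda>R. u - (1/2) ^ R) \<longlonglongrightarrow> u"
    by (rule tendsto_eq_intros LIMSEQ_power_zero | simp)+
  show "\<forall>\<^sub>F R in sequentially. u - (1/2) ^ R \<le> real (nat \<lfloor>u * 2 ^ R\<rfloor>) / 2 ^ R"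
  proof (rule always_eventually, rule allI)
    fix R
    have "u * 2 ^ R - 1 \<le> real (nat \<lfloor>u * 2 ^ R\<rfloor>)" using assms by linarith
    then have "(u * 2 ^ R - 1) / 2 ^ R \<le> real (nat \<lfloor>u * 2 ^ R\<rfloor>) / 2 ^ R" by (intro divide_right_mono) auto
    then show "u - (1/2) ^ R \<le> real (nat \<lfloor>u * 2 ^ R\<rfloor>) / 2 ^ R" by (simp add: diff_divide_distrib power_divide)
  qed
  show "\<forall>\<^sub>F R in sequentially. real (nat \<lfloor>u * 2 ^ R\<rfloor>) / 2 ^ R \<le> u"
  proof (rule always_eventually, rule allI)
    fix R
    have "real (nat \<lfloor>u * 2 ^ R\<rfloor>) \<le> u * 2 ^ R" using assms by simp
    then show "real (nat \<lfloor>u * 2 ^ R\<rfloor>) / 2 ^ R \<le> u" by (simp add: divide_le_eq)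
  qed
qed simp

text \<open>Chaining on each dyadic grid gives a constant that does not depend on the grid;
  continuity carries the bound to all points, approximated by dyadic ones from below.\<close>

lemma dyadic_path_holder:
  fixes f :: "real \<Rightarrow> 'a::real_normed_vector"
  assumes beta: "0 < \<beta>" "\<beta> \<le> 1" and "0 < h" and \<kappa>: "0 \<le> \<kappa>"
    and cont: "continuous_on {s..s + h} f"
    and incr: "\<And>r j. j < 2 ^ r \<Longrightarrow> norm (f (s + real (Suc j) * (h / 2 ^ r)) - f (s + real j * (h / 2 ^ r))) \<le> \<kappa> * (1 / 2 ^ r) powr \<beta>"
    and uv: "s \<le> u" "u < v" "v \<le> s + h"
  shows "norm (f v - f u) \<le> 3 * \<kappa> * chain_const \<beta> * ((v - u) / h) powr \<beta>"
proof -
  define p where "p w R = nat \<lfloor>((w - s) / h) * 2 ^ R\<rfloor>" for w and R :: nat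
  have conv: "(\<lambda>R. real (p w R) / 2 ^ R) \<longlonglongrightarrow> (w - s) / h" if "s \<le> w" for w
    unfolding p_def using that \<open>0 < h\<close> by (intro dyadic_floor_tendsto) auto
  have p_le: "p w R \<le> 2 ^ R" if "w \<le> s + h" for w R
  proof -
    have "(w - s) / h * 2 ^ R \<le> 1 * 2 ^ R" using that \<open>0 < h\<close> by (intro mult_right_mono) auto
    then have "\<lfloor>(w - s) / h * 2 ^ R\<rfloor> \<le> 2 ^ R" by (simp add: floor_le_iff)
    then show ?thesis unfolding p_def by (simp add: nat_le_iff)
  qed
  have fconv: "(\<lambda>R. f (s + real (p w R) * (h / 2 ^ R))) \<longlonglongrightarrow> f w" if w: "s \<le> w" "w \<le> s + h" for w
  proof (rule continuous_on_tendsto_compose[OF cont])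
    have "(\<lambda>R. s + (real (p w R) / 2 ^ R) * h) \<longlonglongrightarrow> s + ((w - s) / h) * h"
      by (intro tendsto_intros conv w)
    then show "(\<lambda>R. s + real (p w R) * (h / 2 ^ R)) \<longlonglongrightarrow> w" using \<open>0 < h\<close> by simp
    show "w \<in> {s..s + h}" using w by simp
    have "s + real (p w R) * (h / 2 ^ R) \<le> s + h" for R
    proof -
      have "real (p w R) \<le> 2 ^ R" using p_le[OF w(2), of R] by (metis of_nat_le_iff of_nat_numeral of_nat_power)
      then have "real (p w R) * (h / 2 ^ R) \<le> 2 ^ R * (h / 2 ^ R)" using \<open>0 < h\<close> by (intro mult_right_mono) auto
      then show ?thesis by simp
    qed
    then show "\<forall>\<^sub>F R in sequentially. s + real (p w R) * (h / 2 ^ R) \<in> {s..s + h}"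
      using \<open>0 < h\<close> by (intro always_eventually allI) auto
  qed
  have bound: "norm (f (s + real b * (h / 2 ^ R)) - f (s + real a * (h / 2 ^ R))) \<le> 3 * \<kappa> * chain_const \<beta> * ((real b - real a) / 2 ^ R) powr \<beta>"
    if "a < b" "b \<le> 2 ^ R" for a b R
  proof -
    have "norm (f (s + real b * (h / 2 ^ R)) - f (s + real a * (h / 2 ^ R)))
       \<le> 3 * (\<kappa> * (1 / 2 ^ R) powr \<beta>) * chain_const \<beta> * real (b - a) powr \<beta>"
    proof (rule dyadic_chaining[where s = "\<lambda>j. f (s + real j * (h / 2 ^ R))" and n = "2 ^ R"])
      fix \<rho> j :: nat assume j: "(j + 1) * 2 ^ \<rho> \<le> 2 ^ R"
      have "1 * 2 ^ \<rho> \<le> (j + 1) * 2 ^ \<rho>" by (intro mult_right_mono) auto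
      then have "(2::nat) ^ \<rho> \<le> 2 ^ R" using j by linarith
      then have \<rho>: "\<rho> \<le> R" by simp
      have R: "(2::nat) ^ R = 2 ^ (R - \<rho>) * 2 ^ \<rho>" "(2::real) ^ R = 2 ^ (R - \<rho>) * 2 ^ \<rho>" using \<rho> by (simp_all flip: power_add)
      have "j + 1 \<le> 2 ^ (R - \<rho>)" using j unfolding R(1) by (simp only: mult_le_cancel2) simp
      then have "norm (f (s + real (Suc j) * (h / 2 ^ (R - \<rho>))) - f (s + real j * (h / 2 ^ (R - \<rho>)))) \<le> \<kappa> * (1 / 2 ^ (R - \<rho>)) powr \<beta>"
        by (intro incr) auto
      moreover have "real (i * 2 ^ \<rho>) * (h / 2 ^ R) = real i * (h / 2 ^ (R - \<rho>))" for i
        unfolding R(2) by simp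
      moreover have "(1 / 2 ^ (R - \<rho>)) powr \<beta> = (1 / 2 ^ R) powr \<beta> * (2 ^ \<rho>) powr \<beta>"
        unfolding R(2) by (simp flip: powr_mult)
      ultimately show "norm (f (s + real ((j + 1) * 2 ^ \<rho>) * (h / 2 ^ R)) - f (s + real (j * 2 ^ \<rho>) * (h / 2 ^ R)))
          \<le> \<kappa> * (1 / 2 ^ R) powr \<beta> * (2 ^ \<rho>) powr \<beta>"
        by (simp only: Suc_eq_plus1 mult.assoc)
    qed (use beta \<kappa> that in auto)
    also have "\<dots> = 3 * \<kappa> * chain_const \<beta> * ((real b - real a) / 2 ^ R) powr \<beta>"
      using that by (simp add: powr_divide of_nat_diff)
    finally show ?thesis .
  qed
  have le: "norm (f (s + real (p v R) * (h / 2 ^ R)) - f (s + real (p u R) * (h / 2 ^ R)))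
     \<le> 3 * \<kappa> * chain_const \<beta> * \<bar>real (p v R) / 2 ^ R - real (p u R) / 2 ^ R\<bar> powr \<beta>" for R
  proof -
    have "p u R \<le> p v R" unfolding p_def using uv \<open>0 < h\<close>
      by (intro nat_mono floor_mono mult_right_mono divide_right_mono) auto
    then show ?thesis
      using bound[of "p u R" "p v R" R] p_le[OF uv(3), of R]
      by (cases "p u R = p v R") (auto simp: diff_divide_distrib[symmetric])
  qed
  have lim: "(\<lambda>R. 3 * \<kappa> * chain_const \<beta> * \<bar>real (p v R) / 2 ^ R - real (p u R) / 2 ^ R\<bar> powr \<beta>)
     \<longlonglongrightarrow> 3 * \<kappa> * chain_const \<beta> * \<bar>(v - s) / h - (u - s) / h\<bar> powr \<beta>"
    using uv \<open>0 < h\<close> by (intro tendsto_intros conv) auto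
  have "(\<lambda>R. norm (f (s + real (p v R) * (h / 2 ^ R)) - f (s + real (p u R) * (h / 2 ^ R)))) \<longlonglongrightarrow> norm (f v - f u)"
    using uv by (intro tendsto_norm tendsto_diff fconv) auto
  then have "norm (f v - f u) \<le> 3 * \<kappa> * chain_const \<beta> * \<bar>(v - s) / h - (u - s) / h\<bar> powr \<beta>"
    by (rule LIMSEQ_le[OF _ lim]) (use le in blast)
  also have "\<bar>(v - s) / h - (u - s) / h\<bar> = (v - u) / h"
    using uv \<open>0 < h\<close> by (simp add: diff_divide_distrib[symmetric])
  finally show ?thesis .
qed


section \<open>Moments of fractional Brownian increments\<close>

text \<open>The moment of order 2 q of a standard normal variable, that is, the double factorial (2
  q - 1)!!.\<close>

definition gauss_moment :: "nat \<Rightarrow> real" where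
  "gauss_moment q = fact (2 * q) / (2 ^ q * fact q)"

lemma gauss_moment_pos: "0 < gauss_moment q" by (simp add: gauss_moment_def)

lemma gauss_moment_simps [simp]: "gauss_moment 0 = 1" "gauss_moment (Suc 0) = 1"
  by (simp_all add: gauss_moment_def fact_numeral)

lemma gauss_moment_Suc: "gauss_moment (Suc q) = (2 * real q + 1) * gauss_moment q"
proof -
  have "gauss_moment (Suc q) = (2 * (real q + 1) * ((2 * real q + 1) * fact (2 * q))) / (2 * (real q + 1) * (2 ^ q * fact q))"
    by (simp add: gauss_moment_def algebra_simps)
  also have "\<dots> = ((2 * real q + 1) * fact (2 * q)) / (2 ^ q * fact q)"
    by (rule mult_divide_mult_cancel_left) simp
  finally show ?thesis by (simp add: gauss_moment_def)
qed

lemma gauss_moment_le: "gauss_moment q \<le> (2 * real q) ^ q"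
proof (induction q)
  case (Suc q)
  have "gauss_moment (Suc q) \<le> (2 * real (Suc q)) * (2 * real q) ^ q"
    unfolding gauss_moment_Suc using Suc by (intro mult_mono) (auto simp: gauss_moment_pos less_imp_le)
  also have "\<dots> \<le> (2 * real (Suc q)) * (2 * real (Suc q)) ^ q"
    by (intro mult_left_mono power_mono) auto
  finally show ?case by simp
qed simp

text \<open>Keeps the factorial that cancels the one in the exponential series;
  \<open>gauss_moment_le\<close> is the form for moments whose order grows with n.\<close>

lemma gauss_moment_le_fact: "gauss_moment q \<le> 2 ^ q * fact q"
proof (induction q)
  case (Suc q)
  have "gauss_moment (Suc q) \<le> (2 * (real q + 1)) * (2 ^ q * fact q)"
    unfolding gauss_moment_Suc using Suc by (intro mult_mono) (auto simp: gauss_moment_pos less_imp_le)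
  then show ?case by (simp add: algebra_simps)
qed simp

lemma (in prob_space) gaussian_moment:
  assumes Z: "gaussian_rv M Z" and mean: "(\<integral>\<omega>. Z \<omega> \<partial>M) = 0"
  shows "integrable M (\<lambda>\<omega>. Z \<omega> ^ (2 * q))"
    and "(\<integral>\<omega>. Z \<omega> ^ (2 * q) \<partial>M) = gauss_moment q * (\<integral>\<omega>. (Z \<omega>)\<^sup>2 \<partial>M) ^ q"
proof -
  have [measurable]: "Z \<in> borel_measurable M" using Z by (simp add: gaussian_rv_def)
  from Z consider (const) \<mu> where "AE \<omega> in M. Z \<omega> = \<mu>"
    | (dens) \<mu> \<sigma> where "\<sigma> > 0" "distributed M lborel Z (normal_density \<mu> \<sigma>)"
    unfolding gaussian_rv_def by blast
  then have "integrable M (\<lambda>\<omega>. Z \<omega> ^ (2 * q)) \<and>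
    (\<integral>\<omega>. Z \<omega> ^ (2 * q) \<partial>M) = gauss_moment q * (\<integral>\<omega>. (Z \<omega>)\<^sup>2 \<partial>M) ^ q"
  proof cases
    case const
    have "(\<integral>\<omega>. Z \<omega> \<partial>M) = (\<integral>\<omega>. \<mu> \<partial>M)" using const by (intro integral_cong_AE) auto
    \<comment> \<open>A centred point mass sits at 0; for q = 0 both sides are 1 because 0^0 =
      1.\<close>
    then have "\<mu> = 0" using mean by (simp add: prob_space)
    then have ae: "AE \<omega> in M. Z \<omega> ^ k = 0 ^ k" for k using const by auto
    have "integrable M (\<lambda>\<omega>. Z \<omega> ^ (2 * q)) \<longleftrightarrow> integrable M (\<lambda>\<omega>. 0 ^ (2 * q) :: real)"
      using ae by (intro integrable_cong_AE) auto
    moreover have "(\<integral>\<omega>. Z \<omega> ^ k \<partial>M) = (\<integral>\<omega>. 0 ^ k \<partial>M)" for k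
      using ae by (intro integral_cong_AE) auto
    ultimately show ?thesis by (cases "q = 0") (simp_all add: prob_space power_0_left)
  next
    case dens
    have "(\<integral>\<omega>. Z \<omega> \<partial>M) = (\<integral>x. normal_density \<mu> \<sigma> x * x \<partial>lborel)"
      by (rule distributed_integral[OF dens(2), symmetric]) auto
    then have "(\<integral>\<omega>. Z \<omega> \<partial>M) = \<mu>" by (simp only: integral_normal_moment_nz_1[OF dens(1)])
    then have \<mu>: "\<mu> = 0" using mean by simp
    have I: "(\<integral>\<omega>. Z \<omega> ^ (2 * k) \<partial>M) = gauss_moment k * \<sigma>\<^sup>2 ^ k" for k
    proof -
      have "(\<integral>\<omega>. Z \<omega> ^ (2 * k) \<partial>M) = (\<integral>x. normal_density \<mu> \<sigma> x * x ^ (2 * k) \<partial>lborel)"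
        by (rule distributed_integral[OF dens(2), symmetric]) auto
      also have "\<dots> = fact (2 * k) / ((2 / \<sigma>\<^sup>2) ^ k * fact k)"
        using integral_normal_moment_even[OF dens(1), of 0 k] unfolding \<mu> by simp
      finally show ?thesis using dens(1) by (simp add: gauss_moment_def power_divide)
    qed
    have "integrable M (\<lambda>\<omega>. Z \<omega> ^ (2 * q))"
    proof (rule distributed_integrable[OF dens(2), THEN iffD1])
      show "integrable lborel (\<lambda>x. normal_density \<mu> \<sigma> x * x ^ (2 * q))"
        using integrable_normal_moment[OF dens(1), of 0 "2 * q"] unfolding \<mu> by simp
    qed auto
    moreover have "(\<integral>\<omega>. (Z \<omega>)\<^sup>2 \<partial>M) = \<sigma>\<^sup>2" using I[of 1] by simp
    ultimately show ?thesis using I[of q] by simp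
  qed
  then show "integrable M (\<lambda>\<omega>. Z \<omega> ^ (2 * q))"
    "(\<integral>\<omega>. Z \<omega> ^ (2 * q) \<partial>M) = gauss_moment q * (\<integral>\<omega>. (Z \<omega>)\<^sup>2 \<partial>M) ^ q" by auto
qed

text \<open>Jensen's inequality for weights that need not sum to 1. The induction step is
  Chebyshev's sum inequality: symmetrised in c and d, it reduces to (x d - x c) * (x d ^ Suc q - x c
  ^ Suc q) >= 0.\<close>

lemma sum_power_jensen:
  fixes \<rho> x :: "'i \<Rightarrow> real"
  assumes "finite J" "\<And>c. c \<in> J \<Longrightarrow> 0 \<le> \<rho> c" "\<And>c. c \<in> J \<Longrightarrow> 0 \<le> x c"
  shows "(\<Sum>c\<in>J. \<rho> c * x c) ^ Suc q \<le> (\<Sum>c\<in>J. \<rho> c) ^ q * (\<Sum>c\<in>J. \<rho> c * x c ^ Suc q)"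
proof (induction q)
  case (Suc q)
  let ?S = "\<Sum>c\<in>J. \<rho> c"
  have S: "0 \<le> ?S" using assms by (intro sum_nonneg) auto
  have "(\<Sum>c\<in>J. \<rho> c * x c) ^ Suc (Suc q) = (\<Sum>c\<in>J. \<rho> c * x c) * (\<Sum>c\<in>J. \<rho> c * x c) ^ Suc q" by simp
  also have "\<dots> \<le> (\<Sum>c\<in>J. \<rho> c * x c) * (?S ^ q * (\<Sum>c\<in>J. \<rho> c * x c ^ Suc q))"
    using assms Suc by (intro mult_left_mono sum_nonneg) auto
  also have "\<dots> = ?S ^ q * ((\<Sum>c\<in>J. \<rho> c * x c) * (\<Sum>c\<in>J. \<rho> c * x c ^ Suc q))" by simp
  also have "\<dots> \<le> ?S ^ q * (?S * (\<Sum>c\<in>J. \<rho> c * x c ^ Suc (Suc q)))"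
  proof (intro mult_left_mono)
    let ?f = "\<lambda>c d. \<rho> c * \<rho> d * (x c * x d ^ Suc q)"
    let ?g = "\<lambda>c d. \<rho> c * \<rho> d * (x d ^ Suc (Suc q))"
    have "(\<Sum>c\<in>J. \<rho> c * x c) * (\<Sum>c\<in>J. \<rho> c * x c ^ Suc q) = (\<Sum>c\<in>J. \<Sum>d\<in>J. ?f c d)"
      unfolding sum_product by (intro sum.cong refl) simp
    moreover have "?S * (\<Sum>c\<in>J. \<rho> c * x c ^ Suc (Suc q)) = (\<Sum>c\<in>J. \<Sum>d\<in>J. ?g c d)"
      unfolding sum_product by (intro sum.cong refl) simp
    moreover have "(\<Sum>c\<in>J. \<Sum>d\<in>J. ?f c d) + (\<Sum>c\<in>J. \<Sum>d\<in>J. ?f d c) \<le> (\<Sum>c\<in>J. \<Sum>d\<in>J. ?g c d) + (\<Sum>c\<in>J. \<Sum>d\<in>J. ?g d c)"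
      unfolding sum.distrib[symmetric]
    proof (intro sum_mono)
      fix c d assume cd: "c \<in> J" "d \<in> J"
      have "0 \<le> (x d - x c) * (x d ^ Suc q - x c ^ Suc q)"
      proof (cases "x c \<le> x d")
        case True
        then show ?thesis using assms(3) cd by (intro mult_nonneg_nonneg) (auto intro: power_mono simp del: power_Suc)
      next
        case False
        then show ?thesis using assms(3) cd by (intro mult_nonpos_nonpos) (auto intro: power_mono simp del: power_Suc)
      qed
      then have "x c * x d ^ Suc q + x d * x c ^ Suc q \<le> x d ^ Suc (Suc q) + x c ^ Suc (Suc q)"
        by (simp add: algebra_simps)
      then have "\<rho> c * \<rho> d * (x c * x d ^ Suc q + x d * x c ^ Suc q) \<le> \<rho> c * \<rho> d * (x d ^ Suc (Suc q) + x c ^ Suc (Suc q))"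
        using assms(2) cd by (intro mult_left_mono) auto
      then show "?f c d + ?f d c \<le> ?g c d + ?g d c" by (simp add: algebra_simps)
    qed
    moreover have "(\<Sum>c\<in>J. \<Sum>d\<in>J. ?f d c) = (\<Sum>c\<in>J. \<Sum>d\<in>J. ?f c d)" by (rule sum.swap)
    moreover have "(\<Sum>c\<in>J. \<Sum>d\<in>J. ?g d c) = (\<Sum>c\<in>J. \<Sum>d\<in>J. ?g c d)" by (rule sum.swap)
    ultimately show "(\<Sum>c\<in>J. \<rho> c * x c) * (\<Sum>c\<in>J. \<rho> c * x c ^ Suc q) \<le> ?S * (\<Sum>c\<in>J. \<rho> c * x c ^ Suc (Suc q))"
      by linarith
  qed (use S in auto)
  finally show ?case by (simp add: mult_ac)
qed simp

section \<open>Increments of fractional Brownian motion\<close>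

locale fbm = prob_space M for M :: "'w measure" +
  fixes H T :: real and B :: "real \<Rightarrow> 'w \<Rightarrow> real"
  assumes fbm: "fractional_brownian_motion M H T B" and H: "1 / 2 < H" "H < 1"
begin

lemma B_gaussian_process: "gaussian_process M {0..T} B"
  and B_mean: "t \<in> {0..T} \<Longrightarrow> (\<integral>\<omega>. B t \<omega> \<partial>M) = 0"
  and B_cov: "s \<in> {0..T} \<Longrightarrow> t \<in> {0..T} \<Longrightarrow>
    (\<integral>\<omega>. B s \<omega> * B t \<omega> \<partial>M) = (t powr (2 * H) + s powr (2 * H) - \<bar>t - s\<bar> powr (2 * H)) / 2"
  and B_continuous: "\<omega> \<in> space M \<Longrightarrow> continuous_on {0..T} (\<lambda>t. B t \<omega>)"
  using fbm by (simp_all add: fractional_brownian_motion_def)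

lemma B_gaussian: "t \<in> {0..T} \<Longrightarrow> gaussian_rv M (B t)"
  using B_gaussian_process[unfolded gaussian_process_def, rule_format, of "{t}" "\<lambda>_. 1"] by simp

lemma B_measurable [measurable]: "t \<in> {0..T} \<Longrightarrow> B t \<in> borel_measurable M"
  using B_gaussian[of t] by (simp add: gaussian_rv_def)

lemma gaussian_increments:
  assumes "finite J" "\<And>c. c \<in> J \<Longrightarrow> u c \<in> {0..T} \<and> v c \<in> {0..T}"
  shows "gaussian_rv M (\<lambda>\<omega>. \<Sum>c\<in>J. \<alpha> c * (B (v c) \<omega> - B (u c) \<omega>))"
proof -
  define S where "S = u ` J \<union> v ` J"
  \<comment> \<open>A Gaussian process is defined with one coefficient per time, so the coefficients
    of increments that share an endpoint are collected here.\<close>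
  define \<gamma> where "\<gamma> s = (\<Sum>c\<in>J. \<alpha> c * (of_bool (v c = s) - of_bool (u c = s)))" for s
  have S: "finite S" "S \<subseteq> {0..T}" using assms by (auto simp: S_def)
  have "(\<Sum>s\<in>S. \<gamma> s * B s \<omega>) = (\<Sum>c\<in>J. \<alpha> c * (B (v c) \<omega> - B (u c) \<omega>))" for \<omega>
  proof -
    have "(\<Sum>s\<in>S. \<gamma> s * B s \<omega>) = (\<Sum>c\<in>J. \<Sum>s\<in>S. \<alpha> c * (of_bool (v c = s) - of_bool (u c = s)) * B s \<omega>)"
      unfolding \<gamma>_def sum_distrib_right by (rule sum.swap)
    also have "\<dots> = (\<Sum>c\<in>J. \<alpha> c * (B (v c) \<omega> - B (u c) \<omega>))"
    proof (intro sum.cong refl)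
      fix c assume c: "c \<in> J"
      have "(\<Sum>s\<in>S. of_bool (w = s) * B s \<omega>) = B w \<omega>" if "w \<in> S" for w
      proof -
        have "(\<Sum>s\<in>S. of_bool (w = s) * B s \<omega>) = (\<Sum>s\<in>S. if w = s then B s \<omega> else 0)"
          by (intro sum.cong) auto
        then show ?thesis using that S(1) by simp
      qed
      then have "(\<Sum>s\<in>S. of_bool (v c = s) * B s \<omega>) = B (v c) \<omega>" "(\<Sum>s\<in>S. of_bool (u c = s) * B s \<omega>) = B (u c) \<omega>"
        using c by (auto simp: S_def)
      then show "(\<Sum>s\<in>S. \<alpha> c * (of_bool (v c = s) - of_bool (u c = s)) * B s \<omega>) = \<alpha> c * (B (v c) \<omega> - B (u c) \<omega>)"
        by (simp add: left_diff_distrib right_diff_distrib sum_subtractf sum_distrib_left[symmetric] mult.assoc)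
    qed
    finally show ?thesis .
  qed
  then show ?thesis
    using B_gaussian_process[unfolded gaussian_process_def, rule_format, of S \<gamma>] S by simp
qed

lemma B_square_integrable: "t \<in> {0..T} \<Longrightarrow> integrable M (\<lambda>\<omega>. (B t \<omega>)\<^sup>2)"
  using gaussian_moment(1)[OF B_gaussian B_mean, of t 1] by simp

lemma B_integrable:
  assumes "t \<in> {0..T}"
  shows "integrable M (B t)"
proof (rule Bochner_Integration.integrable_bound)
  show "integrable M (\<lambda>\<omega>. 1 + (B t \<omega>)\<^sup>2)" using B_square_integrable[OF assms] by simp
  have "\<bar>x\<bar> \<le> 1 + x\<^sup>2" for x :: real
    using sum_squares_bound[of "\<bar>x\<bar>" 1] by simp
  moreover have "\<bar>1 + x\<^sup>2\<bar> = 1 + x\<^sup>2" for x :: real by simp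
  ultimately show "AE x in M. norm (B t x) \<le> norm (1 + (B t x)\<^sup>2)" by (simp del: abs_of_nonneg)
qed (use assms in simp)

lemma B_product_integrable:
  assumes "s \<in> {0..T}" "t \<in> {0..T}"
  shows "integrable M (\<lambda>\<omega>. B s \<omega> * B t \<omega>)"
proof (rule Bochner_Integration.integrable_bound)
  have [measurable]: "B t \<in> borel_measurable M" "B s \<in> borel_measurable M" using assms by simp_all
  show "integrable M (\<lambda>\<omega>. (B s \<omega>)\<^sup>2 + (B t \<omega>)\<^sup>2)" using B_square_integrable assms by simp
  have "\<bar>x * y\<bar> \<le> \<bar>x\<^sup>2 + y\<^sup>2\<bar>" for x y :: real
  proof -
    have "2 * (\<bar>x\<bar> * \<bar>y\<bar>) \<le> x\<^sup>2 + y\<^sup>2" "0 \<le> \<bar>x\<bar> * \<bar>y\<bar>" using sum_squares_bound[of "\<bar>x\<bar>" "\<bar>y\<bar>"] by auto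
    then show ?thesis unfolding abs_mult by linarith
  qed
  then show "AE x in M. norm (B s x * B t x) \<le> norm ((B s x)\<^sup>2 + (B t x)\<^sup>2)" by simp
  show "(\<lambda>\<omega>. B s \<omega> * B t \<omega>) \<in> borel_measurable M" by simp
qed

definition cov :: "real \<Rightarrow> real \<Rightarrow> real \<Rightarrow> real \<Rightarrow> real" where
  "cov u v u' v' = (\<bar>v' - u\<bar> powr (2 * H) + \<bar>u' - v\<bar> powr (2 * H) - \<bar>v' - v\<bar> powr (2 * H) - \<bar>u' - u\<bar> powr (2 * H)) / 2"

lemma increment_cov:
  assumes "u \<in> {0..T}" "v \<in> {0..T}" "u' \<in> {0..T}" "v' \<in> {0..T}"
  shows "integrable M (\<lambda>\<omega>. (B v \<omega> - B u \<omega>) * (B v' \<omega> - B u' \<omega>))"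
    "(\<integral>\<omega>. (B v \<omega> - B u \<omega>) * (B v' \<omega> - B u' \<omega>) \<partial>M) = cov u v u' v'"
proof -
  have eq: "(B v \<omega> - B u \<omega>) * (B v' \<omega> - B u' \<omega>) = B v \<omega> * B v' \<omega> - B v \<omega> * B u' \<omega> - B u \<omega> * B v' \<omega> + B u \<omega> * B u' \<omega>" for \<omega>
    by (simp add: algebra_simps)
  show "integrable M (\<lambda>\<omega>. (B v \<omega> - B u \<omega>) * (B v' \<omega> - B u' \<omega>))"
    unfolding eq using assms by (intro Bochner_Integration.integrable_add Bochner_Integration.integrable_diff B_product_integrable)
  show "(\<integral>\<omega>. (B v \<omega> - B u \<omega>) * (B v' \<omega> - B u' \<omega>) \<partial>M) = cov u v u' v'"
    unfolding eq using assms by (simp add: B_product_integrable B_cov cov_def field_simps abs_minus_commute)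
qed

lemma increments_moment:
  assumes J: "finite J" "\<And>c. c \<in> J \<Longrightarrow> u c \<in> {0..T} \<and> v c \<in> {0..T}"
  shows "integrable M (\<lambda>\<omega>. (\<Sum>c\<in>J. \<alpha> c * (B (v c) \<omega> - B (u c) \<omega>)) ^ (2 * q))"
    "(\<integral>\<omega>. (\<Sum>c\<in>J. \<alpha> c * (B (v c) \<omega> - B (u c) \<omega>)) ^ (2 * q) \<partial>M)
      = gauss_moment q * (\<Sum>c\<in>J. \<Sum>d\<in>J. \<alpha> c * \<alpha> d * cov (u c) (v c) (u d) (v d)) ^ q"
proof -
  let ?Z = "\<lambda>\<omega>. \<Sum>c\<in>J. \<alpha> c * (B (v c) \<omega> - B (u c) \<omega>)"
  have "(\<integral>\<omega>. ?Z \<omega> \<partial>M) = (\<Sum>c\<in>J. \<integral>\<omega>. \<alpha> c * (B (v c) \<omega> - B (u c) \<omega>) \<partial>M)"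
    using J by (intro Bochner_Integration.integral_sum integrable_mult_right Bochner_Integration.integrable_diff B_integrable) auto
  also have "\<dots> = 0"
    using J by (intro sum.neutral ballI) (simp add: B_integrable B_mean)
  finally have mean: "(\<integral>\<omega>. ?Z \<omega> \<partial>M) = 0" .
  have "(\<integral>\<omega>. (?Z \<omega>)\<^sup>2 \<partial>M) = (\<integral>\<omega>. (\<Sum>c\<in>J. \<Sum>d\<in>J. \<alpha> c * \<alpha> d * ((B (v c) \<omega> - B (u c) \<omega>) * (B (v d) \<omega> - B (u d) \<omega>))) \<partial>M)"
    unfolding power2_eq_square sum_product by (simp add: mult_ac)
  also have "\<dots> = (\<Sum>c\<in>J. \<integral>\<omega>. (\<Sum>d\<in>J. \<alpha> c * \<alpha> d * ((B (v c) \<omega> - B (u c) \<omega>) * (B (v d) \<omega> - B (u d) \<omega>))) \<partial>M)"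
    using J by (intro Bochner_Integration.integral_sum Bochner_Integration.integrable_sum integrable_mult_right increment_cov) auto
  also have "\<dots> = (\<Sum>c\<in>J. \<Sum>d\<in>J. \<integral>\<omega>. \<alpha> c * \<alpha> d * ((B (v c) \<omega> - B (u c) \<omega>) * (B (v d) \<omega> - B (u d) \<omega>)) \<partial>M)"
    using J by (intro sum.cong refl Bochner_Integration.integral_sum integrable_mult_right increment_cov) auto
  also have "\<dots> = (\<Sum>c\<in>J. \<Sum>d\<in>J. \<alpha> c * \<alpha> d * cov (u c) (v c) (u d) (v d))"
    using J by (intro sum.cong refl) (simp add: increment_cov)
  finally have var: "(\<integral>\<omega>. (?Z \<omega>)\<^sup>2 \<partial>M) = (\<Sum>c\<in>J. \<Sum>d\<in>J. \<alpha> c * \<alpha> d * cov (u c) (v c) (u d) (v d))" .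
  show "integrable M (\<lambda>\<omega>. ?Z \<omega> ^ (2 * q))"
    "(\<integral>\<omega>. ?Z \<omega> ^ (2 * q) \<partial>M) = gauss_moment q * (\<Sum>c\<in>J. \<Sum>d\<in>J. \<alpha> c * \<alpha> d * cov (u c) (v c) (u d) (v d)) ^ q"
    using gaussian_moment[OF gaussian_increments[OF J] mean, of q] unfolding var by auto
qed

lemma increment_moment:
  assumes "u \<in> {0..T}" "v \<in> {0..T}"
  shows "(\<integral>\<^sup>+\<omega>. ennreal ((B v \<omega> - B u \<omega>) ^ (2 * q)) \<partial>M) = ennreal (gauss_moment q * (\<bar>v - u\<bar> powr H) ^ (2 * q))"
proof -
  have "cov u v u v = (\<bar>v - u\<bar> powr H)\<^sup>2"
    by (simp add: cov_def power2_eq_square abs_minus_commute flip: powr_add)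
  then show ?thesis
    using increments_moment[of "{()}" "\<lambda>_. u" "\<lambda>_. v", where \<alpha> = "\<lambda>_. 1" and q = q] assms
    by (subst nn_integral_eq_integral) (auto simp: power_mult)
qed

text \<open>With nonnegative correlations the quadratic form is dominated by a diagonal one.\<close>

lemma weighted_increments_moment:
  assumes J: "finite J" "\<And>c. c \<in> J \<Longrightarrow> u c \<in> {0..T} \<and> v c \<in> {0..T}"
    and pos: "\<And>c d. c \<in> J \<Longrightarrow> d \<in> J \<Longrightarrow> 0 \<le> cov (u c) (v c) (u d) (v d)"
  defines "\<rho> \<equiv> \<lambda>c. \<Sum>d\<in>J. cov (u c) (v c) (u d) (v d)"
  shows "(\<integral>\<^sup>+\<omega>. ennreal ((\<Sum>c\<in>J. \<alpha> c * (B (v c) \<omega> - B (u c) \<omega>)) ^ (2 * Suc q)) \<partial>M)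
     \<le> ennreal (gauss_moment (Suc q) * (\<Sum>c\<in>J. \<rho> c) ^ q * (\<Sum>c\<in>J. \<rho> c * \<alpha> c ^ (2 * Suc q)))"
proof -
  let ?R = "\<lambda>c d. cov (u c) (v c) (u d) (v d)"
  have sym: "?R c d = ?R d c" for c d
    by (simp add: cov_def abs_minus_commute algebra_simps)
  have \<rho>: "0 \<le> \<rho> c" if "c \<in> J" for c unfolding \<rho>_def using pos that by (intro sum_nonneg) auto
  have V0: "0 \<le> (\<Sum>c\<in>J. \<Sum>d\<in>J. \<alpha> c * \<alpha> d * ?R c d)"
  proof -
    have "0 \<le> (\<integral>\<omega>. (\<Sum>c\<in>J. \<alpha> c * (B (v c) \<omega> - B (u c) \<omega>)) ^ (2 * 1) \<partial>M)"
      by (intro Bochner_Integration.integral_nonneg) simp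
    also have "\<dots> = gauss_moment 1 * (\<Sum>c\<in>J. \<Sum>d\<in>J. \<alpha> c * \<alpha> d * ?R c d) ^ 1"
      by (rule increments_moment(2)[OF J])
    finally show ?thesis by simp
  qed
  have "(\<Sum>c\<in>J. \<Sum>d\<in>J. \<alpha> c * \<alpha> d * ?R c d) \<le> (\<Sum>c\<in>J. \<Sum>d\<in>J. ((\<alpha> c)\<^sup>2 * ?R c d + (\<alpha> d)\<^sup>2 * ?R d c) / 2)"
  proof (intro sum_mono)
    fix c d assume cd: "c \<in> J" "d \<in> J"
    have "\<alpha> c * \<alpha> d \<le> ((\<alpha> c)\<^sup>2 + (\<alpha> d)\<^sup>2) / 2" using sum_squares_bound[of "\<alpha> c" "\<alpha> d"] by simp
    then have "\<alpha> c * \<alpha> d * ?R c d \<le> ((\<alpha> c)\<^sup>2 + (\<alpha> d)\<^sup>2) / 2 * ?R c d"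
      using pos[OF cd] by (intro mult_right_mono)
    then show "\<alpha> c * \<alpha> d * ?R c d \<le> ((\<alpha> c)\<^sup>2 * ?R c d + (\<alpha> d)\<^sup>2 * ?R d c) / 2"
      by (simp add: sym[of d c] algebra_simps)
  qed
  also have "\<dots> = ((\<Sum>c\<in>J. \<Sum>d\<in>J. (\<alpha> c)\<^sup>2 * ?R c d) + (\<Sum>c\<in>J. \<Sum>d\<in>J. (\<alpha> d)\<^sup>2 * ?R d c)) / 2"
    by (simp add: sum.distrib sum_divide_distrib[symmetric])
  also have "(\<Sum>c\<in>J. \<Sum>d\<in>J. (\<alpha> d)\<^sup>2 * ?R d c) = (\<Sum>c\<in>J. \<Sum>d\<in>J. (\<alpha> c)\<^sup>2 * ?R c d)" by (rule sum.swap)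
  also have "((\<Sum>c\<in>J. \<Sum>d\<in>J. (\<alpha> c)\<^sup>2 * ?R c d) + (\<Sum>c\<in>J. \<Sum>d\<in>J. (\<alpha> c)\<^sup>2 * ?R c d)) / 2 = (\<Sum>c\<in>J. \<rho> c * (\<alpha> c)\<^sup>2)"
    by (simp add: \<rho>_def sum_distrib_left[symmetric] mult.commute)
  finally have "(\<Sum>c\<in>J. \<Sum>d\<in>J. \<alpha> c * \<alpha> d * ?R c d) \<le> (\<Sum>c\<in>J. \<rho> c * (\<alpha> c)\<^sup>2)" .
  then have "(\<Sum>c\<in>J. \<Sum>d\<in>J. \<alpha> c * \<alpha> d * ?R c d) ^ Suc q \<le> (\<Sum>c\<in>J. \<rho> c * (\<alpha> c)\<^sup>2) ^ Suc q"
    using V0 by (rule power_mono)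
  \<comment> \<open>Jensen moves the power onto the single coefficients, so that after conditioning
    only moments of single increments are required.\<close>
  also have "\<dots> \<le> (\<Sum>c\<in>J. \<rho> c) ^ q * (\<Sum>c\<in>J. \<rho> c * (\<alpha> c)\<^sup>2 ^ Suc q)"
    using J(1) \<rho> by (intro sum_power_jensen) auto
  finally have "gauss_moment (Suc q) * (\<Sum>c\<in>J. \<Sum>d\<in>J. \<alpha> c * \<alpha> d * ?R c d) ^ Suc q
     \<le> gauss_moment (Suc q) * (\<Sum>c\<in>J. \<rho> c) ^ q * (\<Sum>c\<in>J. \<rho> c * \<alpha> c ^ (2 * Suc q))"
    using gauss_moment_pos[of "Suc q"] by (simp only: power_mult[symmetric] mult.assoc mult_le_cancel_left_pos)
  then show ?thesis
    using increments_moment[OF J, where \<alpha> = \<alpha> and q = "Suc q"]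
    by (subst nn_integral_eq_integral) (auto intro!: ennreal_leI simp del: power_Suc mult_Suc_right)
qed

end


section \<open>Moments of the levels of the Levy area\<close>

lemma powr_midpoint:
  fixes a b p :: real
  assumes "1 \<le> p" "0 \<le> a" "a \<le> b"
  shows "2 * ((a + b) / 2) powr p \<le> a powr p + b powr p"
proof (cases "a = 0")
  case True
  have "2 * (b / 2) powr p = 2 powr (1 - p) * b powr p"
    using assms by (simp add: powr_divide powr_diff)
  also have "\<dots> \<le> 1 * b powr p"
    using assms powr_mono[of "1 - p" 0 2] by (intro mult_right_mono) auto
  finally show ?thesis using True by simp
next
  case False
  then have "a \<in> {0<..}" "b \<in> {0<..}" using assms by auto
  from convex_onD[OF powr_convex[OF assms(1)], of "1/2", OF _ _ this]
  show ?thesis by (simp add: field_simps)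
qed

lemma sum_blocks:
  fixes f :: "nat \<Rightarrow> 'a::comm_monoid_add"
  assumes "a \<le> b"
  shows "(\<Sum>k\<in>{a..<b}. \<Sum>c<m. f (k * m + c)) = (\<Sum>c\<in>{a * m..<b * m}. f c)"
  using assms
proof (induction b)
  case (Suc b)
  show ?case
  proof (cases "a \<le> b")
    case True
    have "(\<Sum>c<m. f (b * m + c)) = (\<Sum>c\<in>{b * m..<b * m + m}. f c)"
      using sum.shift_bounds_nat_ivl[of f 0 "b * m" m] by (simp add: lessThan_atLeast0 add.commute)
    then have "(\<Sum>k\<in>{a..<Suc b}. \<Sum>c<m. f (k * m + c)) = (\<Sum>c\<in>{a * m..<b * m}. f c) + (\<Sum>c\<in>{b * m..<b * m + m}. f c)"
      using True Suc.IH by simp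
    also have "\<dots> = (\<Sum>c\<in>{a * m..<b * m + m}. f c)"
      using True by (intro sum.atLeastLessThan_concat) auto
    finally show ?thesis by (simp add: add.commute)
  qed (use Suc.prems in \<open>auto simp: le_Suc_eq\<close>)
qed simp

lemma levy_level_grid:
  "levy_level x i j (real k * h) (real (Suc k) * h) r
    = (\<Sum>c<2 ^ r. levy_piece x i j (real (k * 2 ^ r + c) * (h / 2 ^ r)) (real (Suc (k * 2 ^ r + c)) * (h / 2 ^ r)))"
  unfolding levy_level_def
  by (intro sum.cong refl arg_cong2[where f = "levy_piece x i j"]) (simp_all add: field_simps)

lemma sum_levy_level:
  assumes "a \<le> b"
  shows "(\<Sum>k\<in>{a..<b}. levy_level x i j (real k * h) (real (Suc k) * h) r)
    = (\<Sum>c\<in>{a * 2 ^ r..<b * 2 ^ r}. levy_piece x i j (real c * (h / 2 ^ r)) (real (Suc c) * (h / 2 ^ r)))"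
  unfolding levy_level_grid by (rule sum_blocks[OF assms])

text \<open>On the grid of half the cell size each triangle pairs an even with an odd increment,
  which prepares the splitting into two sums of products.\<close>

lemma levy_piece_grid:
  fixes x :: "'d \<Rightarrow> real \<Rightarrow> real" and \<delta> :: real
  defines "w \<equiv> \<lambda>l k. x l (real (Suc k) * \<delta>) - x l (real k * \<delta>)"
  shows "levy_piece x i j (real c * (2 * \<delta>)) (real (Suc c) * (2 * \<delta>))
    = (w i (2 * c) * w j (2 * c + 1) - w i (2 * c + 1) * w j (2 * c)) / 2"
proof -
  have m: "(real c * (2 * \<delta>) + real (Suc c) * (2 * \<delta>)) / 2 = real (2 * c + 1) * \<delta>"
    and l: "real c * (2 * \<delta>) = real (2 * c) * \<delta>" and r: "real (Suc c) * (2 * \<delta>) = real (2 * c + 1 + 1) * \<delta>"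
    by (simp_all add: algebra_simps)
  show ?thesis unfolding levy_piece_def m unfolding l r w_def by (simp only: Suc_eq_plus1)
qed

lemma levy_piece_swap: "levy_piece x j i s t = - levy_piece x i j s t"
proof -
  have "(a * b - c * d) / 2 = - ((d * c - b * a) / 2)" for a b c d :: real by (simp add: mult.commute diff_divide_distrib)
  then show ?thesis unfolding levy_piece_def .
qed

lemma levy_level_swap: "levy_level x j i s t r = - levy_level x i j s t r"
  unfolding levy_level_def levy_piece_swap[of x j i] sum_negf ..

lemma levy_level_same [simp]: "levy_level x i i s t r = 0"
  by (simp add: levy_level_def levy_piece_def mult.commute)

lemma half_diff_power_le:
  fixes x y :: real
  shows "((x - y) / 2) ^ (2 * q) \<le> x ^ (2 * q) + y ^ (2 * q)"
proof -
  have "((x - y) / 2) ^ (2 * q) = \<bar>(x - y) / 2\<bar> ^ (2 * q)" by (rule power_even_abs[symmetric]) simp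
  also have "\<dots> \<le> (max \<bar>x\<bar> \<bar>y\<bar>) ^ (2 * q)" by (intro power_mono) auto
  also have "\<dots> \<le> \<bar>x\<bar> ^ (2 * q) + \<bar>y\<bar> ^ (2 * q)" by (simp add: max_def)
  finally show ?thesis by (simp add: power_even_abs)
qed

context fbm
begin

text \<open>The covariance of two grid increments is half a second difference of |t|^(2 H), and
  convexity for 2 H >= 1 makes it nonnegative.\<close>

lemma cov_grid_nonneg:
  assumes "0 \<le> \<delta>"
  shows "0 \<le> cov (real k * \<delta>) (real (Suc k) * \<delta>) (real k' * \<delta>) (real (Suc k') * \<delta>)"
proof -
  have *: "0 \<le> cov (real k * \<delta>) (real (Suc k) * \<delta>) (real (k + m) * \<delta>) (real (Suc (k + m)) * \<delta>)" for k m
  proof -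
    have e: "real (Suc (k + m)) * \<delta> - real k * \<delta> = (real m + 1) * \<delta>" "real (k + m) * \<delta> - real (Suc k) * \<delta> = (real m - 1) * \<delta>"
      "real (Suc (k + m)) * \<delta> - real (Suc k) * \<delta> = real m * \<delta>" "real (k + m) * \<delta> - real k * \<delta> = real m * \<delta>"
      by (simp_all add: algebra_simps)
    show ?thesis
    proof (cases m)
      case 0
      then show ?thesis unfolding cov_def e by simp
    next
      case (Suc m')
      have "2 * (((real m - 1) * \<delta> + (real m + 1) * \<delta>) / 2) powr (2 * H) \<le> ((real m - 1) * \<delta>) powr (2 * H) + ((real m + 1) * \<delta>) powr (2 * H)"
        using assms H Suc by (intro powr_midpoint mult_right_mono) auto
      moreover have "((real m - 1) * \<delta> + (real m + 1) * \<delta>) / 2 = real m * \<delta>" by (simp add: algebra_simps)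
      ultimately show ?thesis unfolding cov_def e using assms Suc by simp
    qed
  qed
  have sym: "cov u v u' v' = cov u' v' u v" for u v u' v'
    by (simp add: cov_def abs_minus_commute algebra_simps)
  show ?thesis
  proof (cases "k \<le> k'")
    case True
    then show ?thesis using *[of k "k' - k"] by simp
  next
    case False
    then show ?thesis using *[of k' "k - k'"] by (subst sym) simp
  qed
qed

text \<open>Nonnegativity allows all missing pairs of cells to be added; the full double sum is the
  variance of the increment over the whole range.\<close>

lemma sum_cov_grid_le:
  assumes "0 \<le> \<delta>" "k0 \<le> k1" "real k1 * \<delta> \<le> T" and J: "inj_on \<kappa> J" "\<kappa> ` J \<subseteq> {k0..<k1}"
  shows "(\<Sum>c\<in>J. \<Sum>d\<in>J. cov (real (\<kappa> c) * \<delta>) (real (Suc (\<kappa> c)) * \<delta>) (real (\<kappa> d) * \<delta>) (real (Suc (\<kappa> d)) * \<delta>))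
     \<le> (real (k1 - k0) * \<delta>) powr (2 * H)"
proof -
  let ?R = "\<lambda>k k'. cov (real k * \<delta>) (real (Suc k) * \<delta>) (real k' * \<delta>) (real (Suc k') * \<delta>)"
  have in_T: "real k * \<delta> \<in> {0..T}" if "k \<le> k1" for k
    using that assms(1,3) order_trans[OF mult_right_mono[of "real k" "real k1" \<delta>]] by auto
  have "(\<Sum>c\<in>J. \<Sum>d\<in>J. ?R (\<kappa> c) (\<kappa> d)) = (\<Sum>c\<in>\<kappa> ` J. \<Sum>d\<in>\<kappa> ` J. ?R c d)"
    using J(1) by (simp add: sum.reindex)
  also have "\<dots> \<le> (\<Sum>c\<in>{k0..<k1}. \<Sum>d\<in>\<kappa> ` J. ?R c d)"
    using J(2) assms(1) by (intro sum_mono2 sum_nonneg cov_grid_nonneg) auto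
  also have "\<dots> \<le> (\<Sum>c\<in>{k0..<k1}. \<Sum>d\<in>{k0..<k1}. ?R c d)"
    using J(2) assms(1) by (intro sum_mono sum_mono2 cov_grid_nonneg) auto
  also have "\<dots> = (\<integral>\<omega>. (\<Sum>c\<in>{k0..<k1}. 1 * (B (real (Suc c) * \<delta>) \<omega> - B (real c * \<delta>) \<omega>)) ^ (2 * 1) \<partial>M)"
    using increments_moment(2)[of "{k0..<k1}" "\<lambda>c. real c * \<delta>" "\<lambda>c. real (Suc c) * \<delta>" "\<lambda>_. 1" 1] in_T
    by (simp del: of_nat_Suc)
  also have "(\<lambda>\<omega>. (\<Sum>c\<in>{k0..<k1}. 1 * (B (real (Suc c) * \<delta>) \<omega> - B (real c * \<delta>) \<omega>)) ^ (2 * 1))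
     = (\<lambda>\<omega>. (B (real k1 * \<delta>) \<omega> - B (real k0 * \<delta>) \<omega>) * (B (real k1 * \<delta>) \<omega> - B (real k0 * \<delta>) \<omega>))"
    using assms(2) sum_Suc_diff'[OF assms(2), of "\<lambda>c. B (real c * \<delta>) \<omega>" for \<omega>] by (simp add: power2_eq_square)
  also have "(\<integral>\<omega>. (B (real k1 * \<delta>) \<omega> - B (real k0 * \<delta>) \<omega>) * (B (real k1 * \<delta>) \<omega> - B (real k0 * \<delta>) \<omega>) \<partial>M)
     = cov (real k0 * \<delta>) (real k1 * \<delta>) (real k0 * \<delta>) (real k1 * \<delta>)"
    using in_T assms(2) by (intro increment_cov) auto
  also have "\<dots> = (real (k1 - k0) * \<delta>) powr (2 * H)"
    using assms(1,2) by (simp add: cov_def abs_minus_commute of_nat_diff left_diff_distrib[symmetric] abs_mult)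
  finally show ?thesis .
qed

text \<open>Given \<open>A\<close>, the sum is a linear form in the increments of \<open>B\<close>, hence Gaussian.\<close>

lemma independent_product_moment:
  assumes A: "indep_var (PiM {0..T} (\<lambda>_. borel)) (\<lambda>\<omega>. \<lambda>t\<in>{0..T}. A t \<omega>) (PiM {0..T} (\<lambda>_. borel)) (\<lambda>\<omega>. \<lambda>t\<in>{0..T}. B t \<omega>)"
    and J: "finite J" "\<And>c. c \<in> J \<Longrightarrow> p c \<in> {0..T} \<and> p' c \<in> {0..T} \<and> u c \<in> {0..T} \<and> v c \<in> {0..T}"
    and pos: "\<And>c d. c \<in> J \<Longrightarrow> d \<in> J \<Longrightarrow> 0 \<le> cov (u c) (v c) (u d) (v d)"
    and m: "0 \<le> m" "\<And>c. c \<in> J \<Longrightarrow> (\<integral>\<^sup>+\<omega>. ennreal ((A (p' c) \<omega> - A (p c) \<omega>) ^ (2 * Suc q)) \<partial>M) \<le> ennreal m"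
    and S: "(\<Sum>c\<in>J. \<Sum>d\<in>J. cov (u c) (v c) (u d) (v d)) \<le> S"
  shows "(\<integral>\<^sup>+\<omega>. ennreal ((\<Sum>c\<in>J. (A (p' c) \<omega> - A (p c) \<omega>) * (B (v c) \<omega> - B (u c) \<omega>)) ^ (2 * Suc q)) \<partial>M)
     \<le> ennreal (gauss_moment (Suc q) * m * S ^ Suc q)"
proof -
  let ?N = "PiM {0..T} (\<lambda>_. borel :: real measure)"
  define A' where "A' \<omega> = (\<lambda>t\<in>{0..T}. A t \<omega>)" for \<omega>
  define B' where "B' \<omega> = (\<lambda>t\<in>{0..T}. B t \<omega>)" for \<omega>
  have ind: "random_variable ?N A'" "random_variable ?N B'"
    "distr M (?N \<Otimes>\<^sub>M ?N) (\<lambda>\<omega>. (A' \<omega>, B' \<omega>)) = distr M ?N A' \<Otimes>\<^sub>M distr M ?N B'"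
    using A unfolding indep_var_distribution_eq A'_def B'_def by auto
  note [measurable] = ind(1,2)
  define f where "f z = ennreal ((\<Sum>c\<in>J. (fst z (p' c) - fst z (p c)) * (snd z (v c) - snd z (u c))) ^ (2 * Suc q))"
    for z :: "(real \<Rightarrow> real) \<times> (real \<Rightarrow> real)"
  have comp: "(\<lambda>z. fst z t) \<in> borel_measurable (?N \<Otimes>\<^sub>M ?N)" "(\<lambda>z. snd z t) \<in> borel_measurable (?N \<Otimes>\<^sub>M ?N)"
    if "t \<in> {0..T}" for t
    using measurable_compose[OF measurable_fst measurable_component_singleton[OF that]]
      measurable_compose[OF measurable_snd measurable_component_singleton[OF that]] by auto
  have f [measurable]: "f \<in> borel_measurable (?N \<Otimes>\<^sub>M ?N)"
    unfolding f_def using J by (intro measurable_compose[OF _ measurable_ennreal] borel_measurable_power borel_measurable_sum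
      borel_measurable_times borel_measurable_diff comp) auto
  have fAB: "f (A' \<omega>, B' \<omega>') = ennreal ((\<Sum>c\<in>J. (A (p' c) \<omega> - A (p c) \<omega>) * (B (v c) \<omega>' - B (u c) \<omega>')) ^ (2 * Suc q))" for \<omega> \<omega>'
    unfolding f_def A'_def B'_def using J(2)
    by (intro arg_cong[where f = ennreal] arg_cong[where f = "\<lambda>z. z ^ (2 * Suc q)"] sum.cong refl) auto
  interpret DB: prob_space "distr M ?N B'" by (rule prob_space_distr) fact
  have Am [measurable]: "A t \<in> borel_measurable M" if "t \<in> {0..T}" for t
  proof -
    have "(\<lambda>\<omega>. A' \<omega> t) \<in> borel_measurable M"
      by (rule measurable_compose[OF ind(1) measurable_component_singleton[OF that]])
    then show ?thesis using that by (simp add: A'_def)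
  qed
  let ?\<rho> = "\<lambda>c. \<Sum>d\<in>J. cov (u c) (v c) (u d) (v d)"
  have \<rho>: "0 \<le> ?\<rho> c" if "c \<in> J" for c using pos that by (intro sum_nonneg) auto
  have \<rho>s: "0 \<le> (\<Sum>c\<in>J. ?\<rho> c)" by (rule sum_nonneg) (rule \<rho>)
  \<comment> \<open>Independence makes the joint law a product, so by Tonelli the inner integral
    runs over \<open>B\<close> with the path of \<open>A\<close> frozen, and the increments of
    \<open>A\<close> act as deterministic coefficients.\<close>
  have "(\<integral>\<^sup>+\<omega>. f (A' \<omega>, B' \<omega>) \<partial>M) = (\<integral>\<^sup>+z. f z \<partial>distr M (?N \<Otimes>\<^sub>M ?N) (\<lambda>\<omega>. (A' \<omega>, B' \<omega>)))"
    by (subst nn_integral_distr) auto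
  also have "\<dots> = (\<integral>\<^sup>+x. \<integral>\<^sup>+y. f (x, y) \<partial>distr M ?N B' \<partial>distr M ?N A')"
    unfolding ind(3) by (rule DB.nn_integral_fst[symmetric]) (simp cong: measurable_cong_sets)
  also have "\<dots> = (\<integral>\<^sup>+\<omega>. \<integral>\<^sup>+y. f (A' \<omega>, y) \<partial>distr M ?N B' \<partial>M)"
    by (subst nn_integral_distr) (auto intro!: DB.borel_measurable_nn_integral cong: measurable_cong_sets)
  also have "\<dots> = (\<integral>\<^sup>+\<omega>. \<integral>\<^sup>+\<omega>'. f (A' \<omega>, B' \<omega>') \<partial>M \<partial>M)"
    by (intro nn_integral_cong, subst nn_integral_distr) auto
  also have "\<dots> \<le> (\<integral>\<^sup>+\<omega>. ennreal (gauss_moment (Suc q) * (\<Sum>c\<in>J. ?\<rho> c) ^ q * (\<Sum>c\<in>J. ?\<rho> c * (A (p' c) \<omega> - A (p c) \<omega>) ^ (2 * Suc q))) \<partial>M)"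
    unfolding fAB using J pos by (intro nn_integral_mono weighted_increments_moment) auto
  also have "\<dots> = (\<integral>\<^sup>+\<omega>. ennreal (gauss_moment (Suc q) * (\<Sum>c\<in>J. ?\<rho> c) ^ q)
      * (\<Sum>c\<in>J. ennreal (?\<rho> c) * ennreal ((A (p' c) \<omega> - A (p c) \<omega>) ^ (2 * Suc q))) \<partial>M)"
  proof (intro nn_integral_cong)
    fix \<omega>
    have nn: "0 \<le> ?\<rho> c * (A (p' c) \<omega> - A (p c) \<omega>) ^ (2 * Suc q)" if "c \<in> J" for c
      using \<rho>[OF that] by (intro mult_nonneg_nonneg) (simp_all only: power_mult zero_le_power zero_le_power2)
    have "ennreal (\<Sum>c\<in>J. ?\<rho> c * (A (p' c) \<omega> - A (p c) \<omega>) ^ (2 * Suc q))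
      = (\<Sum>c\<in>J. ennreal (?\<rho> c) * ennreal ((A (p' c) \<omega> - A (p c) \<omega>) ^ (2 * Suc q)))"
    proof -
      have "(\<Sum>c\<in>J. ennreal (?\<rho> c) * ennreal ((A (p' c) \<omega> - A (p c) \<omega>) ^ (2 * Suc q)))
        = (\<Sum>c\<in>J. ennreal (?\<rho> c * (A (p' c) \<omega> - A (p c) \<omega>) ^ (2 * Suc q)))"
        by (rule sum.cong[OF refl], rule ennreal_mult'[symmetric], rule \<rho>)
      then show ?thesis using sum_ennreal[OF nn, of J "\<lambda>c. c"] by simp
    qed
    then show "ennreal (gauss_moment (Suc q) * (\<Sum>c\<in>J. ?\<rho> c) ^ q * (\<Sum>c\<in>J. ?\<rho> c * (A (p' c) \<omega> - A (p c) \<omega>) ^ (2 * Suc q)))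
      = ennreal (gauss_moment (Suc q) * (\<Sum>c\<in>J. ?\<rho> c) ^ q) * (\<Sum>c\<in>J. ennreal (?\<rho> c) * ennreal ((A (p' c) \<omega> - A (p c) \<omega>) ^ (2 * Suc q)))"
      using gauss_moment_pos[of "Suc q"] \<rho>s by (subst ennreal_mult') auto
  qed
  also have "\<dots> = ennreal (gauss_moment (Suc q) * (\<Sum>c\<in>J. ?\<rho> c) ^ q)
      * (\<Sum>c\<in>J. ennreal (?\<rho> c) * (\<integral>\<^sup>+\<omega>. ennreal ((A (p' c) \<omega> - A (p c) \<omega>) ^ (2 * Suc q)) \<partial>M))"
    using J by (subst nn_integral_cmult) (auto simp: nn_integral_sum nn_integral_cmult simp del: power_Suc mult_Suc_right intro!: borel_measurable_sum)
  also have "\<dots> \<le> ennreal (gauss_moment (Suc q) * (\<Sum>c\<in>J. ?\<rho> c) ^ q) * (\<Sum>c\<in>J. ennreal (?\<rho> c) * ennreal m)"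
    using m by (intro mult_left_mono sum_mono) auto
  also have "\<dots> = ennreal (gauss_moment (Suc q) * (\<Sum>c\<in>J. ?\<rho> c) ^ q * ((\<Sum>c\<in>J. ?\<rho> c) * m))"
    using \<rho> m \<rho>s gauss_moment_pos[of "Suc q"]
    by (simp add: sum_distrib_right[symmetric] ennreal_mult[symmetric] less_imp_le)
  also have "\<dots> \<le> ennreal (gauss_moment (Suc q) * m * S ^ Suc q)"
  proof (intro ennreal_leI)
    have "(\<Sum>c\<in>J. ?\<rho> c) ^ Suc q \<le> S ^ Suc q" using S \<rho>s by (intro power_mono)
    then have "gauss_moment (Suc q) * m * (\<Sum>c\<in>J. ?\<rho> c) ^ Suc q \<le> gauss_moment (Suc q) * m * S ^ Suc q"
      using m gauss_moment_pos[of "Suc q"] by (intro mult_left_mono) auto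
    then show "gauss_moment (Suc q) * (\<Sum>c\<in>J. ?\<rho> c) ^ q * ((\<Sum>c\<in>J. ?\<rho> c) * m) \<le> gauss_moment (Suc q) * m * S ^ Suc q"
      by (simp add: mult_ac)
  qed
  finally show ?thesis unfolding fAB .
qed

end


section \<open>Area sums of the driving process\<close>

locale driving = prob_space M for M :: "'w measure" +
  fixes T H :: real and i\<^sub>1 :: "'d::finite" and X :: "real \<Rightarrow> 'w \<Rightarrow> real ^ 'd"
  assumes T: "0 < T" and H: "1 / 2 < H" "H < 1" and driving: "driving_process M H T i\<^sub>1 X"
begin

lemma X_time: "\<omega> \<in> space M \<Longrightarrow> t \<in> {0..T} \<Longrightarrow> X t \<omega> $ i\<^sub>1 = t"
  using driving by (simp add: driving_process_def)

lemma X_fbm: "l \<noteq> i\<^sub>1 \<Longrightarrow> fbm M H T (\<lambda>t \<omega>. X t \<omega> $ l)"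
  using driving H by unfold_locales (simp_all add: driving_process_def)

lemma X_indep:
  assumes "i \<noteq> i\<^sub>1" "j \<noteq> i\<^sub>1" "i \<noteq> j"
  shows "indep_var (PiM {0..T} (\<lambda>_. borel)) (\<lambda>\<omega>. \<lambda>t\<in>{0..T}. X t \<omega> $ i) (PiM {0..T} (\<lambda>_. borel)) (\<lambda>\<omega>. \<lambda>t\<in>{0..T}. X t \<omega> $ j)"
proof -
  have "indep_vars (\<lambda>_. PiM {0..T} (\<lambda>_. borel)) (\<lambda>l \<omega>. \<lambda>t\<in>{0..T}. X t \<omega> $ l) {l. l \<noteq> i\<^sub>1}"
    using driving by (simp add: driving_process_def)
  then have "indep_var (PiM {i} (\<lambda>_. PiM {0..T} (\<lambda>_. borel))) (\<lambda>\<omega>. \<lambda>l\<in>{i}. \<lambda>t\<in>{0..T}. X t \<omega> $ l)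
      (PiM {j} (\<lambda>_. PiM {0..T} (\<lambda>_. borel))) (\<lambda>\<omega>. \<lambda>l\<in>{j}. \<lambda>t\<in>{0..T}. X t \<omega> $ l)"
    by (rule indep_var_restrict) (use assms in auto)
  from indep_var_compose[OF this measurable_component_singleton[of i] measurable_component_singleton[of j]]
  show ?thesis by (simp add: o_def)
qed

text \<open>One constant for both kinds of coefficients: the Gaussian moment for a fractional
  coordinate, and the power of T^(1 - H) for time, whose increment satisfies \<delta> <= T^(1 - H) *
  \<delta>^H.\<close>

definition moment_const :: "nat \<Rightarrow> real" where
  "moment_const q = gauss_moment q + (T powr (1 - H)) ^ (2 * q)"

lemma moment_const: "0 \<le> moment_const q"
  using gauss_moment_pos[of q] by (simp add: moment_const_def power_mult less_imp_le)

text \<open>\<open>\<kappa>\<close> and \<open>\<kappa>'\<close> select the cells of the two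
  factors, later the even and the odd ones. Coordinate j supplies the Gaussian variable and hence
  must be fractional; coordinate i only supplies coefficients and may be time.\<close>

lemma product_sum_moment:
  fixes \<delta> :: real
  assumes ij: "i \<noteq> j" "j \<noteq> i\<^sub>1" and \<delta>: "0 \<le> \<delta>" and k: "k0 \<le> k1" "real k1 * \<delta> \<le> T"
    and J: "finite J" "inj_on \<kappa>' J" "\<kappa> ` J \<subseteq> {k0..<k1}" "\<kappa>' ` J \<subseteq> {k0..<k1}"
  shows "(\<integral>\<^sup>+\<omega>. ennreal ((\<Sum>c\<in>J. (X (real (Suc (\<kappa> c)) * \<delta>) \<omega> $ i - X (real (\<kappa> c) * \<delta>) \<omega> $ i)
        * (X (real (Suc (\<kappa>' c)) * \<delta>) \<omega> $ j - X (real (\<kappa>' c) * \<delta>) \<omega> $ j)) ^ (2 * Suc q)) \<partial>M)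
     \<le> ennreal (gauss_moment (Suc q) * moment_const (Suc q) * (\<delta> powr H * (real (k1 - k0) * \<delta>) powr H) ^ (2 * Suc q))"
proof -
  interpret B: fbm M H T "\<lambda>t \<omega>. X t \<omega> $ j" by (rule X_fbm[OF ij(2)])
  let ?m = "moment_const (Suc q) * (\<delta> powr H) ^ (2 * Suc q)"
  let ?S = "(real (k1 - k0) * \<delta>) powr (2 * H)"
  let ?u = "\<lambda>c. real (\<kappa>' c) * \<delta>" and ?v = "\<lambda>c. real (Suc (\<kappa>' c)) * \<delta>"
  let ?R = "\<lambda>c d. B.cov (?u c) (?v c) (?u d) (?v d)"
  have in_T: "real a * \<delta> \<in> {0..T}" if "a \<le> k1" for a
    using that \<delta> k order_trans[OF mult_right_mono[of "real a" "real k1" \<delta>]] by auto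
  have \<kappa>: "\<kappa> c < k1" "\<kappa>' c < k1" if "c \<in> J" for c using J that by auto
  have JT: "?u c \<in> {0..T} \<and> ?v c \<in> {0..T}" "real (\<kappa> c) * \<delta> \<in> {0..T} \<and> real (Suc (\<kappa> c)) * \<delta> \<in> {0..T}" if "c \<in> J" for c
    using \<kappa>[OF that] by (intro conjI in_T; simp)+
  have pos: "0 \<le> ?R c d" for c d by (rule B.cov_grid_nonneg[OF \<delta>])
  have S: "(\<Sum>c\<in>J. \<Sum>d\<in>J. ?R c d) \<le> ?S" by (rule B.sum_cov_grid_le[OF \<delta> k J(2,4)])
  have m0: "0 \<le> ?m" using moment_const[of "Suc q"] by (intro mult_nonneg_nonneg) auto
  have fin: "gauss_moment (Suc q) * ?m * ?S ^ Suc q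
      = gauss_moment (Suc q) * moment_const (Suc q) * (\<delta> powr H * (real (k1 - k0) * \<delta>) powr H) ^ (2 * Suc q)"
  proof -
    have "?S = ((real (k1 - k0) * \<delta>) powr H)\<^sup>2" by (simp add: power2_eq_square flip: powr_add)
    then have "?S ^ Suc q = ((real (k1 - k0) * \<delta>) powr H) ^ (2 * Suc q)" by (simp only: power_mult)
    then show ?thesis by (simp only: power_mult_distrib mult.assoc)
  qed
  show ?thesis
  proof (cases "i = i\<^sub>1")
    case False
    interpret A: fbm M H T "\<lambda>t \<omega>. X t \<omega> $ i" by (rule X_fbm[OF False])
    have mom: "(\<integral>\<^sup>+\<omega>. ennreal ((X (real (Suc (\<kappa> c)) * \<delta>) \<omega> $ i - X (real (\<kappa> c) * \<delta>) \<omega> $ i) ^ (2 * Suc q)) \<partial>M) \<le> ennreal ?m" if "c \<in> J" for c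
    proof -
      have "\<bar>real (Suc (\<kappa> c)) * \<delta> - real (\<kappa> c) * \<delta>\<bar> = \<delta>" using \<delta> by (simp add: algebra_simps)
      then have "(\<integral>\<^sup>+\<omega>. ennreal ((X (real (Suc (\<kappa> c)) * \<delta>) \<omega> $ i - X (real (\<kappa> c) * \<delta>) \<omega> $ i) ^ (2 * Suc q)) \<partial>M)
         = ennreal (gauss_moment (Suc q) * (\<delta> powr H) ^ (2 * Suc q))"
        using A.increment_moment[of "real (\<kappa> c) * \<delta>" "real (Suc (\<kappa> c)) * \<delta>" "Suc q"] JT(2)[OF that] by (simp only:)
      also have "\<dots> \<le> ennreal ?m"
        by (intro ennreal_leI mult_right_mono) (auto simp: moment_const_def power_mult)
      finally show ?thesis .
    qed
    show ?thesis unfolding fin[symmetric]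
      by (rule B.independent_product_moment[OF X_indep[OF False ij(2,1)] J(1) _ pos m0 mom S]) (use JT in blast)+
  next
    case True
    have "(\<integral>\<^sup>+\<omega>. ennreal ((\<Sum>c\<in>J. (X (real (Suc (\<kappa> c)) * \<delta>) \<omega> $ i - X (real (\<kappa> c) * \<delta>) \<omega> $ i)
        * (X (?v c) \<omega> $ j - X (?u c) \<omega> $ j)) ^ (2 * Suc q)) \<partial>M)
      = (\<integral>\<^sup>+\<omega>. ennreal ((\<Sum>c\<in>J. \<delta> * (X (?v c) \<omega> $ j - X (?u c) \<omega> $ j)) ^ (2 * Suc q)) \<partial>M)"
    proof (intro nn_integral_cong arg_cong[where f = ennreal] arg_cong[where f = "\<lambda>z. z ^ (2 * Suc q)"] sum.cong refl arg_cong2[where f = "(*)"])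
      fix \<omega> c assume "\<omega> \<in> space M" "c \<in> J"
      then show "X (real (Suc (\<kappa> c)) * \<delta>) \<omega> $ i - X (real (\<kappa> c) * \<delta>) \<omega> $ i = \<delta>"
        using X_time JT(2)[of c] True by (simp add: algebra_simps)
    qed
    also have "\<dots> \<le> ennreal (gauss_moment (Suc q) * (\<Sum>c\<in>J. \<Sum>d\<in>J. ?R c d) ^ q * (\<Sum>c\<in>J. (\<Sum>d\<in>J. ?R c d) * \<delta> ^ (2 * Suc q)))"
      using J JT pos by (intro B.weighted_increments_moment) auto
    also have "\<dots> \<le> ennreal (gauss_moment (Suc q) * ?m * ?S ^ Suc q)"
    proof (intro ennreal_leI)
      let ?s = "\<Sum>c\<in>J. \<Sum>d\<in>J. ?R c d"
      have s0: "0 \<le> ?s" by (intro sum_nonneg pos)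
      \<comment> \<open>A selected cell exists and fits into [0,T], whence \<delta> <= T.\<close>
      have dm: "\<delta> ^ (2 * Suc q) \<le> ?m" if "J \<noteq> {}"
      proof (cases "\<delta> = 0")
        case False
        have "\<delta> \<le> real k1 * \<delta>"
        proof -
          obtain c where "c \<in> J" using \<open>J \<noteq> {}\<close> by auto
          then have "1 \<le> real k1" using \<kappa>(1)[of c] by simp
          then show ?thesis using mult_right_mono[of 1 "real k1" \<delta>] \<delta> by simp
        qed
        then have "\<delta> \<le> T" using k by linarith
        have "\<delta> = \<delta> powr (1 - H) * \<delta> powr H" using False \<delta> by (simp flip: powr_add)
        also have "\<dots> \<le> T powr (1 - H) * \<delta> powr H" using \<open>\<delta> \<le> T\<close> \<delta> H by (intro mult_right_mono powr_mono2) auto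
        finally have "\<delta> ^ (2 * Suc q) \<le> (T powr (1 - H) * \<delta> powr H) ^ (2 * Suc q)" using \<delta> by (intro power_mono)
        also have "\<dots> = (T powr (1 - H)) ^ (2 * Suc q) * (\<delta> powr H) ^ (2 * Suc q)" by (rule power_mult_distrib)
        also have "\<dots> \<le> ?m"
          using gauss_moment_pos[of "Suc q"] by (intro mult_right_mono) (auto simp: moment_const_def)
        finally show ?thesis .
      qed (use m0 in simp)
      have "gauss_moment (Suc q) * ?s ^ q * (\<Sum>c\<in>J. (\<Sum>d\<in>J. ?R c d) * \<delta> ^ (2 * Suc q))
          = gauss_moment (Suc q) * \<delta> ^ (2 * Suc q) * ?s ^ Suc q"
        unfolding sum_distrib_right[symmetric] by (simp add: mult_ac)
      also have "\<dots> \<le> gauss_moment (Suc q) * ?m * ?S ^ Suc q"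
      proof (cases "J = {}")
        case True
        then show ?thesis using m0 gauss_moment_pos[of "Suc q"] by simp
      next
        case False
        show ?thesis
          using dm[OF False] m0 s0 S gauss_moment_pos[of "Suc q"] \<delta> moment_const[of "Suc q"]
          by (intro mult_mono power_mono mult_left_mono mult_nonneg_nonneg zero_le_power) auto
      qed
      finally show "gauss_moment (Suc q) * ?s ^ q * (\<Sum>c\<in>J. (\<Sum>d\<in>J. ?R c d) * \<delta> ^ (2 * Suc q))
        \<le> gauss_moment (Suc q) * ?m * ?S ^ Suc q" .
    qed
    finally show ?thesis unfolding fin .
  qed
qed

lemma X_measurable [measurable]: "t \<in> {0..T} \<Longrightarrow> (\<lambda>\<omega>. X t \<omega> $ l) \<in> borel_measurable M"
proof -
  assume t: "t \<in> {0..T}"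
  show "(\<lambda>\<omega>. X t \<omega> $ l) \<in> borel_measurable M"
  proof (cases "l = i\<^sub>1")
    case True
    then show ?thesis using measurable_cong[of M "\<lambda>\<omega>. X t \<omega> $ l" "\<lambda>_. t"] X_time t by simp
  next
    case False
    interpret B: fbm M H T "\<lambda>t \<omega>. X t \<omega> $ l" by (rule X_fbm[OF False])
    show ?thesis using t by (rule B.B_measurable)
  qed
qed

text \<open>Each level splits into an even-odd and an odd-even sum of products on the grid of step h
  / 2^(r + 1), and both fall under \<open>product_sum_moment\<close>. One factor H-th power measures
  a single fine cell, the other the whole run.\<close>

lemma level_moment:
  assumes h: "0 \<le> h" and ab: "a < b" and T: "real b * h \<le> T" and "i \<noteq> j"
  shows "(\<integral>\<^sup>+\<omega>. ennreal ((\<Sum>k\<in>{a..<b}. levy_level (\<lambda>l t. X t \<omega> $ l) i j (real k * h) (real (Suc k) * h) r) ^ (2 * Suc q)) \<partial>M)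
    \<le> ennreal (2 * gauss_moment (Suc q) * moment_const (Suc q) * ((h / 2 ^ Suc r) powr H * (real (b - a) * h) powr H) ^ (2 * Suc q))"
proof -
  define L where "L i j \<omega> = (\<Sum>k\<in>{a..<b}. levy_level (\<lambda>l t. X t \<omega> $ l) i j (real k * h) (real (Suc k) * h) r)" for i j \<omega>
  define \<delta> where "\<delta> = h / 2 ^ Suc r"
  define k0 where "k0 = a * 2 ^ Suc r"
  define k1 where "k1 = b * 2 ^ Suc r"
  let ?J = "{a * 2 ^ r..<b * 2 ^ r}"
  have \<delta>: "0 \<le> \<delta>" "h / 2 ^ r = 2 * \<delta>" using h by (auto simp: \<delta>_def)
  have k: "k0 \<le> k1" "real k1 * \<delta> \<le> T" "real (k1 - k0) * \<delta> = real (b - a) * h"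
    using ab T by (auto simp: k0_def k1_def \<delta>_def of_nat_diff field_simps)
  let ?C = "gauss_moment (Suc q) * moment_const (Suc q) * (\<delta> powr H * (real (b - a) * h) powr H) ^ (2 * Suc q)"
  have C0: "0 \<le> ?C" using gauss_moment_pos[of "Suc q"] moment_const[of "Suc q"]
    by (intro mult_nonneg_nonneg) auto
  have main: "(\<integral>\<^sup>+\<omega>. ennreal (L i j \<omega> ^ (2 * Suc q)) \<partial>M) \<le> ennreal (2 * ?C)" if ij: "i \<noteq> j" "j \<noteq> i\<^sub>1" for i j
  proof -
    define w where "w l k \<omega> = X (real (Suc k) * \<delta>) \<omega> $ l - X (real k * \<delta>) \<omega> $ l" for l k \<omega>
    define P where "P \<omega> = (\<Sum>c\<in>?J. w i (2 * c) \<omega> * w j (2 * c + 1) \<omega>)" for \<omega>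
    define P' where "P' \<omega> = (\<Sum>c\<in>?J. w i (2 * c + 1) \<omega> * w j (2 * c) \<omega>)" for \<omega>
    have LP: "L i j \<omega> = (P \<omega> - P' \<omega>) / 2" for \<omega>
      unfolding L_def sum_levy_level[OF less_imp_le[OF ab]] \<delta>(2) levy_piece_grid P_def P'_def w_def
      by (simp only: sum_subtractf sum_divide_distrib[symmetric])
    have wm: "w l k \<in> borel_measurable M" if "k < k1" for l k
    proof -
      have "real a * \<delta> \<in> {0..T}" if "a \<le> k1" for a
        using that \<delta> k order_trans[OF mult_right_mono[of "real a" "real k1" \<delta>]] by auto
      then show ?thesis unfolding w_def using that by (intro borel_measurable_diff X_measurable) (auto simp del: of_nat_Suc)
    qed
    have Jk: "2 * c \<in> {k0..<k1}" "2 * c + 1 \<in> {k0..<k1}" if "c \<in> ?J" for c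
      using that by (auto simp: k0_def k1_def)
    have [measurable]: "P \<in> borel_measurable M" "P' \<in> borel_measurable M"
      unfolding P_def P'_def using Jk by (auto intro!: borel_measurable_sum borel_measurable_times wm)
    have "(\<integral>\<^sup>+\<omega>. ennreal (L i j \<omega> ^ (2 * Suc q)) \<partial>M) \<le> (\<integral>\<^sup>+\<omega>. ennreal (P \<omega> ^ (2 * Suc q)) + ennreal (P' \<omega> ^ (2 * Suc q)) \<partial>M)"
      unfolding LP
    proof (intro nn_integral_mono)
      fix \<omega>
      have "0 \<le> P \<omega> ^ (2 * Suc q)" "0 \<le> P' \<omega> ^ (2 * Suc q)" by (simp_all only: power_mult zero_le_power zero_le_power2)
      then show "ennreal (((P \<omega> - P' \<omega>) / 2) ^ (2 * Suc q)) \<le> ennreal (P \<omega> ^ (2 * Suc q)) + ennreal (P' \<omega> ^ (2 * Suc q))"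
        using half_diff_power_le[of "P \<omega>" "P' \<omega>" "Suc q"] by (simp only: ennreal_plus[symmetric] ennreal_leI)
    qed
    also have "\<dots> = (\<integral>\<^sup>+\<omega>. ennreal (P \<omega> ^ (2 * Suc q)) \<partial>M) + (\<integral>\<^sup>+\<omega>. ennreal (P' \<omega> ^ (2 * Suc q)) \<partial>M)"
      by (rule nn_integral_add) simp_all
    also have "\<dots> \<le> ennreal ?C + ennreal ?C"
    proof (intro add_mono)
      show "(\<integral>\<^sup>+\<omega>. ennreal (P \<omega> ^ (2 * Suc q)) \<partial>M) \<le> ennreal ?C"
        unfolding P_def w_def k(3)[symmetric]
        using Jk by (intro product_sum_moment[OF ij \<delta>(1) k(1,2)]) (auto simp: inj_on_def)
      show "(\<integral>\<^sup>+\<omega>. ennreal (P' \<omega> ^ (2 * Suc q)) \<partial>M) \<le> ennreal ?C"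
        unfolding P'_def w_def k(3)[symmetric]
        using Jk by (intro product_sum_moment[OF ij \<delta>(1) k(1,2)]) (auto simp: inj_on_def)
    qed
    also have "\<dots> = ennreal (2 * ?C)" unfolding ennreal_plus[OF C0 C0, symmetric] mult_2[of ?C] ..
    finally show ?thesis .
  qed
  have "(\<integral>\<^sup>+\<omega>. ennreal (L i j \<omega> ^ (2 * Suc q)) \<partial>M) \<le> ennreal (2 * ?C)"
  proof (cases "j = i\<^sub>1")
    case False
    then show ?thesis using \<open>i \<noteq> j\<close> by (intro main)
  next
    case True
    \<comment> \<open>If time occupies the Gaussian slot, antisymmetry exchanges the two
      coordinates.\<close>
    have "L i j \<omega> ^ (2 * Suc q) = L j i \<omega> ^ (2 * Suc q)" for \<omega>
    proof -
      have "L i j \<omega> = - L j i \<omega>" unfolding L_def levy_level_swap[of _ i j] sum_negf ..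
      then show ?thesis by (simp add: power_mult)
    qed
    then show ?thesis using main[of j i] True \<open>i \<noteq> j\<close> by simp
  qed
  then show ?thesis unfolding L_def \<delta>_def by (simp only: mult.assoc)
qed

end


section \<open>Families with bounded moments\<close>

lemma SUP_power_le:
  fixes f :: "'i \<Rightarrow> ennreal"
  assumes "0 < q" "\<And>i. i \<in> I \<Longrightarrow> f i ^ q \<le> S"
  shows "(SUP i\<in>I. f i) ^ q \<le> S"
proof (cases S)
  case (real s)
  have "f i \<le> ennreal (root q s)" if "i \<in> I" for i
  proof (cases "f i")
    case (real a)
    then have "a ^ q \<le> s" using assms(2)[OF that] \<open>S = ennreal s\<close> \<open>0 \<le> s\<close> by (simp add: ennreal_power)
    then have "root q (a ^ q) \<le> root q s" using assms(1) by (intro real_root_le_mono)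
    then show ?thesis using real assms(1) by (simp add: real_root_power_cancel ennreal_leI)
  next
    case top
    then show ?thesis using assms(2)[OF that] assms(1) \<open>S = ennreal s\<close> by (simp add: top_power_ennreal top_unique)
  qed
  then have "(SUP i\<in>I. f i) \<le> ennreal (root q s)" by (rule SUP_least)
  then have "(SUP i\<in>I. f i) ^ q \<le> ennreal (root q s) ^ q" by (intro power_mono) auto
  also have "\<dots> = S" using real assms(1) by (simp add: ennreal_power real_root_pow_pos2)
  finally show ?thesis .
qed simp

lemma ennreal_power_le_add:
  fixes x :: ennreal
  assumes "q \<le> q'"
  shows "x ^ q \<le> 1 + x ^ q'"
proof (cases "x \<le> 1")
  case True
  then have "x ^ q \<le> 1" using power_mono[OF True, of q] by simp
  then show ?thesis by (simp add: add_increasing2)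
next
  case False
  then have "x ^ q \<le> x ^ q'" using assms by (intro power_increasing) auto
  then show ?thesis by (simp add: add_increasing)
qed

text \<open>The index is the number of cells, and the bounds are uniform in it. Integer orders
  dominate all real ones, and extended values keep suprema total.\<close>

definition moment_bounded :: "'w measure \<Rightarrow> (nat \<Rightarrow> 'w \<Rightarrow> ennreal) \<Rightarrow> bool" where
  "moment_bounded M U \<longleftrightarrow> (\<forall>n\<ge>1. U n \<in> borel_measurable M) \<and>
     (\<forall>q. \<exists>C::real. \<forall>n\<ge>1. (\<integral>\<^sup>+\<omega>. U n \<omega> ^ q \<partial>M) \<le> ennreal C)"

context prob_space
begin

lemma moment_le_add:
  fixes U :: "'a \<Rightarrow> ennreal"
  assumes "U \<in> borel_measurable M" "q \<le> q'" "(\<integral>\<^sup>+\<omega>. U \<omega> ^ q' \<partial>M) \<le> ennreal C"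
  shows "(\<integral>\<^sup>+\<omega>. U \<omega> ^ q \<partial>M) \<le> ennreal (1 + max 0 C)"
proof -
  note [measurable] = assms(1)
  have "(\<integral>\<^sup>+\<omega>. U \<omega> ^ q \<partial>M) \<le> (\<integral>\<^sup>+\<omega>. 1 + U \<omega> ^ q' \<partial>M)"
    by (intro nn_integral_mono ennreal_power_le_add assms)
  also have "\<dots> = 1 + (\<integral>\<^sup>+\<omega>. U \<omega> ^ q' \<partial>M)" by (subst nn_integral_add) (auto simp: emeasure_space_1)
  also have "\<dots> \<le> ennreal 1 + ennreal (max 0 C)"
    using order_trans[OF assms(3) ennreal_leI[of C "max 0 C"]] by (intro add_mono) auto
  also have "\<dots> = ennreal (1 + max 0 C)" by (subst ennreal_plus) auto
  finally show ?thesis .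
qed

lemma moment_bounded_measurable: "moment_bounded M U \<Longrightarrow> 1 \<le> n \<Longrightarrow> U n \<in> borel_measurable M"
  by (simp add: moment_bounded_def)

lemma moment_bounded_bound:
  assumes "moment_bounded M U"
  shows "\<exists>C::real. 0 \<le> C \<and> (\<forall>n\<ge>1. (\<integral>\<^sup>+\<omega>. U n \<omega> ^ q \<partial>M) \<le> ennreal C)"
proof -
  from assms have "\<exists>C::real. \<forall>n\<ge>1. (\<integral>\<^sup>+\<omega>. U n \<omega> ^ q \<partial>M) \<le> ennreal C"
    by (simp add: moment_bounded_def)
  then obtain C :: real where C: "\<forall>n\<ge>1. (\<integral>\<^sup>+\<omega>. U n \<omega> ^ q \<partial>M) \<le> ennreal C" ..
  have "ennreal C \<le> ennreal (max 0 C)" by (intro ennreal_leI) simp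
  then have "\<forall>n\<ge>1. (\<integral>\<^sup>+\<omega>. U n \<omega> ^ q \<partial>M) \<le> ennreal (max 0 C)"
    using C by (blast intro: order_trans)
  then show ?thesis by (intro exI[of _ "max 0 C"]) auto
qed

text \<open>On a probability space arbitrarily high moments control all lower ones, so estimates
  valid for large orders only are enough.\<close>

lemma moment_boundedI:
  assumes "\<And>n. 1 \<le> n \<Longrightarrow> U n \<in> borel_measurable M"
    and "\<And>q. \<exists>C::real. \<exists>q'\<ge>q. \<forall>n\<ge>1. (\<integral>\<^sup>+\<omega>. U n \<omega> ^ q' \<partial>M) \<le> ennreal C"
  shows "moment_bounded M U"
  unfolding moment_bounded_def
proof (intro conjI allI impI)
  fix q
  obtain C :: real and q' where C: "q \<le> q'" "\<forall>n\<ge>1. (\<integral>\<^sup>+\<omega>. U n \<omega> ^ q' \<partial>M) \<le> ennreal C"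
    using assms(2)[of q] by blast
  have "\<forall>n\<ge>1. (\<integral>\<^sup>+\<omega>. U n \<omega> ^ q \<partial>M) \<le> ennreal (1 + max 0 C)"
    using moment_le_add[OF assms(1) C(1)] C(2) by blast
  then show "\<exists>C::real. \<forall>n\<ge>1. (\<integral>\<^sup>+\<omega>. U n \<omega> ^ q \<partial>M) \<le> ennreal C" ..
qed (rule assms(1))

lemma ennreal_add_power_le: "(a + b) ^ q \<le> 2 ^ q * (a ^ q + b ^ q)" for a b :: ennreal
proof -
  have "a + b \<le> max a b + max a b" by (intro add_mono) auto
  then have "(a + b) ^ q \<le> (2 * max a b) ^ q" by (intro power_mono) (simp_all only: mult_2 zero_le)
  also have "\<dots> = 2 ^ q * max a b ^ q" by (rule power_mult_distrib)
  also have "\<dots> \<le> 2 ^ q * (a ^ q + b ^ q)"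
    by (intro mult_left_mono) (simp_all add: max_def)
  finally show ?thesis .
qed

lemma ennreal_mult_power_le: "(a * b) ^ q \<le> a ^ (2 * q) + b ^ (2 * q)" for a b :: ennreal
proof -
  have "(a * b) ^ q \<le> ((max a b)\<^sup>2) ^ q"
    unfolding power2_eq_square by (intro power_mono mult_mono) auto
  also have "\<dots> = max a b ^ (2 * q)" by (rule power_mult[symmetric])
  also have "\<dots> \<le> a ^ (2 * q) + b ^ (2 * q)" by (simp add: max_def)
  finally show ?thesis .
qed

lemma moment_bounded_add:
  assumes U: "moment_bounded M U" and V: "moment_bounded M V"
  shows "moment_bounded M (\<lambda>n \<omega>. U n \<omega> + V n \<omega>)"
proof (rule moment_boundedI)
  show "(\<lambda>\<omega>. U n \<omega> + V n \<omega>) \<in> borel_measurable M" if "1 \<le> n" for n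
    by (intro borel_measurable_add moment_bounded_measurable[OF U that] moment_bounded_measurable[OF V that])
  fix q
  obtain A :: real where A: "0 \<le> A" "\<And>n. 1 \<le> n \<Longrightarrow> (\<integral>\<^sup>+\<omega>. U n \<omega> ^ q \<partial>M) \<le> ennreal A"
    using moment_bounded_bound[OF U] by blast
  obtain B :: real where B: "0 \<le> B" "\<And>n. 1 \<le> n \<Longrightarrow> (\<integral>\<^sup>+\<omega>. V n \<omega> ^ q \<partial>M) \<le> ennreal B"
    using moment_bounded_bound[OF V] by blast
  have "(\<integral>\<^sup>+\<omega>. (U n \<omega> + V n \<omega>) ^ q \<partial>M) \<le> ennreal (2 ^ q * (A + B))" if n: "1 \<le> n" for n
  proof -
    note [measurable] = moment_bounded_measurable[OF U n] moment_bounded_measurable[OF V n]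
    have "(\<integral>\<^sup>+\<omega>. (U n \<omega> + V n \<omega>) ^ q \<partial>M) \<le> (\<integral>\<^sup>+\<omega>. 2 ^ q * (U n \<omega> ^ q + V n \<omega> ^ q) \<partial>M)"
      by (intro nn_integral_mono ennreal_add_power_le)
    also have "\<dots> = 2 ^ q * ((\<integral>\<^sup>+\<omega>. U n \<omega> ^ q \<partial>M) + (\<integral>\<^sup>+\<omega>. V n \<omega> ^ q \<partial>M))"
      by (simp add: nn_integral_cmult nn_integral_add)
    also have "\<dots> \<le> 2 ^ q * (ennreal A + ennreal B)"
      by (intro mult_left_mono add_mono A(2)[OF n] B(2)[OF n]) simp
    also have "\<dots> = ennreal (2 ^ q) * ennreal (A + B)"
      using A(1) B(1) by (simp add: ennreal_plus ennreal_power[symmetric] ennreal_numeral[symmetric] del: ennreal_numeral)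
    also have "\<dots> = ennreal (2 ^ q * (A + B))" by (rule ennreal_mult'[symmetric]) simp
    finally show ?thesis .
  qed
  then show "\<exists>C::real. \<exists>q'\<ge>q. \<forall>n\<ge>1. (\<integral>\<^sup>+\<omega>. (U n \<omega> + V n \<omega>) ^ q' \<partial>M) \<le> ennreal C" by blast
qed

lemma moment_bounded_mult:
  assumes U: "moment_bounded M U" and V: "moment_bounded M V"
  shows "moment_bounded M (\<lambda>n \<omega>. U n \<omega> * V n \<omega>)"
proof (rule moment_boundedI)
  show "(\<lambda>\<omega>. U n \<omega> * V n \<omega>) \<in> borel_measurable M" if "1 \<le> n" for n
    by (intro borel_measurable_times_ennreal moment_bounded_measurable[OF U that] moment_bounded_measurable[OF V that])
  fix q
  obtain A :: real where A: "0 \<le> A" "\<And>n. 1 \<le> n \<Longrightarrow> (\<integral>\<^sup>+\<omega>. U n \<omega> ^ (2 * q) \<partial>M) \<le> ennreal A"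
    using moment_bounded_bound[OF U] by blast
  obtain B :: real where B: "0 \<le> B" "\<And>n. 1 \<le> n \<Longrightarrow> (\<integral>\<^sup>+\<omega>. V n \<omega> ^ (2 * q) \<partial>M) \<le> ennreal B"
    using moment_bounded_bound[OF V] by blast
  have "(\<integral>\<^sup>+\<omega>. (U n \<omega> * V n \<omega>) ^ q \<partial>M) \<le> ennreal (A + B)" if n: "1 \<le> n" for n
  proof -
    note [measurable] = moment_bounded_measurable[OF U n] moment_bounded_measurable[OF V n]
    have "(\<integral>\<^sup>+\<omega>. (U n \<omega> * V n \<omega>) ^ q \<partial>M) \<le> (\<integral>\<^sup>+\<omega>. U n \<omega> ^ (2 * q) + V n \<omega> ^ (2 * q) \<partial>M)"
      by (intro nn_integral_mono ennreal_mult_power_le)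
    also have "\<dots> = (\<integral>\<^sup>+\<omega>. U n \<omega> ^ (2 * q) \<partial>M) + (\<integral>\<^sup>+\<omega>. V n \<omega> ^ (2 * q) \<partial>M)"
      by (simp add: nn_integral_add)
    also have "\<dots> \<le> ennreal A + ennreal B" by (intro add_mono A(2)[OF n] B(2)[OF n])
    finally show ?thesis using A(1) B(1) by simp
  qed
  then show "\<exists>C::real. \<exists>q'\<ge>q. \<forall>n\<ge>1. (\<integral>\<^sup>+\<omega>. (U n \<omega> * V n \<omega>) ^ q' \<partial>M) \<le> ennreal C" by blast
qed

lemma moment_bounded_const: "0 \<le> c \<Longrightarrow> moment_bounded M (\<lambda>n \<omega>. ennreal c)"
proof (rule moment_boundedI)
  fix q
  assume "0 \<le> c"
  then have "(\<integral>\<^sup>+\<omega>. ennreal c ^ q \<partial>M) \<le> ennreal (c ^ q)" by (simp add: ennreal_power emeasure_space_1)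
  then show "\<exists>C. \<exists>q'\<ge>q. \<forall>n\<ge>1::nat. (\<integral>\<^sup>+\<omega>. ennreal c ^ q' \<partial>M) \<le> ennreal C" by blast
qed simp

lemma moment_bounded_finite:
  assumes U: "moment_bounded M U" and n: "1 \<le> n"
  shows "AE \<omega> in M. U n \<omega> \<noteq> \<top>"
proof -
  obtain A :: real where A: "0 \<le> A" "\<And>n. 1 \<le> n \<Longrightarrow> (\<integral>\<^sup>+\<omega>. U n \<omega> ^ 1 \<partial>M) \<le> ennreal A"
    using moment_bounded_bound[OF U] by blast
  have "(\<integral>\<^sup>+\<omega>. U n \<omega> \<partial>M) \<noteq> \<infinity>" using A(2)[OF n] by (auto simp: top_unique)
  from nn_integral_PInf_AE[OF moment_bounded_measurable[OF U n] this] show ?thesis by simp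
qed

end

section \<open>Suprema over the grid\<close>

lemma suminf_ennreal_half: "0 \<le> c \<Longrightarrow> (\<Sum>r. ennreal (c * (1 / 2) ^ r)) = ennreal (2 * c)"
proof -
  assume "0 \<le> c"
  have s: "(\<lambda>r. c * (1 / 2) ^ r) sums (c * (1 / (1 - 1 / 2)))"
    by (intro sums_mult geometric_sums) simp
  have "(\<Sum>r. ennreal (c * (1 / 2) ^ r)) = ennreal (c * (1 / (1 - 1 / 2)))"
    by (rule suminf_ennreal_eq[OF _ s]) (use \<open>0 \<le> c\<close> in simp)
  then show ?thesis by (simp add: mult.commute)
qed

text \<open>A union over 2^r terms is paid for by a small gain e in the exponent once the moment
  order m is large; what remains is summable in r.\<close>

lemma powr_power_half:
  assumes "2 \<le> e * real m"
  shows "2 ^ r * ((2 ^ r) powr (- e)) ^ m \<le> (1 / 2) ^ r"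
proof -
  have "((2 ^ r) powr (- e)) ^ m = (2 ^ r) powr (- (e * real m))"
    by (simp add: powr_powr mult.assoc flip: powr_realpow)
  also have "\<dots> \<le> (2 ^ r) powr (- 2)" using assms by (intro powr_mono) auto
  also have "\<dots> = (1 / 2) ^ r * (1 / 2) ^ r" by (simp add: powr_minus powr_numeral power2_eq_square power_divide divide_simps)
  finally have "2 ^ r * ((2 ^ r) powr (- e)) ^ m \<le> 2 ^ r * ((1 / 2) ^ r * (1 / 2) ^ r)" by (intro mult_left_mono) auto
  also have "\<dots> = (1 / 2) ^ r" by (simp add: power_divide)
  finally show ?thesis .
qed

context driving
begin

text \<open>\<open>kappa \<beta> 1\<close> bounds the Hoelder constant of the fractional coordinates on \<open>[0,T]\<close>, and \<open>kappa \<beta> n\<close>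
  their oscillation within a cell of the grid, up to constants.\<close>

definition kappa :: "real \<Rightarrow> nat \<Rightarrow> 'w \<Rightarrow> ennreal" where
  "kappa \<beta> n \<omega> = (SUP (l, r, j) \<in> {(l, r, j). l \<noteq> i\<^sub>1 \<and> j < n * 2 ^ r}.
     ennreal ((2 ^ r) powr \<beta> * \<bar>X (real (Suc j) * (T / real n / 2 ^ r)) \<omega> $ l - X (real j * (T / real n / 2 ^ r)) \<omega> $ l\<bar>))"

lemma grid_in:
  assumes "1 \<le> n" "j \<le> n * 2 ^ r"
  shows "real j * (T / real n / 2 ^ r) \<in> {0..T}"
proof -
  have "real j \<le> real n * 2 ^ r" using assms(2) by (metis of_nat_le_iff of_nat_mult of_nat_numeral of_nat_power)
  then have "real j * (T / real n / 2 ^ r) \<le> (real n * 2 ^ r) * (T / real n / 2 ^ r)" using T by (intro mult_right_mono) auto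
  then show ?thesis using assms T by simp
qed

lemma kappa_measurable:
  assumes "1 \<le> n" shows "kappa \<beta> n \<in> borel_measurable M"
  unfolding kappa_def
proof (rule borel_measurable_SUP)
  show "countable {(l::'d, r::nat, j). l \<noteq> i\<^sub>1 \<and> j < n * 2 ^ r}" by (rule countableI_type)
  fix p :: "'d \<times> nat \<times> nat" assume p: "p \<in> {(l, r, j). l \<noteq> i\<^sub>1 \<and> j < n * 2 ^ r}"
  obtain l r j where p': "p = (l, r, j)" by (cases p)
  have "real (Suc j) * (T / real n / 2 ^ r) \<in> {0..T}" "real j * (T / real n / 2 ^ r) \<in> {0..T}"
    by (rule grid_in; use p p' assms in simp)+
  note [measurable] = this[THEN X_measurable, of l]
  show "(\<lambda>\<omega>. case p of (l, r, j) \<Rightarrow> ennreal ((2 ^ r) powr \<beta> * \<bar>X (real (Suc j) * (T / real n / 2 ^ r)) \<omega> $ l - X (real j * (T / real n / 2 ^ r)) \<omega> $ l\<bar>)) \<in> borel_measurable M"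
    unfolding p' prod.case by measurable
qed

text \<open>The power of the supremum is bounded by the sum over the n * 2^r increments of each
  level. The gain H - \<beta> makes the levels summable; the factor n, the number of cells,
  remains.\<close>

lemma kappa_moment:
  assumes n: "1 \<le> n" and q: "2 \<le> (H - \<beta>) * real (2 * q)"
  shows "(\<integral>\<^sup>+\<omega>. kappa \<beta> n \<omega> ^ (2 * q) \<partial>M) \<le> ennreal (2 * real CARD('d) * real n * gauss_moment q * ((T / real n) powr H) ^ (2 * q))"
proof -
  let ?h = "T / real n"
  have q0: "0 < q" using q by (cases q) auto
  define F where "F l r j \<omega> = ennreal ((2 ^ r) powr \<beta> * \<bar>X (real (Suc j) * (?h / 2 ^ r)) \<omega> $ l - X (real j * (?h / 2 ^ r)) \<omega> $ l\<bar>)"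
    for l and r j :: nat and \<omega>
  let ?L = "{l. l \<noteq> i\<^sub>1}"
  have grid: "real (Suc j) * (?h / 2 ^ r) \<in> {0..T}" "real j * (?h / 2 ^ r) \<in> {0..T}" if "j < n * 2 ^ r" for j r
    by (rule grid_in; use that n in simp)+
  have Fm: "F l r j \<in> borel_measurable M" if "j < n * 2 ^ r" for l r j
  proof -
    note [measurable] = grid[OF that, THEN X_measurable, of l]
    show ?thesis unfolding F_def by measurable
  qed
  have kF: "kappa \<beta> n \<omega> = (SUP (l, r, j) \<in> {(l, r, j). l \<noteq> i\<^sub>1 \<and> j < n * 2 ^ r}. F l r j \<omega>)" for \<omega>
    unfolding kappa_def F_def ..
  have le: "kappa \<beta> n \<omega> ^ (2 * q) \<le> (\<Sum>l\<in>?L. \<Sum>r. \<Sum>j<n * 2 ^ r. F l r j \<omega> ^ (2 * q))" for \<omega>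
    unfolding kF
  proof (rule SUP_power_le)
    fix p :: "'d \<times> nat \<times> nat" assume "p \<in> {(l, r, j). l \<noteq> i\<^sub>1 \<and> j < n * 2 ^ r}"
    then obtain l r j where p: "p = (l, r, j)" "l \<noteq> i\<^sub>1" "j < n * 2 ^ r" by auto
    have "F l r j \<omega> ^ (2 * q) \<le> (\<Sum>j<n * 2 ^ r. F l r j \<omega> ^ (2 * q))" using p by (intro member_le_sum) auto
    also have "\<dots> \<le> (\<Sum>r. \<Sum>j<n * 2 ^ r. F l r j \<omega> ^ (2 * q))"
      using sum_le_suminf[of "\<lambda>r. \<Sum>j<n * 2 ^ r. F l r j \<omega> ^ (2 * q)" "{r}"] by simp
    also have "\<dots> \<le> (\<Sum>l\<in>?L. \<Sum>r. \<Sum>j<n * 2 ^ r. F l r j \<omega> ^ (2 * q))"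
      using p by (intro member_le_sum) auto
    finally show "(case p of (l, r, j) \<Rightarrow> F l r j \<omega>) ^ (2 * q) \<le> (\<Sum>l\<in>?L. \<Sum>r. \<Sum>j<n * 2 ^ r. F l r j \<omega> ^ (2 * q))"
      by (simp add: p)
  qed (use q0 in simp)
  let ?C = "real n * gauss_moment q * (?h powr H) ^ (2 * q)"
  have C0: "0 \<le> ?C" using gauss_moment_pos[of q] by simp
  have mom: "(\<integral>\<^sup>+\<omega>. (\<Sum>j<n * 2 ^ r. F l r j \<omega> ^ (2 * q)) \<partial>M) \<le> ennreal (?C * (1/2) ^ r)" if l: "l \<noteq> i\<^sub>1" for l r
  proof -
    interpret B: fbm M H T "\<lambda>t \<omega>. X t \<omega> $ l" by (rule X_fbm[OF l])
    have Fj: "(\<integral>\<^sup>+\<omega>. F l r j \<omega> ^ (2 * q) \<partial>M) = ennreal (gauss_moment q * (?h powr H) ^ (2 * q) * ((2 ^ r) powr (- (H - \<beta>))) ^ (2 * q))"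
      if j: "j < n * 2 ^ r" for j
    proof -
      have "F l r j \<omega> ^ (2 * q) = ennreal (((2 ^ r) powr \<beta>) ^ (2 * q)) * ennreal ((X (real (Suc j) * (?h / 2 ^ r)) \<omega> $ l - X (real j * (?h / 2 ^ r)) \<omega> $ l) ^ (2 * q))" for \<omega>
        unfolding F_def by (subst ennreal_power) (auto simp: power_mult_distrib power_even_abs ennreal_mult')
      then have "(\<integral>\<^sup>+\<omega>. F l r j \<omega> ^ (2 * q) \<partial>M) = ennreal (((2 ^ r) powr \<beta>) ^ (2 * q)) *
          (\<integral>\<^sup>+\<omega>. ennreal ((X (real (Suc j) * (?h / 2 ^ r)) \<omega> $ l - X (real j * (?h / 2 ^ r)) \<omega> $ l) ^ (2 * q)) \<partial>M)"
        using grid[OF j, THEN X_measurable, of l] by (simp add: nn_integral_cmult)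
      also have "(\<integral>\<^sup>+\<omega>. ennreal ((X (real (Suc j) * (?h / 2 ^ r)) \<omega> $ l - X (real j * (?h / 2 ^ r)) \<omega> $ l) ^ (2 * q)) \<partial>M)
          = ennreal (gauss_moment q * (\<bar>real (Suc j) * (?h / 2 ^ r) - real j * (?h / 2 ^ r)\<bar> powr H) ^ (2 * q))"
        by (rule B.increment_moment[OF grid(2,1)[OF j]])
      also have "\<bar>real (Suc j) * (?h / 2 ^ r) - real j * (?h / 2 ^ r)\<bar> = ?h / 2 ^ r"
      proof -
        have "\<bar>real (Suc j) * d - real j * d\<bar> = d" if "0 \<le> d" for d using that by (simp add: algebra_simps)
        then show ?thesis by this (use T in simp)
      qed
      also have "ennreal (((2 ^ r) powr \<beta>) ^ (2 * q)) * ennreal (gauss_moment q * ((?h / 2 ^ r) powr H) ^ (2 * q))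
         = ennreal (gauss_moment q * ((2 ^ r) powr \<beta> * (?h / 2 ^ r) powr H) ^ (2 * q))"
        by (subst ennreal_mult'[symmetric]) (auto simp: power_mult_distrib mult_ac)
      also have "(2 ^ r) powr \<beta> * (?h / 2 ^ r) powr H = ?h powr H * (2 ^ r) powr (- (H - \<beta>))"
        using T by (simp add: powr_divide powr_diff powr_mult)
      finally show ?thesis by (simp add: power_mult_distrib mult.assoc)
    qed
    have "(\<integral>\<^sup>+\<omega>. (\<Sum>j<n * 2 ^ r. F l r j \<omega> ^ (2 * q)) \<partial>M) = (\<Sum>j<n * 2 ^ r. \<integral>\<^sup>+\<omega>. F l r j \<omega> ^ (2 * q) \<partial>M)"
      by (rule nn_integral_sum) (use Fm in auto)
    also have "\<dots> = (\<Sum>j<n * 2 ^ r. ennreal (gauss_moment q * (?h powr H) ^ (2 * q) * ((2 ^ r) powr (- (H - \<beta>))) ^ (2 * q)))"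
      by (rule sum.cong) (auto simp: Fj)
    also have "\<dots> = ennreal (\<Sum>j<n * 2 ^ r. gauss_moment q * (?h powr H) ^ (2 * q) * ((2 ^ r) powr (- (H - \<beta>))) ^ (2 * q))"
      by (rule sum_ennreal) (auto simp: gauss_moment_pos less_imp_le)
    also have "\<dots> = ennreal (?C * (2 ^ r * ((2 ^ r) powr (- (H - \<beta>))) ^ (2 * q)))" by (simp add: mult_ac)
    also have "\<dots> \<le> ennreal (?C * (1/2) ^ r)"
      using powr_power_half[OF q] C0 by (intro ennreal_leI mult_left_mono)
    finally show ?thesis .
  qed
  have Fm': "(\<lambda>\<omega>. \<Sum>j<n * 2 ^ r. F l r j \<omega> ^ (2 * q)) \<in> borel_measurable M" for l r
    using Fm by (intro borel_measurable_sum borel_measurable_power) auto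
  have "(\<integral>\<^sup>+\<omega>. kappa \<beta> n \<omega> ^ (2 * q) \<partial>M) \<le> (\<integral>\<^sup>+\<omega>. (\<Sum>l\<in>?L. \<Sum>r. \<Sum>j<n * 2 ^ r. F l r j \<omega> ^ (2 * q)) \<partial>M)"
    by (intro nn_integral_mono le)
  also have "\<dots> = (\<Sum>l\<in>?L. \<Sum>r. \<integral>\<^sup>+\<omega>. (\<Sum>j<n * 2 ^ r. F l r j \<omega> ^ (2 * q)) \<partial>M)"
    using Fm' by (simp add: nn_integral_sum nn_integral_suminf)
  also have "\<dots> \<le> (\<Sum>l\<in>?L. \<Sum>r. ennreal (?C * (1/2) ^ r))"
    using mom by (intro sum_mono suminf_le) auto
  also have "\<dots> = of_nat (card ?L) * ennreal (2 * ?C)"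
    by (simp only: suminf_ennreal_half[OF C0] sum_constant)
  also have "\<dots> \<le> of_nat CARD('d) * ennreal (2 * ?C)"
    by (intro mult_right_mono) (auto intro: card_mono)
  also have "\<dots> = ennreal (2 * real CARD('d) * real n * gauss_moment q * (?h powr H) ^ (2 * q))"
    using C0 by (subst ennreal_of_nat_eq_real_of_nat, subst ennreal_mult'[symmetric]) (auto simp: mult_ac)
  finally show ?thesis .
qed

end


section \<open>Suprema over blocks of Levy areas\<close>

lemma sum_powers_le:
  assumes "1 \<le> n"
  shows "(\<Sum>\<rho> | 2 ^ \<rho> \<le> n. (2::nat) ^ \<rho>) \<le> 2 * n" "finite {\<rho>. (2::nat) ^ \<rho> \<le> n}"
proof -
  have "\<exists>R. 2 ^ R \<le> n \<and> n < 2 ^ (R + 1)" using assms by (intro ex_power_ivl1) auto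
  then obtain R where R: "2 ^ R \<le> n" "n < 2 ^ (R + 1)" by blast
  have "\<rho> \<le> R" if "(2::nat) ^ \<rho> \<le> n" for \<rho>
  proof -
    have "(2::nat) ^ \<rho> < 2 ^ (R + 1)" using that R by linarith
    then have "\<rho> < R + 1" by (rule power_less_imp_less_exp[rotated]) simp
    then show ?thesis by simp
  qed
  then have sub: "{\<rho>. (2::nat) ^ \<rho> \<le> n} \<subseteq> {..<Suc R}" by (auto simp: less_Suc_eq_le)
  then show "finite {\<rho>. (2::nat) ^ \<rho> \<le> n}" by (rule finite_subset) simp
  have geo: "(\<Sum>\<rho><m. (2::nat) ^ \<rho>) \<le> 2 ^ m" for m by (induction m) auto
  have "(\<Sum>\<rho> | 2 ^ \<rho> \<le> n. (2::nat) ^ \<rho>) \<le> (\<Sum>\<rho><Suc R. 2 ^ \<rho>)" using sub by (intro sum_mono2) auto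
  also have "\<dots> \<le> 2 ^ Suc R" by (rule geo)
  also have "\<dots> \<le> 2 * n" using R by simp
  finally show "(\<Sum>\<rho> | 2 ^ \<rho> \<le> n. (2::nat) ^ \<rho>) \<le> 2 * n" .
qed

context driving
begin

definition area_block :: "nat \<Rightarrow> 'd \<Rightarrow> 'd \<Rightarrow> nat \<Rightarrow> nat \<Rightarrow> nat \<Rightarrow> 'w \<Rightarrow> real" where
  "area_block n i j r \<rho> k \<omega> = (\<Sum>c\<in>{k * 2 ^ \<rho>..<(k + 1) * 2 ^ \<rho>}.
     levy_level (\<lambda>l t. X t \<omega> $ l) i j (real c * (T / real n)) (real (Suc c) * (T / real n)) r)"

text \<open>A block has size about (2^-r h)^H * (2^\<rho> h)^H with h = T / n. Half of the decay
  2^(- r H) is built into the supremum, to make the levels summable on each path, and half is left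
  for the union over r; the surplus (2^\<rho> h)^(H - \<beta>) is left for the union over
  blocks.\<close>

definition block_weight :: "real \<Rightarrow> nat \<Rightarrow> nat \<Rightarrow> nat \<Rightarrow> real" where
  "block_weight \<beta> n r \<rho> = (2 ^ r) powr (H / 2) / ((T / real n) powr H * (2 ^ \<rho> * (T / real n)) powr \<beta>)"

definition area_sup :: "real \<Rightarrow> nat \<Rightarrow> 'w \<Rightarrow> ennreal" where
  "area_sup \<beta> n \<omega> = (SUP (i, j, r, \<rho>, k) \<in> {(i, j, r, \<rho>, k). 2 ^ \<rho> \<le> n \<and> k < n div 2 ^ \<rho>}.
     ennreal (block_weight \<beta> n r \<rho> * \<bar>area_block n i j r \<rho> k \<omega>\<bar>))"

lemma block_le: "k < n div 2 ^ \<rho> \<Longrightarrow> (k + 1) * 2 ^ \<rho> \<le> (n::nat)"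
  by (metis Suc_eq_plus1 Suc_leI div_times_less_eq_dividend mult_le_mono1 order_trans)

lemma area_block_measurable:
  assumes "1 \<le> n" "k < n div 2 ^ \<rho>"
  shows "area_block n i j r \<rho> k \<in> borel_measurable M"
proof -
  have "(\<lambda>\<omega>. levy_level (\<lambda>l t. X t \<omega> $ l) i j (real c * (T / real n)) (real (Suc c) * (T / real n)) r) \<in> borel_measurable M"
    if "c < n" for c
    unfolding levy_level_grid
  proof (intro borel_measurable_sum)
    fix m :: nat assume m: "m \<in> {..<2 ^ r}"
    have "c * 2 ^ r + m < (c + 1) * 2 ^ r" using m by simp
    also have "\<dots> \<le> n * 2 ^ r" using that by (intro mult_right_mono) auto
    finally have cm: "c * 2 ^ r + m < n * 2 ^ r" .
    let ?d = "T / real n / 2 ^ r"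
    have s: "real (c * 2 ^ r + m) * ?d \<in> {0..T}" "real (Suc (c * 2 ^ r + m)) * ?d \<in> {0..T}"
      by (rule grid_in; use cm assms in simp)+
    then have u: "(real (c * 2 ^ r + m) * ?d + real (Suc (c * 2 ^ r + m)) * ?d) / 2 \<in> {0..T}" by simp
    note [measurable] = X_measurable[OF s(1)] X_measurable[OF s(2)] X_measurable[OF u]
    show "(\<lambda>\<omega>. levy_piece (\<lambda>l t. X t \<omega> $ l) i j (real (c * 2 ^ r + m) * ?d) (real (Suc (c * 2 ^ r + m)) * ?d)) \<in> borel_measurable M"
      unfolding levy_piece_def by measurable
  qed
  then show ?thesis
    unfolding area_block_def using block_le[OF assms(2)] by (intro borel_measurable_sum) auto
qed

lemma area_sup_measurable:
  assumes "1 \<le> n" shows "area_sup \<beta> n \<in> borel_measurable M"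
  unfolding area_sup_def
proof (rule borel_measurable_SUP)
  show "countable {(i::'d, j::'d, r::nat, \<rho>, k). 2 ^ \<rho> \<le> n \<and> k < n div 2 ^ \<rho>}" by (rule countableI_type)
  fix p :: "'d \<times> 'd \<times> nat \<times> nat \<times> nat" assume p: "p \<in> {(i, j, r, \<rho>, k). 2 ^ \<rho> \<le> n \<and> k < n div 2 ^ \<rho>}"
  obtain i j r \<rho> k where p': "p = (i, j, r, \<rho>, k)" by (cases p)
  have "area_block n i j r \<rho> k \<in> borel_measurable M"
    by (rule area_block_measurable) (use p p' assms in auto)
  note [measurable] = this
  show "(\<lambda>\<omega>. case p of (i, j, r, \<rho>, k) \<Rightarrow> ennreal (block_weight \<beta> n r \<rho> * \<bar>area_block n i j r \<rho> k \<omega>\<bar>)) \<in> borel_measurable M"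
    unfolding p' prod.case by measurable
qed

text \<open>The order is large enough to turn the two surplus powers into 2^-r and (2^\<rho> / n)^2.
  The square pays once for the n / 2^\<rho> blocks of a given length and once more for the sum over
  all lengths.\<close>

lemma area_block_moment:
  assumes n: "1 \<le> n" and k: "k < n div 2 ^ \<rho>" and q: "2 \<le> (H - \<beta>) * real (2 * Suc q)" and "0 \<le> \<beta>"
  shows "(\<integral>\<^sup>+\<omega>. ennreal (block_weight \<beta> n r \<rho> * \<bar>area_block n i j r \<rho> k \<omega>\<bar>) ^ (2 * Suc q) \<partial>M)
    \<le> ennreal (2 * gauss_moment (Suc q) * moment_const (Suc q) * (T powr (H - \<beta>)) ^ (2 * Suc q)
        * (1 / 2) ^ r * (2 ^ \<rho> / real n)\<^sup>2)"
proof -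
  let ?h = "T / real n" and ?w = "block_weight \<beta> n r \<rho>" and ?m = "2 * Suc q"
  let ?g = "2 * gauss_moment (Suc q) * moment_const (Suc q)"
  have g0: "0 \<le> ?g" using gauss_moment_pos[of "Suc q"] moment_const[of "Suc q"] by simp
  have h: "0 < ?h" using n T by simp
  have w0: "0 \<le> ?w" by (simp add: block_weight_def)
  have e: "0 < H - \<beta>" using q by (metis mult_nonpos_nonneg not_le of_nat_0_le_iff order_trans zero_less_numeral less_le_not_le)
  have \<rho>n: "2 ^ \<rho> / real n \<le> 1" using block_le[OF k] n
    by (simp add: divide_le_eq)
  have A: "(\<integral>\<^sup>+\<omega>. ennreal (area_block n i j r \<rho> k \<omega> ^ ?m) \<partial>M) \<le> ennreal (?g * ((?h / 2 ^ Suc r) powr H * (2 ^ \<rho> * ?h) powr H) ^ ?m)"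
  proof (cases "i = j")
    case True
    then show ?thesis by (simp add: area_block_def)
  next
    case False
    have "real ((k + 1) * 2 ^ \<rho>) * ?h \<le> real n * ?h"
      using block_le[OF k] h by (intro mult_right_mono) (auto simp del: of_nat_mult of_nat_add)
    then have "real ((k + 1) * 2 ^ \<rho>) * ?h \<le> T" using n by simp
    moreover have "real ((k + 1) * 2 ^ \<rho> - k * 2 ^ \<rho>) = 2 ^ \<rho>" by (simp add: algebra_simps)
    ultimately show ?thesis
      using level_moment[of ?h "k * 2 ^ \<rho>" "(k + 1) * 2 ^ \<rho>" i j r q] False h unfolding area_block_def by simp
  qed
  have "ennreal (?w * \<bar>area_block n i j r \<rho> k \<omega>\<bar>) ^ ?m = ennreal (?w ^ ?m) * ennreal (area_block n i j r \<rho> k \<omega> ^ ?m)" for \<omega>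
  proof -
    have "ennreal (?w * \<bar>area_block n i j r \<rho> k \<omega>\<bar>) ^ ?m = ennreal ((?w * \<bar>area_block n i j r \<rho> k \<omega>\<bar>) ^ ?m)"
      using w0 by (intro ennreal_power) simp
    also have "(?w * \<bar>area_block n i j r \<rho> k \<omega>\<bar>) ^ ?m = ?w ^ ?m * area_block n i j r \<rho> k \<omega> ^ ?m"
      unfolding power_mult_distrib by (intro arg_cong2[where f = "(*)"] refl power_even_abs) simp
    finally show ?thesis using w0 by (simp add: ennreal_mult' del: power_Suc mult_Suc_right)
  qed
  then have "(\<integral>\<^sup>+\<omega>. ennreal (?w * \<bar>area_block n i j r \<rho> k \<omega>\<bar>) ^ ?m \<partial>M)
     = ennreal (?w ^ ?m) * (\<integral>\<^sup>+\<omega>. ennreal (area_block n i j r \<rho> k \<omega> ^ ?m) \<partial>M)"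
    using area_block_measurable[OF n k, of i j r] by (simp add: nn_integral_cmult del: power_Suc mult_Suc_right)
  also have "\<dots> \<le> ennreal (?w ^ ?m) * ennreal (?g * ((?h / 2 ^ Suc r) powr H * (2 ^ \<rho> * ?h) powr H) ^ ?m)"
    by (intro mult_left_mono A) simp
  also have "\<dots> = ennreal (?g * (?w * ((?h / 2 ^ Suc r) powr H * (2 ^ \<rho> * ?h) powr H)) ^ ?m)"
    using w0 by (subst ennreal_mult'[symmetric]) (auto simp: power_mult_distrib mult_ac simp del: power_Suc mult_Suc_right)
  also have "\<dots> \<le> ennreal (?g * ((2 ^ r) powr (- (H / 2)) * (T powr (H - \<beta>) * (2 ^ \<rho> / real n) powr (H - \<beta>))) ^ ?m)"
  proof (intro ennreal_leI mult_left_mono power_mono g0)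
    have "(?h / 2 ^ Suc r) powr H \<le> (?h / 2 ^ r) powr H"
      using h H T by (intro powr_mono2 divide_left_mono) auto
    also have "\<dots> = ?h powr H / (2 ^ r) powr H" using h T by (simp add: powr_divide powr_mult)
    finally have "?w * ((?h / 2 ^ Suc r) powr H * (2 ^ \<rho> * ?h) powr H) \<le> ?w * (?h powr H / (2 ^ r) powr H * (2 ^ \<rho> * ?h) powr H)"
      using w0 by (intro mult_left_mono mult_right_mono) auto
    also have "\<dots> = ((2 ^ r) powr (H / 2) / (2 ^ r) powr H) * ((2 ^ \<rho> * ?h) powr H / (2 ^ \<rho> * ?h) powr \<beta>)"
    proof -
      have "a / (b * c) * (b / d * e) = (a / d) * (e / c)" if "b \<noteq> 0" for a b c d e :: real using that by simp
      then show ?thesis unfolding block_weight_def by this (use n T in simp)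
    qed
    also have "(2 ^ r) powr (H / 2) / (2 ^ r) powr H = (2 ^ r) powr (- (H / 2))"
      by (simp add: powr_diff[symmetric])
    also have "(2 ^ \<rho> * ?h) powr H / (2 ^ \<rho> * ?h) powr \<beta> = (T * (2 ^ \<rho> / real n)) powr (H - \<beta>)"
      by (subst powr_diff[symmetric]) (simp add: mult.commute)
    also have "\<dots> = T powr (H - \<beta>) * (2 ^ \<rho> / real n) powr (H - \<beta>)"
      using T by (intro powr_mult)
    finally show "?w * ((?h / 2 ^ Suc r) powr H * (2 ^ \<rho> * ?h) powr H)
      \<le> (2 ^ r) powr (- (H / 2)) * (T powr (H - \<beta>) * (2 ^ \<rho> / real n) powr (H - \<beta>))" .
  qed (use w0 in simp)
  also have "\<dots> = ennreal (?g * (T powr (H - \<beta>)) ^ ?m * (((2 ^ r) powr (- (H / 2))) ^ ?m * ((2 ^ \<rho> / real n) powr (H - \<beta>)) ^ ?m))"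
    by (simp only: power_mult_distrib mult_ac)
  also have "\<dots> \<le> ennreal (?g * (T powr (H - \<beta>)) ^ ?m * ((1 / 2) ^ r * (2 ^ \<rho> / real n)\<^sup>2))"
  proof (intro ennreal_leI mult_left_mono mult_mono)
    have mH: "2 \<le> H * real ?m"
      using q mult_right_mono[of "H - \<beta>" H "real ?m"] \<open>0 \<le> \<beta>\<close> by linarith
    have "((2 ^ r) powr (- (H / 2))) ^ ?m = (2 ^ r) powr (- (H / 2) * real ?m)"
      by (subst powr_power) (simp_all add: mult.commute)
    also have "\<dots> \<le> (2 ^ r) powr (- 1)" using mH by (intro powr_mono) auto
    also have "\<dots> = (1 / 2) ^ r" by (simp add: powr_minus power_divide divide_simps)
    finally show "((2 ^ r) powr (- (H / 2))) ^ ?m \<le> (1 / 2) ^ r" .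
    have "((2 ^ \<rho> / real n) powr (H - \<beta>)) ^ ?m = (2 ^ \<rho> / real n) powr ((H - \<beta>) * real ?m)"
      by (subst powr_power) (use n in \<open>simp_all add: mult.commute\<close>)
    also have "\<dots> \<le> (2 ^ \<rho> / real n) powr 2" using q \<rho>n n by (intro powr_mono') auto
    also have "\<dots> = (2 ^ \<rho> / real n)\<^sup>2" using n by (intro powr_numeral) auto
    finally show "((2 ^ \<rho> / real n) powr (H - \<beta>)) ^ ?m \<le> (2 ^ \<rho> / real n)\<^sup>2" .
  qed (use g0 in auto)
  finally show ?thesis by (simp add: mult.assoc)
qed

text \<open>In the union bound the sum over \<rho> of (n / 2^\<rho>) * (2^\<rho> / n)^2 is at most
  2, so in contrast to \<open>kappa_moment\<close> no factor n survives and fixed orders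
  suffice.\<close>

lemma area_sup_moment:
  assumes n: "1 \<le> n" and q: "2 \<le> (H - \<beta>) * real (2 * Suc q)" and "0 \<le> \<beta>"
  shows "(\<integral>\<^sup>+\<omega>. area_sup \<beta> n \<omega> ^ (2 * Suc q) \<partial>M)
    \<le> ennreal (real CARD('d) * real CARD('d) * (8 * gauss_moment (Suc q) * moment_const (Suc q) * (T powr (H - \<beta>)) ^ (2 * Suc q)))"
proof -
  let ?m = "2 * Suc q" and ?P = "{\<rho>. (2::nat) ^ \<rho> \<le> n}"
  define C where "C = 2 * gauss_moment (Suc q) * moment_const (Suc q) * (T powr (H - \<beta>)) ^ ?m"
  have C0: "0 \<le> C" using gauss_moment_pos[of "Suc q"] moment_const[of "Suc q"] by (simp add: C_def)
  define F where "F i j r \<rho> k \<omega> = ennreal (block_weight \<beta> n r \<rho> * \<bar>area_block n i j r \<rho> k \<omega>\<bar>) ^ ?m" for i j r \<rho> k \<omega>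
  define S where "S i j r \<omega> = (\<Sum>\<rho>\<in>?P. \<Sum>k<n div 2 ^ \<rho>. F i j r \<rho> k \<omega>)" for i j r \<omega>
  have fin: "finite ?P" by (rule sum_powers_le(2)[OF n])
  have Fm: "F i j r \<rho> k \<in> borel_measurable M" if "k < n div 2 ^ \<rho>" for i j r \<rho> k
    unfolding F_def using area_block_measurable[OF n that, of i j r] by measurable
  have Sm: "S i j r \<in> borel_measurable M" for i j r
    unfolding S_def using Fm by (intro borel_measurable_sum) auto
  have le: "area_sup \<beta> n \<omega> ^ ?m \<le> (\<Sum>i\<in>UNIV. \<Sum>j\<in>UNIV. \<Sum>r. S i j r \<omega>)" for \<omega>
    unfolding area_sup_def
  proof (rule SUP_power_le)
    fix p :: "'d \<times> 'd \<times> nat \<times> nat \<times> nat" assume "p \<in> {(i, j, r, \<rho>, k). 2 ^ \<rho> \<le> n \<and> k < n div 2 ^ \<rho>}"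
    then obtain i j r \<rho> k where p: "p = (i, j, r, \<rho>, k)" "\<rho> \<in> ?P" "k < n div 2 ^ \<rho>" by auto
    have "F i j r \<rho> k \<omega> \<le> (\<Sum>k<n div 2 ^ \<rho>. F i j r \<rho> k \<omega>)" using p by (intro member_le_sum) auto
    also have "\<dots> \<le> S i j r \<omega>" unfolding S_def using p fin by (intro member_le_sum) auto
    also have "\<dots> \<le> (\<Sum>r. S i j r \<omega>)" using sum_le_suminf[of "\<lambda>r. S i j r \<omega>" "{r}"] by simp
    also have "\<dots> \<le> (\<Sum>j\<in>UNIV. \<Sum>r. S i j r \<omega>)" by (intro member_le_sum) auto
    also have "\<dots> \<le> (\<Sum>i\<in>UNIV. \<Sum>j\<in>UNIV. \<Sum>r. S i j r \<omega>)" by (intro member_le_sum) auto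
    finally show "(case p of (i, j, r, \<rho>, k) \<Rightarrow> ennreal (block_weight \<beta> n r \<rho> * \<bar>area_block n i j r \<rho> k \<omega>\<bar>)) ^ ?m
        \<le> (\<Sum>i\<in>UNIV. \<Sum>j\<in>UNIV. \<Sum>r. S i j r \<omega>)"
      by (simp only: p prod.case F_def)
  qed simp
  have SI: "(\<integral>\<^sup>+\<omega>. S i j r \<omega> \<partial>M) \<le> ennreal (2 * C * (1/2) ^ r)" for i j r
  proof -
    have "(\<integral>\<^sup>+\<omega>. S i j r \<omega> \<partial>M) = (\<Sum>\<rho>\<in>?P. \<Sum>k<n div 2 ^ \<rho>. \<integral>\<^sup>+\<omega>. F i j r \<rho> k \<omega> \<partial>M)"
      unfolding S_def using Fm by (subst nn_integral_sum) (auto intro!: sum.cong nn_integral_sum borel_measurable_sum)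
    also have "\<dots> \<le> (\<Sum>\<rho>\<in>?P. \<Sum>k<n div 2 ^ \<rho>. ennreal (C * (1 / 2) ^ r * (2 ^ \<rho> / real n)\<^sup>2))"
      unfolding F_def C_def using area_block_moment[OF n _ q \<open>0 \<le> \<beta>\<close>] by (intro sum_mono) auto
    also have "\<dots> = ennreal (\<Sum>\<rho>\<in>?P. \<Sum>k<n div 2 ^ \<rho>. C * (1 / 2) ^ r * (2 ^ \<rho> / real n)\<^sup>2)"
      using C0 by (simp add: sum_ennreal sum_nonneg del: sum_constant)
    also have "\<dots> \<le> ennreal (2 * C * (1/2) ^ r)"
    proof (intro ennreal_leI)
      have "(\<Sum>\<rho>\<in>?P. \<Sum>k<n div 2 ^ \<rho>. C * (1 / 2) ^ r * (2 ^ \<rho> / real n)\<^sup>2) \<le> (\<Sum>\<rho>\<in>?P. C * (1 / 2) ^ r * (2 ^ \<rho> / real n))"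
      proof (intro sum_mono)
        fix \<rho>
        have "real (n div 2 ^ \<rho> * 2 ^ \<rho>) \<le> real n" by (intro of_nat_mono div_times_less_eq_dividend)
        then have "real (n div 2 ^ \<rho>) * (2 ^ \<rho> / real n) \<le> 1" using n by (simp add: divide_le_eq)
        then have "(C * (1 / 2) ^ r * (2 ^ \<rho> / real n)) * (real (n div 2 ^ \<rho>) * (2 ^ \<rho> / real n)) \<le> (C * (1 / 2) ^ r * (2 ^ \<rho> / real n)) * 1"
          using C0 by (intro mult_left_mono) auto
        then show "(\<Sum>k<n div 2 ^ \<rho>. C * (1 / 2) ^ r * (2 ^ \<rho> / real n)\<^sup>2) \<le> C * (1 / 2) ^ r * (2 ^ \<rho> / real n)"
          by (simp add: power2_eq_square mult_ac)
      qed
      also have "\<dots> = C * (1 / 2) ^ r * (real (\<Sum>\<rho>\<in>?P. 2 ^ \<rho>) / real n)"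
        by (simp add: sum_distrib_left sum_divide_distrib)
      also have "\<dots> \<le> C * (1 / 2) ^ r * 2"
      proof (intro mult_left_mono)
        have "real (\<Sum>\<rho>\<in>?P. 2 ^ \<rho>) \<le> real (2 * n)" by (intro of_nat_mono sum_powers_le(1) n)
        then show "real (\<Sum>\<rho>\<in>?P. 2 ^ \<rho>) / real n \<le> 2" using n by (simp add: divide_le_eq)
      qed (use C0 in simp)
      finally show "(\<Sum>\<rho>\<in>?P. \<Sum>k<n div 2 ^ \<rho>. C * (1 / 2) ^ r * (2 ^ \<rho> / real n)\<^sup>2) \<le> 2 * C * (1/2) ^ r" by simp
    qed
    finally show ?thesis .
  qed
  have "(\<integral>\<^sup>+\<omega>. area_sup \<beta> n \<omega> ^ ?m \<partial>M) \<le> (\<integral>\<^sup>+\<omega>. (\<Sum>i\<in>UNIV. \<Sum>j\<in>UNIV. \<Sum>r. S i j r \<omega>) \<partial>M)"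
    by (intro nn_integral_mono le)
  also have "\<dots> = (\<Sum>i\<in>UNIV. \<Sum>j\<in>UNIV. \<Sum>r. \<integral>\<^sup>+\<omega>. S i j r \<omega> \<partial>M)"
    using Sm by (simp add: nn_integral_sum nn_integral_suminf)
  also have "\<dots> \<le> (\<Sum>i\<in>(UNIV::'d set). \<Sum>j\<in>(UNIV::'d set). \<Sum>r. ennreal (2 * C * (1/2) ^ r))"
    using SI by (intro sum_mono suminf_le) auto
  also have "\<dots> = of_nat CARD('d) * (of_nat CARD('d) * ennreal (2 * (2 * C)))"
    using C0 by (subst suminf_ennreal_half) simp_all
  also have "\<dots> = ennreal (real CARD('d) * (real CARD('d) * (2 * (2 * C))))"
    using C0 by (simp add: ennreal_of_nat_eq_real_of_nat ennreal_mult')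
  finally show ?thesis by (simp add: C_def mult.assoc)
qed

end


context driven
begin

text \<open>Chaining is done on each level of the areas separately, carrying the decay in r along as
  a factor; the levels are summed afterwards as a geometric series.\<close>

lemma area_sum_bound:
  assumes n: "1 \<le> n" "real n * h = T" and A: "0 \<le> A" and "0 < \<eta>"
    and block: "\<And>r \<rho> k. (k + 1) * 2 ^ \<rho> \<le> n \<Longrightarrow>
      \<bar>\<Sum>c\<in>{k * 2 ^ \<rho>..<(k + 1) * 2 ^ \<rho>}. area_level i j (real c * h) (real (Suc c) * h) r\<bar>
        \<le> A * (2 ^ r) powr (- \<eta>) * (2 ^ \<rho>) powr \<beta>"
    and ab: "a < b" "b \<le> n"
  shows "\<bar>\<Sum>k\<in>{a..<b}. area i j (real k * h) (real (Suc k) * h)\<bar>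
    \<le> 3 * A * chain_const \<beta> / (1 - 2 powr (- \<eta>)) * real (b - a) powr \<beta>"
proof -
  have h0: "0 < h" using n T by (metis less_le_not_le mult_nonneg_nonpos of_nat_0_le_iff not_le)
  have cell: "0 \<le> real k * h" "real k * h < real (Suc k) * h" "real (Suc k) * h \<le> T" if "k < n" for k
  proof -
    have "real (Suc k) * h \<le> real n * h" using that h0 by (intro mult_right_mono) auto
    then show "real (Suc k) * h \<le> T" using n by simp
  qed (use h0 in auto)
  define s where "s r m = (\<Sum>k<m. area_level i j (real k * h) (real (Suc k) * h) r)" for r m :: nat
  have s: "s r m' - s r m = (\<Sum>k\<in>{m..<m'}. area_level i j (real k * h) (real (Suc k) * h) r)" if "m \<le> m'" for r m m'
    using that unfolding s_def by (simp add: lessThan_atLeast0 flip: sum.atLeastLessThan_concat[of 0 m m'])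
  let ?B = "\<lambda>r. A * (2 ^ r) powr (- \<eta>)"
  have level: "\<bar>\<Sum>k\<in>{a..<b}. area_level i j (real k * h) (real (Suc k) * h) r\<bar> \<le> 3 * ?B r * chain_const \<beta> * real (b - a) powr \<beta>" for r
  proof -
    have "norm (s r b - s r a) \<le> 3 * ?B r * chain_const \<beta> * real (b - a) powr \<beta>"
    proof (rule dyadic_chaining)
      fix \<rho> k assume k: "(k + 1) * 2 ^ \<rho> \<le> n"
      have "k * 2 ^ \<rho> \<le> (k + 1) * 2 ^ \<rho>" by (intro mult_right_mono) auto
      from s[OF this, of r] block[OF k, of r]
      show "norm (s r ((k + 1) * 2 ^ \<rho>) - s r (k * 2 ^ \<rho>)) \<le> ?B r * (2 ^ \<rho>) powr \<beta>" by simp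
    qed (use beta A ab in auto)
    then show ?thesis using s[of a b r] ab by simp
  qed
  have "(\<Sum>k\<in>{a..<b}. area i j (real k * h) (real (Suc k) * h)) = (\<Sum>r. \<Sum>k\<in>{a..<b}. area_level i j (real k * h) (real (Suc k) * h) r)"
    unfolding levy_area_def using ab cell by (intro suminf_sum[symmetric] area_summable(1)) auto
  moreover have "norm (\<Sum>r. \<Sum>k\<in>{a..<b}. area_level i j (real k * h) (real (Suc k) * h) r)
    \<le> (\<Sum>r. 3 * A * chain_const \<beta> * real (b - a) powr \<beta> * (2 powr (- \<eta>)) ^ r)"
  proof (rule norm_suminf_le)
    fix r
    have "(2 ^ r) powr (- \<eta>) = (2 powr (- \<eta>)) ^ r"
      by (simp add: powr_powr mult.commute flip: powr_realpow)
    then show "norm (\<Sum>k\<in>{a..<b}. area_level i j (real k * h) (real (Suc k) * h) r) \<le> 3 * A * chain_const \<beta> * real (b - a) powr \<beta> * (2 powr (- \<eta>)) ^ r"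
      using level[of r] by (simp add: mult_ac)
  next
    show "summable (\<lambda>r. 3 * A * chain_const \<beta> * real (b - a) powr \<beta> * (2 powr (- \<eta>)) ^ r)"
      using \<open>0 < \<eta>\<close> powr_less_mono[of "- \<eta>" 0 2] by (intro summable_mult summable_geometric) simp
  qed
  moreover have "(\<Sum>r. 3 * A * chain_const \<beta> * real (b - a) powr \<beta> * (2 powr (- \<eta>)) ^ r)
     = 3 * A * chain_const \<beta> * real (b - a) powr \<beta> * (1 / (1 - 2 powr (- \<eta>)))"
  proof -
    have lt: "norm (2 powr (- \<eta>) :: real) < 1" using \<open>0 < \<eta>\<close> powr_less_mono[of "- \<eta>" 0 2] by simp
    show ?thesis unfolding suminf_mult[OF summable_geometric[OF lt]] suminf_geometric[OF lt] ..
  qed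
  ultimately show ?thesis by simp
qed

end

section \<open>Tails of the Hoelder constants\<close>

lemma powr_le_square:
  fixes K s \<epsilon> :: real
  assumes "0 < \<epsilon>" "0 < s" "s < 2" "0 < K"
  shows "K powr s \<le> \<epsilon> * K\<^sup>2 + (\<epsilon> powr (1 / (s - 2))) powr s"
proof -
  \<comment> \<open>Up to \<open>k\<close> the power is bounded by a constant; beyond it K^(s - 2)
    <= \<epsilon>.\<close>
  define k where "k = \<epsilon> powr (1 / (s - 2))"
  have k: "0 < k" "k powr (s - 2) = \<epsilon>" using assms by (auto simp: k_def powr_powr)
  show ?thesis
  proof (cases "K \<le> k")
    case True
    then have "K powr s \<le> k powr s" using assms by (intro powr_mono2) auto
    then show ?thesis using assms by (simp add: k_def add_increasing)
  next
    case False
    have "K powr s = K powr (s - 2) * K powr 2" by (simp flip: powr_add)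
    also have "\<dots> \<le> k powr (s - 2) * K powr 2"
      using False k assms by (intro mult_right_mono powr_mono2') auto
    also have "\<dots> = \<epsilon> * K\<^sup>2" using k assms by (simp add: powr_numeral)
    finally show ?thesis by (simp add: add_increasing2)
  qed
qed

context driving
begin

lemma exponent_exists:
  assumes "\<beta> < H" obtains q0 :: nat where "0 < q0" "\<And>q. q0 \<le> q \<Longrightarrow> 2 \<le> (H - \<beta>) * real (2 * q)"
proof -
  obtain m :: nat where m: "1 / (H - \<beta>) < real m" using reals_Archimedean2 by blast
  have "2 \<le> (H - \<beta>) * real (2 * q)" if "Suc m \<le> q" for q
  proof -
    have "1 < (H - \<beta>) * real m" using m assms by (simp add: divide_less_eq mult.commute)
    also have "\<dots> \<le> (H - \<beta>) * real q" using that assms by (intro mult_left_mono) auto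
    finally show ?thesis by simp
  qed
  then show thesis by (rule that[of "Suc m", rotated]) auto
qed

lemma area_sup_bounded:
  assumes "0 \<le> \<beta>" "\<beta> < H"
  shows "moment_bounded M (area_sup \<beta>)"
proof (rule moment_boundedI[OF area_sup_measurable])
  fix q :: nat
  obtain q0 :: nat where q0: "\<And>q. q0 \<le> q \<Longrightarrow> 2 \<le> (H - \<beta>) * real (2 * q)" using exponent_exists[OF assms(2)] by blast
  define m where "m = q + q0"
  have "\<forall>n\<ge>1. (\<integral>\<^sup>+\<omega>. area_sup \<beta> n \<omega> ^ (2 * Suc m) \<partial>M)
    \<le> ennreal (real CARD('d) * real CARD('d) * (8 * gauss_moment (Suc m) * moment_const (Suc m) * (T powr (H - \<beta>)) ^ (2 * Suc m)))"
    by (intro allI impI area_sup_moment[OF _ q0 assms(1)]) (auto simp: m_def)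
  then show "\<exists>C. \<exists>q'\<ge>q. \<forall>n\<ge>1. (\<integral>\<^sup>+\<omega>. area_sup \<beta> n \<omega> ^ q' \<partial>M) \<le> ennreal C"
    by (intro exI[of _ "real CARD('d) * real CARD('d) * (8 * gauss_moment (Suc m) * moment_const (Suc m) * (T powr (H - \<beta>)) ^ (2 * Suc m))"] exI[of _ "2 * Suc m"] conjI) (simp add: m_def)
qed

text \<open>The order of the largest oscillation over n cells. The summand 1 keeps it positive at n
  = 1, where the logarithm vanishes.\<close>

definition log_scale :: "nat \<Rightarrow> real" where
  "log_scale n = (T / real n) powr H * (1 + sqrt (ln (real n)))"

lemma log_scale_pos: "1 \<le> n \<Longrightarrow> 0 < log_scale n"
  using T unfolding log_scale_def by (intro mult_pos_pos add_pos_nonneg) auto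

text \<open>Moments of order about \<open>ln n\<close> show that the modulus at scale \<open>T / n\<close> only loses a factor
  \<open>sqrt (ln n)\<close>.\<close>

lemma kappa_bounded:
  assumes "\<beta> < H"
  shows "moment_bounded M (\<lambda>n \<omega>. ennreal (1 / log_scale n) * kappa \<beta> n \<omega>)"
proof (rule moment_boundedI)
  show "(\<lambda>\<omega>. ennreal (1 / log_scale n) * kappa \<beta> n \<omega>) \<in> borel_measurable M" if "1 \<le> n" for n
    using kappa_measurable[OF that, of \<beta>] by simp
  fix q :: nat
  obtain q0 :: nat where q0: "\<And>q. q0 \<le> q \<Longrightarrow> 2 \<le> (H - \<beta>) * real (2 * q)" using exponent_exists[OF assms] by blast
  define Q where "Q = q + q0"
  \<comment> \<open>Large enough that 2 P <= \<mu>^2 * (1 + sqrt (ln n))^2 / exp 1 for the order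
    \<open>P\<close> chosen below; the division by exp 1 produces the factor exp (- P) that cancels
    the n cells of the union bound.\<close>
  define \<mu> where "\<mu> = sqrt (2 * (real Q + 1) * exp 1)"
  have \<mu>: "0 < \<mu>" "\<mu>\<^sup>2 = 2 * (real Q + 1) * exp 1" by (simp_all add: \<mu>_def)
  let ?D = "real CARD('d)"
  have "(\<integral>\<^sup>+\<omega>. (ennreal (1 / log_scale n) * kappa \<beta> n \<omega>) ^ (2 * Q) \<partial>M) \<le> ennreal (\<mu> ^ (2 * Q) * (1 + 2 * ?D))" if n: "1 \<le> n" for n
  proof -
    note [measurable] = kappa_measurable[OF n, of \<beta>]
    \<comment> \<open>The order grows like ln n, so that n <= exp P. The moment of the fixed order 2
      Q then follows from that of order 2 P at a bounded cost.\<close>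
    define P where "P = Q + nat \<lceil>ln (real n)\<rceil>"
    define w where "w = 1 / (\<mu> * log_scale n)"
    let ?h = "T / real n" and ?l = "ln (real n)"
    have l0: "0 \<le> ?l" using n by simp
    have w: "0 < w" "1 / log_scale n = \<mu> * w" using \<mu> log_scale_pos[OF n] by (auto simp: w_def)
    have P: "Q \<le> P" "?l \<le> real P" "real P \<le> real Q + 1 + ?l" unfolding P_def using l0 by (auto simp: of_nat_nat) linarith+
    have small: "w ^ (2 * P) * (2 * ?D * real n * gauss_moment P * (?h powr H) ^ (2 * P)) \<le> 2 * ?D"
    proof -
      define s where "s = \<mu> * (1 + sqrt ?l)"
      have s: "0 < s" using \<mu> l0 by (simp add: s_def add_pos_nonneg)
      have "w * ?h powr H = 1 / s" using T n by (simp add: w_def log_scale_def s_def)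
      then have e: "w ^ (2 * P) * (?h powr H) ^ (2 * P) = 1 / (s\<^sup>2) ^ P"
        by (simp add: power_mult_distrib[symmetric] power_divide power_mult)
      have "0 \<le> real Q * ?l" using l0 by simp
      moreover have "2 * (real Q + 1) * (1 + ?l) = 2 * real Q + 2 + 2 * ?l + 2 * (real Q * ?l)" by (simp add: algebra_simps)
      ultimately have "2 * real P \<le> 2 * (real Q + 1) * (1 + ?l)" using P(3) by linarith
      also have "\<dots> \<le> 2 * (real Q + 1) * (1 + sqrt ?l)\<^sup>2"
        using l0 by (intro mult_left_mono) (simp_all add: power2_eq_square algebra_simps)
      also have "\<dots> = s\<^sup>2 / exp 1" by (simp add: s_def power_mult_distrib \<mu>(2))
      finally have "(2 * real P) ^ P \<le> (s\<^sup>2 / exp 1) ^ P" by (intro power_mono) auto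
      with gauss_moment_le[of P] have "gauss_moment P \<le> (s\<^sup>2) ^ P / exp (real P)"
        by (simp add: power_divide exp_of_nat_mult[symmetric])
      also have "\<dots> \<le> (s\<^sup>2) ^ P / real n"
      proof (intro divide_left_mono)
        have "real n = exp ?l" using n by simp
        also have "\<dots> \<le> exp (real P)" using P(2) by simp
        finally show "real n \<le> exp (real P)" .
      qed (use n in auto)
      finally have "real n * gauss_moment P \<le> (s\<^sup>2) ^ P" using n by (simp add: field_simps)
      then have "real n * gauss_moment P * (1 / (s\<^sup>2) ^ P) \<le> 1" using s by (simp add: divide_le_eq)
      then have "2 * ?D * (real n * gauss_moment P * (1 / (s\<^sup>2) ^ P)) \<le> 2 * ?D * 1" by (intro mult_left_mono) auto
      then show ?thesis unfolding e[symmetric] by (simp add: mult_ac)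
    qed
    have "(\<integral>\<^sup>+\<omega>. (ennreal w * kappa \<beta> n \<omega>) ^ (2 * P) \<partial>M) = ennreal (w ^ (2 * P)) * (\<integral>\<^sup>+\<omega>. kappa \<beta> n \<omega> ^ (2 * P) \<partial>M)"
      using w by (simp add: power_mult_distrib ennreal_power nn_integral_cmult)
    also have "\<dots> \<le> ennreal (w ^ (2 * P)) * ennreal (2 * ?D * real n * gauss_moment P * (?h powr H) ^ (2 * P))"
      using q0 P(1) by (intro mult_left_mono kappa_moment n) (auto simp: Q_def)
    also have "\<dots> = ennreal (w ^ (2 * P) * (2 * ?D * real n * gauss_moment P * (?h powr H) ^ (2 * P)))"
      using w by (intro ennreal_mult'[symmetric]) simp
    also have "\<dots> \<le> ennreal (2 * ?D)" by (intro ennreal_leI small)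
    finally have "(\<integral>\<^sup>+\<omega>. (ennreal w * kappa \<beta> n \<omega>) ^ (2 * Q) \<partial>M) \<le> ennreal (1 + max 0 (2 * ?D))"
      using P(1) by (intro moment_le_add[of _ "2 * Q" "2 * P"]) auto
    then have "ennreal (\<mu> ^ (2 * Q)) * (\<integral>\<^sup>+\<omega>. (ennreal w * kappa \<beta> n \<omega>) ^ (2 * Q) \<partial>M) \<le> ennreal (\<mu> ^ (2 * Q)) * ennreal (1 + 2 * ?D)"
      by (intro mult_left_mono) (auto simp: max_def)
    also have "ennreal (\<mu> ^ (2 * Q)) * (\<integral>\<^sup>+\<omega>. (ennreal w * kappa \<beta> n \<omega>) ^ (2 * Q) \<partial>M)
       = (\<integral>\<^sup>+\<omega>. (ennreal (1 / log_scale n) * kappa \<beta> n \<omega>) ^ (2 * Q) \<partial>M)"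
      using \<mu> w(1) unfolding w(2) by (simp add: nn_integral_cmult[symmetric] power_mult_distrib ennreal_mult ennreal_power mult.assoc)
    also have "ennreal (\<mu> ^ (2 * Q)) * ennreal (1 + 2 * ?D) = ennreal (\<mu> ^ (2 * Q) * (1 + 2 * ?D))"
      using \<mu> by (intro ennreal_mult'[symmetric]) simp
    finally show ?thesis .
  qed
  then show "\<exists>C. \<exists>q'\<ge>q. \<forall>n\<ge>1. (\<integral>\<^sup>+\<omega>. (ennreal (1 / log_scale n) * kappa \<beta> n \<omega>) ^ q' \<partial>M) \<le> ennreal C"
    by (intro exI[of _ "\<mu> ^ (2 * Q) * (1 + 2 * ?D)"] exI[of _ "2 * Q"]) (auto simp: Q_def)
qed

lemma kappa_finite:
  assumes "\<beta> < H" "1 \<le> n" shows "AE \<omega> in M. kappa \<beta> n \<omega> \<noteq> \<top>"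
  using moment_bounded_finite[OF kappa_bounded[OF assms(1)] assms(2)]
proof eventually_elim
  case (elim \<omega>)
  then show ?case using log_scale_pos[OF assms(2)] by (auto simp: ennreal_mult_top)
qed

text \<open>A Fernique-type bound: the exponential series is integrated term by term, and the
  Gaussian moments, at most 2^q * q!, cancel its factorials.\<close>

lemma exp_square_kappa:
  assumes "\<beta> < H"
  shows "\<exists>\<epsilon>>0. (\<integral>\<^sup>+\<omega>. ennreal (exp (\<epsilon> * (enn2real (kappa \<beta> 1 \<omega>))\<^sup>2)) \<partial>M) < \<top>"
proof -
  note [measurable] = kappa_measurable[OF order_refl, of \<beta>]
  obtain q0 :: nat where q0: "\<And>q. q0 \<le> q \<Longrightarrow> 2 \<le> (H - \<beta>) * real (2 * q)" using exponent_exists[OF assms] by blast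
  let ?D = "real CARD('d)"
  \<comment> \<open>Makes the ratio 2 * \<epsilon> * T^(2 H) of the resulting geometric series equal
    to 1/2.\<close>
  define \<epsilon> where "\<epsilon> = 1 / (4 * (T powr H)\<^sup>2)"
  have \<epsilon>: "0 < \<epsilon>" using T by (simp add: \<epsilon>_def)
  have mom: "(\<integral>\<^sup>+\<omega>. kappa \<beta> 1 \<omega> ^ (2 * q) \<partial>M) \<le> ennreal (2 * ?D * gauss_moment q * (T powr H) ^ (2 * q))" if "q0 \<le> q" for q
    using kappa_moment[of 1 \<beta> q] q0[OF that] by simp
  \<comment> \<open>Orders below \<open>q0\<close> lie outside the moment bound and are controlled
    together through order \<open>q0\<close>.\<close>
  define c where "c = 1 + 2 * ?D * gauss_moment q0 * (T powr H) ^ (2 * q0)"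
  have mom': "(\<integral>\<^sup>+\<omega>. kappa \<beta> 1 \<omega> ^ (2 * q) \<partial>M) \<le> ennreal c" if "q \<le> q0" for q
  proof -
    have "(\<integral>\<^sup>+\<omega>. kappa \<beta> 1 \<omega> ^ (2 * q) \<partial>M) \<le> ennreal (1 + max 0 (2 * ?D * gauss_moment q0 * (T powr H) ^ (2 * q0)))"
      using mom[of q0] that by (intro moment_le_add[of _ "2 * q" "2 * q0"] kappa_measurable) auto
    then show ?thesis using gauss_moment_pos[of q0] by (simp add: c_def max_def del: ennreal_plus)
  qed
  \<comment> \<open>The weights 2^q in the finite sum let one constant dominate the low orders by A
    * (1/2)^q as well.\<close>
  define A where "A = 2 * ?D + (\<Sum>q<q0. \<epsilon> ^ q * c * 2 ^ q)"
  have c0: "0 \<le> c" unfolding c_def using gauss_moment_pos[of q0] by simp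
  have A0: "0 \<le> A" unfolding A_def using \<epsilon> c0 by (intro add_nonneg_nonneg sum_nonneg) auto
  have tm: "(\<integral>\<^sup>+\<omega>. ennreal ((\<epsilon> * (enn2real (kappa \<beta> 1 \<omega>))\<^sup>2) ^ q / fact q) \<partial>M) \<le> ennreal (A * (1 / 2) ^ q)" for q
  proof -
    have "ennreal ((\<epsilon> * (enn2real (kappa \<beta> 1 \<omega>))\<^sup>2) ^ q / fact q) \<le> ennreal (\<epsilon> ^ q / fact q) * kappa \<beta> 1 \<omega> ^ (2 * q)" for \<omega>
    proof -
      have "(\<epsilon> * (enn2real (kappa \<beta> 1 \<omega>))\<^sup>2) ^ q / fact q = \<epsilon> ^ q / fact q * enn2real (kappa \<beta> 1 \<omega>) ^ (2 * q)"
        by (simp add: power_mult_distrib power_mult)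
      then have "ennreal ((\<epsilon> * (enn2real (kappa \<beta> 1 \<omega>))\<^sup>2) ^ q / fact q) = ennreal (\<epsilon> ^ q / fact q) * ennreal (enn2real (kappa \<beta> 1 \<omega>)) ^ (2 * q)"
        using \<epsilon> by (simp only: ennreal_power enn2real_nonneg) (intro ennreal_mult, auto)
      also have "\<dots> \<le> ennreal (\<epsilon> ^ q / fact q) * kappa \<beta> 1 \<omega> ^ (2 * q)"
      proof (intro mult_left_mono power_mono)
        show "ennreal (enn2real (kappa \<beta> 1 \<omega>)) \<le> kappa \<beta> 1 \<omega>" by (cases "kappa \<beta> 1 \<omega>") auto
      qed auto
      finally show ?thesis .
    qed
    then have "(\<integral>\<^sup>+\<omega>. ennreal ((\<epsilon> * (enn2real (kappa \<beta> 1 \<omega>))\<^sup>2) ^ q / fact q) \<partial>M) \<le> (\<integral>\<^sup>+\<omega>. ennreal (\<epsilon> ^ q / fact q) * kappa \<beta> 1 \<omega> ^ (2 * q) \<partial>M)"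
      by (intro nn_integral_mono)
    also have "\<dots> = ennreal (\<epsilon> ^ q / fact q) * (\<integral>\<^sup>+\<omega>. kappa \<beta> 1 \<omega> ^ (2 * q) \<partial>M)" by (simp add: nn_integral_cmult del: One_nat_def)
    also have "\<dots> \<le> ennreal (A * (1 / 2) ^ q)"
    proof (cases "q0 \<le> q")
      case True
      have "ennreal (\<epsilon> ^ q / fact q) * (\<integral>\<^sup>+\<omega>. kappa \<beta> 1 \<omega> ^ (2 * q) \<partial>M) \<le> ennreal (\<epsilon> ^ q / fact q) * ennreal (2 * ?D * gauss_moment q * (T powr H) ^ (2 * q))"
        by (intro mult_left_mono mom True) simp
      also have "\<dots> = ennreal (\<epsilon> ^ q / fact q * (2 * ?D * gauss_moment q * (T powr H) ^ (2 * q)))"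
        using \<epsilon> by (intro ennreal_mult'[symmetric]) simp
      also have "\<dots> \<le> ennreal (A * (1 / 2) ^ q)"
      proof (intro ennreal_leI)
        have "\<epsilon> ^ q / fact q * (2 * ?D * gauss_moment q * (T powr H) ^ (2 * q)) \<le> \<epsilon> ^ q / fact q * (2 * ?D * (2 ^ q * fact q) * (T powr H) ^ (2 * q))"
          using \<epsilon> gauss_moment_le_fact[of q] by (intro mult_left_mono mult_right_mono) auto
        also have "\<dots> = 2 * ?D * (\<epsilon> * 2 * (T powr H)\<^sup>2) ^ q" by (simp add: power_mult_distrib power_mult)
        also have "\<epsilon> * 2 * (T powr H)\<^sup>2 = 1 / 2" using T by (simp add: \<epsilon>_def)
        also have "2 * ?D * (1 / 2) ^ q \<le> A * (1 / 2) ^ q"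
          unfolding A_def using \<epsilon> c0 by (intro mult_right_mono) (auto intro!: sum_nonneg)
        finally show "\<epsilon> ^ q / fact q * (2 * ?D * gauss_moment q * (T powr H) ^ (2 * q)) \<le> A * (1 / 2) ^ q" .
      qed
      finally show ?thesis .
    next
      case False
      have "ennreal (\<epsilon> ^ q / fact q) * (\<integral>\<^sup>+\<omega>. kappa \<beta> 1 \<omega> ^ (2 * q) \<partial>M) \<le> ennreal (\<epsilon> ^ q / fact q) * ennreal c"
        using False by (intro mult_left_mono mom') auto
      also have "\<dots> = ennreal (\<epsilon> ^ q / fact q * c)" using \<epsilon> by (intro ennreal_mult'[symmetric]) simp
      also have "\<dots> \<le> ennreal (A * (1 / 2) ^ q)"
      proof (intro ennreal_leI)
        have "\<epsilon> ^ q / fact q * c \<le> \<epsilon> ^ q / 1 * c" using \<epsilon> c0 by (intro mult_right_mono divide_left_mono) auto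
        also have "\<dots> = \<epsilon> ^ q * c * 2 ^ q * (1 / 2) ^ q" by (simp add: power_divide)
        also have "\<dots> \<le> A * (1 / 2) ^ q"
        proof (intro mult_right_mono)
          have "\<epsilon> ^ q * c * 2 ^ q \<le> (\<Sum>q<q0. \<epsilon> ^ q * c * 2 ^ q)"
            using False \<epsilon> c0 by (intro member_le_sum[of q "{..<q0}" "\<lambda>q. \<epsilon> ^ q * c * 2 ^ q"]) auto
          then show "\<epsilon> ^ q * c * 2 ^ q \<le> A" by (simp add: A_def)
        qed simp
        finally show "\<epsilon> ^ q / fact q * c \<le> A * (1 / 2) ^ q" .
      qed
      finally show ?thesis .
    qed
    finally show ?thesis .
  qed
  have "(\<integral>\<^sup>+\<omega>. ennreal (exp (\<epsilon> * (enn2real (kappa \<beta> 1 \<omega>))\<^sup>2)) \<partial>M)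
     = (\<integral>\<^sup>+\<omega>. (\<Sum>q. ennreal ((\<epsilon> * (enn2real (kappa \<beta> 1 \<omega>))\<^sup>2) ^ q / fact q)) \<partial>M)"
  proof (intro nn_integral_cong)
    fix \<omega>
    let ?x = "\<epsilon> * (enn2real (kappa \<beta> 1 \<omega>))\<^sup>2"
    have "(\<lambda>q. ?x ^ q / fact q) sums exp ?x"
      using exp_converges[of ?x] by (simp add: divide_inverse mult.commute)
    then show "ennreal (exp ?x) = (\<Sum>q. ennreal (?x ^ q / fact q))"
      using \<epsilon> by (intro suminf_ennreal_eq[symmetric]) auto
  qed
  also have "\<dots> = (\<Sum>q. \<integral>\<^sup>+\<omega>. ennreal ((\<epsilon> * (enn2real (kappa \<beta> 1 \<omega>))\<^sup>2) ^ q / fact q) \<partial>M)"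
    by (intro nn_integral_suminf) measurable
  also have "\<dots> \<le> (\<Sum>q. ennreal (A * (1 / 2) ^ q))" by (intro suminf_le tm) auto
  also have "\<dots> = ennreal (2 * A)" by (rule suminf_ennreal_half[OF A0])
  also have "\<dots> < \<top>" by simp
  finally show ?thesis using \<epsilon> by blast
qed

text \<open>Since \<open>1 / \<beta> < 2\<close>, the exponent is dominated by a small multiple of \<open>(kappa \<beta> 1)\<^sup>2\<close>.\<close>

lemma exp_kappa_bounded:
  assumes "1 / 2 < \<beta>" "\<beta> < H" "0 \<le> c" "0 \<le> a" "1 \<le> b"
  shows "moment_bounded M (\<lambda>n \<omega>. ennreal (exp (c * (b + a * enn2real (kappa \<beta> 1 \<omega>)) powr (1 / \<beta>))))"
proof (rule moment_boundedI)
  note [measurable] = kappa_measurable[OF order_refl, of \<beta>]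
  show "(\<lambda>\<omega>. ennreal (exp (c * (b + a * enn2real (kappa \<beta> 1 \<omega>)) powr (1 / \<beta>)))) \<in> borel_measurable M" by measurable
  fix q :: nat
  obtain \<epsilon> where \<epsilon>: "0 < \<epsilon>" "(\<integral>\<^sup>+\<omega>. ennreal (exp (\<epsilon> * (enn2real (kappa \<beta> 1 \<omega>))\<^sup>2)) \<partial>M) < \<top>"
    using exp_square_kappa[OF assms(2)] by blast
  then obtain E where E: "(\<integral>\<^sup>+\<omega>. ennreal (exp (\<epsilon> * (enn2real (kappa \<beta> 1 \<omega>))\<^sup>2)) \<partial>M) = ennreal E" "0 \<le> E"
    by (cases "\<integral>\<^sup>+\<omega>. ennreal (exp (\<epsilon> * (enn2real (kappa \<beta> 1 \<omega>))\<^sup>2)) \<partial>M") auto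
  \<comment> \<open>Small enough that the part of q * c * (b + a * k)^(1/\<beta>) quadratic in k
    stays below \<epsilon> * k^2; the summands 1 keep the denominator positive.\<close>
  define \<delta> where "\<delta> = \<epsilon> / ((real q * c + 1) * (2 * (a\<^sup>2 + 1)))"
  have den: "0 < (real q * c + 1) * (2 * (a\<^sup>2 + 1))" using assms by (intro mult_pos_pos add_nonneg_pos) auto
  have \<delta>: "0 < \<delta>" "real q * c * (\<delta> * (2 * a\<^sup>2)) \<le> \<epsilon>"
  proof -
    show "0 < \<delta>" using \<epsilon> den by (simp add: \<delta>_def)
    have "real q * c * (2 * a\<^sup>2) \<le> (real q * c + 1) * (2 * (a\<^sup>2 + 1))" using assms by (intro mult_mono) auto
    then have "\<delta> * (real q * c * (2 * a\<^sup>2)) \<le> \<delta> * ((real q * c + 1) * (2 * (a\<^sup>2 + 1)))" using \<open>0 < \<delta>\<close> by (intro mult_left_mono) auto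
    also have "\<dots> = \<epsilon>" unfolding \<delta>_def times_divide_eq_left by (metis den less_irrefl nonzero_mult_div_cancel_right)
    finally show "real q * c * (\<delta> * (2 * a\<^sup>2)) \<le> \<epsilon>" by (simp add: mult_ac)
  qed
  define g where "g = real q * c * (\<delta> * (2 * b\<^sup>2) + (\<delta> powr (1 / (1 / \<beta> - 2))) powr (1 / \<beta>))"
  have "(\<integral>\<^sup>+\<omega>. ennreal (exp (c * (b + a * enn2real (kappa \<beta> 1 \<omega>)) powr (1 / \<beta>))) ^ q \<partial>M)
     \<le> (\<integral>\<^sup>+\<omega>. ennreal (exp g) * ennreal (exp (\<epsilon> * (enn2real (kappa \<beta> 1 \<omega>))\<^sup>2)) \<partial>M)"
  proof (intro nn_integral_mono)
    fix \<omega>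
    define k where "k = enn2real (kappa \<beta> 1 \<omega>)"
    have k0: "0 \<le> k" by (simp add: k_def)
    have "(b + a * k) powr (1 / \<beta>) \<le> \<delta> * (b + a * k)\<^sup>2 + (\<delta> powr (1 / (1 / \<beta> - 2))) powr (1 / \<beta>)"
      using assms \<delta> k0 by (intro powr_le_square) (auto simp: field_simps add_pos_nonneg)
    also have "(b + a * k)\<^sup>2 \<le> 2 * b\<^sup>2 + 2 * a\<^sup>2 * k\<^sup>2"
      using sum_squares_bound[of b "a * k"] by (simp add: power2_sum power_mult_distrib)
    finally have "(b + a * k) powr (1 / \<beta>) \<le> \<delta> * (2 * b\<^sup>2 + 2 * a\<^sup>2 * k\<^sup>2) + (\<delta> powr (1 / (1 / \<beta> - 2))) powr (1 / \<beta>)"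
      using \<delta>(1) by simp
    then have "real q * c * (b + a * k) powr (1 / \<beta>) \<le> real q * c * (\<delta> * (2 * b\<^sup>2 + 2 * a\<^sup>2 * k\<^sup>2) + (\<delta> powr (1 / (1 / \<beta> - 2))) powr (1 / \<beta>))"
      using assms by (intro mult_left_mono) auto
    also have "\<dots> = g + real q * c * (\<delta> * (2 * a\<^sup>2)) * k\<^sup>2" by (simp add: g_def algebra_simps)
    also have "\<dots> \<le> g + \<epsilon> * k\<^sup>2" using \<delta>(2) by (intro add_left_mono mult_right_mono) auto
    finally have "exp (real q * (c * (b + a * k) powr (1 / \<beta>))) \<le> exp (g + \<epsilon> * k\<^sup>2)" by (simp add: mult.assoc)
    then show "ennreal (exp (c * (b + a * enn2real (kappa \<beta> 1 \<omega>)) powr (1 / \<beta>))) ^ q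
       \<le> ennreal (exp g) * ennreal (exp (\<epsilon> * (enn2real (kappa \<beta> 1 \<omega>))\<^sup>2))"
      unfolding k_def by (simp add: ennreal_power exp_of_nat_mult exp_add ennreal_mult[symmetric] ennreal_leI)
  qed
  also have "\<dots> = ennreal (exp g) * ennreal E" by (simp add: nn_integral_cmult E del: One_nat_def)
  also have "\<dots> = ennreal (exp g * E)" using E by (simp add: ennreal_mult)
  finally show "\<exists>C. \<exists>q'\<ge>q. \<forall>n\<ge>1::nat. (\<integral>\<^sup>+\<omega>. ennreal (exp (c * (b + a * enn2real (kappa \<beta> 1 \<omega>)) powr (1 / \<beta>))) ^ q' \<partial>M) \<le> ennreal C"
    by blast
qed

end

section \<open>From moments to \<open>L\<^sup>p\<close> norms\<close>

lemma enn_powr_mono: "x \<le> y \<Longrightarrow> 0 \<le> p \<Longrightarrow> enn_powr x p \<le> enn_powr y p"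
  unfolding enn_powr_def
  by (auto simp: top_unique intro!: ennreal_leI powr_mono2 enn2real_mono simp: less_top[symmetric])

text \<open>The constant is chosen before n, \<open>F\<close> and \<open>\<epsilon>\<close>. Almost
  sure domination is all that enters about \<open>F\<close>, so a supremum over uncountably many
  times can be inserted without a measurability argument.\<close>

lemma (in prob_space) Lp_norm_le:
  assumes G: "moment_bounded M G" and p: "1 \<le> p"
  shows "\<exists>C\<ge>0. \<forall>n\<ge>1. \<forall>F \<epsilon>. 0 < \<epsilon> \<longrightarrow> (AE \<omega> in M. F \<omega> \<le> ennreal \<epsilon> * G n \<omega>) \<longrightarrow> Lp_norm M p F \<le> ennreal (C * \<epsilon>)"
proof -
  \<comment> \<open>Rounding p up passes to an integer order, at the cost of the summand 1 in r^p <=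
    1 + r^q.\<close>
  define q where "q = nat \<lceil>p\<rceil>"
  have q: "p \<le> real q" unfolding q_def using p by simp
  obtain A :: real where A: "0 \<le> A" "\<forall>n\<ge>1. (\<integral>\<^sup>+\<omega>. G n \<omega> ^ q \<partial>M) \<le> ennreal A"
    using moment_bounded_bound[OF G] by blast
  have "Lp_norm M p F \<le> ennreal ((1 + A) powr (1 / p) * \<epsilon>)"
    if n: "1 \<le> n" and \<epsilon>: "0 < \<epsilon>" and F: "AE \<omega> in M. F \<omega> \<le> ennreal \<epsilon> * G n \<omega>" for n F \<epsilon>
  proof -
    note [measurable] = moment_bounded_measurable[OF G n]
    have le: "enn_powr (ennreal \<epsilon> * g) p \<le> ennreal (\<epsilon> powr p) * (1 + g ^ q)" for g
    proof (cases g)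
      case (real r)
      have "r powr p \<le> 1 + r ^ q"
      proof (cases "r \<le> 1")
        case True
        then have "r powr p \<le> 1 powr p" using real p by (intro powr_mono2) auto
        then show ?thesis using real by (simp add: add_increasing2)
      next
        case False
        then have "r powr p \<le> r powr (real q)" using q by (intro powr_mono) auto
        then show ?thesis using False by (simp add: powr_realpow)
      qed
      then have "\<epsilon> powr p * r powr p \<le> \<epsilon> powr p * (1 + r ^ q)" by (intro mult_left_mono) auto
      moreover have "enn_powr (ennreal \<epsilon> * g) p = ennreal (\<epsilon> powr p * r powr p)"
        using real \<epsilon> by (simp add: enn_powr_def ennreal_mult[symmetric] powr_mult)
      moreover have "ennreal (\<epsilon> powr p) * (1 + g ^ q) = ennreal (\<epsilon> powr p * (1 + r ^ q))"
        using real by (simp add: ennreal_mult ennreal_power ennreal_plus[symmetric] del: ennreal_plus flip: ennreal_1)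
      ultimately show ?thesis by (simp add: ennreal_leI)
    next
      case top
      have "0 < q" using q p by (cases q) auto
      then show ?thesis using \<epsilon> by (simp add: top ennreal_mult_top top_power_ennreal)
    qed
    have "(\<integral>\<^sup>+\<omega>. enn_powr (F \<omega>) p \<partial>M) \<le> (\<integral>\<^sup>+\<omega>. ennreal (\<epsilon> powr p) * (1 + G n \<omega> ^ q) \<partial>M)"
      using F by (intro nn_integral_mono_AE) (use p in \<open>auto elim!: eventually_mono intro: order_trans[OF enn_powr_mono le]\<close>)
    also have "\<dots> = ennreal (\<epsilon> powr p) * (1 + (\<integral>\<^sup>+\<omega>. G n \<omega> ^ q \<partial>M))"
      by (simp add: nn_integral_cmult nn_integral_add emeasure_space_1)
    also have "\<dots> \<le> ennreal (\<epsilon> powr p) * (1 + ennreal A)"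
      using A(2) n by (intro mult_left_mono add_left_mono) auto
    also have "\<dots> = ennreal (\<epsilon> powr p * (1 + A))"
      using A(1) by (simp add: ennreal_mult)
    finally have "Lp_norm M p F \<le> enn_powr (ennreal (\<epsilon> powr p * (1 + A))) (1 / p)"
      unfolding Lp_norm_def using p by (intro enn_powr_mono) auto
    also have "\<dots> = ennreal ((\<epsilon> powr p * (1 + A)) powr (1 / p))" using A by (simp add: enn_powr_def)
    also have "(\<epsilon> powr p * (1 + A)) powr (1 / p) = (1 + A) powr (1 / p) * \<epsilon>"
      using A(1) \<epsilon> p by (simp add: powr_mult powr_powr mult.commute)
    finally show ?thesis .
  qed
  then show ?thesis by (intro exI[of _ "(1 + A) powr (1 / p)"]) auto
qed


section \<open>The error of the scheme\<close>

context driving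
begin

lemma kappa_increment:
  assumes "kappa \<beta> n \<omega> \<noteq> \<top>" "l \<noteq> i\<^sub>1" "j < n * 2 ^ r"
  shows "\<bar>X (real (Suc j) * (T / real n / 2 ^ r)) \<omega> $ l - X (real j * (T / real n / 2 ^ r)) \<omega> $ l\<bar>
    \<le> enn2real (kappa \<beta> n \<omega>) * (1 / 2 ^ r) powr \<beta>" (is "?d \<le> _")
proof -
  have "ennreal ((2 ^ r) powr \<beta> * ?d) \<le> kappa \<beta> n \<omega>"
    unfolding kappa_def by (rule SUP_upper2[of "(l, r, j)"]) (use assms in auto)
  also have "\<dots> = ennreal (enn2real (kappa \<beta> n \<omega>))" using assms by (simp add: less_top)
  finally have "(2 ^ r) powr \<beta> * ?d \<le> enn2real (kappa \<beta> n \<omega>)" by simp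
  then show ?thesis by (simp add: powr_divide field_simps)
qed

lemma cell_bounds:
  assumes "k < n"
  shows "0 \<le> real k * (T / real n)" "real k * (T / real n) < real (Suc k) * (T / real n)"
    "real (Suc k) * (T / real n) \<le> T" "real (Suc k) * (T / real n) - real k * (T / real n) = T / real n"
proof -
  define h where "h = T / real n"
  have h: "0 < h" "real n * h = T" using T assms by (auto simp: h_def)
  have "real (Suc k) * h \<le> real n * h" using assms h(1) by (intro mult_right_mono) auto
  then have "real (Suc k) * h \<le> T" unfolding h(2) .
  moreover have "0 \<le> real k * h" "real k * h < real (Suc k) * h" "real (Suc k) * h - real k * h = h"
    using h(1) by (auto simp: algebra_simps)
  ultimately show "0 \<le> real k * (T / real n)" "real k * (T / real n) < real (Suc k) * (T / real n)"
    "real (Suc k) * (T / real n) \<le> T" "real (Suc k) * (T / real n) - real k * (T / real n) = T / real n"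
    by (simp_all only: flip: h_def)
qed

text \<open>Dyadic chaining inside one cell, with length measured relative to the cell. For n = 1
  the only cell is [0,T], so the same statement gives the global Hoelder constant.\<close>

lemma path_holder:
  assumes beta: "0 < \<beta>" "\<beta> \<le> 1" and "1 \<le> n" and \<omega>: "\<omega> \<in> space M" "kappa \<beta> n \<omega> \<noteq> \<top>" and "l \<noteq> i\<^sub>1" "k < n"
    and uv: "real k * (T / real n) \<le> u" "u < v" "v \<le> real (Suc k) * (T / real n)"
  shows "\<bar>X v \<omega> $ l - X u \<omega> $ l\<bar> \<le> 3 * enn2real (kappa \<beta> n \<omega>) * chain_const \<beta> * ((v - u) / (T / real n)) powr \<beta>"
proof -
  interpret B: fbm M H T "\<lambda>t \<omega>. X t \<omega> $ l" by (rule X_fbm) fact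
  define h where "h = T / real n"
  have h: "0 < h" using T assms by (simp add: h_def)
  have nh: "real n * h = T" using assms by (simp add: h_def)
  have Suc_k: "real (Suc k) * h = real k * h + h" by (simp add: algebra_simps)
  have "real (Suc k) * h \<le> real n * h" using h \<open>k < n\<close> by (intro mult_right_mono) auto
  then have sub: "{real k * h..real k * h + h} \<subseteq> {0..T}" using h unfolding nh Suc_k by auto
  have "norm (X v \<omega> $ l - X u \<omega> $ l) \<le> 3 * enn2real (kappa \<beta> n \<omega>) * chain_const \<beta> * ((v - u) / h) powr \<beta>"
  proof (rule dyadic_path_holder[where s = "real k * h" and f = "\<lambda>t. X t \<omega> $ l"])
    fix r j :: nat assume j: "j < 2 ^ r"
    have "k * 2 ^ r + j < (k + 1) * 2 ^ r" using j by simp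
    also have "\<dots> \<le> n * 2 ^ r" using \<open>k < n\<close> by (intro mult_right_mono) auto
    finally have lt: "k * 2 ^ r + j < n * 2 ^ r" .
    have e: "real k * h + real m * (h / 2 ^ r) = real (k * 2 ^ r + m) * (h / 2 ^ r)" for m
      by (simp add: field_simps)
    show "norm (X (real k * h + real (Suc j) * (h / 2 ^ r)) \<omega> $ l - X (real k * h + real j * (h / 2 ^ r)) \<omega> $ l)
      \<le> enn2real (kappa \<beta> n \<omega>) * (1 / 2 ^ r) powr \<beta>"
      using kappa_increment[OF \<omega>(2) \<open>l \<noteq> i\<^sub>1\<close> lt, folded h_def add_Suc_right] unfolding e real_norm_def .
  qed (use beta h uv Suc_k sub continuous_on_subset[OF B.B_continuous[OF \<omega>(1)]] in \<open>auto simp: h_def\<close>)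
  then show ?thesis by (simp add: h_def)
qed

lemma area_block_bound:
  assumes "1 \<le> n" "area_sup \<beta> n \<omega> \<noteq> \<top>" "(k + 1) * 2 ^ \<rho> \<le> n"
  shows "\<bar>area_block n i j r \<rho> k \<omega>\<bar>
    \<le> enn2real (area_sup \<beta> n \<omega>) * (T / real n) powr H * (T / real n) powr \<beta> * (2 ^ r) powr (- (H / 2)) * (2 ^ \<rho>) powr \<beta>"
proof -
  let ?h = "T / real n"
  have "k + 1 \<le> n div 2 ^ \<rho>" using assms(3) by (simp add: less_eq_div_iff_mult_less_eq)
  moreover have "2 ^ \<rho> \<le> n" using order_trans[OF mult_right_mono[of 1 "k + 1" "2 ^ \<rho>"] assms(3)] by simp
  ultimately have "ennreal (block_weight \<beta> n r \<rho> * \<bar>area_block n i j r \<rho> k \<omega>\<bar>) \<le> area_sup \<beta> n \<omega>"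
    unfolding area_sup_def by (intro SUP_upper2[of "(i, j, r, \<rho>, k)"]) auto
  also have "\<dots> = ennreal (enn2real (area_sup \<beta> n \<omega>))" using assms by (simp add: less_top)
  finally have "block_weight \<beta> n r \<rho> * \<bar>area_block n i j r \<rho> k \<omega>\<bar> \<le> enn2real (area_sup \<beta> n \<omega>)" by simp
  moreover have "block_weight \<beta> n r \<rho> = 1 / (?h powr H * ?h powr \<beta> * (2 ^ r) powr (- (H / 2)) * (2 ^ \<rho>) powr \<beta>)"
  proof -
    have "(2 ^ \<rho> * h) powr \<beta> = (2 ^ \<rho>) powr \<beta> * h powr \<beta>" if "0 \<le> h" for h :: real using that by (simp add: powr_mult)
    from this[of ?h] show ?thesis using T by (simp add: block_weight_def powr_minus_divide mult_ac)
  qed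
  moreover have "0 < ?h powr H * ?h powr \<beta> * (2 ^ r) powr (- (H / 2)) * (2 ^ \<rho>) powr \<beta>" using T assms by simp
  ultimately show ?thesis by (simp add: divide_le_eq mult.assoc)
qed

text \<open>The factor that \<open>area_sum_bound\<close> produces for \<eta> = H / 2, the decay
  built into \<open>block_weight\<close>.\<close>

definition area_const :: "real \<Rightarrow> real" where
  "area_const \<beta> = 3 * chain_const \<beta> / (1 - 2 powr (- (H / 2)))"

lemma area_const: "0 < \<beta> \<Longrightarrow> \<beta> \<le> 1 \<Longrightarrow> 0 \<le> area_const \<beta>"
  using chain_const(1)[of \<beta>] powr_less_mono[of "- (H / 2)" 0 2] H unfolding area_const_def by (intro divide_nonneg_pos) auto

text \<open>One Hoelder constant for all coordinates: T^(1 - \<beta>) covers time, T^(- \<beta>)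
  undoes the rescaling of [0,T] to unit length, and the summand 1 allows powers of it to be
  compared.\<close>

definition holder_scale :: "real \<Rightarrow> 'w \<Rightarrow> real" where
  "holder_scale \<beta> \<omega> = 1 + T powr (1 - \<beta>) + 3 * chain_const \<beta> * T powr (- \<beta>) * enn2real (kappa \<beta> 1 \<omega>)"

lemma holder_scale_ge_1: "0 < \<beta> \<Longrightarrow> \<beta> \<le> 1 \<Longrightarrow> 1 \<le> holder_scale \<beta> \<omega>"
  using chain_const(1)[of \<beta>] unfolding holder_scale_def by (simp add: add_nonneg_nonneg)

lemma driving_holder:
  assumes beta: "0 < \<beta>" "\<beta> \<le> 1" and \<omega>: "\<omega> \<in> space M" "kappa \<beta> 1 \<omega> \<noteq> \<top>" and st: "0 \<le> s" "s < t" "t \<le> T"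
  shows "\<bar>X t \<omega> $ l - X s \<omega> $ l\<bar> \<le> holder_scale \<beta> \<omega> * (t - s) powr \<beta>"
proof -
  let ?a = "3 * chain_const \<beta> * T powr (- \<beta>) * enn2real (kappa \<beta> 1 \<omega>)"
  have a: "0 \<le> ?a" using chain_const(1)[OF beta] by simp
  show ?thesis
  proof (cases "l = i\<^sub>1")
    case True
    have "\<bar>X t \<omega> $ l - X s \<omega> $ l\<bar> = t - s" using st \<omega> by (simp add: True X_time)
    also have "\<dots> = (t - s) powr (1 - \<beta>) * (t - s) powr \<beta>" using st by (simp flip: powr_add)
    also have "\<dots> \<le> T powr (1 - \<beta>) * (t - s) powr \<beta>" using st beta by (intro mult_right_mono powr_mono2) auto
    also have "\<dots> \<le> holder_scale \<beta> \<omega> * (t - s) powr \<beta>" using a by (intro mult_right_mono) (auto simp: holder_scale_def)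
    finally show ?thesis .
  next
    case False
    have "\<bar>X t \<omega> $ l - X s \<omega> $ l\<bar> \<le> 3 * enn2real (kappa \<beta> 1 \<omega>) * chain_const \<beta> * ((t - s) / (T / real 1)) powr \<beta>"
      by (rule path_holder[OF beta order_refl \<omega> False, of 0]) (use st in auto)
    also have "\<dots> = ?a * (t - s) powr \<beta>" using st T by (simp add: powr_divide powr_minus field_simps del: One_nat_def)
    also have "\<dots> \<le> holder_scale \<beta> \<omega> * (t - s) powr \<beta>" by (intro mult_right_mono) (auto simp: holder_scale_def)
    finally show ?thesis .
  qed
qed

lemma driving_cell_increment:
  assumes beta: "0 < \<beta>" "\<beta> \<le> 1" and \<omega>: "\<omega> \<in> space M" "kappa \<beta> n \<omega> \<noteq> \<top>" and k: "k < n"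
    and t: "real k * (T / real n) \<le> t" "t \<le> real (Suc k) * (T / real n)"
  shows "\<bar>X t \<omega> $ l - X (real k * (T / real n)) \<omega> $ l\<bar> \<le> 3 * chain_const \<beta> * enn2real (kappa \<beta> n \<omega>) + T / real n"
proof -
  let ?h = "T / real n" and ?c = "3 * chain_const \<beta> * enn2real (kappa \<beta> n \<omega>)"
  have c: "0 \<le> ?c" using chain_const(1)[OF beta] by simp
  have h: "0 < ?h" "real n * ?h = T" using T k by auto
  note cell = cell_bounds[OF k]
  have diff: "t - real k * ?h \<le> ?h" using diff_right_mono[OF t(2), of "real k * ?h"] unfolding cell(4) .
  have tT: "t \<le> T" by (rule order_trans[OF t(2) cell(3)])
  consider "t = real k * ?h" | "l = i\<^sub>1" | "real k * ?h < t" "l \<noteq> i\<^sub>1" using t by fastforce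
  then show ?thesis
  proof cases
    case 1
    then show ?thesis using c h by simp
  next
    case 2
    have "X t \<omega> $ i\<^sub>1 = t" "X (real k * ?h) \<omega> $ i\<^sub>1 = real k * ?h" 
      using tT t cell(1) by (auto intro!: X_time[OF \<omega>(1)] order_trans[OF cell(1)] intro: order_trans)
    then show ?thesis using c diff t 2 by simp
  next
    case 3
    have "\<bar>X t \<omega> $ l - X (real k * ?h) \<omega> $ l\<bar> \<le> 3 * enn2real (kappa \<beta> n \<omega>) * chain_const \<beta> * ((t - real k * ?h) / ?h) powr \<beta>"
      by (rule path_holder[OF beta _ \<omega> 3(2) k]) (use 3 t k in auto)
    also have "\<dots> \<le> 3 * enn2real (kappa \<beta> n \<omega>) * chain_const \<beta> * 1"
    proof (intro mult_left_mono)
      have "(t - real k * ?h) / ?h \<le> 1" using diff h(1) by (simp only: divide_le_eq_1_pos)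
      then have "((t - real k * ?h) / ?h) powr \<beta> \<le> 1 powr \<beta>" using t h(1) beta by (intro powr_mono2 divide_nonneg_pos) auto
      then show "((t - real k * ?h) / ?h) powr \<beta> \<le> 1" by simp
    qed (use chain_const(1)[OF beta] in simp)
    finally show ?thesis using h by (simp add: mult_ac)
  qed
qed

text \<open>The deterministic estimate evaluated on one path: finiteness of the three suprema is all
  that probability has to supply, and the constant is fixed before n and \<omega>.\<close>

lemma pathwise_bound:
  fixes V :: "real ^ 'm \<Rightarrow> real ^ 'd ^ 'm"
  assumes V: "Cb (N + 1) V" and N: "2 \<le> N" and beta: "1 / 2 < \<beta>" "\<beta> < H" "3 * \<beta> - 1 = H"
  shows "\<exists>C\<ge>1. \<forall>n \<omega> Y y t. 1 \<le> n \<and> \<omega> \<in> space M \<and> kappa \<beta> 1 \<omega> \<noteq> \<top> \<and> kappa \<beta> n \<omega> \<noteq> \<top> \<and> area_sup \<beta> n \<omega> \<noteq> \<top> \<and>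
      young_solution V y T (\<lambda>t. X t \<omega>) Y \<and> t \<in> {0..T} \<longrightarrow>
    norm (Y t - linear_interpolation (T / real n) (simplified_euler V N (T / real n) (\<lambda>s. X s \<omega>) y) t)
      \<le> C * holder_scale \<beta> \<omega> ^ (N + 4) * exp (C * holder_scale \<beta> \<omega> powr (1 / \<beta>)) *
        (area_const \<beta> * (T / real n) powr H * enn2real (area_sup \<beta> n \<omega>) +
         (3 * chain_const \<beta> * enn2real (kappa \<beta> n \<omega>) + T / real n) + (T / real n) powr H)"
proof -
  have b: "0 < \<beta>" "\<beta> \<le> 1" using beta H by auto
  define U where "U = (\<lambda>l z. column l (V z))"
  define DU where "DU = (\<lambda>l z. frechet_derivative (U l) (at z))"
  have "Cb 3 V" using V N by (intro Cb_le[OF V]) simp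
  from vector_fields_of_Cb[OF this beta(1) b(2)] obtain L
    where L: "\<And>R3. 0 \<le> R3 \<Longrightarrow> vector_fields U DU (real CARD('d)) L \<beta> R3" unfolding U_def DU_def by blast
  have "\<exists>R\<ge>0. \<forall>\<Delta> z \<delta>. (\<forall>l. \<bar>\<Delta> $ l\<bar> \<le> \<delta>) \<longrightarrow>
      (\<delta> \<le> 1 \<longrightarrow> norm (simplified_step V N \<Delta> z - z - (\<Sum>l\<in>UNIV. (\<Delta> $ l) *\<^sub>R U l z)
        - (\<Sum>i\<in>UNIV. \<Sum>j\<in>UNIV. ((\<Delta> $ i) * (\<Delta> $ j) / 2) *\<^sub>R DU j z (U i z))) \<le> R * \<delta> ^ 3) \<and>
      (1 \<le> \<delta> \<longrightarrow> norm (simplified_step V N \<Delta> z - z) \<le> R * \<delta> ^ N)"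
    using simplified_step_expansion[OF V N] unfolding U_def DU_def .
  then obtain R where R: "0 \<le> R" and RE: "\<forall>\<Delta> z \<delta>. (\<forall>l. \<bar>\<Delta> $ l\<bar> \<le> \<delta>) \<longrightarrow>
      (\<delta> \<le> 1 \<longrightarrow> norm (simplified_step V N \<Delta> z - z - (\<Sum>l\<in>UNIV. (\<Delta> $ l) *\<^sub>R U l z)
        - (\<Sum>i\<in>UNIV. \<Sum>j\<in>UNIV. ((\<Delta> $ i) * (\<Delta> $ j) / 2) *\<^sub>R DU j z (U i z))) \<le> R * \<delta> ^ 3) \<and>
      (1 \<le> \<delta> \<longrightarrow> norm (simplified_step V N \<Delta> z - z) \<le> R * \<delta> ^ N)"
    by (elim exE conjE) (rule that)
  interpret VF: vector_fields U DU "real CARD('d)" L \<beta> R by (rule L[OF R])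
  \<comment> \<open>The increments over a cell are at most K * (1 + T), a number that is at least 1,
    so the second regime of the step expansion bounds a step by B * K^N.\<close>
  define B where "B = R * (1 + T) ^ N"
  have B: "0 \<le> B" using R T by (simp add: B_def)
  obtain C where C: "1 \<le> C" and CE: "\<forall>x K Y \<Lambda>\<^sub>0 n h Q W y t.
     driven_solution U DU (real CARD('d)) L \<beta> R x T K Y \<Lambda>\<^sub>0 \<and> 1 \<le> (n::nat) \<and> real n * h = T \<and> 0 \<le> Q \<and> y 0 = Y 0 \<and>
     (K * h powr \<beta> \<le> 1 \<longrightarrow> scheme U DU (real CARD('d)) L \<beta> R x T K Y \<Lambda>\<^sub>0 n h Q y) \<and>
     (\<forall>l k t. k < n \<and> real k * h \<le> t \<and> t \<le> real (Suc k) * h \<longrightarrow> \<bar>x l t - x l (real k * h)\<bar> \<le> W) \<and>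
     (\<forall>k<n. norm (y (Suc k) - y k) \<le> B * K ^ N) \<and> 0 \<le> t \<and> t \<le> T
     \<longrightarrow> norm (Y t - linear_interpolation h y t)
       \<le> C * K ^ (N + 4) * exp (C * K powr (1 / \<beta>)) * (Q + W + h powr (3 * \<beta> - 1))"
    using VF.pathwise_error[OF T B, of N] by (elim exE conjE) (rule that)
  show ?thesis
  proof (intro exI[of _ C] conjI C allI impI, elim conjE)
    fix n :: nat and \<omega> Y y t
    assume n: "1 \<le> n" and \<omega>: "\<omega> \<in> space M" and k1: "kappa \<beta> 1 \<omega> \<noteq> \<top>" and kn: "kappa \<beta> n \<omega> \<noteq> \<top>" and an: "area_sup \<beta> n \<omega> \<noteq> \<top>"
      and sol: "young_solution V y T (\<lambda>t. X t \<omega>) Y" and t: "t \<in> {0..T}"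
    let ?K = "holder_scale \<beta> \<omega>" and ?h = "T / real n" and ?x = "\<lambda>l t. X t \<omega> $ l"
    let ?y = "simplified_euler V N ?h (\<lambda>s. X s \<omega>) y"
    let ?\<Delta> = "\<lambda>k. X (real (Suc k) * ?h) \<omega> - X (real k * ?h) \<omega>"
    have h: "0 < ?h" "real n * ?h = T" "?h \<le> T" using T n by (auto simp: field_simps)
    have K: "1 \<le> ?K" by (rule holder_scale_ge_1[OF b])
    have hold: "\<bar>X t \<omega> $ l - X s \<omega> $ l\<bar> \<le> ?K * (t - s) powr \<beta>" if "0 \<le> s" "s < t" "t \<le> T" for l s t
      by (rule driving_holder[OF b \<omega> k1 that])
    obtain \<Lambda>\<^sub>0 where ds: "driven_solution U DU (real CARD('d)) L \<beta> R ?x T ?K Y \<Lambda>\<^sub>0"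
      using young_solution_driven[OF L[OF R, unfolded U_def] T K hold sol] unfolding U_def by blast
    interpret DS: driven_solution U DU "real CARD('d)" L \<beta> R ?x T ?K Y \<Lambda>\<^sub>0 by (rule ds)
    have \<Delta>: "\<bar>?\<Delta> k $ l\<bar> \<le> ?K * ?h powr \<beta>" if "k < n" for k l
      using hold[OF cell_bounds(1-3)[OF that], of l] unfolding cell_bounds(4)[OF that] vector_minus_component .
    let ?Q = "area_const \<beta> * ?h powr H * enn2real (area_sup \<beta> n \<omega>)"
    have Q: "0 \<le> ?Q" using area_const[OF b] by simp
    have "norm (Y t - linear_interpolation ?h ?y t) \<le> C * ?K ^ (N + 4) * exp (C * ?K powr (1 / \<beta>)) *
       (?Q + (3 * chain_const \<beta> * enn2real (kappa \<beta> n \<omega>) + ?h) + ?h powr (3 * \<beta> - 1))"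
    proof (rule CE[THEN spec[of _ ?x], THEN spec[of _ ?K], THEN spec[of _ Y], THEN spec[of _ \<Lambda>\<^sub>0], THEN spec[of _ n], THEN spec[of _ ?h],
        THEN spec[of _ ?Q], THEN spec[of _ "3 * chain_const \<beta> * enn2real (kappa \<beta> n \<omega>) + ?h"], THEN spec[of _ ?y], THEN spec[of _ t], THEN mp],
        intro conjI ds n h(2) Q)
      show "?y 0 = Y 0" using sol by (simp add: young_solution_def)
      show "\<forall>l k t. k < n \<and> real k * ?h \<le> t \<and> t \<le> real (Suc k) * ?h \<longrightarrow>
          \<bar>?x l t - ?x l (real k * ?h)\<bar> \<le> 3 * chain_const \<beta> * enn2real (kappa \<beta> n \<omega>) + ?h"
        by (intro allI impI, elim conjE, rule driving_cell_increment[OF b \<omega> kn])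
      show "\<forall>k<n. norm (?y (Suc k) - ?y k) \<le> B * ?K ^ N"
      proof (intro allI impI)
        fix k assume k: "k < n"
        have "?h powr \<beta> \<le> (1 + T) powr \<beta>" using h T b by (intro powr_mono2) auto
        also have "\<dots> \<le> (1 + T) powr 1" using T b by (intro powr_mono) auto
        finally have "?K * ?h powr \<beta> \<le> ?K * (1 + T)" using K T by (intro mult_left_mono) auto
        then have "\<bar>?\<Delta> k $ l\<bar> \<le> ?K * (1 + T)" for l using \<Delta>[OF k, of l] by linarith
        moreover have "1 * 1 \<le> ?K * (1 + T)" using K T by (intro mult_mono) auto
        ultimately have "norm (simplified_step V N (?\<Delta> k) (?y k) - ?y k) \<le> R * (?K * (1 + T)) ^ N"
          using RE[THEN spec, THEN spec, THEN spec, of "?\<Delta> k" "?K * (1 + T)" "?y k"] by simp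
        then show "norm (?y (Suc k) - ?y k) \<le> B * ?K ^ N" by (simp add: B_def power_mult_distrib mult_ac del: of_nat_Suc)
      qed
      show "?K * ?h powr \<beta> \<le> 1 \<longrightarrow> scheme U DU (real CARD('d)) L \<beta> R ?x T ?K Y \<Lambda>\<^sub>0 n ?h ?Q ?y"
      proof (intro impI scheme.intro scheme_axioms.intro ds n h(2) Q)
        assume Kh: "?K * ?h powr \<beta> \<le> 1"
        then show "?K * ?h powr \<beta> \<le> 1" .
        fix k assume k: "k < n"
        have "norm (simplified_step V N (?\<Delta> k) (?y k) - ?y k - (\<Sum>l\<in>UNIV. (?\<Delta> k $ l) *\<^sub>R U l (?y k))
          - (\<Sum>i\<in>UNIV. \<Sum>j\<in>UNIV. ((?\<Delta> k $ i) * (?\<Delta> k $ j) / 2) *\<^sub>R DU j (?y k) (U i (?y k)))) \<le> R * (?K * ?h powr \<beta>) ^ 3"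
          using RE[THEN spec, THEN spec, THEN spec, of "?\<Delta> k" "?K * ?h powr \<beta>" "?y k"] \<Delta>[OF k] Kh by blast
        also have "R * (?K * ?h powr \<beta>) ^ 3 = R * ?K ^ 3 * ?h powr (3 * \<beta>)"
          using h(1) by (simp add: power_mult_distrib powr_powr mult.commute[of \<beta>] flip: powr_numeral)
        finally show "norm (?y (Suc k) - ?y k - (\<Sum>l\<in>UNIV. (?x l (real (Suc k) * ?h) - ?x l (real k * ?h)) *\<^sub>R U l (?y k))
          - (\<Sum>i\<in>UNIV. \<Sum>j\<in>UNIV. ((?x i (real (Suc k) * ?h) - ?x i (real k * ?h)) * (?x j (real (Suc k) * ?h) - ?x j (real k * ?h)) / 2)
            *\<^sub>R DU j (?y k) (U i (?y k)))) \<le> R * ?K ^ 3 * ?h powr (3 * \<beta>)"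
          by (simp only: simplified_euler.simps vector_minus_component)
      next
        show "?y 0 = Y 0" using sol by (simp add: young_solution_def)
      next
        fix i j and a c :: nat assume ac: "a < c" "c \<le> n"
        let ?A = "enn2real (area_sup \<beta> n \<omega>) * ?h powr H * ?h powr \<beta>"
        have "\<bar>\<Sum>k\<in>{a..<c}. levy_area ?x i j (real k * ?h) (real (Suc k) * ?h)\<bar>
          \<le> 3 * ?A * chain_const \<beta> / (1 - 2 powr (- (H / 2))) * real (c - a) powr \<beta>"
          by (rule DS.area_sum_bound[OF n h(2) _ _ area_block_bound[OF n an, unfolded area_block_def] ac]) (use H in auto)
        also have "\<dots> = ?Q * (real (c - a) * ?h) powr \<beta>"
        proof -
          have "(real (c - a) * h) powr \<beta> = real (c - a) powr \<beta> * h powr \<beta>" if "0 < h" for h :: real using that by (simp add: powr_mult)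
          note e = this[OF h(1)]
          show ?thesis unfolding e area_const_def by (simp only: times_divide_eq_left times_divide_eq_right mult_ac)
        qed
        finally show "\<bar>\<Sum>k\<in>{a..<c}. levy_area ?x i j (real k * ?h) (real (Suc k) * ?h)\<bar> \<le> ?Q * (real (c - a) * ?h) powr \<beta>" .
      qed
    qed (use t in auto)
    then show "norm (Y t - linear_interpolation ?h ?y t) \<le> C * ?K ^ (N + 4) * exp (C * ?K powr (1 / \<beta>)) *
       (?Q + (3 * chain_const \<beta> * enn2real (kappa \<beta> n \<omega>) + ?h) + ?h powr H)"
      unfolding beta(3) .
  qed
qed

section \<open>Comparison with the claimed rate\<close>

lemma error_le_log_scale:
  assumes "1 \<le> n" "0 \<le> a" "0 \<le> k" "0 \<le> q"
  shows "q * (T / real n) powr H * a + (k + T / real n) + (T / real n) powr H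
    \<le> log_scale n * (q * a + 1 / log_scale n * k + (1 + T powr (1 - H)))"
proof -
  let ?h = "T / real n" and ?s = "log_scale n"
  have h: "0 < ?h" "?h \<le> T" using T assms by (auto simp: field_simps)
  have "?h powr H * 1 \<le> ?h powr H * (1 + sqrt (ln (real n)))" using assms by (intro mult_left_mono) auto
  then have s: "?h powr H \<le> ?s" by (simp add: log_scale_def)
  have "?h = ?h powr (1 - H) * ?h powr H" using h by (simp flip: powr_add)
  also have "\<dots> \<le> T powr (1 - H) * ?s" using h H s by (intro mult_mono powr_mono2) auto
  finally have "?h \<le> T powr (1 - H) * ?s" .
  moreover have "q * ?h powr H * a \<le> q * ?s * a" using assms s by (intro mult_right_mono mult_left_mono) auto
  moreover have "?s * (q * a + 1 / ?s * k + (1 + T powr (1 - H))) = q * ?s * a + k + ?s + T powr (1 - H) * ?s"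
    using log_scale_pos[OF assms(1)] by (simp add: field_simps)
  ultimately show ?thesis using s by linarith
qed

text \<open>For n >= 2 the bound ln n >= ln 2 >= 1/4 gives 1 <= 2 * sqrt (ln n), so the logarithmic
  term of the rate absorbs everything with factor 3. For n = 1 the logarithm vanishes and h = T, and
  the first term of the rate takes over with the factor T^(1/2 - H).\<close>

lemma log_scale_le_rate:
  assumes "1 \<le> n"
  shows "log_scale n \<le> (3 + T powr (1 / 2 - H)) * ((T / real n) powr (2 * H - 1 / 2) + (T / real n) powr H * sqrt (ln (T / (T / real n))))"
proof -
  let ?h = "T / real n" and ?l = "sqrt (ln (real n))"
  have e: "T / ?h = real n" using T assms by simp
  have l: "0 \<le> ?l" using assms by simp
  show ?thesis
  proof (cases "n = 1")
    case True
    have "T powr H = T powr (1 / 2 - H) * T powr (2 * H - 1 / 2)" by (simp flip: powr_add)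
    also have "\<dots> \<le> (3 + T powr (1 / 2 - H)) * T powr (2 * H - 1 / 2)" by (intro mult_right_mono) auto
    finally show ?thesis using T by (simp add: True log_scale_def)
  next
    case False
    then have "ln 2 \<le> ln (real n)" using assms by (subst ln_le_cancel_iff) auto
    then have "(1 / 2)\<^sup>2 \<le> ln (real n)" using ln2_ge_two_thirds by (simp add: power2_eq_square)
    then have "1 / 2 \<le> ?l" by (rule real_le_rsqrt)
    then have "?h powr H * (1 + ?l) \<le> ?h powr H * (3 * ?l)" by (intro mult_left_mono) auto
    also have "\<dots> = 3 * (?h powr H * ?l)" by simp
    also have "\<dots> \<le> (3 + T powr (1 / 2 - H)) * (?h powr (2 * H - 1 / 2) + ?h powr H * ?l)"
      using l by (intro mult_mono) auto
    finally show ?thesis unfolding e by (simp add: log_scale_def)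
  qed
qed

end

theorem mainTheorem3:
  fixes M :: "'w measure" and T H :: real and N :: nat
    and i\<^sub>1 :: "'d::finite" and X :: "real \<Rightarrow> 'w \<Rightarrow> real ^ 'd"
    and y :: "real ^ 'm" and V :: "real ^ 'm \<Rightarrow> real ^ 'd ^ 'm"
    and Y :: "real \<Rightarrow> 'w \<Rightarrow> real ^ 'm"
  assumes "prob_space M"
    and "T > 0" and "1 / 2 < H" and "H < 1"
    and "driving_process M H T i\<^sub>1 X"
    and "N \<ge> 2" and "Cb (N + 1) V"
    and "AE \<omega> in M. young_solution V y T (\<lambda>t. X t \<omega>) (\<lambda>t. Y t \<omega>)"
  shows "\<forall>p\<ge>1. \<exists>C::real. \<forall>n::nat. n \<ge> 1 \<longrightarrow> (let h = T / real n in
    Lp_norm M p (\<lambda>\<omega>. SUP t\<in>{0..T}. ennreal (norm (Y t \<omega> -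
        linear_interpolation h (simplified_euler V N h (\<lambda>s. X s \<omega>) y) t)))
      \<le> ennreal (C * (h powr (2 * H - 1 / 2) + h powr H * sqrt (ln (T / h)))))"
proof (intro allI impI)
  interpret driving M T H i\<^sub>1 X by (intro driving.intro driving_axioms.intro assms)
  fix p :: real assume p: "1 \<le> p"
  define \<beta> where "\<beta> = (H + 1) / 3"
  have "3 * \<beta> = H + 1" by (simp add: \<beta>_def)
  then have beta: "1 / 2 < \<beta>" "\<beta> < H" "3 * \<beta> - 1 = H" and b: "0 < \<beta>" "\<beta> \<le> 1" using H by auto
  obtain C where C: "1 \<le> C" and CE: "\<forall>n \<omega> Y y t. 1 \<le> n \<and> \<omega> \<in> space M \<and> kappa \<beta> 1 \<omega> \<noteq> \<top> \<and> kappa \<beta> n \<omega> \<noteq> \<top> \<and> area_sup \<beta> n \<omega> \<noteq> \<top> \<and>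
      young_solution V y T (\<lambda>t. X t \<omega>) Y \<and> t \<in> {0..T} \<longrightarrow>
    norm (Y t - linear_interpolation (T / real n) (simplified_euler V N (T / real n) (\<lambda>s. X s \<omega>) y) t)
      \<le> C * holder_scale \<beta> \<omega> ^ (N + 4) * exp (C * holder_scale \<beta> \<omega> powr (1 / \<beta>)) *
        (area_const \<beta> * (T / real n) powr H * enn2real (area_sup \<beta> n \<omega>) +
         (3 * chain_const \<beta> * enn2real (kappa \<beta> n \<omega>) + T / real n) + (T / real n) powr H)"
    using pathwise_bound[OF assms(7,6) beta] by (elim exE conjE) (rule that)
  \<comment> \<open>With K = \<open>holder_scale \<beta> \<omega>\<close> >= 1, the power K^(N + 4)
    is at most exp ((N + 4) * K^(1/\<beta>)), because K <= exp K and K <= K^(1/\<beta>); so one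
    exponential moment covers both factors.\<close>
  define E where "E \<omega> = exp ((real (N + 4) + C) * holder_scale \<beta> \<omega> powr (1 / \<beta>))" for \<omega>
  define c where "c = 3 * chain_const \<beta>"
  have c: "0 \<le> c" using chain_const(1)[OF b] by (simp add: c_def)
  note q = area_const[OF b]
  \<comment> \<open>The random factor that remains once \<open>log_scale n\<close> is taken out of
    the error bound, written in extended reals so that the closure of bounded moments under sums and
    products applies.\<close>
  define G where "G n \<omega> = ennreal C * ennreal (E \<omega>) * (ennreal (area_const \<beta>) * area_sup \<beta> n \<omega>
      + ennreal c * (ennreal (1 / log_scale n) * kappa \<beta> n \<omega>) + ennreal (1 + T powr (1 - H)))" for n \<omega>
  have "moment_bounded M (\<lambda>n \<omega>. ennreal (E \<omega>))"
    unfolding E_def holder_scale_def by (rule exp_kappa_bounded[OF beta(1,2)]) (use C c in \<open>auto simp: c_def\<close>)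
  then have G: "moment_bounded M G"
    unfolding G_def using C c q beta
    by (intro moment_bounded_mult moment_bounded_add moment_bounded_const area_sup_bounded kappa_bounded) auto
  obtain C' where C': "0 \<le> C'" and Lp: "\<forall>n\<ge>1. \<forall>F \<epsilon>. 0 < \<epsilon> \<longrightarrow> (AE \<omega> in M. F \<omega> \<le> ennreal \<epsilon> * G n \<omega>) \<longrightarrow> Lp_norm M p F \<le> ennreal (C' * \<epsilon>)"
    using Lp_norm_le[OF G p] by (elim exE conjE) (rule that)
  have bound: "Lp_norm M p (\<lambda>\<omega>. SUP t\<in>{0..T}. ennreal (norm (Y t \<omega> -
        linear_interpolation (T / real n) (simplified_euler V N (T / real n) (\<lambda>s. X s \<omega>) y) t))) \<le> ennreal (C' * log_scale n)"
    if n: "1 \<le> n" for n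
  proof (rule Lp[rule_format, OF n log_scale_pos[OF n]])
    show "AE \<omega> in M. (SUP t\<in>{0..T}. ennreal (norm (Y t \<omega> -
        linear_interpolation (T / real n) (simplified_euler V N (T / real n) (\<lambda>s. X s \<omega>) y) t))) \<le> ennreal (log_scale n) * G n \<omega>"
      using assms(8) kappa_finite[OF beta(2) order_refl] kappa_finite[OF beta(2) n]
        moment_bounded_finite[OF area_sup_bounded[OF less_imp_le[OF b(1)] beta(2)] n] AE_space
    proof eventually_elim
      case (elim \<omega>)
      let ?K = "holder_scale \<beta> \<omega>" and ?a = "enn2real (area_sup \<beta> n \<omega>)" and ?k = "enn2real (kappa \<beta> n \<omega>)"
      let ?S = "area_const \<beta> * ?a + 1 / log_scale n * (c * ?k) + (1 + T powr (1 - H))"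
      have K: "1 \<le> ?K" by (rule holder_scale_ge_1[OF b])
      have S: "0 \<le> ?S" using q c log_scale_pos[OF n] by (intro add_nonneg_nonneg mult_nonneg_nonneg) auto
      have E: "?K ^ (N + 4) * exp (C * ?K powr (1 / \<beta>)) \<le> E \<omega>"
      proof -
        have "?K ^ (N + 4) \<le> exp ?K ^ (N + 4)" using K exp_ge_add_one_self[of ?K] by (intro power_mono) linarith+
        also have "\<dots> = exp (real (N + 4) * ?K powr 1)" using K unfolding exp_of_nat_mult by simp
        also have "\<dots> \<le> exp (real (N + 4) * ?K powr (1 / \<beta>))"
          unfolding exp_le_cancel_iff using K b by (intro mult_left_mono powr_mono) auto
        finally have "?K ^ (N + 4) * exp (C * ?K powr (1 / \<beta>)) \<le> exp (real (N + 4) * ?K powr (1 / \<beta>)) * exp (C * ?K powr (1 / \<beta>))"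
          by (intro mult_right_mono) auto
        then show ?thesis unfolding E_def distrib_right exp_add .
      qed
      have "G n \<omega> = ennreal (C * E \<omega> * ?S)"
      proof -
        have "area_sup \<beta> n \<omega> = ennreal ?a" "kappa \<beta> n \<omega> = ennreal ?k" using elim by (auto simp: less_top)
        then have "G n \<omega> = ennreal C * ennreal (E \<omega>) * (ennreal (area_const \<beta>) * ennreal ?a
          + ennreal c * (ennreal (1 / log_scale n) * ennreal ?k) + ennreal (1 + T powr (1 - H)))" by (simp only: G_def)
        also have "ennreal c * (ennreal (1 / log_scale n) * ennreal ?k) = ennreal (1 / log_scale n * (c * ?k))"
          using c log_scale_pos[OF n] by (simp add: ennreal_mult[symmetric] mult_ac)
        also have "ennreal (area_const \<beta>) * ennreal ?a = ennreal (area_const \<beta> * ?a)" using q by (simp add: ennreal_mult)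
        also have "ennreal (area_const \<beta> * ?a) + ennreal (1 / log_scale n * (c * ?k)) + ennreal (1 + T powr (1 - H)) = ennreal ?S"
          using q c log_scale_pos[OF n] by (simp flip: ennreal_plus)
        also have "ennreal C * ennreal (E \<omega>) * ennreal ?S = ennreal (C * E \<omega> * ?S)"
          using C S by (simp add: ennreal_mult E_def)
        finally show ?thesis .
      qed
      moreover have "norm (Y t \<omega> - linear_interpolation (T / real n) (simplified_euler V N (T / real n) (\<lambda>s. X s \<omega>) y) t)
          \<le> log_scale n * (C * E \<omega> * ?S)" if t: "t \<in> {0..T}" for t
      proof -
        have "norm (Y t \<omega> - linear_interpolation (T / real n) (simplified_euler V N (T / real n) (\<lambda>s. X s \<omega>) y) t)
          \<le> C * ?K ^ (N + 4) * exp (C * ?K powr (1 / \<beta>)) *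
            (area_const \<beta> * (T / real n) powr H * ?a + (c * ?k + T / real n) + (T / real n) powr H)"
          unfolding c_def by (rule CE[THEN spec[of _ n], THEN spec[of _ \<omega>], THEN spec[of _ "\<lambda>t. Y t \<omega>"], THEN spec[of _ y], THEN spec[of _ t], THEN mp]) (use n elim t in auto)
        also have "\<dots> \<le> C * ?K ^ (N + 4) * exp (C * ?K powr (1 / \<beta>)) * (log_scale n * ?S)"
          using C K c q by (intro mult_left_mono error_le_log_scale n) auto
        also have "\<dots> = ?K ^ (N + 4) * exp (C * ?K powr (1 / \<beta>)) * (C * (log_scale n * ?S))" by (simp only: mult_ac)
        also have "\<dots> \<le> E \<omega> * (C * (log_scale n * ?S))"
          using C S log_scale_pos[OF n] by (intro mult_right_mono E mult_nonneg_nonneg) auto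
        also have "\<dots> = log_scale n * (C * E \<omega> * ?S)" by (simp only: mult_ac)
        finally show ?thesis .
      qed
      ultimately show ?case
        using log_scale_pos[OF n] by (intro SUP_least) (simp add: ennreal_mult'[symmetric] ennreal_leI)
    qed
  qed
  show "\<exists>C::real. \<forall>n::nat. n \<ge> 1 \<longrightarrow> (let h = T / real n in
    Lp_norm M p (\<lambda>\<omega>. SUP t\<in>{0..T}. ennreal (norm (Y t \<omega> -
        linear_interpolation h (simplified_euler V N h (\<lambda>s. X s \<omega>) y) t)))
      \<le> ennreal (C * (h powr (2 * H - 1 / 2) + h powr H * sqrt (ln (T / h)))))"
    unfolding Let_def
  proof (intro exI[of _ "C' * (3 + T powr (1 / 2 - H))"] allI impI)
    fix n :: nat assume n: "n \<ge> 1"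
    show "Lp_norm M p (\<lambda>\<omega>. SUP t\<in>{0..T}. ennreal (norm (Y t \<omega> -
        linear_interpolation (T / real n) (simplified_euler V N (T / real n) (\<lambda>s. X s \<omega>) y) t)))
      \<le> ennreal (C' * (3 + T powr (1 / 2 - H)) * ((T / real n) powr (2 * H - 1 / 2) + (T / real n) powr H * sqrt (ln (T / (T / real n)))))"
      using mult_left_mono[OF log_scale_le_rate[OF n] C']
      by (intro order_trans[OF bound[OF n]] ennreal_leI) (simp only: mult.assoc)
  qed
qed

end
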